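(* Let $\kappa>1$, let $c:\mathbb{R}\to[\kappa^{-1},\kappa]$ be smooth, let $u_0:\mathbb{R}\to\mathbb{R}$ be absolutely continuous with $(u_0)_x\in L^2(\mathbb{R})$, and let $u_1\in L^2(\mathbb{R})$. Let $u=u(t,x)$ be the constructed solution (defined in the context) of the Cauchy problem $$u_{tt}-c(u)\big(c(u)u_x\big)_x=0,\qquad u(0,x)=u_0(x),\quad u_t(0,x)=u_1(x),$$ and set $\mathcal{E}_0\doteq\frac12\int_{\mathbb{R}}\big[u_1^2(x)+c^2(u_0(x))(u_0)_x^2(x)\big]dx$. Then there exists a continuous family $\{\mu_t;\ t\in\mathbb{R}\}$ of positive Radon measures on the real line (continuous meaning that $t\mapsto\int f\,d\mu_t$ is continuous for every $f\in C_c(\mathbb{R})$) with the following properties. (i) At every time $t$, one has $\mu_t(\mathbb{R})=\mathcal{E}_0$. (ii) For each $t$, the absolutely continuous part of $\mu_t$ has density $\frac12\big(u_t^2(t,\cdot)+c^2(u(t,\cdot))\,u_x^2(t,\cdot)\big)$ with respect to Lebesgue measure. (iii) For almost every $t\in\mathbb{R}$, the singular part of $\mu_t$ is concentrated on the set $\{x\in\mathbb{R}:\ c'(u(t,x))=0\}$.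
   Context: Constructed solution. Put $R_0\doteq u_1+c(u_0)(u_0)_x$ and $S_0\doteq u_1-c(u_0)(u_0)_x$, both in $L^2(\mathbb{R})$. Define $$X(x)\doteq\int_0^x(1+R_0^2(y))\,dy,\qquad Y(x)\doteq-\int_0^x(1+S_0^2(y))\,dy,$$ so that $x\mapsto(X(x),Y(x))$ parametrizes a curve $\gamma=\{(X,Y): Y=\varphi(X)\}$ in $\mathbb{R}^2$, with $\varphi:\mathbb{R}\to\mathbb{R}$ a continuous strictly decreasing bijection. On $\gamma$, at the point with parameter $x$, prescribe the boundary data $$\bar w=2\arctan R_0(x),\quad \bar z=2\arctan S_0(x),\quad \bar p=1,\quad \bar q=1,\quad \bar u=u_0(x).$$ Let $(w,z,p,q,u)$, functions of $(X,Y)\in\mathbb{R}^2$, be the unique solution with these data on $\gamma$ of the semilinear system (with $c=c(u)$, $c'=c'(u)$) $$w_Y=\tfrac{c'}{8c^2}(\cos z-\cos w)\,q,\qquad z_X=\tfrac{c'}{8c^2}(\cos w-\cos z)\,p,$$ $$p_Y=\tfrac{c'}{8c^2}(\sin z-\sin w)\,pq,\qquad q_X=\tfrac{c'}{8c^2}(\sin w-\sin z)\,pq,$$ $$u_X=\tfrac{\sin w}{4c}\,p,\qquad u_Y=\tfrac{\sin z}{4c}\,q,$$ understood in integral form: the equations for $w,p$ (resp. $z,q$) are integrated in $Y$ from $\varphi(X)$ (resp. in $X$ from $\varphi^{-1}(Y)$); $w,z,p,q$ are locally bounded and measurable and $u$ is locally Lipschitz. Let $x(X,Y)$, $t(X,Y)$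 be the functions on $\mathbb{R}^2$ satisfying $$x_X=\tfrac{(1+\cos w)p}{4},\quad x_Y=-\tfrac{(1+\cos z)q}{4},\quad t_X=\tfrac{(1+\cos w)p}{4c},\quad t_Y=\tfrac{(1+\cos z)q}{4c},$$ with $t=0$ on $\gamma$ and $x(X(y),Y(y))=y$ for all $y\in\mathbb{R}$. The map $(X,Y)\mapsto(t,x)$ is onto $\mathbb{R}^2$, and the value $u(X,Y)$ depends only on $(t(X,Y),x(X,Y))$; the constructed solution is $u(t,x)\doteq u(X,Y)$ for any $(X,Y)$ with $t(X,Y)=t$, $x(X,Y)=x$. Here $u_t(t,\cdot)$ is the derivative of $t\mapsto u(t,\cdot)$ with values in $L^p_{\rm loc}(\mathbb{R})$ ($1\le p<2$), and $u_x$ is the weak derivative in $x$. "Absolutely continuous part" and "singular part" refer to the Lebesgue decomposition with respect to Lebesgue measure. *)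

theory Defs
  imports "HOL-Analysis.Analysis"
begin

section \<open>Function classes on the real line\<close>

definition smooth_fun :: "(real \<Rightarrow> real) \<Rightarrow> bool" where
  "smooth_fun f \<longleftrightarrow> (\<forall>n. (deriv ^^ n) f differentiable_on UNIV)"

definition compactly_supported :: "(real \<Rightarrow> real) \<Rightarrow> bool" where
  "compactly_supported f \<longleftrightarrow> compact (closure {x. f x \<noteq> 0})"

(* A finite family of intervals is a finite set of endpoint pairs; only the interiors
   have to be disjoint. *)
definition abs_continuous_fun :: "(real \<Rightarrow> real) \<Rightarrow> bool" where
  "abs_continuous_fun f \<longleftrightarrow>
     (\<forall>\<epsilon>>0. \<exists>\<delta>>0. \<forall>D :: (real \<times> real) set.
        finite D \<and> (\<forall>(a, b)\<in>D. a < b) \<and>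
        pairwise (\<lambda>I J. {fst I<..<snd I} \<inter> {fst J<..<snd J} = {}) D \<and>
        (\<Sum>(a, b)\<in>D. b - a) < \<delta>
        \<longrightarrow> (\<Sum>(a, b)\<in>D. \<bar>f b - f a\<bar>) < \<epsilon>)"

(* Elements of Lebesgue spaces are handled through Lebesgue measurable representatives. *)
definition L2_fun :: "(real \<Rightarrow> real) \<Rightarrow> bool" where
  "L2_fun f \<longleftrightarrow> f \<in> borel_measurable lebesgue \<and> integrable lebesgue (\<lambda>x. (f x)\<^sup>2)"

definition Lp_loc :: "real \<Rightarrow> (real \<Rightarrow> real) \<Rightarrow> bool" where
  "Lp_loc p f \<longleftrightarrow> f \<in> borel_measurable lebesgue \<and>
     (\<forall>K. compact K \<longrightarrow> set_integrable lebesgue K (\<lambda>x. \<bar>f x\<bar> powr p))"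

definition has_Lp_loc_derivative ::
  "real \<Rightarrow> (real \<Rightarrow> real \<Rightarrow> real) \<Rightarrow> real \<Rightarrow> (real \<Rightarrow> real) \<Rightarrow> bool" where
  "has_Lp_loc_derivative p U t v \<longleftrightarrow> (\<forall>s. Lp_loc p (U s)) \<and> Lp_loc p v \<and>
     (\<forall>K. compact K \<longrightarrow>
        ((\<lambda>h. LINT x:K|lebesgue. (\<bar>(U (t + h) x - U t x) / h - v x\<bar> powr p)) \<longlongrightarrow> 0) (at 0))"

definition has_weak_derivative :: "(real \<Rightarrow> real) \<Rightarrow> (real \<Rightarrow> real) \<Rightarrow> bool" where
  "has_weak_derivative f g \<longleftrightarrow> Lp_loc 1 f \<and> Lp_loc 1 g \<and>
     (\<forall>\<psi>. smooth_fun \<psi> \<and> compactly_supported \<psi> \<longrightarrow>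
        (LINT x|lebesgue. (f x * deriv \<psi> x)) = - (LINT x|lebesgue. (g x * \<psi> x)))"

section \<open>Radon measures on the real line\<close>

definition radon_measure :: "real measure \<Rightarrow> bool" where
  "radon_measure M \<longleftrightarrow> sets M = sets borel \<and>
     (\<forall>K. compact K \<longrightarrow> emeasure M K < \<infinity>) \<and>
     (\<forall>B\<in>sets borel. emeasure M B = (SUP K\<in>{K. compact K \<and> K \<subseteq> B}. emeasure M K))"

definition vaguely_continuous :: "(real \<Rightarrow> real measure) \<Rightarrow> bool" where
  "vaguely_continuous \<mu> \<longleftrightarrow>
     (\<forall>f. continuous_on UNIV f \<and> compactly_supported f \<longrightarrow>
        continuous_on UNIV (\<lambda>t. LINT x|\<mu> t. f x))"

definition lebesgue_decomposition :: "real measure \<Rightarrow> real measure \<Rightarrow> real measure \<Rightarrow> bool" where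
  "lebesgue_decomposition M A S \<longleftrightarrow>
     sets M = sets borel \<and> sets A = sets borel \<and> sets S = sets borel \<and>
     (\<forall>B\<in>sets borel. emeasure M B = emeasure A B + emeasure S B) \<and>
     absolutely_continuous lborel A \<and>
     (\<exists>N\<in>null_sets lborel. emeasure S (UNIV - N) = 0)"

section \<open>The initial curve in the characteristic plane\<close>

definition R_init :: "(real \<Rightarrow> real) \<Rightarrow> (real \<Rightarrow> real) \<Rightarrow> (real \<Rightarrow> real) \<Rightarrow> real \<Rightarrow> real" where
  "R_init c u0 u1 y = u1 y + c (u0 y) * deriv u0 y"

definition S_init :: "(real \<Rightarrow> real) \<Rightarrow> (real \<Rightarrow> real) \<Rightarrow> (real \<Rightarrow> real) \<Rightarrow> real \<Rightarrow> real" where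
  "S_init c u0 u1 y = u1 y - c (u0 y) * deriv u0 y"

definition X_curve :: "(real \<Rightarrow> real) \<Rightarrow> (real \<Rightarrow> real) \<Rightarrow> (real \<Rightarrow> real) \<Rightarrow> real \<Rightarrow> real" where
  "X_curve c u0 u1 x = (LINT y=ereal 0..ereal x|lebesgue. (1 + (R_init c u0 u1 y)\<^sup>2))"

definition Y_curve :: "(real \<Rightarrow> real) \<Rightarrow> (real \<Rightarrow> real) \<Rightarrow> (real \<Rightarrow> real) \<Rightarrow> real \<Rightarrow> real" where
  "Y_curve c u0 u1 x = - (LINT y=ereal 0..ereal x|lebesgue. (1 + (S_init c u0 u1 y)\<^sup>2))"

definition curve_fun :: "(real \<Rightarrow> real) \<Rightarrow> (real \<Rightarrow> real) \<Rightarrow> (real \<Rightarrow> real) \<Rightarrow> real \<Rightarrow> real" where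
  "curve_fun c u0 u1 = (\<lambda>X. Y_curve c u0 u1 (inv (X_curve c u0 u1) X))"

definition initial_energy :: "(real \<Rightarrow> real) \<Rightarrow> (real \<Rightarrow> real) \<Rightarrow> (real \<Rightarrow> real) \<Rightarrow> real" where
  "initial_energy c u0 u1 =
     1 / 2 * (LINT x|lebesgue. ((u1 x)\<^sup>2 + (c (u0 x))\<^sup>2 * (deriv u0 x)\<^sup>2))"

section \<open>The semilinear system in integral form\<close>

definition locally_bounded_measurable :: "(real \<Rightarrow> real \<Rightarrow> real) \<Rightarrow> bool" where
  "locally_bounded_measurable f \<longleftrightarrow>
     (\<lambda>(X, Y). f X Y) \<in> borel_measurable lebesgue \<and>
     (\<forall>K. compact K \<longrightarrow> bounded ((\<lambda>(X, Y). f X Y) ` K))"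

definition locally_lipschitz_plane :: "(real \<Rightarrow> real \<Rightarrow> real) \<Rightarrow> bool" where
  "locally_lipschitz_plane f \<longleftrightarrow>
     (\<forall>K. compact K \<longrightarrow> (\<exists>L. L-lipschitz_on K (\<lambda>(X, Y). f X Y)))"

(* The equations f_Y = g and f_X = g, integrated from the curve Y = phi X. Since all
   coefficients are defined up to null sets of the plane, the equations are imposed on almost
   every vertical, respectively horizontal, line. The interval integrals are oriented. *)
definition integrated_in_Y ::
  "(real \<Rightarrow> real) \<Rightarrow> (real \<Rightarrow> real \<Rightarrow> real) \<Rightarrow> (real \<Rightarrow> real \<Rightarrow> real) \<Rightarrow> bool" where
  "integrated_in_Y \<phi> f g \<longleftrightarrow>
     (AE X in lebesgue. \<forall>Y.
        f X Y = f X (\<phi> X) + (LINT s=ereal (\<phi> X)..ereal Y|lebesgue. g X s))"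

definition integrated_in_X ::
  "(real \<Rightarrow> real) \<Rightarrow> (real \<Rightarrow> real \<Rightarrow> real) \<Rightarrow> (real \<Rightarrow> real \<Rightarrow> real) \<Rightarrow> bool" where
  "integrated_in_X \<phi> f g \<longleftrightarrow>
     (AE Y in lebesgue. \<forall>X.
        f X Y = f (inv \<phi> Y) Y + (LINT s=ereal (inv \<phi> Y)..ereal X|lebesgue. g s Y))"

definition solves_semilinear_system ::
  "(real \<Rightarrow> real) \<Rightarrow> (real \<Rightarrow> real) \<Rightarrow> (real \<Rightarrow> real) \<Rightarrow>
   (real \<Rightarrow> real \<Rightarrow> real) \<Rightarrow> (real \<Rightarrow> real \<Rightarrow> real) \<Rightarrow>
   (real \<Rightarrow> real \<Rightarrow> real) \<Rightarrow> (real \<Rightarrow> real \<Rightarrow> real) \<Rightarrow> (real \<Rightarrow> real \<Rightarrow> real) \<Rightarrow> bool" where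
  "solves_semilinear_system c u0 u1 w z p q u \<longleftrightarrow>
    (let \<phi> = curve_fun c u0 u1;
         Xc = X_curve c u0 u1;
         Yc = Y_curve c u0 u1;
         k = (\<lambda>X Y. deriv c (u X Y) / (8 * (c (u X Y))\<^sup>2))
     in
       locally_bounded_measurable w \<and> locally_bounded_measurable z \<and>
       locally_bounded_measurable p \<and> locally_bounded_measurable q \<and>
       locally_lipschitz_plane u \<and>
       (AE y in lebesgue.
          w (Xc y) (Yc y) = 2 * arctan (R_init c u0 u1 y) \<and>
          z (Xc y) (Yc y) = 2 * arctan (S_init c u0 u1 y) \<and>
          p (Xc y) (Yc y) = 1 \<and> q (Xc y) (Yc y) = 1) \<and>
       (\<forall>y. u (Xc y) (Yc y) = u0 y) \<and>
       integrated_in_Y \<phi> w (\<lambda>X Y. k X Y * (cos (z X Y) - cos (w X Y)) * q X Y) \<and>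
       integrated_in_X \<phi> z (\<lambda>X Y. k X Y * (cos (w X Y) - cos (z X Y)) * p X Y) \<and>
       integrated_in_Y \<phi> p (\<lambda>X Y. k X Y * (sin (z X Y) - sin (w X Y)) * (p X Y * q X Y)) \<and>
       integrated_in_X \<phi> q (\<lambda>X Y. k X Y * (sin (w X Y) - sin (z X Y)) * (p X Y * q X Y)) \<and>
       integrated_in_X \<phi> u (\<lambda>X Y. sin (w X Y) / (4 * c (u X Y)) * p X Y) \<and>
       integrated_in_Y \<phi> u (\<lambda>X Y. sin (z X Y) / (4 * c (u X Y)) * q X Y))"

definition original_variables ::
  "(real \<Rightarrow> real) \<Rightarrow> (real \<Rightarrow> real) \<Rightarrow> (real \<Rightarrow> real) \<Rightarrow>
   (real \<Rightarrow> real \<Rightarrow> real) \<Rightarrow> (real \<Rightarrow> real \<Rightarrow> real) \<Rightarrow>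
   (real \<Rightarrow> real \<Rightarrow> real) \<Rightarrow> (real \<Rightarrow> real \<Rightarrow> real) \<Rightarrow> (real \<Rightarrow> real \<Rightarrow> real) \<Rightarrow>
   (real \<Rightarrow> real \<Rightarrow> real) \<Rightarrow> (real \<Rightarrow> real \<Rightarrow> real) \<Rightarrow> bool" where
  "original_variables c u0 u1 w z p q u t x \<longleftrightarrow>
    (let \<phi> = curve_fun c u0 u1;
         Xc = X_curve c u0 u1;
         Yc = Y_curve c u0 u1
     in
       locally_lipschitz_plane t \<and> locally_lipschitz_plane x \<and>
       (\<forall>y. t (Xc y) (Yc y) = 0) \<and> (\<forall>y. x (Xc y) (Yc y) = y) \<and>
       integrated_in_X \<phi> x (\<lambda>X Y. (1 + cos (w X Y)) * p X Y / 4) \<and>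
       integrated_in_Y \<phi> x (\<lambda>X Y. - ((1 + cos (z X Y)) * q X Y / 4)) \<and>
       integrated_in_X \<phi> t (\<lambda>X Y. (1 + cos (w X Y)) * p X Y / (4 * c (u X Y))) \<and>
       integrated_in_Y \<phi> t (\<lambda>X Y. (1 + cos (z X Y)) * q X Y / (4 * c (u X Y))))"

(* U is determined by this, because (X, Y) \<mapsto> (t, x) maps onto the plane; that
   surjectivity follows from the equations and is not part of the definition. *)
definition constructed_solution ::
  "(real \<Rightarrow> real) \<Rightarrow> (real \<Rightarrow> real) \<Rightarrow> (real \<Rightarrow> real) \<Rightarrow> (real \<Rightarrow> real \<Rightarrow> real) \<Rightarrow> bool" where
  "constructed_solution c u0 u1 U \<longleftrightarrow>
     (\<exists>w z p q u t x.
        solves_semilinear_system c u0 u1 w z p q u \<and>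
        original_variables c u0 u1 w z p q u t x \<and>
        (\<forall>\<tau> \<xi> X Y. t X Y = \<tau> \<and> x X Y = \<xi> \<longrightarrow> U \<tau> \<xi> = u X Y))"

end

theory Submission
  imports Defs
begin

text \<open>In characteristic coordinates the energy has the potential \<open>e = m / 4 - x / 2\<close>, where
  \<open>m\<^sub>X = p\<close> and \<open>m\<^sub>Y = - q\<close>, so that \<open>e\<^sub>X = (1 - cos w) p / 8\<close> and \<open>e\<^sub>Y = - (1 - cos z) q / 8\<close>.
  The measure at time \<open>\<tau>\<close> is the image under \<open>x\<close> of \<open>de\<close> along the level curve \<open>t = \<tau>\<close>; its mass is
  the difference of the limits of \<open>e\<close> at the two ends of the plane, which does not depend on \<open>\<tau>\<close>.
  Where both \<open>x\<^sub>X\<close> and \<open>x\<^sub>Y\<close> are nonzero, \<open>de / dx\<close> is the classical energy density, so the singular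
  part lives on \<open>cos w = -1\<close> or \<open>cos z = -1\<close>. There \<open>w\<^sub>Y = (c' / 8 c\<^sup>2) (cos z - cos w) q\<close>: if
  \<open>c' \<noteq> 0\<close> and \<open>t\<^sub>Y \<noteq> 0\<close>, then \<open>w\<close> crosses \<open>\<pi>\<close> transversally, hence at only countably many
  \<open>Y\<close> for each \<open>X\<close>, and integrating in \<open>Y\<close> first shows that only a null set of times sees such points.\<close>

section \<open>Calculus on the line\<close>

text \<open>The equations hold only on almost every characteristic line, while a level curve of
  \<open>t\<close> is a null set that may even run along an exceptional line. Traces on it make
  sense because each coefficient that is integrated in one variable is Lipschitz in the other. Hence
  \<open>t\<close>, \<open>x\<close>, \<open>u\<close> and \<open>e\<close> have bounded mixed
  differences, their derivatives exist on whole lines off one null set of lines, and a piece of the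
  curve on an exceptional line is seen by the other differential only.

  The derivative in time is claimed at every time, not at almost every one. At each time the
  difference quotients converge at almost every position, because \<open>dx\<close> along the level
  curve is shared equally by the two families of characteristics, and their square integrals are
  bounded. That bound uses only monotonicity: increments of \<open>u\<close> are estimated by those
  of \<open>x\<close> and \<open>e\<close> along two characteristic segments. Almost everywhere
  convergence with bounded square integrals gives convergence in L^p exactly for
  \<open>p < 2\<close>.

  Continuity in time comes from quantiles of the energy, which move with speed at most
  \<open>\<kappa>\<close>.\<close>

lemma indefinite_integral_deriv_right_ae:
  fixes f F :: "real \<Rightarrow> real"
  assumes F: "\<And>a b. a \<le> b \<Longrightarrow> (f has_integral (F b - F a)) {a..b}"
  obtains N where "negligible N"
    "\<And>x. x \<notin> N \<Longrightarrow> (F has_real_derivative f x) (at_right x)"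
proof -
  have "f integrable_on cbox a b" for a b
    using F[of a b] by (cases "a \<le> b") (auto simp: integrable_on_def)
  from integrable_ccontinuous_explicit[OF this] obtain N where N: "negligible N"
    and *: "\<And>x e. \<lbrakk>x \<notin> N; 0 < e\<rbrakk> \<Longrightarrow>
         \<exists>d>0. \<forall>h. 0 < h \<and> h < d \<longrightarrow> norm (integral (cbox x (x + h *\<^sub>R One)) f /\<^sub>R h ^ DIM(real) - f x) < e"
    by metis
  have "(F has_real_derivative f x) (at_right x)" if "x \<notin> N" for x
    unfolding has_field_derivative_iff tendsto_iff
  proof (intro allI impI)
    fix e :: real assume "e > 0"
    from *[OF that this] obtain d where d: "d > 0"
      and dd: "\<And>h. 0 < h \<Longrightarrow> h < d \<Longrightarrow> norm (integral (cbox x (x + h *\<^sub>R One)) f /\<^sub>R h ^ DIM(real) - f x) < e"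
      by blast
    have "dist ((F y - F x) / (y - x)) (f x) < e" if y: "x < y" "y < x + d" for y
    proof -
      have "integral {x..y} f = F y - F x"
        using F[of x y] y by (simp add: integral_unique)
      then show ?thesis using dd[of "y - x"] y
        by (simp add: dist_real_def divide_inverse mult.commute)
    qed
    then show "\<forall>\<^sub>F y in at_right x. dist ((F y - F x) / (y - x)) (f x) < e"
      unfolding eventually_at_right_field using d by (intro exI[of _ "x + d"]) auto
  qed
  with N that show thesis by blast
qed

text \<open>The left derivative of \<open>F\<close> at \<open>x\<close> is the right derivative of
  \<open>\<lambda>x. - F (- x)\<close> at \<open>- x\<close>, so the one-sided differentiation
  theorem is applied twice, the second time to the reflected density.\<close>

theorem indefinite_integral_deriv_ae:
  fixes f F :: "real \<Rightarrow> real"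
  assumes F: "\<And>a b. a \<le> b \<Longrightarrow> (f has_integral (F b - F a)) {a..b}"
  obtains N where "negligible N"
    "\<And>x. x \<notin> N \<Longrightarrow> (F has_real_derivative f x) (at x)"
proof -
  obtain N1 where N1: "negligible N1" "\<And>x. x \<notin> N1 \<Longrightarrow> (F has_real_derivative f x) (at_right x)"
    using indefinite_integral_deriv_right_ae[OF F] by metis
  have "((\<lambda>x. f (- x)) has_integral (- F (- b) - (- F (- a)))) {a..b}" if "a \<le> b" for a b
    using has_integral_reflect_real[of f "F (-a) - F (-b)" "-a" "-b"] F[of "-b" "-a"] that
    by simp
  then obtain N2 where N2: "negligible N2"
    "\<And>x. x \<notin> N2 \<Longrightarrow> ((\<lambda>x. - F (- x)) has_real_derivative f (- x)) (at_right x)"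
    using indefinite_integral_deriv_right_ae[of "\<lambda>x. f (- x)" "\<lambda>x. - F (- x)"] by metis
  have left: "(F has_real_derivative f x) (at_left x)" if "x \<notin> uminus ` N2" for x
  proof -
    have "- x \<notin> N2" using that by force
    then have "((\<lambda>x. - F (- x)) has_real_derivative f x) (at_right (- x))" using N2(2)[of "-x"] by simp
    then have "((\<lambda>y. (- F (- y) + F x) / (y + x)) \<longlongrightarrow> f x) (at_right (- x))"
      by (simp add: has_field_derivative_iff)
    then have "((\<lambda>y. (- F y + F x) / (- y + x)) \<longlongrightarrow> f x) (at_left x)"
      by (simp add: filterlim_at_left_to_right add.commute)
    moreover have "(- F y + F x) / (- y + x) = (F y - F x) / (y - x)" for y
      by (metis (no_types, opaque_lifting) minus_diff_eq minus_divide_divide add.commute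
          uminus_add_conv_diff)
    ultimately show ?thesis by (simp add: has_field_derivative_iff)
  qed
  have "negligible (uminus ` N2)"
    by (rule negligible_differentiable_image_negligible[OF _ N2(1)])
      (auto intro!: differentiable_on_minus differentiable_on_ident)
  then have "negligible (N1 \<union> uminus ` N2)" using N1(1) by simp
  moreover have "(F has_real_derivative f x) (at x)" if "x \<notin> N1 \<union> uminus ` N2" for x
    using N1(2)[of x] left[of x] that unfolding has_field_derivative_iff filterlim_at_split by auto
  ultimately show thesis using that by blast
qed

lemma has_integral_Diff_negligible:
  fixes f :: "real \<Rightarrow> real"
  assumes "negligible S"
  shows "(f has_integral y) (T - S) \<longleftrightarrow> (f has_integral y) T"
proof (rule has_integral_spike_set_eq)
  show "negligible {x \<in> T - S - T. f x \<noteq> 0}"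
    by (rule negligible_subset[OF assms]) auto
  show "negligible {x \<in> T - (T - S). f x \<noteq> 0}"
    by (rule negligible_subset[OF assms]) auto
qed

text \<open>The difference quotients of \<open>F\<close> are bounded by \<open>L\<close> and
  converge to \<open>f\<close> off \<open>N\<close>. Their integrals are differences of quotients of
  a primitive \<open>H\<close>, so dominated convergence yields both the integrability of
  \<open>f\<close> and the value of its integral.\<close>

lemma lipschitz_has_integral_deriv:
  fixes F f :: "real \<Rightarrow> real"
  assumes ab: "a \<le> b" and N: "negligible N" and lip: "L-lipschitz_on {a..b} F"
    and der: "\<And>x. x \<in> {a<..<b} - N \<Longrightarrow> (F has_real_derivative f x) (at x)"
  shows "(f has_integral (F b - F a)) {a..b}"
proof -
  \<comment> \<open>Clamping the argument extends \<open>F\<close> to a globally Lipschitz function,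
    so that quotients with a positive step make sense up to \<open>b\<close>.\<close>
  define G where "G = (\<lambda>x. F (max a (min b x)))"
  have L0: "L \<ge> 0" using lip lipschitz_on_nonneg by blast
  have Glip: "\<bar>G x - G y\<bar> \<le> L * \<bar>x - y\<bar>" for x y
  proof -
    have "\<bar>G x - G y\<bar> \<le> L * \<bar>max a (min b x) - max a (min b y)\<bar>"
      unfolding G_def using lipschitz_onD[OF lip, of "max a (min b x)" "max a (min b y)"] ab
      by (simp add: dist_real_def)
    also have "\<dots> \<le> L * \<bar>x - y\<bar>" by (intro mult_left_mono L0) linarith
    finally show ?thesis .
  qed
  have Gc: "continuous_on UNIV G"
  proof (rule lipschitz_on_continuous_on[of L])
    show "L-lipschitz_on UNIV G" using Glip L0 by (auto simp: lipschitz_on_def dist_real_def)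
  qed
  \<comment> \<open>The margins put all shifted points, which lie in \<open>{a..b+1}\<close>, into
    the interior, where the derivative within the interval is the ordinary one.\<close>
  obtain H where H: "\<And>x. x \<in> {a-1..b+2} \<Longrightarrow> (H has_vector_derivative G x) (at x within {a-1..b+2})"
    using antiderivative_continuous[OF continuous_on_subset[OF Gc subset_UNIV]] by metis
  have H': "(H has_real_derivative G x) (at x)" if "a \<le> x" "x \<le> b+1" for x
    using H[of x] that at_within_interior[of x "{a-1..b+2}"]
    by (simp add: has_real_derivative_iff_has_vector_derivative)
  define h where "h = (\<lambda>n x. real (Suc n) * (G (x + 1 / real (Suc n)) - G x))"
  have hint: "(h n has_integral (real (Suc n) * (H (b + 1 / real (Suc n)) - H b) -
       real (Suc n) * (H (a + 1 / real (Suc n)) - H a))) {a..b}" for n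
  proof (rule fundamental_theorem_of_calculus[OF ab])
    fix x assume x: "x \<in> {a..b}"
    have le: "1 / real (Suc n) \<le> 1" by simp
    have sh: "x + 1 / real (Suc n) \<le> b + 1" "a \<le> x + 1 / real (Suc n)"
      using x le by (simp_all del: of_nat_Suc add: add_mono add_increasing2)
    have "((\<lambda>x. H (x + 1 / real (Suc n))) has_real_derivative G (x + 1 / real (Suc n))) (at x)"
      using DERIV_shift[of H "G (x + 1 / real (Suc n))" x "1 / real (Suc n)"] H'[OF sh(2,1)] by simp
    moreover have "(H has_real_derivative G x) (at x)" using H' x by auto
    ultimately have "((\<lambda>x. real (Suc n) * (H (x + 1 / real (Suc n)) - H x)) has_real_derivative h n x) (at x)"
      unfolding h_def by (intro DERIV_cmult DERIV_diff)
    then show "((\<lambda>x. real (Suc n) * (H (x + 1 / real (Suc n)) - H x)) has_vector_derivative h n x) (at x within {a..b})"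
      by (simp add: has_real_derivative_iff_has_vector_derivative has_vector_derivative_at_within)
  qed
  have seq0: "filterlim (\<lambda>n. 1 / real (Suc n)) (at 0) sequentially"
    unfolding filterlim_at using LIMSEQ_Suc[OF lim_1_over_n] by (auto simp del: of_nat_Suc)
  have quot: "(\<lambda>n. real (Suc n) * (K (y + 1 / real (Suc n)) - K y)) \<longlonglongrightarrow> d"
    if "(K has_real_derivative d) (at y)" for K :: "real \<Rightarrow> real" and d y
  proof -
    have "((\<lambda>h. (K (y + h) - K y) / h) \<longlongrightarrow> d) (at 0)" using that by (simp add: DERIV_def)
    from filterlim_compose[OF this seq0] show ?thesis by (simp add: mult.commute del: of_nat_Suc)
  qed
  define S where "S = N \<union> {a, b}"
  have S: "negligible S" unfolding S_def using N by (simp add: negligible_Un_eq)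
  have pt: "(\<lambda>n. h n x) \<longlonglongrightarrow> f x" if x: "x \<in> {a..b} - S" for x
  proof -
    have x': "a < x" "x < b" "x \<notin> N" using x by (auto simp: S_def)
    have "(F has_real_derivative f x) (at x)" using der x' by auto
    moreover have "\<forall>\<^sub>F y in nhds x. G y = F y"
      using eventually_nhds_in_open[of "{a<..<b}" x] x' by (auto simp: G_def elim!: eventually_mono)
    ultimately have "(G has_real_derivative f x) (at x)"
      using DERIV_cong_ev[of x x G F "f x" "f x"] by simp
    from quot[OF this] show ?thesis by (simp add: h_def)
  qed
  have Ga: "G a = F a" "G b = F b" using ab by (auto simp: G_def)
  have int: "(h n has_integral (real (Suc n) * (H (b + 1 / real (Suc n)) - H b) -
       real (Suc n) * (H (a + 1 / real (Suc n)) - H a))) ({a..b} - S)" for n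
    using hint by (simp only: has_integral_Diff_negligible[OF S])
  have bd: "\<bar>h n x\<bar> \<le> L" for n x
  proof -
    have "\<bar>h n x\<bar> = real (Suc n) * \<bar>G (x + 1 / real (Suc n)) - G x\<bar>" by (simp add: h_def abs_mult del: of_nat_Suc)
    also have "\<dots> \<le> real (Suc n) * (L * \<bar>(x + 1 / real (Suc n)) - x\<bar>)" by (intro mult_left_mono Glip) auto
    also have "\<dots> = L" by simp
    finally show ?thesis .
  qed
  have Lint: "(\<lambda>x. L) integrable_on {a..b} - S"
    using integrable_const_ivl[of L a b] unfolding integrable_on_def has_integral_Diff_negligible[OF S] .
  have "(\<lambda>n. real (Suc n) * (H (b + 1 / real (Suc n)) - H b) -
       real (Suc n) * (H (a + 1 / real (Suc n)) - H a)) \<longlonglongrightarrow> G b - G a"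
    by (intro tendsto_diff quot H') (use ab in auto)
  then have "(\<lambda>n. integral ({a..b} - S) (h n)) \<longlonglongrightarrow> F b - F a"
    unfolding integral_unique[OF int] Ga .
  moreover have "f integrable_on {a..b} - S" "(\<lambda>n. integral ({a..b} - S) (h n)) \<longlonglongrightarrow> integral ({a..b} - S) f"
  proof -
    have "h n integrable_on {a..b} - S" for n using int by (rule has_integral_integrable)
    moreover have "norm (h n x) \<le> L" for n x using bd by simp
    ultimately show "f integrable_on {a..b} - S" "(\<lambda>n. integral ({a..b} - S) (h n)) \<longlonglongrightarrow> integral ({a..b} - S) f"
      using dominated_convergence[of h "{a..b} - S" "\<lambda>x. L" f] pt Lint by blast+
  qed
  ultimately have "(f has_integral (F b - F a)) ({a..b} - S)"
    using LIMSEQ_unique integrable_integral by metis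
  then show ?thesis
    by (simp only: has_integral_Diff_negligible[OF S])
qed

lemma lipschitz_deriv_nonneg_imp_le:
  fixes F f :: "real \<Rightarrow> real"
  assumes ab: "a \<le> b" and N: "negligible N" and lip: "L-lipschitz_on {a..b} F"
    and der: "\<And>x. x \<in> {a<..<b} - N \<Longrightarrow> (F has_real_derivative f x) (at x)"
    and nn: "\<And>x. x \<in> {a<..<b} - N \<Longrightarrow> 0 \<le> f x"
  shows "F a \<le> F b"
proof -
  have "(f has_integral (F b - F a)) {a..b}" by (rule lipschitz_has_integral_deriv[OF ab N lip der])
  then have "((\<lambda>x. max 0 (f x)) has_integral (F b - F a)) {a..b}"
    by (rule has_integral_spike[rotated -1, where S="N \<union> {a, b}"])
       (use N nn in \<open>auto simp: negligible_Un_eq max_def not_le intro!: antisym\<close>)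
  then have "0 \<le> F b - F a" by (rule has_integral_nonneg) auto
  then show ?thesis by simp
qed

text \<open>Cutting \<open>{a..b}\<close> into \<open>n + 1\<close> equal pieces leaves a total
  increment of order \<open>1 / (n + 1)\<close>. This replaces the chain rule along curves:
  comparing a short arc with a staircase costs an error that is quadratic in its length.\<close>

lemma quadratic_increments_imp_const:
  fixes D :: "real \<Rightarrow> real"
  assumes ab: "a \<le> b" and D: "\<And>x y. a \<le> x \<Longrightarrow> x \<le> y \<Longrightarrow> y \<le> b \<Longrightarrow> \<bar>D y - D x\<bar> \<le> L * (y - x)\<^sup>2"
  shows "D a = D b"
proof -
  have "(\<lambda>n. L * (b - a)\<^sup>2 / real (Suc n)) \<longlonglongrightarrow> 0"
    by (rule LIMSEQ_Suc[OF lim_const_over_n])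
  moreover have "\<bar>D b - D a\<bar> \<le> L * (b - a)\<^sup>2 / real (Suc n)" for n
  proof -
    define p where "p = (\<lambda>i. a + real i * (b - a) / real (Suc n))"
    have step: "\<bar>D (p (Suc i)) - D (p i)\<bar> \<le> L * ((b - a) / real (Suc n))\<^sup>2" if "i < Suc n" for i
    proof -
      have 1: "p (Suc i) - p i = (b - a) / real (Suc n)"
        by (simp add: p_def flip: diff_divide_distrib left_diff_distrib)
      have 2: "a \<le> p i" using ab by (simp add: p_def)
      have "real (Suc i) * (b - a) / real (Suc n) \<le> (b - a)"
        using that ab by (simp add: divide_le_eq mult_right_mono mult.commute[of "b - a"] del: of_nat_Suc)
      then have 3: "p (Suc i) \<le> b" by (simp add: p_def)
      have "(b - a) / real (Suc n) \<ge> 0" using ab by simp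
      then show ?thesis using D[OF 2 _ 3] 1 by simp
    qed
    have "D b - D a = D (p (Suc n)) - D (p 0)" by (simp add: p_def del: of_nat_Suc)
    also have "\<dots> = (\<Sum>i<Suc n. D (p (Suc i)) - D (p i))"
      by (rule sum_lessThan_telescope[symmetric])
    also have "\<bar>\<dots>\<bar> \<le> (\<Sum>i<Suc n. L * ((b - a) / real (Suc n))\<^sup>2)"
      by (rule order_trans[OF sum_abs sum_mono]) (use step in auto)
    also have "\<dots> = L * (b - a)\<^sup>2 / real (Suc n)"
      by (simp add: power2_eq_square field_simps del: of_nat_Suc)
    finally show ?thesis .
  qed
  ultimately have "\<bar>D b - D a\<bar> \<le> 0" by (intro LIMSEQ_le_const) auto
  then show ?thesis by simp
qed

section \<open>Monotone surjections, their generalized inverses and image measures\<close>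

text \<open>The least preimage. Functions such as \<open>t\<close> along a line may be constant on
  intervals, so they have no inverse; the least choice is the one for which the equivalence
  \<open>ginv_le_iff\<close> is true.\<close>

definition ginv :: "(real \<Rightarrow> real) \<Rightarrow> real \<Rightarrow> real" where
  "ginv f y = Inf {x. y \<le> f x}"

locale onto_mono =
  fixes f :: "real \<Rightarrow> real"
  assumes mono: "\<And>x y. x \<le> y \<Longrightarrow> f x \<le> f y"
    and cont: "continuous_on UNIV f"
    and unb: "\<And>y. \<exists>x. y \<le> f x" "\<And>y. \<exists>x. f x \<le> y"
begin

lemma bdd_below_superlevel: "bdd_below {x. y \<le> f x}"
proof -
  obtain x0 where "f x0 \<le> y - 1" using unb(2) by blast
  then have "x0 \<le> x" if "y \<le> f x" for x using mono[of x x0] that by (cases "x \<le> x0") auto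
  then show ?thesis by (auto intro!: bdd_belowI[of _ x0])
qed

lemma ginv_eq: "f (ginv f y) = y"
  and ginv_le_iff: "ginv f y \<le> x \<longleftrightarrow> y \<le> f x"
proof -
  have ne: "{x. y \<le> f x} \<noteq> {}" using unb(1) by auto
  have "closed {x. y \<le> f x}" by (rule closed_Collect_le) (auto intro: cont)
  then have mem: "y \<le> f (ginv f y)"
    using closed_contains_Inf[OF ne bdd_below_superlevel] by (simp add: ginv_def)
  obtain x0 where x0: "f x0 \<le> y" using unb(2) by blast
  obtain x1 where x1: "y \<le> f x1" using unb(1) by blast
  have "\<exists>z. f z = y"
  proof (cases "x0 \<le> x1")
    case True
    then show ?thesis using IVT'[OF x0 x1 True] cont continuous_on_subset by blast
  next
    case False
    then show ?thesis using mono[of x1 x0] x0 x1 by (intro exI[of _ x1]) linarith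
  qed
  then obtain z where z: "f z = y" by blast
  then have "ginv f y \<le> z" unfolding ginv_def by (intro cInf_lower bdd_below_superlevel) auto
  then show 1: "f (ginv f y) = y" using mono z mem by force
  show "ginv f y \<le> x \<longleftrightarrow> y \<le> f x"
  proof
    assume "ginv f y \<le> x" then show "y \<le> f x" using mono 1 by metis
  next
    assume "y \<le> f x" then show "ginv f y \<le> x"
      unfolding ginv_def by (intro cInf_lower bdd_below_superlevel) auto
  qed
qed

lemma ginv_mono: "y \<le> y' \<Longrightarrow> ginv f y \<le> ginv f y'"
  unfolding ginv_le_iff by (simp add: ginv_eq)

lemma ginv_measurable: "ginv f \<in> borel_measurable borel"
  by (rule borel_measurable_mono) (auto intro!: monoI ginv_mono)

text \<open>The largest preimage \<open>r a\<close> is minus the least preimage for the reflected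
  function. It turns the preimage of \<open>{a<..b}\<close> into \<open>{r a<..r b}\<close>, again a
  half-open interval.\<close>

lemma vimage_Ioc: obtains r where "\<And>a. f (r a) = a" "\<And>a y. f y \<le> a \<longleftrightarrow> y \<le> r a"
proof -
  interpret m: onto_mono "\<lambda>x. - f (- x)"
  proof
    show "- f (- x) \<le> - f (- y)" if "x \<le> y" for x y using mono[of "-y" "-x"] that by simp
    show "continuous_on UNIV (\<lambda>x. - f (- x))"
      by (intro continuous_intros continuous_on_compose2[OF cont]) auto
    show "\<exists>x. y \<le> - f (- x)" for y
      using unb(2)[of "-y"] by (metis add.inverse_inverse le_imp_neg_le)
    show "\<exists>x. - f (- x) \<le> y" for y
      using unb(1)[of "-y"] by (metis add.inverse_inverse le_imp_neg_le)
  qed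
  show thesis
  proof
    show "f (- ginv (\<lambda>x. - f (- x)) (- a)) = a" for a using m.ginv_eq[of "-a"] by simp
    show "f y \<le> a \<longleftrightarrow> y \<le> - ginv (\<lambda>x. - f (- x)) (- a)" for a y
      using m.ginv_le_iff[of "-a" "-y"] by auto
  qed
qed

lemma measurable_self: "f \<in> borel_measurable borel"
  by (rule borel_measurable_mono) (auto intro!: monoI mono)

end

lemma measure_eqI_Ioc:
  fixes M N :: "real measure"
  assumes sets: "sets M = sets borel" "sets N = sets borel"
    and eq: "\<And>a b. a \<le> b \<Longrightarrow> emeasure M {a<..b} = emeasure N {a<..b}"
    and fin: "\<And>a b. a \<le> b \<Longrightarrow> emeasure M {a<..b} < \<infinity>"
  shows "M = N"
proof (rule measure_eqI_generator_eq[where A="\<lambda>i::nat. {- real i<..real i}" and \<Omega>=UNIV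
      and E="range (\<lambda>(a, b). {a<..b})"])
  show "Int_stable (range (\<lambda>(a::real, b). {a<..b}))"
  proof (rule Int_stableI_image)
    fix p q :: "real \<times> real"
    show "\<exists>r\<in>UNIV. (case p of (a, b) \<Rightarrow> {a<..b}) \<inter> (case q of (a, b) \<Rightarrow> {a<..b}) = (case r of (a, b) \<Rightarrow> {a<..b})"
      by (rule bexI[of _ "(max (fst p) (fst q), min (snd p) (snd q))"]) (auto split: prod.split)
  qed
  show "sets M = sigma_sets UNIV (range (\<lambda>(a, b). {a<..b}))"
    "sets N = sigma_sets UNIV (range (\<lambda>(a, b). {a<..b}))"
    using sets by (simp_all add: borel_sigma_sets_Ioc)
  show "(\<Union>i. {- real i<..real i}) = UNIV"
  proof safe
    fix x :: real
    obtain n :: nat where "\<bar>x\<bar> < real n" using reals_Archimedean2 by blast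
    then show "x \<in> (\<Union>i. {- real i<..real i})" by (intro UN_I[of n]) auto
  qed auto
  show "emeasure M {- real i<..real i} \<noteq> \<infinity>" for i using fin[of "- real i" "real i"] by simp
  fix X assume "X \<in> range (\<lambda>(a::real, b). {a<..b})"
  then obtain a b where "X = {a<..b}" by auto
  then show "emeasure M X = emeasure N X" using eq[of a b] by (cases "a \<le> b") auto
qed auto

text \<open>The Stieltjes measure of \<open>f\<close> gives no mass to intervals on which
  \<open>f\<close> is constant, so its image under \<open>f\<close> is Lebesgue measure even where
  \<open>f\<close> is not injective.\<close>

lemma (in onto_mono) distr_eq_lborel:
  assumes sets: "sets M = sets borel"
    and M: "\<And>a b. a \<le> b \<Longrightarrow> emeasure M {a<..b} = ennreal (f b - f a)"
  shows "distr M borel f = lborel"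
proof (rule measure_eqI_Ioc)
  fix a b :: real assume ab: "a \<le> b"
  obtain r where r: "\<And>a. f (r a) = a" "\<And>a y. f y \<le> a \<longleftrightarrow> y \<le> r a" using vimage_Ioc by blast
  have sp: "space M = UNIV" using sets_eq_imp_space_eq[OF sets] by simp
  have v: "f -` {a<..b} = {r a<..r b}"
    using r(2) by (auto simp: not_le[symmetric])
  have "f \<in> measurable M borel" using measurable_self measurable_cong_sets[OF sets refl] by blast
  then have "emeasure (distr M borel f) {a<..b} = emeasure M {r a<..r b}"
    by (subst emeasure_distr) (auto simp: sp v)
  also have "\<dots> = ennreal (b - a)" using M[of "r a" "r b"] r(1) r(2)[of "r a" b] ab by simp
  finally show "emeasure (distr M borel f) {a<..b} = emeasure lborel {a<..b}"
    and "emeasure (distr M borel f) {a<..b} < \<infinity>" using ab by (auto simp: emeasure_lborel_Ioc)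
qed auto

section \<open>Truncation, Borel versions and shifts of monotone functions\<close>

text \<open>Below a height \<open>A\<close> dominated convergence applies. Above it
  \<open>\<bar>y\<bar> powr p\<close> is at most \<open>A powr (p - 2) * y\<^sup>2\<close>, which is
  small in the mean for large \<open>A\<close> because \<open>p < 2\<close> and the second moments
  are bounded by \<open>C\<close>.\<close>

lemma Lp_tendsto_0_of_L2_bounded:
  fixes g :: "nat \<Rightarrow> 'a \<Rightarrow> real"
  assumes M: "finite_measure M" and p: "1 \<le> p" "p < 2"
    and meas[measurable]: "\<And>n. g n \<in> borel_measurable M"
    and ae: "AE x in M. (\<lambda>n. g n x) \<longlonglongrightarrow> 0"
    and int: "\<And>n. integrable M (\<lambda>x. (g n x)\<^sup>2)" "\<And>n. (\<integral>x. (g n x)\<^sup>2 \<partial>M) \<le> C"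
  shows "(\<lambda>n. \<integral>x. \<bar>g n x\<bar> powr p \<partial>M) \<longlonglongrightarrow> 0"
proof (rule LIMSEQ_I)
  fix e :: real assume e: "e > 0"
  interpret finite_measure M by fact
  have "0 \<le> (\<integral>x. (g 0 x)\<^sup>2 \<partial>M)" by (rule Bochner_Integration.integral_nonneg) simp
  then have C: "C \<ge> 0" using int(2)[of 0] by linarith
  have "((\<lambda>A. A powr (p - 2)) \<longlongrightarrow> 0) at_top"
    using p by (intro tendsto_neg_powr filterlim_ident) auto
  \<comment> \<open>With this choice the part above height \<open>A\<close> costs at most
    \<open>e / 2\<close>; \<open>C + 1\<close> in place of \<open>C\<close> keeps the quotient
    meaningful when \<open>C = 0\<close>.\<close>
  then have "\<forall>\<^sub>F A in at_top. A powr (p - 2) < e / (2 * (C + 1))"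
    using e C order_tendstoD(2)[of _ 0 at_top "e / (2 * (C + 1))"] by simp
  then obtain A where A: "A \<ge> 1" "A powr (p - 2) < e / (2 * (C + 1))"
    using eventually_at_top_linorder by (metis (no_types, lifting) nle_le order_refl)
  have pw: "\<bar>y\<bar> powr p \<le> (min \<bar>y\<bar> A) powr p + A powr (p - 2) * y\<^sup>2" for y
  proof (cases "\<bar>y\<bar> \<le> A")
    case False
    then have y: "\<bar>y\<bar> > 0" "\<bar>y\<bar> \<ge> A" using A by auto
    have "\<bar>y\<bar> powr p = \<bar>y\<bar> powr (p - 2) * y\<^sup>2"
      using powr_add[of "\<bar>y\<bar>" "p - 2" 2] y by simp
    also have "\<bar>y\<bar> powr (p - 2) * y\<^sup>2 \<le> A powr (p - 2) * y\<^sup>2"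
      using y A p by (intro mult_right_mono powr_mono2') auto
    finally show ?thesis by (simp add: add_increasing)
  qed simp
  have lim: "(\<lambda>n. \<integral>x. (min \<bar>g n x\<bar> A) powr p \<partial>M) \<longlonglongrightarrow> (\<integral>x. 0 \<partial>M)"
  proof (rule integral_dominated_convergence[where w="\<lambda>x. A powr p"])
    show "AE x in M. (\<lambda>n. (min \<bar>g n x\<bar> A) powr p) \<longlonglongrightarrow> 0"
      using ae
    proof eventually_elim
      case (elim x)
      have "(\<lambda>n. min \<bar>g n x\<bar> A) \<longlonglongrightarrow> min \<bar>0\<bar> A" by (intro tendsto_intros elim)
      then have "(\<lambda>n. min \<bar>g n x\<bar> A) \<longlonglongrightarrow> 0" using A by simp
      from tendsto_powr'[OF this tendsto_const, of p] show ?case using p A by simp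
    qed
    show "AE x in M. norm (min \<bar>g n x\<bar> A powr p) \<le> A powr p" for n
      using A p by (auto intro!: powr_mono2)
  qed auto
  then have "\<exists>N. \<forall>n\<ge>N. norm ((\<integral>x. (min \<bar>g n x\<bar> A) powr p \<partial>M) - 0) < e / 2"
    using e by (intro LIMSEQ_D) auto
  then obtain N where N: "\<And>n. n \<ge> N \<Longrightarrow> \<bar>\<integral>x. (min \<bar>g n x\<bar> A) powr p \<partial>M\<bar> < e / 2"
    by auto
  have "norm ((\<integral>x. \<bar>g n x\<bar> powr p \<partial>M) - 0) < e" if "n \<ge> N" for n
  proof -
    have i1: "integrable M (\<lambda>x. (min \<bar>g n x\<bar> A) powr p)"
      by (rule integrable_const_bound[of _ "A powr p"]) (use A p in \<open>auto intro!: powr_mono2\<close>)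
    have i2: "integrable M (\<lambda>x. (min \<bar>g n x\<bar> A) powr p + A powr (p - 2) * (g n x)\<^sup>2)"
      by (intro Bochner_Integration.integrable_add i1 integrable_mult_right int)
    have "integrable M (\<lambda>x. \<bar>g n x\<bar> powr p)"
      by (rule Bochner_Integration.integrable_bound[OF i2]) (use pw in \<open>auto intro!: AE_I2 order_trans[OF _ abs_ge_self]\<close>)
    then have "(\<integral>x. \<bar>g n x\<bar> powr p \<partial>M) \<le> (\<integral>x. (min \<bar>g n x\<bar> A) powr p + A powr (p - 2) * (g n x)\<^sup>2 \<partial>M)"
      by (intro integral_mono i2 pw)
    also have "\<dots> = (\<integral>x. (min \<bar>g n x\<bar> A) powr p \<partial>M) + A powr (p - 2) * (\<integral>x. (g n x)\<^sup>2 \<partial>M)"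
      by (subst Bochner_Integration.integral_add) (auto intro!: i1 int)
    also have "A powr (p - 2) * (\<integral>x. (g n x)\<^sup>2 \<partial>M) \<le> (e / (2 * (C + 1))) * C"
      using A C int(2)[of n] e by (intro mult_mono) (auto intro!: Bochner_Integration.integral_nonneg)
    also have "(e / (2 * (C + 1))) * C \<le> e / 2"
      using C e by (simp add: field_simps)
    finally have "(\<integral>x. \<bar>g n x\<bar> powr p \<partial>M) < e" using N[OF that] by linarith
    moreover have "(\<integral>x. \<bar>g n x\<bar> powr p \<partial>M) \<ge> 0" by (intro Bochner_Integration.integral_nonneg) auto
    ultimately show ?thesis by simp
  qed
  then show "\<exists>N. \<forall>n\<ge>N. norm ((\<integral>x. \<bar>g n x\<bar> powr p \<partial>M) - 0) < e" by blast
qed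

text \<open>Sections of a Lebesgue measurable function are measurable only on almost every line, so
  Fubini arguments run on a Borel version. The last conclusion is obtained by transporting the null
  set under the exchange of coordinates.\<close>

lemma lebesgue_plane_borel_version:
  fixes f :: "real \<times> real \<Rightarrow> real"
  assumes "f \<in> borel_measurable lebesgue"
  obtains f' where "f' \<in> borel_measurable borel" "AE z in lborel \<Otimes>\<^sub>M lborel. f z = f' z"
    "AE X in lborel. AE Y in lborel. f (X, Y) = f' (X, Y)"
    "AE Y in lborel. AE X in lborel. f (X, Y) = f' (X, Y)"
proof -
  obtain f' where f': "f' \<in> borel_measurable lborel" "AE x in lborel. f x = f' x"
    using completion_ex_borel_measurable_real[OF assms] by blast
  have P: "AE x in lborel \<Otimes>\<^sub>M lborel. f x = f' x" unfolding lborel_prod by (rule f'(2))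
  then have "AE x in distr (lborel \<Otimes>\<^sub>M lborel) (lborel \<Otimes>\<^sub>M lborel) (\<lambda>(x, y). (y, x)). f x = f' x"
    by (rule lborel_pair.distr_pair_swap[THEN subst])
  then have "AE x in lborel \<Otimes>\<^sub>M lborel. f (snd x, fst x) = f' (snd x, fst x)"
    by (rule AE_distrD[rotated, THEN AE_mp]) (auto simp: split_beta intro!: AE_I2)
  from lborel_pair.AE_pair[OF this] lborel_pair.AE_pair[OF P] P show thesis
    using f'(1) by (intro that[of f']) auto
qed

lemma integral_mono_shift_le:
  fixes E :: "real \<Rightarrow> real"
  assumes mono: "\<And>x y. x \<le> y \<Longrightarrow> E x \<le> E y" and bd: "\<And>x. m \<le> E x" "\<And>x. E x \<le> M"
    and d: "d \<ge> 0" and ab: "a \<le> b"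
  shows "(\<lambda>x. E x - E (x - d)) integrable_on {a..b}"
    "integral {a..b} (\<lambda>x. E x - E (x - d)) \<le> d * (M - m)"
proof -
  have int: "E integrable_on {x..y}" for x y
    by (intro integrable_on_mono_on monotone_onI mono)
  have sh: "((\<lambda>x. E (x - d)) has_integral i) {a..b}" if "(E has_integral i) {a - d..b - d}" for i
    using has_integral_affinity[of E i "a-d" "b-d" 1 "-d"] that by (simp add: image_affinity_atLeastAtMost_diff)
  have E1: "((\<lambda>x. E (x - d)) has_integral integral {a-d..b-d} E) {a..b}"
    by (rule sh) (simp add: int integrable_integral)
  then have *: "((\<lambda>x. E x - E (x - d)) has_integral (integral {a..b} E - integral {a-d..b-d} E)) {a..b}"
    by (intro has_integral_diff integrable_integral int)
  then show "(\<lambda>x. E x - E (x - d)) integrable_on {a..b}" by blast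
  have "integral {b-d..b} E \<le> integral {b-d..b} (\<lambda>x. M)"
    by (intro integral_le int integrable_const_ivl bd)
  moreover have "integral {a-d..a} (\<lambda>x. m) \<le> integral {a-d..a} E"
    by (intro integral_le int integrable_const_ivl bd)
  moreover have "integral {a-d..b-d} E + integral {b-d..b} E = integral {a-d..b} E"
    "integral {a-d..a} E + integral {a..b} E = integral {a-d..b} E"
    using ab d by (auto intro!: Henstock_Kurzweil_Integration.integral_combine int)
  ultimately show "integral {a..b} (\<lambda>x. E x - E (x - d)) \<le> d * (M - m)"
    using integral_unique[OF *] d by (simp add: algebra_simps)
qed

section \<open>Characteristic charts\<close>

text \<open>The last condition bounds the mixed difference, the substitute for a bounded \<open>F\<^sub>X\<^sub>Y\<close>; it makes the
  \<open>X\<close>-derivative exist on whole lines.\<close>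

definition rect_bound :: "(real \<Rightarrow> real \<Rightarrow> real) \<Rightarrow> real \<Rightarrow> real \<Rightarrow> bool" where
  "rect_bound F M L \<longleftrightarrow> 0 \<le> L \<and>
     (\<forall>X X' Y Y'. \<bar>X\<bar> \<le> M \<and> \<bar>X'\<bar> \<le> M \<and> \<bar>Y\<bar> \<le> M \<and> \<bar>Y'\<bar> \<le> M \<longrightarrow>
     \<bar>F X Y - F X' Y\<bar> \<le> L * \<bar>X - X'\<bar> \<and> \<bar>F X Y - F X Y'\<bar> \<le> L * \<bar>Y - Y'\<bar> \<and>
     \<bar>F X Y - F X' Y - F X Y' + F X' Y'\<bar> \<le> L * (\<bar>X - X'\<bar> * \<bar>Y - Y'\<bar>))"

definition rect_lipschitz :: "(real \<Rightarrow> real \<Rightarrow> real) \<Rightarrow> bool" where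
  "rect_lipschitz F \<longleftrightarrow> (\<forall>M. \<exists>L. rect_bound F M L)"

lemma rect_boundD:
  assumes "rect_bound F M L"
  shows "L \<ge> 0"
    "\<And>X X' Y. \<bar>X\<bar> \<le> M \<Longrightarrow> \<bar>X'\<bar> \<le> M \<Longrightarrow> \<bar>Y\<bar> \<le> M \<Longrightarrow> \<bar>F X Y - F X' Y\<bar> \<le> L * \<bar>X - X'\<bar>"
    "\<And>X Y Y'. \<bar>X\<bar> \<le> M \<Longrightarrow> \<bar>Y\<bar> \<le> M \<Longrightarrow> \<bar>Y'\<bar> \<le> M \<Longrightarrow> \<bar>F X Y - F X Y'\<bar> \<le> L * \<bar>Y - Y'\<bar>"
    "\<And>X X' Y Y'. \<bar>X\<bar> \<le> M \<Longrightarrow> \<bar>X'\<bar> \<le> M \<Longrightarrow> \<bar>Y\<bar> \<le> M \<Longrightarrow> \<bar>Y'\<bar> \<le> M \<Longrightarrow>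
       \<bar>F X Y - F X' Y - F X Y' + F X' Y'\<bar> \<le> L * (\<bar>X - X'\<bar> * \<bar>Y - Y'\<bar>)"
  using assms unfolding rect_bound_def by auto

lemma rect_boundI:
  assumes "L \<ge> 0"
    "\<And>X X' Y. \<bar>X\<bar> \<le> M \<Longrightarrow> \<bar>X'\<bar> \<le> M \<Longrightarrow> \<bar>Y\<bar> \<le> M \<Longrightarrow> \<bar>F X Y - F X' Y\<bar> \<le> L * \<bar>X - X'\<bar>"
    "\<And>X Y Y'. \<bar>X\<bar> \<le> M \<Longrightarrow> \<bar>Y\<bar> \<le> M \<Longrightarrow> \<bar>Y'\<bar> \<le> M \<Longrightarrow> \<bar>F X Y - F X Y'\<bar> \<le> L * \<bar>Y - Y'\<bar>"
    "\<And>X X' Y Y'. \<bar>X\<bar> \<le> M \<Longrightarrow> \<bar>X'\<bar> \<le> M \<Longrightarrow> \<bar>Y\<bar> \<le> M \<Longrightarrow> \<bar>Y'\<bar> \<le> M \<Longrightarrow>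
       \<bar>F X Y - F X' Y - F X Y' + F X' Y'\<bar> \<le> L * (\<bar>X - X'\<bar> * \<bar>Y - Y'\<bar>)"
  shows "rect_bound F M L"
  using assms unfolding rect_bound_def by auto

lemma rect_lipschitzE:
  assumes "rect_lipschitz F" obtains L where "rect_bound F M L"
  using assms unfolding rect_lipschitz_def by blast

lemma rect_lipschitz_swap: "rect_lipschitz F \<Longrightarrow> rect_lipschitz (\<lambda>X Y. F Y X)"
  unfolding rect_lipschitz_def
proof (intro allI)
  fix M assume "\<forall>M. \<exists>L. rect_bound F M L"
  then obtain L where L: "rect_bound F M L" by blast
  have "rect_bound (\<lambda>X Y. F Y X) M L"
  proof (rule rect_boundI)
    fix X X' Y Y' assume b: "\<bar>X\<bar> \<le> M" "\<bar>X'\<bar> \<le> M" "\<bar>Y\<bar> \<le> M" "\<bar>Y'\<bar> \<le> M"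
    have "F Y X - F Y X' - F Y' X + F Y' X' = F Y X - F Y' X - F Y X' + F Y' X'" by simp
    then show "\<bar>F Y X - F Y X' - F Y' X + F Y' X'\<bar> \<le> L * (\<bar>X - X'\<bar> * \<bar>Y - Y'\<bar>)"
      using rect_boundD(4)[OF L b(3,4,1,2)] by (metis mult.commute)
  qed (use rect_boundD[OF L] in auto)
  then show "\<exists>L. rect_bound (\<lambda>X Y. F Y X) M L" by blast
qed

lemma rect_lipschitz_add:
  assumes "rect_lipschitz F" "rect_lipschitz G" shows "rect_lipschitz (\<lambda>X Y. F X Y + G X Y)"
  unfolding rect_lipschitz_def
proof (intro allI)
  fix M
  obtain L where L: "rect_bound F M L" using rect_lipschitzE[OF assms(1)] .
  obtain K where K: "rect_bound G M K" using rect_lipschitzE[OF assms(2)] .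
  have tri: "\<bar>v\<bar> \<le> (L + K) * d" if "\<bar>r\<bar> \<le> L * d" "\<bar>s\<bar> \<le> K * d" "v = r + s" for r s d v
    using that by (simp add: distrib_right)
  have "rect_bound (\<lambda>X Y. F X Y + G X Y) M (L + K)"
  proof (rule rect_boundI)
    show "0 \<le> L + K" using rect_boundD(1)[OF L] rect_boundD(1)[OF K] by simp
    fix X X' Y Y' assume b: "\<bar>X\<bar> \<le> M" "\<bar>X'\<bar> \<le> M" "\<bar>Y\<bar> \<le> M"
    show "\<bar>F X Y + G X Y - (F X' Y + G X' Y)\<bar> \<le> (L + K) * \<bar>X - X'\<bar>"
      by (rule tri[OF rect_boundD(2)[OF L b] rect_boundD(2)[OF K b]]) simp
    assume b': "\<bar>Y'\<bar> \<le> M"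
    show "\<bar>F X Y + G X Y - (F X Y' + G X Y')\<bar> \<le> (L + K) * \<bar>Y - Y'\<bar>"
      by (rule tri[OF rect_boundD(3)[OF L b(1,3) b'] rect_boundD(3)[OF K b(1,3) b']]) simp
    show "\<bar>F X Y + G X Y - (F X' Y + G X' Y) - (F X Y' + G X Y') + (F X' Y' + G X' Y')\<bar>
        \<le> (L + K) * (\<bar>X - X'\<bar> * \<bar>Y - Y'\<bar>)"
      by (rule tri[OF rect_boundD(4)[OF L b b'] rect_boundD(4)[OF K b b']]) simp
  qed
  then show "\<exists>L. rect_bound (\<lambda>X Y. F X Y + G X Y) M L" by blast
qed

lemma rect_lipschitz_cmult:
  assumes "rect_lipschitz F" shows "rect_lipschitz (\<lambda>X Y. r * F X Y)"
  unfolding rect_lipschitz_def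
proof (intro allI)
  fix M
  obtain L where L: "rect_bound F M L" using rect_lipschitzE[OF assms(1)] .
  have tri: "\<bar>v\<bar> \<le> (\<bar>r\<bar> * L) * d" if "\<bar>s\<bar> \<le> L * d" "v = r * s" for s d v
    using mult_left_mono[OF that(1), of "\<bar>r\<bar>"] that(2) by (simp add: abs_mult mult.assoc)
  have "rect_bound (\<lambda>X Y. r * F X Y) M (\<bar>r\<bar> * L)"
  proof (rule rect_boundI)
    show "0 \<le> \<bar>r\<bar> * L" using rect_boundD(1)[OF L] by simp
    fix X X' Y Y' assume b: "\<bar>X\<bar> \<le> M" "\<bar>X'\<bar> \<le> M" "\<bar>Y\<bar> \<le> M"
    show "\<bar>r * F X Y - r * F X' Y\<bar> \<le> \<bar>r\<bar> * L * \<bar>X - X'\<bar>"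
      by (rule tri[OF rect_boundD(2)[OF L b]]) (simp add: algebra_simps)
    assume b': "\<bar>Y'\<bar> \<le> M"
    show "\<bar>r * F X Y - r * F X Y'\<bar> \<le> \<bar>r\<bar> * L * \<bar>Y - Y'\<bar>"
      by (rule tri[OF rect_boundD(3)[OF L b(1,3) b']]) (simp add: algebra_simps)
    show "\<bar>r * F X Y - r * F X' Y - r * F X Y' + r * F X' Y'\<bar> \<le> \<bar>r\<bar> * L * (\<bar>X - X'\<bar> * \<bar>Y - Y'\<bar>)"
      by (rule tri[OF rect_boundD(4)[OF L b b']]) (simp add: algebra_simps)
  qed
  then show "\<exists>L. rect_bound (\<lambda>X Y. r * F X Y) M L" by blast
qed

lemma rect_lipschitz_uminus: "rect_lipschitz F \<Longrightarrow> rect_lipschitz (\<lambda>X Y. - F X Y)"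
  using rect_lipschitz_cmult[of F "-1"] by simp

lemma rect_lipschitz_diff:
  "rect_lipschitz F \<Longrightarrow> rect_lipschitz G \<Longrightarrow> rect_lipschitz (\<lambda>X Y. F X Y - G X Y)"
  using rect_lipschitz_add[OF _ rect_lipschitz_uminus, of F G] by simp

lemma rect_lipschitz_lipschitz_X:
  assumes "rect_lipschitz F" obtains L where "L-lipschitz_on {r..s} (\<lambda>X. F X Y)"
proof -
  obtain L where L: "rect_bound F (\<bar>r\<bar> + \<bar>s\<bar> + \<bar>Y\<bar>) L" using rect_lipschitzE[OF assms] .
  have "L-lipschitz_on {r..s} (\<lambda>X. F X Y)"
    by (rule lipschitz_onI) (auto simp: dist_real_def intro!: rect_boundD[OF L])
  then show thesis by (rule that)
qed

lemma rect_lipschitz_continuous: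
  assumes F: "rect_lipschitz F" shows "continuous_on UNIV (\<lambda>p. F (fst p) (snd p))"
  unfolding continuous_on_iff
proof (intro ballI allI impI)
  fix p :: "real \<times> real" and \<epsilon> :: real assume e: "\<epsilon> > 0"
  define M where "M = \<bar>fst p\<bar> + \<bar>snd p\<bar> + 1"
  obtain L where L: "rect_bound F M L" using rect_lipschitzE[OF F] .
  note L = rect_boundD[OF L]
  define \<delta> where "\<delta> = min 1 (\<epsilon> / (2 * L + 1))"
  have "\<delta> > 0" using e L by (auto simp: \<delta>_def)
  moreover have "dist (F (fst q) (snd q)) (F (fst p) (snd p)) < \<epsilon>" if "dist q p < \<delta>" for q
  proof -
    have d: "\<bar>fst q - fst p\<bar> < \<delta>" "\<bar>snd q - snd p\<bar> < \<delta>"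
      using that dist_fst_le[of q p] dist_snd_le[of q p] by (auto simp: dist_real_def)
    then have b: "\<bar>fst q\<bar> \<le> M" "\<bar>snd q\<bar> \<le> M" "\<bar>fst p\<bar> \<le> M" "\<bar>snd p\<bar> \<le> M"
      by (auto simp: M_def \<delta>_def)
    have "\<bar>F (fst q) (snd q) - F (fst p) (snd p)\<bar> \<le> L * \<bar>fst q - fst p\<bar> + L * \<bar>snd q - snd p\<bar>"
      using L(2)[OF b(1,3,2)] L(3)[OF b(3,2,4)] by linarith
    also have "\<dots> \<le> L * \<delta> + L * \<delta>" using d L by (intro add_mono mult_left_mono) auto
    also have "\<dots> < (2 * L + 1) * \<delta>" using \<open>\<delta> > 0\<close> by (simp add: algebra_simps)
    also have "\<dots> \<le> (2 * L + 1) * (\<epsilon> / (2 * L + 1))"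
      using L(1) by (intro mult_left_mono) (auto simp: \<delta>_def)
    also have "\<dots> = \<epsilon>" using L(1) by simp
    finally show ?thesis by (simp add: dist_real_def)
  qed
  ultimately show "\<exists>\<delta>>0. \<forall>q\<in>UNIV. dist q p < \<delta> \<longrightarrow> dist (F (fst q) (snd q)) (F (fst p) (snd p)) < \<epsilon>"
    by blast
qed

text \<open>Most estimates in a chart are obtained in this form: a linear combination of
  \<open>t\<close>, \<open>x\<close>, \<open>u\<close>, \<open>e\<close> whose
  \<open>X\<close>-derivative is nonnegative off a null set is monotone on every horizontal
  line.\<close>

lemma rect_lipschitz_mono_X:
  assumes F: "rect_lipschitz F" and N: "N \<in> null_sets lborel"
    and der: "\<And>X. X \<notin> N \<Longrightarrow> ((\<lambda>X. F X Y) has_real_derivative f X) (at X)"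
    and nn: "\<And>X. X \<notin> N \<Longrightarrow> 0 \<le> f X" and le: "X \<le> X'"
  shows "F X Y \<le> F X' Y"
proof -
  obtain L where "L-lipschitz_on {X..X'} (\<lambda>X. F X Y)" using rect_lipschitz_lipschitz_X[OF F] .
  moreover have "negligible N" using N by (simp add: negligible_iff_null_sets null_sets_completionI)
  ultimately show ?thesis
    using lipschitz_deriv_nonneg_imp_le[OF le, of N L "\<lambda>X. F X Y" f] der nn by auto
qed

text \<open>\<open>\<alpha>, \<beta>, \<gamma>\<close> stand for \<open>x\<^sub>X, e\<^sub>X, c u\<^sub>X\<close> and \<open>a, b, g\<close> for \<open>- x\<^sub>Y, - e\<^sub>Y, c u\<^sub>Y\<close>. The exceptional sets
  \<open>NX\<close> and \<open>NY\<close> consist of whole lines, because level curves of \<open>t\<close> are null sets of the plane.\<close>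

locale wave_chart =
  fixes \<kappa> :: real and c dc :: "real \<Rightarrow> real" and t x u e :: "real \<Rightarrow> real \<Rightarrow> real"
    and \<alpha> \<beta> \<gamma> a b g :: "real \<Rightarrow> real \<Rightarrow> real" and NX NY :: "real set"
    and Xc Yc :: "real \<Rightarrow> real" and em ep :: real
  assumes kappa: "\<kappa> > 0" and c_bounds: "\<And>v. 1 / \<kappa> \<le> c v" "\<And>v. c v \<le> \<kappa>"
    and c_cont: "continuous_on UNIV c" and dc_meas: "dc \<in> borel_measurable borel"
    and reg: "rect_lipschitz t" "rect_lipschitz x" "rect_lipschitz u" "rect_lipschitz e"
    and null: "NX \<in> null_sets lborel" "NY \<in> null_sets lborel"
    and meas: "(\<lambda>p. \<alpha> (fst p) (snd p)) \<in> borel_measurable borel"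
      "(\<lambda>p. \<beta> (fst p) (snd p)) \<in> borel_measurable borel"
      "(\<lambda>p. a (fst p) (snd p)) \<in> borel_measurable borel"
      "(\<lambda>p. b (fst p) (snd p)) \<in> borel_measurable borel"
    and der_X: "\<And>X Y. X \<notin> NX \<Longrightarrow> ((\<lambda>X. t X Y) has_real_derivative \<alpha> X Y / c (u X Y)) (at X)"
      "\<And>X Y. X \<notin> NX \<Longrightarrow> ((\<lambda>X. x X Y) has_real_derivative \<alpha> X Y) (at X)"
      "\<And>X Y. X \<notin> NX \<Longrightarrow> ((\<lambda>X. u X Y) has_real_derivative \<gamma> X Y / c (u X Y)) (at X)"
      "\<And>X Y. X \<notin> NX \<Longrightarrow> ((\<lambda>X. e X Y) has_real_derivative \<beta> X Y) (at X)"
    and nonneg_X: "\<And>X Y. X \<notin> NX \<Longrightarrow> 0 \<le> \<alpha> X Y" "\<And>X Y. X \<notin> NX \<Longrightarrow> 0 \<le> \<beta> X Y"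
    and sq_X: "\<And>X Y. X \<notin> NX \<Longrightarrow> (\<gamma> X Y)\<^sup>2 = 2 * \<alpha> X Y * \<beta> X Y"
    and degen_X: "\<And>X. X \<notin> NX \<Longrightarrow>
      AE Y in lborel. \<alpha> X Y = 0 \<longrightarrow> \<beta> X Y \<noteq> 0 \<longrightarrow> a X Y \<noteq> 0 \<longrightarrow> dc (u X Y) = 0"
    and der_Y: "\<And>X Y. Y \<notin> NY \<Longrightarrow> ((\<lambda>Y. t X Y) has_real_derivative a X Y / c (u X Y)) (at Y)"
      "\<And>X Y. Y \<notin> NY \<Longrightarrow> ((\<lambda>Y. x X Y) has_real_derivative - a X Y) (at Y)"
      "\<And>X Y. Y \<notin> NY \<Longrightarrow> ((\<lambda>Y. u X Y) has_real_derivative g X Y / c (u X Y)) (at Y)"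
      "\<And>X Y. Y \<notin> NY \<Longrightarrow> ((\<lambda>Y. e X Y) has_real_derivative - b X Y) (at Y)"
    and nonneg_Y: "\<And>X Y. Y \<notin> NY \<Longrightarrow> 0 \<le> a X Y" "\<And>X Y. Y \<notin> NY \<Longrightarrow> 0 \<le> b X Y"
    and sq_Y: "\<And>X Y. Y \<notin> NY \<Longrightarrow> (g X Y)\<^sup>2 = 2 * a X Y * b X Y"
    and degen_Y: "\<And>Y. Y \<notin> NY \<Longrightarrow>
      AE X in lborel. a X Y = 0 \<longrightarrow> b X Y \<noteq> 0 \<longrightarrow> \<alpha> X Y \<noteq> 0 \<longrightarrow> dc (u X Y) = 0"
    and Xc: "\<And>y y'. y \<le> y' \<Longrightarrow> Xc y \<le> Xc y'" "\<And>X. \<exists>y. Xc y = X"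
    and Yc: "\<And>y y'. y \<le> y' \<Longrightarrow> Yc y' \<le> Yc y" "\<And>Y. \<exists>y. Yc y = Y"
    and on_curve: "\<And>y. t (Xc y) (Yc y) = 0" "\<And>y. x (Xc y) (Yc y) = y"
    and e_lim: "((\<lambda>y. e (Xc y) (Yc y)) \<longlongrightarrow> ep) at_top" "((\<lambda>y. e (Xc y) (Yc y)) \<longlongrightarrow> em) at_bot"
begin

lemma c_pos: "c v > 0"
  using c_bounds(1)[of v] kappa by (smt (verit) zero_less_divide_1_iff)

lemma inv_c_le: "1 / c v \<le> \<kappa>"
  using c_bounds(1)[of v] kappa c_pos[of v] by (simp add: field_simps)

text \<open>Exchanging the two characteristics reverses the orientation of the line.\<close>

lemma swap:
  "wave_chart \<kappa> c dc (\<lambda>X Y. t Y X) (\<lambda>X Y. - x Y X) (\<lambda>X Y. u Y X) (\<lambda>X Y. - e Y X)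
     (\<lambda>X Y. a Y X) (\<lambda>X Y. b Y X) (\<lambda>X Y. g Y X) (\<lambda>X Y. \<alpha> Y X) (\<lambda>X Y. \<beta> Y X) (\<lambda>X Y. \<gamma> Y X)
     NY NX (\<lambda>y. Yc (- y)) (\<lambda>y. Xc (- y)) (- ep) (- em)"
proof (unfold_locales, goal_cases)
  have m: "(\<lambda>p. f (snd p) (fst p)) \<in> borel_measurable borel"
    if "(\<lambda>p. f (fst p) (snd p)) \<in> borel_measurable borel" for f :: "real \<Rightarrow> real \<Rightarrow> real"
  proof -
    have "(\<lambda>p::real \<times> real. (snd p, fst p)) \<in> borel_measurable borel"
      by (intro borel_measurable_continuous_onI continuous_intros)
    from measurable_compose[OF this that] show ?thesis by simp
  qed
  {
    case 12 show ?case by (rule m[OF meas(3)])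
  next
    case 13 show ?case by (rule m[OF meas(4)])
  next
    case 14 show ?case by (rule m[OF meas(1)])
  next
    case 15 show ?case by (rule m[OF meas(2)])
  next
    case (17 X Y) then show ?case using DERIV_minus[OF der_Y(2)[of X Y]] by simp
  next
    case (19 X Y) then show ?case using DERIV_minus[OF der_Y(4)[of X Y]] by simp
  next
    case (25 X Y) then show ?case using DERIV_minus[OF der_X(2)[of Y X]] by simp
  next
    case (27 X Y) then show ?case using DERIV_minus[OF der_X(4)[of Y X]] by simp
  next
    case (33 X) then show ?case using Yc(2)[of X] by (metis minus_minus)
  next
    case (35 X) then show ?case using Xc(2)[of X] by (metis minus_minus)
  next
    case 38 show ?case
      using tendsto_minus[OF filterlim_compose[OF e_lim(2) filterlim_uminus_at_bot_at_top]] by simp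
  next
    case 39 show ?case
      using tendsto_minus[OF filterlim_compose[OF e_lim(1) filterlim_uminus_at_top_at_bot]] by simp
  }
qed (simp_all add: kappa c_bounds c_cont dc_meas reg null der_X der_Y nonneg_X nonneg_Y sq_X sq_Y degen_X degen_Y Xc Yc on_curve
      rect_lipschitz_swap rect_lipschitz_uminus)
end

lemma four_mult_le_square_add: "4 * p * q \<le> (p + q)\<^sup>2" for p q :: real
  using zero_le_power2[of "p - q"] by (simp add: power2_eq_square algebra_simps)

section \<open>Monotonicity, cone bounds and order in the chart\<close>

context wave_chart
begin

lemma mono_X:
  assumes "X \<le> X'"
  shows "t X Y \<le> t X' Y" "x X Y \<le> x X' Y" "e X Y \<le> e X' Y"
    by (rule rect_lipschitz_mono_X[OF reg(1) null(1) der_X(1) _ assms]; simp add: nonneg_X c_pos less_imp_le)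
       (rule rect_lipschitz_mono_X[OF reg(2) null(1) der_X(2) _ assms] rect_lipschitz_mono_X[OF reg(4) null(1) der_X(4) _ assms];
        simp add: nonneg_X c_pos)+

lemma mono_Y:
  assumes "Y \<le> Y'"
  shows "t X Y \<le> t X Y'" "x X Y' \<le> x X Y" "e X Y' \<le> e X Y"
  using wave_chart.mono_X[OF swap assms, of X] by simp_all

text \<open>Along an \<open>X\<close>-characteristic the derivatives of \<open>x\<close> and
  \<open>t\<close> have the ratio \<open>c\<close>, which lies between \<open>1 / \<kappa>\<close>
  and \<open>\<kappa>\<close>. So \<open>\<kappa> * t - x\<close> and
  \<open>\<kappa> * x - t\<close> are both nondecreasing.\<close>

lemma cone_X:
  assumes "X \<le> X'"
  shows "x X' Y - x X Y \<le> \<kappa> * (t X' Y - t X Y)" "t X' Y - t X Y \<le> \<kappa> * (x X' Y - x X Y)"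
proof -
  have "\<kappa> * t X Y - x X Y \<le> \<kappa> * t X' Y - x X' Y"
  proof (rule rect_lipschitz_mono_X[OF rect_lipschitz_diff[OF rect_lipschitz_cmult[OF reg(1)] reg(2)] null(1) _ _ assms])
    fix X assume X: "X \<notin> NX"
    show "((\<lambda>X. \<kappa> * t X Y - x X Y) has_real_derivative (\<kappa> * (\<alpha> X Y / c (u X Y)) - \<alpha> X Y)) (at X)"
      by (intro DERIV_diff DERIV_cmult der_X X)
    have "\<alpha> X Y * c (u X Y) \<le> \<alpha> X Y * \<kappa>" by (intro mult_left_mono c_bounds nonneg_X X)
    then show "0 \<le> \<kappa> * (\<alpha> X Y / c (u X Y)) - \<alpha> X Y" using c_pos[of "u X Y"] by (simp add: field_simps)
  qed
  then show "x X' Y - x X Y \<le> \<kappa> * (t X' Y - t X Y)" by (simp add: algebra_simps)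
  have "\<kappa> * x X Y - t X Y \<le> \<kappa> * x X' Y - t X' Y"
  proof (rule rect_lipschitz_mono_X[OF rect_lipschitz_diff[OF rect_lipschitz_cmult[OF reg(2)] reg(1)] null(1) _ _ assms])
    fix X assume X: "X \<notin> NX"
    show "((\<lambda>X. \<kappa> * x X Y - t X Y) has_real_derivative (\<kappa> * \<alpha> X Y - \<alpha> X Y / c (u X Y))) (at X)"
      by (intro DERIV_diff DERIV_cmult der_X X)
    have "\<alpha> X Y * (1 / c (u X Y)) \<le> \<alpha> X Y * \<kappa>" by (intro mult_left_mono inv_c_le nonneg_X X)
    then show "0 \<le> \<kappa> * \<alpha> X Y - \<alpha> X Y / c (u X Y)" by (simp add: field_simps)
  qed
  then show "t X' Y - t X Y \<le> \<kappa> * (x X' Y - x X Y)" by (simp add: algebra_simps)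
qed

lemma cone_Y:
  assumes "Y \<le> Y'"
  shows "x X Y - x X Y' \<le> \<kappa> * (t X Y' - t X Y)" "t X Y' - t X Y \<le> \<kappa> * (x X Y - x X Y')"
  using wave_chart.cone_X[OF swap assms, of X] by simp_all

text \<open>Since \<open>\<gamma>\<^sup>2 = 2 * \<alpha> * \<beta>\<close>, the weighted mean
  inequality bounds \<open>\<bar>\<gamma>\<bar>\<close> by
  \<open>r * \<alpha> + \<beta> / (2 * r)\<close>. This bound is linear in the increments of
  \<open>x\<close> and \<open>e\<close>, so it adds up along a path of several characteristic
  segments; the weight \<open>r\<close> is optimized only afterwards, in
  \<open>optimal_weight\<close>.\<close>

lemma u_increment_X:
  assumes le: "X \<le> X'" and r: "r > 0"
  shows "\<bar>u X' Y - u X Y\<bar> \<le> \<kappa> * (r * (x X' Y - x X Y) + (e X' Y - e X Y) / (2 * r))"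
proof -
  have g: "\<bar>\<gamma> X Y / c (u X Y)\<bar> \<le> \<kappa> * (r * \<alpha> X Y + \<beta> X Y / (2 * r))" if X: "X \<notin> NX" for X
  proof -
    have nn: "0 \<le> r * \<alpha> X Y + \<beta> X Y / (2 * r)" using nonneg_X[OF X] r by simp
    have "(\<gamma> X Y)\<^sup>2 = 4 * (r * \<alpha> X Y) * (\<beta> X Y / (2 * r))" using r sq_X[OF X] by simp
    also have "\<dots> \<le> (r * \<alpha> X Y + \<beta> X Y / (2 * r))\<^sup>2"
      by (rule four_mult_le_square_add)
    finally have "\<bar>\<gamma> X Y\<bar>\<^sup>2 \<le> (r * \<alpha> X Y + \<beta> X Y / (2 * r))\<^sup>2" by simp
    then have "\<bar>\<gamma> X Y\<bar> \<le> r * \<alpha> X Y + \<beta> X Y / (2 * r)" using nn by (rule power2_le_imp_le)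
    then have "\<bar>\<gamma> X Y\<bar> * (1 / c (u X Y)) \<le> (r * \<alpha> X Y + \<beta> X Y / (2 * r)) * \<kappa>"
      by (rule mult_mono) (use inv_c_le nn c_pos[of "u X Y"] in auto)
    moreover have "\<bar>\<gamma> X Y / c (u X Y)\<bar> = \<bar>\<gamma> X Y\<bar> * (1 / c (u X Y))"
      using c_pos[of "u X Y"] by simp
    ultimately show ?thesis by (simp only: mult.commute[of \<kappa>])
  qed
  have D: "((\<lambda>X. s * u X Y + \<kappa> * (r * x X Y + (1 / (2 * r)) * e X Y)) has_real_derivative
      (s * (\<gamma> X Y / c (u X Y)) + \<kappa> * (r * \<alpha> X Y + (1 / (2 * r)) * \<beta> X Y))) (at X)" if "X \<notin> NX" for X s
    by (intro DERIV_add DERIV_cmult der_X that)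
  have R: "rect_lipschitz (\<lambda>X Y. s * u X Y + \<kappa> * (r * x X Y + (1 / (2 * r)) * e X Y))" for s
    by (intro rect_lipschitz_add rect_lipschitz_cmult reg)
  \<comment> \<open>The signs \<open>s = 1\<close> and \<open>s = -1\<close> give the two halves of
    the absolute value.\<close>
  have "s * u X Y + \<kappa> * (r * x X Y + (1 / (2 * r)) * e X Y) \<le> s * u X' Y + \<kappa> * (r * x X' Y + (1 / (2 * r)) * e X' Y)"
    if "\<bar>s\<bar> = 1" for s
  proof (rule rect_lipschitz_mono_X[OF R null(1) D _ le])
    fix X assume X: "X \<notin> NX"
    show "0 \<le> s * (\<gamma> X Y / c (u X Y)) + \<kappa> * (r * \<alpha> X Y + (1 / (2 * r)) * \<beta> X Y)"
      using g[OF X] that by (auto simp: abs_if split: if_splits)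
  qed
  from this[of 1] this[of "-1"] show ?thesis
    by (simp add: abs_if algebra_simps diff_divide_distrib)
qed

lemma u_increment_Y:
  assumes "Y \<le> Y'" "r > 0"
  shows "\<bar>u X Y' - u X Y\<bar> \<le> \<kappa> * (r * (x X Y - x X Y') + (e X Y - e X Y') / (2 * r))"
  using wave_chart.u_increment_X[OF swap assms, of X] by (simp add: algebra_simps)

text \<open>The corner \<open>(Xc y, Yc y')\<close> is joined to the curve points with parameters
  \<open>y\<close> and \<open>y'\<close> by one characteristic segment each, and \<open>t\<close>
  vanishes on the curve. The cone bounds on these segments give the domain of dependence.\<close>

lemma corner_bounds:
  "\<bar>x (Xc y) (Yc y') - y\<bar> \<le> \<kappa> * \<bar>t (Xc y) (Yc y')\<bar>"
  "\<bar>x (Xc y) (Yc y') - y'\<bar> \<le> \<kappa> * \<bar>t (Xc y) (Yc y')\<bar>"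
  "y' \<le> y \<Longrightarrow> 0 \<le> t (Xc y) (Yc y')" "y \<le> y' \<Longrightarrow> t (Xc y) (Yc y') \<le> 0"
proof -
  have *: "\<bar>x (Xc y) (Yc y') - y\<bar> \<le> \<kappa> * \<bar>t (Xc y) (Yc y')\<bar> \<and> \<bar>x (Xc y) (Yc y') - y'\<bar> \<le> \<kappa> * \<bar>t (Xc y) (Yc y')\<bar> \<and> 0 \<le> t (Xc y) (Yc y')"
    if le: "y' \<le> y"
    using cone_Y(1)[OF Yc(1)[OF le], of "Xc y"] mono_Y[OF Yc(1)[OF le], of "Xc y"]
      cone_X(1)[OF Xc(1)[OF le], of "Yc y'"] mono_X[OF Xc(1)[OF le], of "Yc y'"]
    by (simp add: on_curve abs_of_nonneg abs_of_nonpos abs_le_iff)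
  have **: "\<bar>x (Xc y) (Yc y') - y\<bar> \<le> \<kappa> * \<bar>t (Xc y) (Yc y')\<bar> \<and> \<bar>x (Xc y) (Yc y') - y'\<bar> \<le> \<kappa> * \<bar>t (Xc y) (Yc y')\<bar> \<and> t (Xc y) (Yc y') \<le> 0"
    if le: "y \<le> y'"
    using cone_Y(1)[OF Yc(1)[OF le], of "Xc y"] mono_Y[OF Yc(1)[OF le], of "Xc y"]
      cone_X(1)[OF Xc(1)[OF le], of "Yc y'"] mono_X[OF Xc(1)[OF le], of "Yc y'"]
    by (simp add: on_curve abs_of_nonneg abs_of_nonpos abs_le_iff)
  show "\<bar>x (Xc y) (Yc y') - y\<bar> \<le> \<kappa> * \<bar>t (Xc y) (Yc y')\<bar>"
    "\<bar>x (Xc y) (Yc y') - y'\<bar> \<le> \<kappa> * \<bar>t (Xc y) (Yc y')\<bar>"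
    "y' \<le> y \<Longrightarrow> 0 \<le> t (Xc y) (Yc y')" "y \<le> y' \<Longrightarrow> t (Xc y) (Yc y') \<le> 0"
    using * ** by (meson linear)+
qed

lemma continuous_potentials:
  "continuous_on UNIV (\<lambda>p. t (fst p) (snd p))" "continuous_on UNIV (\<lambda>p. x (fst p) (snd p))"
  "continuous_on UNIV (\<lambda>p. u (fst p) (snd p))" "continuous_on UNIV (\<lambda>p. e (fst p) (snd p))"
  by (intro rect_lipschitz_continuous reg)+

lemma continuous_potentials_comp:
  assumes "continuous_on S f" "continuous_on S h"
  shows "continuous_on S (\<lambda>s. t (f s) (h s))" "continuous_on S (\<lambda>s. x (f s) (h s))"
    "continuous_on S (\<lambda>s. u (f s) (h s))" "continuous_on S (\<lambda>s. e (f s) (h s))"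
  using continuous_potentials[THEN continuous_on_compose2, of S "\<lambda>s. (f s, h s)"] assms
  by (auto intro: continuous_on_Pair)

lemma onto_mono_t_Y: "onto_mono (\<lambda>Y. t X Y)"
proof
  show "t X Y \<le> t X Y'" if "Y \<le> Y'" for Y Y' using mono_Y[OF that] by simp
  show "continuous_on UNIV (t X)"
    using continuous_potentials_comp(1)[OF continuous_on_const continuous_on_id, of UNIV X] by simp
  obtain y where y: "Xc y = X" using Xc(2) by blast
  \<comment> \<open>By \<open>corner_bounds\<close> the two parameters of a corner differ by at most
    \<open>2 * \<kappa> * \<bar>t\<bar>\<close>, so moving one of them by
    \<open>2 * \<kappa> * s\<close> forces \<open>\<bar>t\<bar>\<close> to be at least
    \<open>\<bar>s\<bar>\<close>. The sign of \<open>t\<close> depends on the direction of the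
    move.\<close>
  have far: "\<bar>s\<bar> \<le> \<bar>t (Xc y) (Yc (y + 2 * \<kappa> * s))\<bar>" for s
  proof -
    have "\<bar>2 * \<kappa> * s\<bar> \<le> 2 * (\<kappa> * \<bar>t (Xc y) (Yc (y + 2 * \<kappa> * s))\<bar>)"
      using corner_bounds(1,2)[of y "y + 2 * \<kappa> * s"] by linarith
    then have "(2 * \<kappa>) * \<bar>s\<bar> \<le> (2 * \<kappa>) * \<bar>t (Xc y) (Yc (y + 2 * \<kappa> * s))\<bar>" using kappa by (simp add: abs_mult mult.assoc)
    then show ?thesis using kappa by simp
  qed
  show "\<exists>Y. T \<le> t X Y" for T
    using far[of "- \<bar>T\<bar>"] corner_bounds(3)[of "y + 2 * \<kappa> * (- \<bar>T\<bar>)" y] kappa y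
    by (intro exI[of _ "Yc (y + 2 * \<kappa> * (- \<bar>T\<bar>))"]) simp
  show "\<exists>Y. t X Y \<le> T" for T
    using far[of "\<bar>T\<bar>"] corner_bounds(4)[of y "y + 2 * \<kappa> * \<bar>T\<bar>"] kappa y
    by (intro exI[of _ "Yc (y + 2 * \<kappa> * \<bar>T\<bar>)"]) simp
qed

lemma onto_mono_t_X: "onto_mono (\<lambda>X. t X Y)"
  using wave_chart.onto_mono_t_Y[OF swap, of Y] by simp

text \<open>On a diagonal both coordinates grow together, so \<open>t\<close> is monotone there; its
  unboundedness is borrowed from the vertical line \<open>X = 0\<close>.\<close>

lemma onto_mono_t_diag: "onto_mono (\<lambda>X. t X (X - s))"
proof
  show "t X (X - s) \<le> t X' (X' - s)" if "X \<le> X'" for X X'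
    using mono_X(1)[OF that, of "X - s"] mono_Y(1)[of "X - s" "X' - s" X'] that by simp
  show "continuous_on UNIV (\<lambda>X. t X (X - s))"
    by (intro continuous_potentials_comp continuous_intros)
  interpret v: onto_mono "\<lambda>Y. t 0 Y" by (rule onto_mono_t_Y)
  show "\<exists>X. T \<le> t X (X - s)" for T
  proof -
    obtain Y where Y: "T \<le> t 0 Y" using v.unb(1) by blast
    define X where "X = max 0 (Y + s)"
    have "t 0 Y \<le> t 0 (X - s)" by (rule mono_Y) (simp add: X_def)
    also have "\<dots> \<le> t X (X - s)" by (rule mono_X) (simp add: X_def)
    finally show ?thesis using Y by (intro exI[of _ X]) linarith
  qed
  show "\<exists>X. t X (X - s) \<le> T" for T
  proof -
    obtain Y where Y: "t 0 Y \<le> T" using v.unb(2) by blast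
    define X where "X = min 0 (Y + s)"
    have "t X (X - s) \<le> t 0 (X - s)" by (rule mono_X) (simp add: X_def)
    also have "\<dots> \<le> t 0 Y" by (rule mono_Y) (simp add: X_def)
    finally show ?thesis using Y by (intro exI[of _ X]) linarith
  qed
qed

text \<open>If \<open>X' \<le> X\<close> and \<open>Y \<le> Y'\<close>, monotonicity of
  \<open>x\<close> contradicts the hypothesis at once. If \<open>X' \<le> X\<close> and
  \<open>Y' \<le> Y\<close>, monotonicity makes \<open>t\<close> constant along the segments from
  \<open>(X', Y')\<close> through \<open>(X, Y')\<close> to \<open>(X, Y)\<close>, and the cone
  bounds then make \<open>x\<close> constant as well.\<close>

lemma level_order_X:
  assumes "t X Y = t X' Y'" "x X Y < x X' Y'"
  shows "X \<le> X'"
proof (rule ccontr)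
  assume "\<not> X \<le> X'" then have lt: "X' \<le> X" by simp
  show False
  proof (cases "Y \<le> Y'")
    case True
    then show False using mono_X(2)[OF lt, of Y'] mono_Y(2)[OF True, of X] assms by simp
  next
    case False
    then have le: "Y' \<le> Y" by simp
    have "t X' Y' = t X Y'" "t X Y' = t X Y"
      using mono_X(1)[OF lt, of Y'] mono_Y(1)[OF le, of X] assms by linarith+
    then show False using cone_X(1)[OF lt, of Y'] mono_X(2)[OF lt, of Y'] cone_Y(1)[OF le, of X] mono_Y(2)[OF le, of X] assms
      by simp
  qed
qed

lemma level_order:
  assumes "t X Y = t X' Y'" "x X Y < x X' Y'"
  shows "X \<le> X'" "Y' \<le> Y" "e X Y \<le> e X' Y'"
proof -
  show 1: "X \<le> X'" by (rule level_order_X[OF assms])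
  show 2: "Y' \<le> Y" using wave_chart.level_order_X[OF swap, where X=Y' and Y=X' and X'=Y and Y'=X] assms by simp
  show "e X Y \<le> e X' Y'" using mono_X(3)[OF 1, of Y] mono_Y(3)[OF 2, of X'] by simp
qed

text \<open>The argument of \<open>level_order_X\<close> with \<open>t\<close> and \<open>x\<close>
  exchanged: the other half of each cone bound transfers constancy from \<open>x\<close> to
  \<open>t\<close>.\<close>

lemma time_order_X:
  assumes "x X Y = x X' Y'" "t X Y < t X' Y'"
  shows "X \<le> X'"
proof (rule ccontr)
  assume "\<not> X \<le> X'" then have lt: "X' \<le> X" by simp
  show False
  proof (cases "Y' \<le> Y")
    case True
    then show False using mono_X(1)[OF lt, of Y'] mono_Y(1)[OF True, of X] assms by simp
  next
    case False
    then have le: "Y \<le> Y'" by simp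
    have "x X' Y' = x X Y'" "x X Y' = x X Y"
      using mono_X(2)[OF lt, of Y'] mono_Y(2)[OF le, of X] assms by linarith+
    then show False using cone_X(2)[OF lt, of Y'] mono_X(1)[OF lt, of Y'] cone_Y(2)[OF le, of X] mono_Y(1)[OF le, of X] assms
      by simp
  qed
qed

lemma time_order:
  assumes "x X Y = x X' Y'" "t X Y < t X' Y'"
  shows "X \<le> X'" "Y \<le> Y'"
  using time_order_X[OF assms] wave_chart.time_order_X[OF swap, where X=Y and Y=X and X'=Y' and Y'=X'] assms by simp_all

lemma e_curve_mono: "y \<le> y' \<Longrightarrow> e (Xc y) (Yc y) \<le> e (Xc y') (Yc y')"
  using mono_X(3)[OF Xc(1), of y y' "Yc y"] mono_Y(3)[OF Yc(1), of y y' "Xc y'"] by simp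

text \<open>As \<open>e\<close> increases in \<open>X\<close> and decreases in \<open>Y\<close>, its
  value at a corner lies between its values at the two curve points on the same characteristics.
  Every point of the plane is such a corner, so the limits of \<open>e\<close> along the curve bound
  \<open>e\<close> everywhere.\<close>

lemma e_corner:
  "e (Xc (min y y')) (Yc (min y y')) \<le> e (Xc y) (Yc y')"
  "e (Xc y) (Yc y') \<le> e (Xc (max y y')) (Yc (max y y'))"
  using mono_X(3)[OF Xc(1), of y y' "Yc y'"] mono_X(3)[OF Xc(1), of y' y "Yc y'"]
    mono_Y(3)[OF Yc(1), of y y' "Xc y"] mono_Y(3)[OF Yc(1), of y' y "Xc y"]
  by (auto simp: min_def max_def)

lemma e_curve_bounds: "em \<le> e (Xc y) (Yc y)" "e (Xc y) (Yc y) \<le> ep"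
proof -
  show "em \<le> e (Xc y) (Yc y)"
    by (rule tendsto_upperbound[OF e_lim(2)]) (auto intro!: eventually_mono[OF eventually_le_at_bot[of y]] e_curve_mono)
  show "e (Xc y) (Yc y) \<le> ep"
    by (rule tendsto_lowerbound[OF e_lim(1)]) (auto intro!: eventually_mono[OF eventually_ge_at_top[of y]] e_curve_mono)
qed

lemma e_bounds: "em \<le> e X Y" "e X Y \<le> ep"
proof -
  obtain y y' where "Xc y = X" "Yc y' = Y" using Xc(2) Yc(2) by blast
  then show "em \<le> e X Y" "e X Y \<le> ep"
    using e_corner[of y y'] e_curve_bounds[of "min y y'"] e_curve_bounds[of "max y y'"] by auto
qed

lemma em_le_ep: "em \<le> ep" using e_bounds[of 0 0] by simp

end

text \<open>The bound is smallest at \<open>r = sqrt (B / (2 * A))\<close>, which turns it into a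
  Cauchy-Schwarz inequality. Since \<open>A\<close> or \<open>B\<close> may vanish, both are first
  enlarged by \<open>d > 0\<close>, and \<open>d\<close> tends to 0 at the end.\<close>

lemma optimal_weight:
  fixes v A B k :: real
  assumes nn: "A \<ge> 0" "B \<ge> 0" "k \<ge> 0" and v: "\<And>r. r > 0 \<Longrightarrow> \<bar>v\<bar> \<le> k * (r * A + B / (2 * r))"
  shows "v\<^sup>2 \<le> 2 * k\<^sup>2 * A * B"
proof -
  have *: "v\<^sup>2 \<le> 2 * k\<^sup>2 * (A + d) * (B + d)" if d: "d > 0" for d
  proof -
    define r where "r = sqrt ((B + d) / (2 * (A + d)))"
    have pos: "A + d > 0" "B + d > 0" using nn d by auto
    then have r: "r > 0" by (simp add: r_def)
    have r2: "r\<^sup>2 = (B + d) / (2 * (A + d))" using pos by (simp add: r_def)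
    have "\<bar>v\<bar> \<le> k * (r * A + B / (2 * r))" using v r by blast
    also have "\<dots> \<le> k * (r * (A + d) + (B + d) / (2 * r))"
      using nn d r by (intro mult_left_mono add_mono divide_right_mono) auto
    finally have "v\<^sup>2 \<le> (k * (r * (A + d) + (B + d) / (2 * r)))\<^sup>2" by (intro abs_le_square_iff[THEN iffD1]) linarith
    also have "\<dots> = k\<^sup>2 * (r\<^sup>2 * (A + d)\<^sup>2 + (A + d) * (B + d) + (B + d)\<^sup>2 / (4 * r\<^sup>2))"
      using r by (simp add: power2_eq_square field_simps)
    also have "r\<^sup>2 * (A + d)\<^sup>2 = (A + d) * (B + d) / 2" unfolding r2 using pos by (simp add: power2_eq_square field_simps)
    also have "(B + d)\<^sup>2 / (4 * r\<^sup>2) = (A + d) * (B + d) / 2" unfolding r2 using pos by (simp add: power2_eq_square field_simps)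
    finally show ?thesis by (simp add: algebra_simps)
  qed
  have "((\<lambda>d. 2 * k\<^sup>2 * (A + d) * (B + d)) \<longlongrightarrow> 2 * k\<^sup>2 * (A + 0) * (B + 0)) (at_right 0)"
    by (intro tendsto_intros)
  from tendsto_lowerbound[OF this, of "v\<^sup>2"] show ?thesis
    using * by (auto simp: eventually_at_right_less intro: eventually_mono[OF eventually_at_right_less])
qed

section \<open>Level curves of time and the energy distribution function\<close>

context wave_chart
begin

definition Ys :: "real \<Rightarrow> real \<Rightarrow> real" where "Ys X \<tau> = ginv (\<lambda>Y. t X Y) \<tau>"
definition Xs :: "real \<Rightarrow> real \<Rightarrow> real" where "Xs Y \<tau> = ginv (\<lambda>X. t X Y) \<tau>"

text \<open>The lower boundary of the level set of \<open>t\<close>, parametrized by \<open>s = X - Y\<close>. The level set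
  itself may have interior.\<close>

definition Xd :: "real \<Rightarrow> real \<Rightarrow> real" where "Xd \<tau> s = ginv (\<lambda>X. t X (X - s)) \<tau>"
definition Yd :: "real \<Rightarrow> real \<Rightarrow> real" where "Yd \<tau> s = Xd \<tau> s - s"
definition xh :: "real \<Rightarrow> real \<Rightarrow> real" where "xh \<tau> s = x (Xd \<tau> s) (Yd \<tau> s)"
definition eh :: "real \<Rightarrow> real \<Rightarrow> real" where "eh \<tau> s = e (Xd \<tau> s) (Yd \<tau> s)"

lemma t_Ys: "t X (Ys X \<tau>) = \<tau>" and Ys_le_iff: "Ys X \<tau> \<le> Y \<longleftrightarrow> \<tau> \<le> t X Y"
  using onto_mono.ginv_eq[OF onto_mono_t_Y] onto_mono.ginv_le_iff[OF onto_mono_t_Y] by (simp_all add: Ys_def)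

lemma t_Xs: "t (Xs Y \<tau>) Y = \<tau>" and Xs_le_iff: "Xs Y \<tau> \<le> X \<longleftrightarrow> \<tau> \<le> t X Y"
  using onto_mono.ginv_eq[OF onto_mono_t_X] onto_mono.ginv_le_iff[OF onto_mono_t_X] by (simp_all add: Xs_def)

lemma t_Xd: "t (Xd \<tau> s) (Yd \<tau> s) = \<tau>" and Xd_le_iff: "Xd \<tau> s \<le> X \<longleftrightarrow> \<tau> \<le> t X (X - s)"
  using onto_mono.ginv_eq[OF onto_mono_t_diag] onto_mono.ginv_le_iff[OF onto_mono_t_diag] by (simp_all add: Xd_def Yd_def)

lemma Xd_mono: "s \<le> s' \<Longrightarrow> Xd \<tau> s \<le> Xd \<tau> s'"
  unfolding Xd_le_iff using mono_Y(1)[of "Yd \<tau> s'" "Xd \<tau> s' - s" "Xd \<tau> s'"] t_Xd[of \<tau> s'] by (simp add: Yd_def)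

lemma Yd_antimono: assumes "s \<le> s'" shows "Yd \<tau> s' \<le> Yd \<tau> s"
proof -
  have "\<tau> \<le> t (Yd \<tau> s + s') (Yd \<tau> s + s' - s')"
    using mono_X(1)[of "Xd \<tau> s" "Yd \<tau> s + s'" "Yd \<tau> s"] t_Xd[of \<tau> s] assms by (simp add: Yd_def)
  then have "Xd \<tau> s' \<le> Yd \<tau> s + s'" unfolding Xd_le_iff .
  then show ?thesis by (simp add: Yd_def)
qed

text \<open>\<open>Xd\<close> increases, \<open>Yd\<close> decreases and their difference is
  \<open>s\<close>, so neither changes faster than \<open>s\<close>.\<close>

lemma Xd_lipschitz: "\<bar>Xd \<tau> s - Xd \<tau> s'\<bar> \<le> \<bar>s - s'\<bar>"
  using Xd_mono[of s s' \<tau>] Xd_mono[of s' s \<tau>] Yd_antimono[of s s' \<tau>] Yd_antimono[of s' s \<tau>]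
  by (auto simp: Yd_def abs_if)

lemma continuous_Xd: "continuous_on S (Xd \<tau>)"
proof (rule lipschitz_on_continuous_on[of 1])
  show "1-lipschitz_on S (Xd \<tau>)" by (rule lipschitz_onI) (auto simp: dist_real_def Xd_lipschitz)
qed

lemma continuous_Yd: "continuous_on S (Yd \<tau>)"
  unfolding Yd_def by (intro continuous_intros continuous_Xd)

text \<open>The lowest point of the level set on a vertical line belongs to the chosen lower
  boundary. Integrals in \<open>X\<close> along the level curve can therefore be rewritten in the
  parameter \<open>s\<close>.\<close>

lemma Xd_section: "Xd \<tau> (X - Ys X \<tau>) = X" "Yd \<tau> (X - Ys X \<tau>) = Ys X \<tau>"
proof -
  define X' where "X' = Xd \<tau> (X - Ys X \<tau>)"
  have le: "X' \<le> X" unfolding X'_def Xd_le_iff by (simp add: t_Ys)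
  have "t X' (X' - (X - Ys X \<tau>)) = \<tau>" using t_Xd[of \<tau> "X - Ys X \<tau>"] by (simp add: X'_def Yd_def)
  then have "\<tau> \<le> t X (X' - (X - Ys X \<tau>))" using mono_X(1)[OF le] by metis
  then have "Ys X \<tau> \<le> X' - (X - Ys X \<tau>)" by (simp add: Ys_le_iff)
  then show 1: "Xd \<tau> (X - Ys X \<tau>) = X" using le by (simp add: X'_def)
  then show "Yd \<tau> (X - Ys X \<tau>) = Ys X \<tau>" by (simp add: Yd_def)
qed

lemma Yd_section: "Xd \<tau> (Xs Y \<tau> - Y) = Xs Y \<tau>" "Yd \<tau> (Xs Y \<tau> - Y) = Y"
proof -
  define X' where "X' = Xd \<tau> (Xs Y \<tau> - Y)"
  have le: "X' \<le> Xs Y \<tau>" unfolding X'_def Xd_le_iff by (simp add: t_Xs)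
  have "t X' (X' - (Xs Y \<tau> - Y)) = \<tau>" using t_Xd[of \<tau> "Xs Y \<tau> - Y"] by (simp add: X'_def Yd_def)
  moreover have "X' - (Xs Y \<tau> - Y) \<le> Y" using le by simp
  ultimately have "\<tau> \<le> t X' Y" using mono_Y(1) by metis
  then have "Xs Y \<tau> \<le> X'" by (simp add: Xs_le_iff)
  then show 1: "Xd \<tau> (Xs Y \<tau> - Y) = Xs Y \<tau>" using le by (simp add: X'_def)
  then show "Yd \<tau> (Xs Y \<tau> - Y) = Y" by (simp add: Yd_def)
qed

lemma xh_mono: "s \<le> s' \<Longrightarrow> xh \<tau> s \<le> xh \<tau> s'"
  unfolding xh_def using mono_X(2)[OF Xd_mono, of s s' \<tau>] mono_Y(2)[OF Yd_antimono, of s s' _ \<tau>] order_trans by blast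

lemma eh_mono: "s \<le> s' \<Longrightarrow> eh \<tau> s \<le> eh \<tau> s'"
  unfolding eh_def using mono_X(3)[OF Xd_mono, of s s' \<tau>] mono_Y(3)[OF Yd_antimono, of s s' _ \<tau>] order_trans by blast

lemma continuous_xh: "continuous_on S (xh \<tau>)" and continuous_eh: "continuous_on S (eh \<tau>)"
  unfolding xh_def eh_def by (intro continuous_potentials_comp continuous_Xd continuous_Yd)+

text \<open>The vertical line through \<open>Xc y\<close> meets the level set in a corner
  \<open>(Xc y, Yc y')\<close>, and \<open>corner_bounds\<close> controls its position and its
  second parameter. This gives both the surjectivity of \<open>xh\<close> and the behaviour of
  \<open>eh\<close> at the two ends.\<close>

lemma point_near_curve: obtains s y' where
  "\<bar>xh \<tau> s - y\<bar> \<le> \<kappa> * \<bar>\<tau>\<bar>" "\<bar>y' - y\<bar> \<le> 2 * \<kappa> * \<bar>\<tau>\<bar>" "eh \<tau> s = e (Xc y) (Yc y')"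
proof -
  obtain y' where y': "Yc y' = Ys (Xc y) \<tau>" using Yc(2) by blast
  have "t (Xc y) (Yc y') = \<tau>" by (simp add: y' t_Ys)
  then show thesis
    using corner_bounds(1,2)[of y y'] that[of "Xc y - Ys (Xc y) \<tau>" y'] by (simp add: xh_def eh_def Xd_section y')
qed

lemma onto_mono_xh: "onto_mono (xh \<tau>)"
proof
  show "continuous_on UNIV (xh \<tau>)" by (rule continuous_xh)
  show "xh \<tau> s \<le> xh \<tau> s'" if "s \<le> s'" for s s' using xh_mono[OF that] .
  show "\<exists>s. \<xi> \<le> xh \<tau> s" for \<xi>
  proof -
    obtain s y' where "\<bar>xh \<tau> s - (\<xi> + \<kappa> * \<bar>\<tau>\<bar>)\<bar> \<le> \<kappa> * \<bar>\<tau>\<bar>" using point_near_curve[of \<tau> "\<xi> + \<kappa> * \<bar>\<tau>\<bar>"] by blast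
    then show ?thesis by (intro exI[of _ s]) linarith
  qed
  show "\<exists>s. xh \<tau> s \<le> \<xi>" for \<xi>
  proof -
    obtain s y' where "\<bar>xh \<tau> s - (\<xi> - \<kappa> * \<bar>\<tau>\<bar>)\<bar> \<le> \<kappa> * \<bar>\<tau>\<bar>" using point_near_curve[of \<tau> "\<xi> - \<kappa> * \<bar>\<tau>\<bar>"] by blast
    then show ?thesis by (intro exI[of _ s]) linarith
  qed
qed

lemma eh_bounds: "em \<le> eh \<tau> s" "eh \<tau> s \<le> ep"
  by (simp_all add: eh_def e_bounds)

text \<open>Here the conservation of energy originates: far out on the level curve,
  \<open>eh\<close> takes the value of \<open>e\<close> at a corner both of whose parameters are far
  out on the initial curve.\<close>

lemma eh_approaches: assumes "r > 0" shows "\<exists>s. ep - r < eh \<tau> s" "\<exists>s. eh \<tau> s < em + r"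
proof -
  have "\<forall>\<^sub>F y in at_top. ep - r < e (Xc y) (Yc y)" using assms by (intro order_tendstoD(1)[OF e_lim(1)]) simp
  then obtain y0 where y0: "ep - r < e (Xc y0) (Yc y0)"
    by (meson eventually_at_top_linorder order_refl)
  \<comment> \<open>The shift by \<open>2 * \<kappa> * \<bar>\<tau>\<bar>\<close> keeps
    \<open>y'\<close> at or beyond \<open>y0\<close>, so the lower bound of \<open>e_corner\<close>
    is still at least the value at \<open>y0\<close>.\<close>
  obtain s y' where s: "\<bar>y' - (y0 + 2 * \<kappa> * \<bar>\<tau>\<bar>)\<bar> \<le> 2 * \<kappa> * \<bar>\<tau>\<bar>" "eh \<tau> s = e (Xc (y0 + 2 * \<kappa> * \<bar>\<tau>\<bar>)) (Yc y')"
    using point_near_curve[of \<tau> "y0 + 2 * \<kappa> * \<bar>\<tau>\<bar>"] by metis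
  have "y0 \<le> min (y0 + 2 * \<kappa> * \<bar>\<tau>\<bar>) y'" using s(1) kappa by auto
  then show "\<exists>s. ep - r < eh \<tau> s" using e_curve_mono e_corner(1) y0 s(2) by (metis order_less_le_trans)
next
  have "\<forall>\<^sub>F y in at_bot. e (Xc y) (Yc y) < em + r" using assms by (intro order_tendstoD(2)[OF e_lim(2)]) simp
  then obtain y0 where y0: "e (Xc y0) (Yc y0) < em + r"
    by (meson eventually_at_bot_linorder order_refl)
  obtain s y' where s: "\<bar>y' - (y0 - 2 * \<kappa> * \<bar>\<tau>\<bar>)\<bar> \<le> 2 * \<kappa> * \<bar>\<tau>\<bar>" "eh \<tau> s = e (Xc (y0 - 2 * \<kappa> * \<bar>\<tau>\<bar>)) (Yc y')"
    using point_near_curve[of \<tau> "y0 - 2 * \<kappa> * \<bar>\<tau>\<bar>"] by metis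
  have "max (y0 - 2 * \<kappa> * \<bar>\<tau>\<bar>) y' \<le> y0" using s(1) kappa by auto
  then show "\<exists>s. eh \<tau> s < em + r" using e_curve_mono e_corner(2) y0 s(2) by (metis order_le_less_trans)
qed

definition sx :: "real \<Rightarrow> real \<Rightarrow> real" where "sx \<tau> \<xi> = ginv (xh \<tau>) \<xi>"
text \<open>\<open>E \<tau> \<xi> - em\<close> is the energy strictly to the left of
  \<open>\<xi>\<close> at time \<open>\<tau>\<close>: since \<open>sx\<close> selects the least
  parameter over \<open>\<xi>\<close>, a concentration of energy at \<open>\<xi>\<close> is not
  counted.\<close>

definition E :: "real \<Rightarrow> real \<Rightarrow> real" where "E \<tau> \<xi> = eh \<tau> (sx \<tau> \<xi>)"

lemma xh_sx: "xh \<tau> (sx \<tau> \<xi>) = \<xi>"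
  unfolding sx_def by (rule onto_mono.ginv_eq[OF onto_mono_xh])

lemma point_over: obtains X Y where "t X Y = \<tau>" "x X Y = \<xi>" "e X Y = E \<tau> \<xi>"
  using that[of "Xd \<tau> (sx \<tau> \<xi>)" "Yd \<tau> (sx \<tau> \<xi>)"] t_Xd xh_sx by (simp add: xh_def E_def eh_def)

lemma E_mono: "\<xi> \<le> \<xi>' \<Longrightarrow> E \<tau> \<xi> \<le> E \<tau> \<xi>'"
  unfolding E_def sx_def by (intro eh_mono onto_mono.ginv_mono[OF onto_mono_xh])

lemma E_bounds: "em \<le> E \<tau> \<xi>" "E \<tau> \<xi> \<le> ep"
  by (simp_all add: E_def eh_bounds)

lemma E_le: "\<xi> < x X Y \<Longrightarrow> E (t X Y) \<xi> \<le> e X Y"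
proof -
  assume "\<xi> < x X Y"
  moreover obtain X' Y' where "t X' Y' = t X Y" "x X' Y' = \<xi>" "e X' Y' = E (t X Y) \<xi>" using point_over .
  ultimately show ?thesis using level_order(3)[of X' Y' X Y] by simp
qed

end

section \<open>Increments of the solution in space and time\<close>

locale wave_solution = wave_chart +
  fixes U :: "real \<Rightarrow> real \<Rightarrow> real"
  assumes U: "U (t X Y) (x X Y) = u X Y"
begin

text \<open>Two points over the same time are joined by an \<open>X\<close>-segment followed by a
  \<open>Y\<close>-segment. Although the corner lies at another time, \<open>x\<close> and
  \<open>e\<close> both increase along the whole path, so their increments telescope before the
  weight is optimized.\<close>

lemma U_space_increment:
  assumes "\<xi> \<le> \<xi>'"
  shows "(U \<tau> \<xi>' - U \<tau> \<xi>)\<^sup>2 \<le> 2 * \<kappa>\<^sup>2 * (\<xi>' - \<xi>) * (E \<tau> \<xi>' - E \<tau> \<xi>)"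
proof (cases "\<xi> = \<xi>'")
  case False
  obtain X Y where P: "t X Y = \<tau>" "x X Y = \<xi>" "e X Y = E \<tau> \<xi>" using point_over .
  obtain X' Y' where P': "t X' Y' = \<tau>" "x X' Y' = \<xi>'" "e X' Y' = E \<tau> \<xi>'" using point_over .
  have le: "X \<le> X'" "Y' \<le> Y" using level_order[of X Y X' Y'] P P' False assms by auto
  show ?thesis
  proof (rule optimal_weight)
    show "0 \<le> \<xi>' - \<xi>" "0 \<le> E \<tau> \<xi>' - E \<tau> \<xi>" "0 \<le> \<kappa>" using assms E_mono kappa by auto
    fix r :: real assume r: "r > 0"
    have "\<bar>U \<tau> \<xi>' - U \<tau> \<xi>\<bar> \<le> \<bar>u X' Y - u X Y\<bar> + \<bar>u X' Y - u X' Y'\<bar>"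
      using U[of X Y] U[of X' Y'] P P' by simp
    also have "\<dots> \<le> \<kappa> * (r * (x X' Y - x X Y) + (e X' Y - e X Y) / (2 * r)) +
        \<kappa> * (r * (x X' Y' - x X' Y) + (e X' Y' - e X' Y) / (2 * r))"
      by (intro add_mono u_increment_X u_increment_Y le r)
    also have "\<dots> = \<kappa> * (r * (\<xi>' - \<xi>) + (E \<tau> \<xi>' - E \<tau> \<xi>) / (2 * r))"
      using P P' r by (simp add: field_simps)
    finally show "\<bar>U \<tau> \<xi>' - U \<tau> \<xi>\<bar> \<le> \<kappa> * (r * (\<xi>' - \<xi>) + (E \<tau> \<xi>' - E \<tau> \<xi>) / (2 * r))" .
  qed
qed simp

text \<open>The path runs through the corner \<open>(X, Y')\<close>. Time only grows along it, so
  the total variation of \<open>x\<close> is at most \<open>\<kappa> * h\<close>. The potential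
  \<open>e\<close> first falls and then rises, and both amounts are bounded by energies in an
  interval to the left of \<open>\<xi>\<close> at the two times.\<close>

lemma U_time_increment:
  assumes lt: "\<tau> < \<tau>'"
  defines "h \<equiv> \<tau>' - \<tau>"
  shows "(U \<tau>' \<xi> - U \<tau> \<xi>)\<^sup>2 \<le> 2 * \<kappa>\<^sup>2 * (\<kappa> * h) *
    ((E \<tau> \<xi> - E \<tau> (\<xi> - 3 * \<kappa> * h)) + (E \<tau>' \<xi> - E \<tau>' (\<xi> - 3 * \<kappa> * h)))"
proof -
  obtain X Y where P: "t X Y = \<tau>" "x X Y = \<xi>" "e X Y = E \<tau> \<xi>" using point_over .
  obtain X' Y' where P': "t X' Y' = \<tau>'" "x X' Y' = \<xi>" "e X' Y' = E \<tau>' \<xi>" using point_over .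
  have le: "X \<le> X'" "Y \<le> Y'" using time_order[of X Y X' Y'] P P' lt by auto
  have h: "h > 0" and kh: "\<kappa> * h > 0" using lt kappa by (auto simp: h_def)
  have tq: "\<tau> \<le> t X Y'" "t X Y' \<le> \<tau>'" using mono_Y(1)[OF le(2), of X] mono_X(1)[OF le(1), of Y'] P P' by auto
  have khm: "\<kappa> * (v - w) \<le> \<kappa> * h" if "v \<le> \<tau>'" "\<tau> \<le> w" for v w
    using that kappa by (intro mult_left_mono) (auto simp: h_def)
  have xq: "\<xi> - \<kappa> * h \<le> x X Y'" using cone_Y(1)[OF le(2), of X] khm[OF tq(2), of \<tau>] P by simp
  \<comment> \<open>The corner lies at most \<open>\<kappa> * h\<close> to the left of
    \<open>\<xi>\<close>, and following a characteristic from it to either time costs at most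
    another \<open>\<kappa> * h\<close>. The factor 3 instead of 2 provides the strict inequality
    that \<open>E_le\<close> demands.\<close>
  have "E \<tau> (\<xi> - 3 * \<kappa> * h) \<le> e (Xs Y' \<tau>) Y'"
  proof -
    have X2: "Xs Y' \<tau> \<le> X" using tq by (simp add: Xs_le_iff)
    have "x X Y' - \<kappa> * h \<le> x (Xs Y' \<tau>) Y'" using cone_X(1)[OF X2, of Y'] khm[OF tq(2), of \<tau>] t_Xs by simp
    then show ?thesis using E_le[of "\<xi> - 3 * \<kappa> * h" "Xs Y' \<tau>" Y'] xq kh t_Xs by simp
  qed
  moreover have "e (Xs Y' \<tau>) Y' \<le> e X Y'" using tq by (intro mono_X) (simp add: Xs_le_iff)
  ultimately have 1: "E \<tau> (\<xi> - 3 * \<kappa> * h) \<le> e X Y'" by linarith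
  have 2: "E \<tau>' (\<xi> - 3 * \<kappa> * h) \<le> e X Y'"
  \<comment> \<open>If the corner is already on level \<open>\<tau>'\<close>, then
    \<open>Ys X \<tau>'\<close> may lie below \<open>Y'\<close>, so the comparison is made at the
    corner itself.\<close>
  proof (cases "t X Y' = \<tau>'")
    case True
    then show ?thesis using E_le[of "\<xi> - 3 * \<kappa> * h" X Y'] xq kh by simp
  next
    case False
    then have "\<not> Ys X \<tau>' \<le> Y'" using tq(2) by (simp add: Ys_le_iff)
    then have Y3: "Y' \<le> Ys X \<tau>'" by simp
    have "x X Y' - \<kappa> * h \<le> x X (Ys X \<tau>')" using cone_Y(1)[OF Y3, of X] khm[OF order_refl tq(1)] t_Ys by simp
    then have "E \<tau>' (\<xi> - 3 * \<kappa> * h) \<le> e X (Ys X \<tau>')" using E_le[of "\<xi> - 3 * \<kappa> * h" X "Ys X \<tau>'"] xq kh t_Ys by simp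
    then show ?thesis using mono_Y(3)[OF Y3, of X] by simp
  qed
  define V where "V = (e X Y - e X Y') + (e X' Y' - e X Y')"
  have V0: "V \<ge> 0" using mono_Y(3)[OF le(2), of X] mono_X(3)[OF le(1), of Y'] by (simp add: V_def)
  have "(U \<tau>' \<xi> - U \<tau> \<xi>)\<^sup>2 \<le> 2 * \<kappa>\<^sup>2 * (\<kappa> * h) * V"
  proof (rule optimal_weight)
    show "0 \<le> \<kappa> * h" "0 \<le> V" "0 \<le> \<kappa>" using V0 kh kappa by auto
    fix r :: real assume r: "r > 0"
    have "\<bar>U \<tau>' \<xi> - U \<tau> \<xi>\<bar> \<le> \<bar>u X Y' - u X Y\<bar> + \<bar>u X' Y' - u X Y'\<bar>"
      using U[of X Y] U[of X' Y'] P P' by simp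
    also have "\<dots> \<le> \<kappa> * (r * (x X Y - x X Y') + (e X Y - e X Y') / (2 * r)) +
        \<kappa> * (r * (x X' Y' - x X Y') + (e X' Y' - e X Y') / (2 * r))"
      by (intro add_mono u_increment_X u_increment_Y le r)
    also have "\<dots> = \<kappa> * (r * ((x X Y - x X Y') + (x X' Y' - x X Y')) + V / (2 * r))"
      using r by (simp add: V_def field_simps)
    also have "\<dots> \<le> \<kappa> * (r * (\<kappa> * h) + V / (2 * r))"
    proof -
      have "(x X Y - x X Y') + (x X' Y' - x X Y') \<le> \<kappa> * h"
        using cone_Y(1)[OF le(2), of X] cone_X(1)[OF le(1), of Y'] P P' by (simp add: h_def algebra_simps)
      then show ?thesis using r kappa by (intro mult_left_mono add_right_mono) auto
    qed
    finally show "\<bar>U \<tau>' \<xi> - U \<tau> \<xi>\<bar> \<le> \<kappa> * (r * (\<kappa> * h) + V / (2 * r))" .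
  qed
  also have "\<dots> \<le> 2 * \<kappa>\<^sup>2 * (\<kappa> * h) *
    ((E \<tau> \<xi> - E \<tau> (\<xi> - 3 * \<kappa> * h)) + (E \<tau>' \<xi> - E \<tau>' (\<xi> - 3 * \<kappa> * h)))"
    using 1 2 P P' kh by (intro mult_left_mono) (auto simp: V_def)
  finally show ?thesis .
qed

text \<open>Bounding the energy increment in \<open>U_space_increment\<close> by
  \<open>ep - em\<close> gives Hoelder continuity with exponent 1/2.\<close>

lemma continuous_U: "continuous_on UNIV (U \<tau>)"
  unfolding continuous_on_def
proof
  fix \<xi> :: real
  have b: "(U \<tau> \<xi>' - U \<tau> \<xi>)\<^sup>2 \<le> 2 * \<kappa>\<^sup>2 * (ep - em) * \<bar>\<xi>' - \<xi>\<bar>" for \<xi>'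
  proof -
    have *: "(U \<tau> v - U \<tau> w)\<^sup>2 \<le> 2 * \<kappa>\<^sup>2 * (ep - em) * (v - w)" if "w \<le> v" for v w
    proof -
      have "2 * \<kappa>\<^sup>2 * (v - w) * (E \<tau> v - E \<tau> w) \<le> 2 * \<kappa>\<^sup>2 * (v - w) * (ep - em)"
        using E_bounds that by (intro mult_left_mono) (auto intro: diff_mono)
      then show ?thesis using U_space_increment[OF that, of \<tau>] by (simp add: mult.commute mult.left_commute)
    qed
    show ?thesis using *[of \<xi> \<xi>'] *[of \<xi>' \<xi>] by (cases "\<xi> \<le> \<xi>'") (simp_all add: power2_commute[of "U \<tau> \<xi>"])
  qed
  have "((\<lambda>\<xi>'. sqrt ((U \<tau> \<xi>' - U \<tau> \<xi>)\<^sup>2)) \<longlongrightarrow> 0) (at \<xi>)"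
  proof (rule tendsto_sandwich[of "\<lambda>_. 0"])
    have "((\<lambda>\<xi>'. sqrt (2 * \<kappa>\<^sup>2 * (ep - em) * \<bar>\<xi>' - \<xi>\<bar>)) \<longlongrightarrow> sqrt (2 * \<kappa>\<^sup>2 * (ep - em) * \<bar>\<xi> - \<xi>\<bar>)) (at \<xi>)"
      by (intro tendsto_intros)
    then show "((\<lambda>\<xi>'. sqrt (2 * \<kappa>\<^sup>2 * (ep - em) * \<bar>\<xi>' - \<xi>\<bar>)) \<longlongrightarrow> 0) (at \<xi>)" by simp
  qed (use b in \<open>auto simp del: real_sqrt_abs\<close>)
  then have "((\<lambda>\<xi>'. U \<tau> \<xi>' - U \<tau> \<xi>) \<longlongrightarrow> 0) (at \<xi>)" by (simp add: tendsto_rabs_zero_iff)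
  then show "(U \<tau> \<longlongrightarrow> U \<tau> \<xi>) (at \<xi> within UNIV)" by (simp add: LIM_zero_iff)
qed

text \<open>Integrating \<open>U_time_increment\<close> and applying
  \<open>integral_mono_shift_le\<close> with \<open>d = 3 * \<kappa> * h\<close> at both times
  supplies the second factor \<open>h\<close>; the numerical constant is 2 from the increment, 2
  from the two times and 3 from \<open>d\<close>.\<close>

lemma U_time_L2:
  assumes ab: "A \<le> B"
  shows "integral {A..B} (\<lambda>\<xi>. (U \<tau>' \<xi> - U \<tau> \<xi>)\<^sup>2) \<le> 12 * \<kappa>^4 * (ep - em) * (\<tau>' - \<tau>)\<^sup>2"
proof -
  have *: "integral {A..B} (\<lambda>\<xi>. (U \<tau>' \<xi> - U \<tau> \<xi>)\<^sup>2) \<le> 12 * \<kappa>^4 * (ep - em) * (\<tau>' - \<tau>)\<^sup>2" if lt: "\<tau> < \<tau>'" for \<tau> \<tau>'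
  proof -
    define h where "h = \<tau>' - \<tau>"
    have h: "h > 0" using lt by (simp add: h_def)
    define d where "d = 3 * \<kappa> * h"
    have d: "d \<ge> 0" using h kappa by (simp add: d_def)
    note i = integral_mono_shift_le[of "E \<sigma>" em ep d A B for \<sigma>, OF E_mono E_bounds d ab]
    have "integral {A..B} (\<lambda>\<xi>. (U \<tau>' \<xi> - U \<tau> \<xi>)\<^sup>2) \<le>
      integral {A..B} (\<lambda>\<xi>. 2 * \<kappa>\<^sup>2 * (\<kappa> * h) * ((E \<tau> \<xi> - E \<tau> (\<xi> - d)) + (E \<tau>' \<xi> - E \<tau>' (\<xi> - d))))"
    proof (rule integral_le)
      show "(\<lambda>\<xi>. (U \<tau>' \<xi> - U \<tau> \<xi>)\<^sup>2) integrable_on {A..B}"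
        by (intro integrable_continuous_real continuous_intros continuous_on_subset[OF continuous_U subset_UNIV])
      show "(\<lambda>\<xi>. 2 * \<kappa>\<^sup>2 * (\<kappa> * h) * ((E \<tau> \<xi> - E \<tau> (\<xi> - d)) + (E \<tau>' \<xi> - E \<tau>' (\<xi> - d)))) integrable_on {A..B}"
        by (intro integrable_on_mult_right Henstock_Kurzweil_Integration.integrable_add i)
    qed (use U_time_increment[OF lt] in \<open>simp add: h_def d_def\<close>)
    also have "\<dots> = 2 * \<kappa>\<^sup>2 * (\<kappa> * h) * (integral {A..B} (\<lambda>\<xi>. E \<tau> \<xi> - E \<tau> (\<xi> - d)) + integral {A..B} (\<lambda>\<xi>. E \<tau>' \<xi> - E \<tau>' (\<xi> - d)))"
      by (simp add: Henstock_Kurzweil_Integration.integral_add i)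
    also have "\<dots> \<le> 2 * \<kappa>\<^sup>2 * (\<kappa> * h) * (d * (ep - em) + d * (ep - em))"
      using h kappa by (intro mult_left_mono add_mono i) auto
    also have "\<dots> = 12 * \<kappa>^4 * (ep - em) * h\<^sup>2"
      by (simp add: d_def power2_eq_square power4_eq_xxxx)
    finally show ?thesis by (simp add: h_def)
  qed
  show ?thesis
    using *[of \<tau> \<tau>'] *[of \<tau>' \<tau>] by (cases \<tau> \<tau>' rule: linorder_cases) (simp_all add: power2_commute)
qed

lemma U_space_L2:
  assumes ab: "A \<le> B"
  shows "integral {A..B} (\<lambda>\<xi>. (U \<tau> (\<xi> + h) - U \<tau> \<xi>)\<^sup>2) \<le> 2 * \<kappa>\<^sup>2 * (ep - em) * h\<^sup>2"
proof -
  have cont: "continuous_on {A..B} (\<lambda>\<xi>. U \<tau> (\<xi> + s))" for s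
    by (intro continuous_on_compose2[OF continuous_U] continuous_intros) auto
  define d where "d = \<bar>h\<bar>"
  \<comment> \<open>One shifted distribution function serves both signs of \<open>h\<close>: in
    either case \<open>E' \<xi> - E' (\<xi> - d)\<close> is the energy between \<open>\<xi>\<close>
    and \<open>\<xi> + h\<close>.\<close>
  define E' where "E' = (\<lambda>\<xi>. E \<tau> (\<xi> + max h 0))"
  have E': "\<And>v w. v \<le> w \<Longrightarrow> E' v \<le> E' w" "\<And>v. em \<le> E' v" "\<And>v. E' v \<le> ep" "d \<ge> 0"
    by (simp_all add: E'_def E_bounds E_mono d_def)
  note i = integral_mono_shift_le[of E' em ep d A B, OF E' ab]
  have pw: "(U \<tau> (\<xi> + h) - U \<tau> \<xi>)\<^sup>2 \<le> 2 * \<kappa>\<^sup>2 * d * (E' \<xi> - E' (\<xi> - d))" for \<xi>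
  proof (cases "h \<ge> 0")
    case True
    then show ?thesis using U_space_increment[of \<xi> "\<xi> + h" \<tau>] by (simp add: d_def E'_def)
  next
    case False
    then show ?thesis using U_space_increment[of "\<xi> + h" \<xi> \<tau>] by (simp add: d_def E'_def power2_commute[of "U \<tau> (\<xi> + h)"])
  qed
  have "integral {A..B} (\<lambda>\<xi>. (U \<tau> (\<xi> + h) - U \<tau> \<xi>)\<^sup>2) \<le> integral {A..B} (\<lambda>\<xi>. 2 * \<kappa>\<^sup>2 * d * (E' \<xi> - E' (\<xi> - d)))"
    by (intro integral_le pw integrable_on_mult_right i integrable_continuous_real continuous_intros cont
        continuous_on_subset[OF continuous_U subset_UNIV])
  also have "\<dots> = 2 * \<kappa>\<^sup>2 * d * integral {A..B} (\<lambda>\<xi>. E' \<xi> - E' (\<xi> - d))" by simp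
  also have "\<dots> \<le> 2 * \<kappa>\<^sup>2 * d * (d * (ep - em))" using i(2) E'(4) by (intro mult_left_mono) auto
  also have "\<dots> = 2 * \<kappa>\<^sup>2 * (ep - em) * h\<^sup>2" by (simp add: d_def power2_eq_square)
  finally show ?thesis .
qed

end

section \<open>Differentiability of the solution at regular points\<close>

lemma DERIV_linear_approx:
  fixes F :: "real \<Rightarrow> real"
  assumes "(F has_real_derivative f) (at x0)" "\<epsilon> > 0"
  obtains r where "r > 0" "\<And>x. \<bar>x - x0\<bar> < r \<Longrightarrow> \<bar>F x - F x0 - f * (x - x0)\<bar> \<le> \<epsilon> * \<bar>x - x0\<bar>"
proof -
  have "\<exists>d>0. \<forall>y. norm (y - x0) < d \<longrightarrow> norm (F y - F x0 - f * (y - x0)) \<le> \<epsilon> * norm (y - x0)"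
    using assms unfolding has_field_derivative_def has_derivative_at_alt by blast
  then show thesis using that by auto
qed

lemma cancel_double: "k > 0 \<Longrightarrow> k * (y / (2 * k)) = y / 2" for k y :: real
  by simp

text \<open>Partial derivatives at a point do not in general give a total derivative. Here the mixed
  difference is at most \<open>L * (\<bar>X - X0\<bar> * \<bar>Y - Y0\<bar>)\<close>, hence of
  second order, and this closes the gap.\<close>

lemma rect_lipschitz_differentiable:
  assumes F: "rect_lipschitz F" and f: "((\<lambda>X. F X Y0) has_real_derivative f) (at X0)"
    and g: "((\<lambda>Y. F X0 Y) has_real_derivative g) (at Y0)" and \<epsilon>: "\<epsilon> > 0"
  obtains r where "r > 0" "\<And>X Y. \<bar>X - X0\<bar> < r \<Longrightarrow> \<bar>Y - Y0\<bar> < r \<Longrightarrow>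
    \<bar>F X Y - F X0 Y0 - f * (X - X0) - g * (Y - Y0)\<bar> \<le> \<epsilon> * (\<bar>X - X0\<bar> + \<bar>Y - Y0\<bar>)"
proof -
  define M where "M = \<bar>X0\<bar> + \<bar>Y0\<bar> + 1"
  obtain L where L: "rect_bound F M L" using rect_lipschitzE[OF F] .
  have L0: "L \<ge> 0" using rect_boundD(1)[OF L] .
  obtain r1 where r1: "r1 > 0" "\<And>X. \<bar>X - X0\<bar> < r1 \<Longrightarrow> \<bar>F X Y0 - F X0 Y0 - f * (X - X0)\<bar> \<le> (\<epsilon> / 2) * \<bar>X - X0\<bar>"
    using DERIV_linear_approx[OF f half_gt_zero[OF \<epsilon>]] by blast
  obtain r2 where r2: "r2 > 0" "\<And>Y. \<bar>Y - Y0\<bar> < r2 \<Longrightarrow> \<bar>F X0 Y - F X0 Y0 - g * (Y - Y0)\<bar> \<le> (\<epsilon> / 2) * \<bar>Y - Y0\<bar>"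
    using DERIV_linear_approx[OF g half_gt_zero[OF \<epsilon>]] by blast
  define r where "r = min (min r1 r2) (min 1 (\<epsilon> / (2 * (L + 1))))"
  show thesis
  proof
    show "r > 0" using r1 r2 \<epsilon> L0 by (simp add: r_def)
    fix X Y assume X: "\<bar>X - X0\<bar> < r" and Y: "\<bar>Y - Y0\<bar> < r"
    have b: "\<bar>X\<bar> \<le> M" "\<bar>X0\<bar> \<le> M" "\<bar>Y\<bar> \<le> M" "\<bar>Y0\<bar> \<le> M" proof -
      have "\<bar>X - X0\<bar> < 1" "\<bar>Y - Y0\<bar> < 1" using X Y by (simp_all add: r_def)
      then show "\<bar>X\<bar> \<le> M" "\<bar>X0\<bar> \<le> M" "\<bar>Y\<bar> \<le> M" "\<bar>Y0\<bar> \<le> M" unfolding M_def by linarith+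
    qed
    have "L * \<bar>Y - Y0\<bar> \<le> (L + 1) * (\<epsilon> / (2 * (L + 1)))" using L0 Y by (intro mult_mono) (auto simp: r_def)
    also have "\<dots> = \<epsilon> / 2" by (rule cancel_double) (use L0 in simp)
    finally have "L * \<bar>Y - Y0\<bar> \<le> \<epsilon> / 2" .
    from mult_right_mono[OF this, of "\<bar>X - X0\<bar>"]
    have "L * (\<bar>X - X0\<bar> * \<bar>Y - Y0\<bar>) \<le> (\<epsilon> / 2) * \<bar>X - X0\<bar>" by (simp add: mult.commute mult.left_commute)
    then have "\<bar>F X Y - F X0 Y - F X Y0 + F X0 Y0\<bar> \<le> (\<epsilon> / 2) * \<bar>X - X0\<bar>" using rect_boundD(4)[OF L b] by linarith
    moreover have "\<bar>F X Y0 - F X0 Y0 - f * (X - X0)\<bar> \<le> (\<epsilon> / 2) * \<bar>X - X0\<bar>" using X by (intro r1) (simp add: r_def)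
    moreover have "\<bar>F X0 Y - F X0 Y0 - g * (Y - Y0)\<bar> \<le> (\<epsilon> / 2) * \<bar>Y - Y0\<bar>" using Y by (intro r2) (simp add: r_def)
    moreover have "(\<epsilon> / 2) * \<bar>Y - Y0\<bar> \<ge> 0" using \<epsilon> by simp
    moreover have "\<epsilon> * (\<bar>X - X0\<bar> + \<bar>Y - Y0\<bar>) = (\<epsilon> / 2) * \<bar>X - X0\<bar> + (\<epsilon> / 2) * \<bar>X - X0\<bar> + (\<epsilon> / 2) * \<bar>Y - Y0\<bar> + (\<epsilon> / 2) * \<bar>Y - Y0\<bar>"
      by (simp add: field_simps)
    ultimately show "\<bar>F X Y - F X0 Y0 - f * (X - X0) - g * (Y - Y0)\<bar> \<le> \<epsilon> * (\<bar>X - X0\<bar> + \<bar>Y - Y0\<bar>)" by linarith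
  qed
qed

context wave_chart
begin

text \<open>The chart map need not be injective, but near a point with \<open>\<alpha> > 0\<close>
  no remote point has nearby values: if \<open>X0 + r \<le> X\<close>, then \<open>t\<close> is too
  large when \<open>Y0 \<le> Y\<close> and \<open>x\<close> is too large when
  \<open>Y \<le> Y0\<close>. The case \<open>X \<le> X0 - r\<close> is the same with small
  values.\<close>

lemma localize_X:
  assumes X0: "X0 \<notin> NX" and \<alpha>: "\<alpha> X0 Y0 > 0" and r: "r > 0"
  obtains \<delta> where "\<delta> > 0" "\<And>X Y. \<bar>t X Y - t X0 Y0\<bar> < \<delta> \<Longrightarrow> \<bar>x X Y - x X0 Y0\<bar> < \<delta> \<Longrightarrow> \<bar>X - X0\<bar> < r"
proof -
  \<comment> \<open>A positive derivative at the single point \<open>X0\<close>, together with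
    monotonicity, already gives strict inequalities at distance \<open>r\<close>.\<close>
  have inc: "F X0 < F (X0 + r)" "F (X0 - r) < F X0"
    if d: "(F has_real_derivative l) (at X0)" and l: "l > 0" and m: "\<And>v w. v \<le> w \<Longrightarrow> F v \<le> F w"
    for F :: "real \<Rightarrow> real" and l
  proof -
    obtain d1 where d1: "d1 > 0" "\<And>h. 0 < h \<Longrightarrow> h < d1 \<Longrightarrow> F X0 < F (X0 + h)"
      using DERIV_pos_inc_right[OF d l] by blast
    obtain d2 where d2: "d2 > 0" "\<And>h. 0 < h \<Longrightarrow> h < d2 \<Longrightarrow> F (X0 - h) < F X0"
      using DERIV_pos_inc_left[OF d l] by blast
    have "F X0 < F (X0 + min (d1 / 2) r)" using d1 r by (intro d1) (auto simp: min_def)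
    also have "\<dots> \<le> F (X0 + r)" by (rule m) simp
    finally show "F X0 < F (X0 + r)" .
    have "F (X0 - r) \<le> F (X0 - min (d2 / 2) r)" by (rule m) simp
    also have "\<dots> < F X0" using d2 r by (intro d2) (auto simp: min_def)
    finally show "F (X0 - r) < F X0" .
  qed
  have "\<alpha> X0 Y0 / c (u X0 Y0) > 0" using \<alpha> c_pos by simp
  note ti = inc[OF der_X(1)[OF X0, of Y0] this mono_X(1)] and xi = inc[OF der_X(2)[OF X0, of Y0] \<alpha> mono_X(2)]
  define \<delta> where "\<delta> = min (min (t (X0 + r) Y0 - t X0 Y0) (t X0 Y0 - t (X0 - r) Y0))
    (min (x (X0 + r) Y0 - x X0 Y0) (x X0 Y0 - x (X0 - r) Y0))"
  show thesis
  proof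
    show "\<delta> > 0" using ti xi by (simp add: \<delta>_def)
    fix X Y assume "\<bar>t X Y - t X0 Y0\<bar> < \<delta>" "\<bar>x X Y - x X0 Y0\<bar> < \<delta>"
    then have d: "t X Y < t (X0 + r) Y0" "t (X0 - r) Y0 < t X Y" "x X Y < x (X0 + r) Y0" "x (X0 - r) Y0 < x X Y"
      by (auto simp: \<delta>_def abs_if split: if_splits)
    show "\<bar>X - X0\<bar> < r"
    proof (rule ccontr)
      assume "\<not> \<bar>X - X0\<bar> < r"
      then consider "X0 + r \<le> X" | "X \<le> X0 - r" by linarith
      then show False
      proof cases
        case 1
        then show False using d mono_X[OF 1, of Y0] mono_Y[of Y0 Y X] mono_Y[of Y Y0 X] by linarith
      next
        case 2
        then show False using d mono_X[OF 2, of Y0] mono_Y[of Y0 Y X] mono_Y[of Y Y0 X] by linarith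
      qed
    qed
  qed
qed

lemma localize:
  assumes reg_pt: "X0 \<notin> NX" "Y0 \<notin> NY" "\<alpha> X0 Y0 > 0" "a X0 Y0 > 0" and r: "r > 0"
  obtains \<delta> where "\<delta> > 0" "\<And>X Y. \<bar>t X Y - t X0 Y0\<bar> + \<bar>x X Y - x X0 Y0\<bar> < \<delta> \<Longrightarrow> \<bar>X - X0\<bar> < r \<and> \<bar>Y - Y0\<bar> < r"
proof -
  obtain d1 where d1: "d1 > 0" "\<And>X Y. \<bar>t X Y - t X0 Y0\<bar> < d1 \<Longrightarrow> \<bar>x X Y - x X0 Y0\<bar> < d1 \<Longrightarrow> \<bar>X - X0\<bar> < r"
    using localize_X[OF reg_pt(1,3) r] by metis
  obtain d2 where d2: "d2 > 0" "\<And>Y X. \<bar>t X Y - t X0 Y0\<bar> < d2 \<Longrightarrow> \<bar>- x X Y - - x X0 Y0\<bar> < d2 \<Longrightarrow> \<bar>Y - Y0\<bar> < r"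
    using wave_chart.localize_X[OF swap, where ?X0.0=Y0 and ?Y0.0=X0, OF reg_pt(2,4) r] by metis
  show thesis
  proof
    show "min d1 d2 > 0" using d1 d2 by simp
    fix X Y assume "\<bar>t X Y - t X0 Y0\<bar> + \<bar>x X Y - x X0 Y0\<bar> < min d1 d2"
    then have "\<bar>t X Y - t X0 Y0\<bar> < d1" "\<bar>x X Y - x X0 Y0\<bar> < d1" "\<bar>t X Y - t X0 Y0\<bar> < d2" "\<bar>- x X Y - - x X0 Y0\<bar> < d2"
      by linarith+
    then show "\<bar>X - X0\<bar> < r \<and> \<bar>Y - Y0\<bar> < r" using d1(2) d2(2) by blast
  qed
qed

text \<open>Where \<open>\<alpha>\<close> and \<open>a\<close> are positive, the chart map is
  differentiable with invertible derivative, and \<open>localize\<close> keeps all preimages of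
  nearby values close. So \<open>u\<close> is differentiable as a function of \<open>(t, x)\<close>;
  \<open>R\<close> and \<open>S\<close> are the Riemann variables \<open>u_t + c u_x\<close> and
  \<open>u_t - c u_x\<close>.\<close>

lemma inverse_chart_differentiable:
  assumes reg_pt: "X0 \<notin> NX" "Y0 \<notin> NY" "\<alpha> X0 Y0 > 0" "a X0 Y0 > 0" and \<epsilon>: "\<epsilon> > 0"
  defines "R \<equiv> \<gamma> X0 Y0 / \<alpha> X0 Y0" and "S \<equiv> g X0 Y0 / a X0 Y0" and "C \<equiv> c (u X0 Y0)"
  obtains \<delta> where "\<delta> > 0"
    "\<And>X Y. \<bar>t X Y - t X0 Y0\<bar> + \<bar>x X Y - x X0 Y0\<bar> < \<delta> \<Longrightarrow>
      \<bar>u X Y - u X0 Y0 - (R + S) / 2 * (t X Y - t X0 Y0) - (R - S) / (2 * C) * (x X Y - x X0 Y0)\<bar>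
        \<le> \<epsilon> * (\<bar>t X Y - t X0 Y0\<bar> + \<bar>x X Y - x X0 Y0\<bar>)"
proof -
  define A where "A = \<alpha> X0 Y0" define B where "B = a X0 Y0"
  have A: "A > 0" and B: "B > 0" and C: "C > 0" using reg_pt c_pos by (simp_all add: A_def B_def C_def)
  define m where "m = min A B"
  have m: "m > 0" using A B by (simp add: m_def)
  define Q where "Q = (\<bar>R\<bar> + \<bar>S\<bar>) * (C + 1) / C + 1"
  define K where "K = 2 * (C + 1) / m"
  have Q: "Q \<ge> 1" and K: "K > 0" using C m by (simp_all add: Q_def K_def)
  \<comment> \<open>The first bound makes \<open>(C + 1) * \<eta> * z\<close> at most half of
    \<open>m * z\<close>, so the displacement \<open>z\<close> in the chart is controlled by that of
    \<open>(t, x)\<close> with factor \<open>K\<close>. The second brings the final error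
    \<open>Q * \<eta> * K\<close> down to \<open>\<epsilon>\<close>.\<close>
  define \<eta> where "\<eta> = min (m / (2 * (C + 1))) (\<epsilon> / (Q * K))"
  have \<eta>: "\<eta> > 0" using m C \<epsilon> Q K by (simp add: \<eta>_def)
  obtain r1 where r1: "r1 > 0" "\<And>X Y. \<bar>X - X0\<bar> < r1 \<Longrightarrow> \<bar>Y - Y0\<bar> < r1 \<Longrightarrow>
    \<bar>t X Y - t X0 Y0 - A / C * (X - X0) - B / C * (Y - Y0)\<bar> \<le> \<eta> * (\<bar>X - X0\<bar> + \<bar>Y - Y0\<bar>)"
    using rect_lipschitz_differentiable[OF reg(1) der_X(1)[OF reg_pt(1)] der_Y(1)[OF reg_pt(2)] \<eta>]
    unfolding A_def B_def C_def by metis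
  obtain r2 where r2: "r2 > 0" "\<And>X Y. \<bar>X - X0\<bar> < r2 \<Longrightarrow> \<bar>Y - Y0\<bar> < r2 \<Longrightarrow>
    \<bar>x X Y - x X0 Y0 - A * (X - X0) - (- B) * (Y - Y0)\<bar> \<le> \<eta> * (\<bar>X - X0\<bar> + \<bar>Y - Y0\<bar>)"
    using rect_lipschitz_differentiable[OF reg(2) der_X(2)[OF reg_pt(1)] der_Y(2)[OF reg_pt(2)] \<eta>]
    unfolding A_def B_def C_def by metis
  obtain r3 where r3: "r3 > 0" "\<And>X Y. \<bar>X - X0\<bar> < r3 \<Longrightarrow> \<bar>Y - Y0\<bar> < r3 \<Longrightarrow>
    \<bar>u X Y - u X0 Y0 - \<gamma> X0 Y0 / C * (X - X0) - g X0 Y0 / C * (Y - Y0)\<bar> \<le> \<eta> * (\<bar>X - X0\<bar> + \<bar>Y - Y0\<bar>)"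
    using rect_lipschitz_differentiable[OF reg(3) der_X(3)[OF reg_pt(1)] der_Y(3)[OF reg_pt(2)] \<eta>]
    unfolding C_def by metis
  have "min r1 (min r2 r3) > 0" using r1 r2 r3 by simp
  then obtain \<delta> where \<delta>: "\<delta> > 0" "\<And>X Y. \<bar>t X Y - t X0 Y0\<bar> + \<bar>x X Y - x X0 Y0\<bar> < \<delta> \<Longrightarrow>
      \<bar>X - X0\<bar> < min r1 (min r2 r3) \<and> \<bar>Y - Y0\<bar> < min r1 (min r2 r3)"
    using localize[OF reg_pt] by metis
  show thesis
  proof (rule that[OF \<delta>(1)])
    fix X Y assume *: "\<bar>t X Y - t X0 Y0\<bar> + \<bar>x X Y - x X0 Y0\<bar> < \<delta>"
    define h where "h = X - X0" define k where "k = Y - Y0"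
    define dt where "dt = t X Y - t X0 Y0" define dx where "dx = x X Y - x X0 Y0"
    define du where "du = u X Y - u X0 Y0"
    define \<rho>t where "\<rho>t = dt - A / C * h - B / C * k"
    define \<rho>x where "\<rho>x = dx - A * h + B * k"
    define \<rho>u where "\<rho>u = du - R * A / C * h - S * B / C * k"
    define z where "z = \<bar>h\<bar> + \<bar>k\<bar>"
    have cl: "\<bar>X - X0\<bar> < r1" "\<bar>Y - Y0\<bar> < r1" "\<bar>X - X0\<bar> < r2" "\<bar>Y - Y0\<bar> < r2" "\<bar>X - X0\<bar> < r3" "\<bar>Y - Y0\<bar> < r3"
      using \<delta>(2)[OF *] by auto
    have RA: "R * A = \<gamma> X0 Y0" "S * B = g X0 Y0" using A B by (simp_all add: R_def S_def A_def B_def)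
    have \<rho>: "\<bar>\<rho>t\<bar> \<le> \<eta> * z" "\<bar>\<rho>x\<bar> \<le> \<eta> * z" "\<bar>\<rho>u\<bar> \<le> \<eta> * z"
      using r1(2)[OF cl(1,2)] r2(2)[OF cl(3,4)] r3(2)[OF cl(5,6)]
      by (simp_all add: \<rho>t_def \<rho>x_def \<rho>u_def RA z_def h_def k_def dt_def dx_def du_def)
    have z0: "z \<ge> 0" by (simp add: z_def)
    \<comment> \<open>This solves the linearized equations: the sum and the difference of
      \<open>C * dt\<close> and \<open>dx\<close> separate the two characteristic directions, and
      the \<open>\<rho>\<close> terms are the remainders.\<close>
    have Ah: "A * h = (C * dt + dx) / 2 - (C * \<rho>t + \<rho>x) / 2"
      and Bk: "B * k = (C * dt - dx) / 2 - (C * \<rho>t - \<rho>x) / 2"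
      using C by (simp_all add: \<rho>t_def \<rho>x_def field_simps)
    have e1: "\<bar>C * \<rho>t + \<rho>x\<bar> \<le> (C + 1) * (\<eta> * z)" "\<bar>C * \<rho>t - \<rho>x\<bar> \<le> (C + 1) * (\<eta> * z)"
    proof -
      have "\<bar>C * \<rho>t\<bar> \<le> C * (\<eta> * z)" using \<rho>(1) C by (simp add: abs_mult)
      then show "\<bar>C * \<rho>t + \<rho>x\<bar> \<le> (C + 1) * (\<eta> * z)" "\<bar>C * \<rho>t - \<rho>x\<bar> \<le> (C + 1) * (\<eta> * z)"
        using \<rho>(2) by (simp_all add: distrib_right)
    qed
    have "m * z \<le> A * \<bar>h\<bar> + B * \<bar>k\<bar>"
      using mult_right_mono[of m A "\<bar>h\<bar>"] mult_right_mono[of m B "\<bar>k\<bar>"] by (simp add: z_def m_def distrib_left)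
    also have "\<dots> = \<bar>A * h\<bar> + \<bar>B * k\<bar>" using A B by (simp add: abs_mult)
    also have "\<dots> \<le> (C * \<bar>dt\<bar> + \<bar>dx\<bar>) + (C + 1) * (\<eta> * z)"
    proof -
      have tri: "\<bar>(p + q) / 2 - v / 2\<bar> + \<bar>(p - q) / 2 - w / 2\<bar> \<le> \<bar>p\<bar> + \<bar>q\<bar> + d"
        if "\<bar>v\<bar> \<le> d" "\<bar>w\<bar> \<le> d" for p q v w d :: real
      proof -
        have "\<bar>p + q - v\<bar> \<le> \<bar>p\<bar> + \<bar>q\<bar> + \<bar>v\<bar>" by linarith
        moreover have "\<bar>p - q - w\<bar> \<le> \<bar>p\<bar> + \<bar>q\<bar> + \<bar>w\<bar>" by linarith
        moreover have "\<bar>(p + q) / 2 - v / 2\<bar> = \<bar>p + q - v\<bar> / 2" "\<bar>(p - q) / 2 - w / 2\<bar> = \<bar>p - q - w\<bar> / 2"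
          by (simp_all flip: diff_divide_distrib)
        ultimately show ?thesis using that by linarith
      qed
      have "\<bar>C * dt\<bar> = C * \<bar>dt\<bar>" using C by (simp add: abs_mult)
      then show ?thesis using tri[OF e1, of "C * dt" dx] unfolding Ah Bk by simp
    qed
    also have "(C + 1) * (\<eta> * z) \<le> (m / 2) * z"
    proof -
      have "(C + 1) * \<eta> \<le> (C + 1) * (m / (2 * (C + 1)))" using C by (intro mult_left_mono) (auto simp: \<eta>_def)
      also have "\<dots> = m / 2" by (rule cancel_double) (use C in simp)
      finally have "(C + 1) * \<eta> \<le> m / 2" .
      then show ?thesis using mult_right_mono[OF _ z0, of "(C + 1) * \<eta>" "m / 2"] by (simp only: mult.assoc)
    qed
    finally have "m * z \<le> 2 * (C * \<bar>dt\<bar> + \<bar>dx\<bar>)" by simp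
    also have "\<dots> \<le> 2 * ((C + 1) * (\<bar>dt\<bar> + \<bar>dx\<bar>))" using C by (simp add: algebra_simps)
    finally have zK: "z \<le> K * (\<bar>dt\<bar> + \<bar>dx\<bar>)" using m by (simp add: K_def field_simps)
    have "du - (R + S) / 2 * dt - (R - S) / (2 * C) * dx =
        \<rho>u - R * (C * \<rho>t + \<rho>x) / (2 * C) - S * (C * \<rho>t - \<rho>x) / (2 * C)"
    proof -
      have "du = \<rho>u + R / C * (A * h) + S / C * (B * k)" by (simp add: \<rho>u_def)
      then have du: "du = \<rho>u + R / C * ((C * dt + dx) / 2 - (C * \<rho>t + \<rho>x) / 2) + S / C * ((C * dt - dx) / 2 - (C * \<rho>t - \<rho>x) / 2)"
        unfolding Ah Bk .
      show ?thesis unfolding du using C by (simp add: field_simps)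
    qed
    also have "\<bar>\<dots>\<bar> \<le> \<eta> * z + \<bar>R\<bar> * ((C + 1) * (\<eta> * z)) / C + \<bar>S\<bar> * ((C + 1) * (\<eta> * z)) / C"
    proof -
      have "\<bar>R * (C * \<rho>t + \<rho>x) / (2 * C)\<bar> \<le> \<bar>R\<bar> * ((C + 1) * (\<eta> * z)) / C"
        and "\<bar>S * (C * \<rho>t - \<rho>x) / (2 * C)\<bar> \<le> \<bar>S\<bar> * ((C + 1) * (\<eta> * z)) / C"
        using C e1 \<eta> z0 by (simp_all add: abs_mult abs_divide, intro frac_le mult_left_mono, auto)+
      then show ?thesis using \<rho>(3) by linarith
    qed
    also have "\<dots> = Q * \<eta> * z" using C by (simp add: Q_def field_simps)
    also have "\<dots> \<le> Q * \<eta> * (K * (\<bar>dt\<bar> + \<bar>dx\<bar>))" using zK Q \<eta> by (intro mult_left_mono) auto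
    also have "\<dots> = (\<eta> * (Q * K)) * (\<bar>dt\<bar> + \<bar>dx\<bar>)" by simp
    also have "\<dots> \<le> \<epsilon> * (\<bar>dt\<bar> + \<bar>dx\<bar>)"
    proof (rule mult_right_mono)
      have "\<eta> * (Q * K) \<le> \<epsilon> / (Q * K) * (Q * K)" using Q K by (intro mult_right_mono) (auto simp: \<eta>_def)
      then show "\<eta> * (Q * K) \<le> \<epsilon>" using Q K by simp
    qed simp
    finally show "\<bar>u X Y - u X0 Y0 - (R + S) / 2 * (t X Y - t X0 Y0) - (R - S) / (2 * C) * (x X Y - x X0 Y0)\<bar>
        \<le> \<epsilon> * (\<bar>t X Y - t X0 Y0\<bar> + \<bar>x X Y - x X0 Y0\<bar>)"
      by (simp add: du_def dt_def dx_def)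
  qed
qed

end

context wave_solution
begin

lemma U_derivatives:
  assumes reg_pt: "X0 \<notin> NX" "Y0 \<notin> NY" "\<alpha> X0 Y0 > 0" "a X0 Y0 > 0"
  shows "((\<lambda>\<tau>. U \<tau> (x X0 Y0)) has_real_derivative (\<gamma> X0 Y0 / \<alpha> X0 Y0 + g X0 Y0 / a X0 Y0) / 2) (at (t X0 Y0))"
    "((\<lambda>\<xi>. U (t X0 Y0) \<xi>) has_real_derivative (\<gamma> X0 Y0 / \<alpha> X0 Y0 - g X0 Y0 / a X0 Y0) / (2 * c (u X0 Y0))) (at (x X0 Y0))"
proof -
  let ?t = "(\<gamma> X0 Y0 / \<alpha> X0 Y0 + g X0 Y0 / a X0 Y0) / 2"
  let ?x = "(\<gamma> X0 Y0 / \<alpha> X0 Y0 - g X0 Y0 / a X0 Y0) / (2 * c (u X0 Y0))"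
  have *: "\<exists>\<delta>>0. \<forall>\<tau> \<xi>. \<bar>\<tau> - t X0 Y0\<bar> + \<bar>\<xi> - x X0 Y0\<bar> < \<delta> \<longrightarrow>
      \<bar>U \<tau> \<xi> - U (t X0 Y0) (x X0 Y0) - ?t * (\<tau> - t X0 Y0) - ?x * (\<xi> - x X0 Y0)\<bar> \<le> \<epsilon> * (\<bar>\<tau> - t X0 Y0\<bar> + \<bar>\<xi> - x X0 Y0\<bar>)"
    if \<epsilon>: "\<epsilon> > 0" for \<epsilon>
  proof -
    obtain \<delta> where \<delta>: "\<delta> > 0" "\<And>X Y. \<bar>t X Y - t X0 Y0\<bar> + \<bar>x X Y - x X0 Y0\<bar> < \<delta> \<Longrightarrow>
      \<bar>u X Y - u X0 Y0 - ?t * (t X Y - t X0 Y0) - ?x * (x X Y - x X0 Y0)\<bar>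
        \<le> \<epsilon> * (\<bar>t X Y - t X0 Y0\<bar> + \<bar>x X Y - x X0 Y0\<bar>)"
      using inverse_chart_differentiable[OF reg_pt \<epsilon>] by metis
    show ?thesis
    proof (intro exI[of _ \<delta>] conjI allI impI \<delta>(1))
      fix \<tau> \<xi>
      obtain X Y where "t X Y = \<tau>" "x X Y = \<xi>" using point_over .
      then show "\<bar>\<tau> - t X0 Y0\<bar> + \<bar>\<xi> - x X0 Y0\<bar> < \<delta> \<Longrightarrow>
        \<bar>U \<tau> \<xi> - U (t X0 Y0) (x X0 Y0) - ?t * (\<tau> - t X0 Y0) - ?x * (\<xi> - x X0 Y0)\<bar> \<le> \<epsilon> * (\<bar>\<tau> - t X0 Y0\<bar> + \<bar>\<xi> - x X0 Y0\<bar>)"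
        using \<delta>(2)[of X Y] U by auto
    qed
  qed
  show "((\<lambda>\<tau>. U \<tau> (x X0 Y0)) has_real_derivative ?t) (at (t X0 Y0))"
    unfolding has_field_derivative_def has_derivative_at_alt
  proof (intro conjI bounded_linear_mult_right allI impI)
    fix \<epsilon> :: real assume "\<epsilon> > 0"
    then obtain \<delta> where "\<delta> > 0" "\<forall>\<tau> \<xi>. \<bar>\<tau> - t X0 Y0\<bar> + \<bar>\<xi> - x X0 Y0\<bar> < \<delta> \<longrightarrow>
      \<bar>U \<tau> \<xi> - U (t X0 Y0) (x X0 Y0) - ?t * (\<tau> - t X0 Y0) - ?x * (\<xi> - x X0 Y0)\<bar> \<le> \<epsilon> * (\<bar>\<tau> - t X0 Y0\<bar> + \<bar>\<xi> - x X0 Y0\<bar>)"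
      using * by blast
    then show "\<exists>d>0. \<forall>y. norm (y - t X0 Y0) < d \<longrightarrow>
      norm (U y (x X0 Y0) - U (t X0 Y0) (x X0 Y0) - ?t * (y - t X0 Y0)) \<le> \<epsilon> * norm (y - t X0 Y0)"
      by (intro exI[of _ \<delta>]) (auto dest: spec2[of _ _ "x X0 Y0"])
  qed
  show "((\<lambda>\<xi>. U (t X0 Y0) \<xi>) has_real_derivative ?x) (at (x X0 Y0))"
    unfolding has_field_derivative_def has_derivative_at_alt
  proof (intro conjI bounded_linear_mult_right allI impI)
    fix \<epsilon> :: real assume "\<epsilon> > 0"
    then obtain \<delta> where "\<delta> > 0" "\<forall>\<tau> \<xi>. \<bar>\<tau> - t X0 Y0\<bar> + \<bar>\<xi> - x X0 Y0\<bar> < \<delta> \<longrightarrow>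
      \<bar>U \<tau> \<xi> - U (t X0 Y0) (x X0 Y0) - ?t * (\<tau> - t X0 Y0) - ?x * (\<xi> - x X0 Y0)\<bar> \<le> \<epsilon> * (\<bar>\<tau> - t X0 Y0\<bar> + \<bar>\<xi> - x X0 Y0\<bar>)"
      using * by blast
    then show "\<exists>d>0. \<forall>y. norm (y - x X0 Y0) < d \<longrightarrow>
      norm (U (t X0 Y0) y - U (t X0 Y0) (x X0 Y0) - ?x * (y - x X0 Y0)) \<le> \<epsilon> * norm (y - x X0 Y0)"
      by (intro exI[of _ \<delta>]) (auto dest: spec2[of _ "t X0 Y0"])
  qed
qed

end

section \<open>Line integrals along level curves\<close>

text \<open>The bounds on differences pass to the derivatives in the limit. The Lipschitz bound in
  \<open>Y\<close> holds at each single \<open>X\<close> where the derivatives exist, which makes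
  the trace of a derivative on a curve comparable with its values on a line.\<close>

lemma rect_lipschitz_deriv_bounds:
  assumes L: "rect_bound F M L" and X: "\<bar>X\<bar> < M" and Y: "\<bar>Y\<bar> \<le> M" "\<bar>Y'\<bar> \<le> M"
    and d: "((\<lambda>X. F X Y) has_real_derivative f) (at X)" and d': "((\<lambda>X. F X Y') has_real_derivative f') (at X)"
  shows "\<bar>f - f'\<bar> \<le> L * \<bar>Y - Y'\<bar>" "\<bar>f\<bar> \<le> L"
proof -
  have near: "\<forall>\<^sub>F h in at 0. \<bar>X + h\<bar> \<le> M \<and> h \<noteq> (0::real)"
    unfolding eventually_at using X by (intro exI[of _ "M - \<bar>X\<bar>"]) (auto simp: dist_real_def)
  have 1: "((\<lambda>h. (F (X + h) Y - F X Y) / h) \<longlongrightarrow> f) (at 0)" "((\<lambda>h. (F (X + h) Y' - F X Y') / h) \<longlongrightarrow> f') (at 0)"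
    using d d' by (simp_all add: DERIV_def)
  have b: "\<bar>X\<bar> \<le> M" using X by simp
  show "\<bar>f - f'\<bar> \<le> L * \<bar>Y - Y'\<bar>"
  proof (rule tendsto_upperbound[OF tendsto_rabs[OF tendsto_diff[OF 1]]])
    show "\<forall>\<^sub>F h in at 0. \<bar>(F (X + h) Y - F X Y) / h - (F (X + h) Y' - F X Y') / h\<bar> \<le> L * \<bar>Y - Y'\<bar>"
      using near
    proof eventually_elim
      case (elim h)
      have "\<bar>F (X + h) Y - F X Y - F (X + h) Y' + F X Y'\<bar> \<le> L * (\<bar>X + h - X\<bar> * \<bar>Y - Y'\<bar>)"
        using elim by (intro rect_boundD(4)[OF L] Y b) auto
      then have "\<bar>F (X + h) Y - F X Y - F (X + h) Y' + F X Y'\<bar> \<le> (L * \<bar>Y - Y'\<bar>) * \<bar>h\<bar>" by (simp add: mult_ac)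
      then have "\<bar>F (X + h) Y - F X Y - F (X + h) Y' + F X Y'\<bar> / \<bar>h\<bar> \<le> L * \<bar>Y - Y'\<bar>"
        using elim by (simp add: pos_divide_le_eq)
      moreover have "(F (X + h) Y - F X Y) / h - (F (X + h) Y' - F X Y') / h = (F (X + h) Y - F X Y - F (X + h) Y' + F X Y') / h"
        by (simp add: diff_divide_distrib add_divide_distrib)
      ultimately show ?case by (simp add: abs_divide)
    qed
  qed simp
  show "\<bar>f\<bar> \<le> L"
  proof (rule tendsto_upperbound[OF tendsto_rabs[OF 1(1)]])
    show "\<forall>\<^sub>F h in at 0. \<bar>(F (X + h) Y - F X Y) / h\<bar> \<le> L"
      using near
    proof eventually_elim
      case (elim h)
      have "\<bar>F (X + h) Y - F X Y\<bar> \<le> L * \<bar>X + h - X\<bar>" using elim by (intro rect_boundD(2)[OF L] Y b) auto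
      then show ?case using elim by (simp add: abs_divide pos_divide_le_eq)
    qed
  qed simp
qed

lemma bounded_borel_integrable_on:
  fixes f :: "real \<Rightarrow> real"
  assumes f: "f \<in> borel_measurable borel" and b: "\<And>x. x \<in> {p..q} \<Longrightarrow> \<bar>f x\<bar> \<le> K"
  shows "f integrable_on {p..q}"
proof (rule measurable_bounded_by_integrable_imp_integrable[where g="\<lambda>_. K"])
  show "f \<in> borel_measurable (lebesgue_on {p..q})"
    by (intro measurable_restrict_space1 measurable_completion) (simp add: f)
qed (use b in auto)

context wave_chart
begin

text \<open>The lower boundary consists of the least point on each diagonal, a choice symmetric in
  the two characteristics; only the parameter \<open>X - Y\<close> changes its sign.\<close>

lemma swap_Xd: "wave_chart.Xd (\<lambda>X Y. t Y X) \<tau> s = Yd \<tau> (- s)" "wave_chart.Yd (\<lambda>X Y. t Y X) \<tau> s = Xd \<tau> (- s)"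
proof -
  have *: "wave_chart.Xd (\<lambda>X Y. t Y X) \<tau> s \<le> Y \<longleftrightarrow> Yd \<tau> (- s) \<le> Y" for Y
    using wave_chart.Xd_le_iff[OF swap, of \<tau> s Y] Xd_le_iff[of \<tau> "-s" "Y - s"] by (simp add: Yd_def le_diff_eq)
  show 1: "wave_chart.Xd (\<lambda>X Y. t Y X) \<tau> s = Yd \<tau> (- s)" using * by (meson order_antisym order_refl)
  show "wave_chart.Yd (\<lambda>X Y. t Y X) \<tau> s = Xd \<tau> (- s)"
    using wave_chart.Yd_def[OF swap, of \<tau> s] 1 by (simp add: Yd_def)
qed

lemma swap_Ys: "wave_chart.Ys (\<lambda>X Y. t Y X) Y \<tau> = Xs Y \<tau>" "wave_chart.Xs (\<lambda>X Y. t Y X) X \<tau> = Ys X \<tau>"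
  using wave_chart.Ys_def[OF swap, of Y \<tau>] wave_chart.Xs_def[OF swap, of X \<tau>] by (simp_all add: Ys_def Xs_def)

lemma Ys_antimono: "X \<le> X' \<Longrightarrow> Ys X' \<tau> \<le> Ys X \<tau>"
  unfolding Ys_le_iff using mono_X(1)[of X X' "Ys X \<tau>"] t_Ys by simp

lemma Ys_measurable: "(\<lambda>X. Ys X \<tau>) \<in> borel_measurable borel"
proof -
  have "(\<lambda>X. - Ys X \<tau>) \<in> borel_measurable borel"
    by (rule borel_measurable_mono) (auto intro!: monoI Ys_antimono)
  then show ?thesis by (rule borel_measurable_uminus_eq[THEN iffD1])
qed

lemma section_between:
  assumes "Xd \<tau> s1 < X" "X < Xd \<tau> s2"
  shows "s1 < X - Ys X \<tau>" "X - Ys X \<tau> < s2" "Yd \<tau> s2 \<le> Ys X \<tau>" "Ys X \<tau> \<le> Yd \<tau> s1"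
proof -
  show 1: "s1 < X - Ys X \<tau>"
    using Xd_mono[of "X - Ys X \<tau>" s1 \<tau>] assms by (force simp: Xd_section)
  show 2: "X - Ys X \<tau> < s2"
    using Xd_mono[of s2 "X - Ys X \<tau>" \<tau>] assms by (force simp: Xd_section)
  show "Yd \<tau> s2 \<le> Ys X \<tau>" "Ys X \<tau> \<le> Yd \<tau> s1"
    using Yd_antimono[of _ _ \<tau>] 1 2 Xd_section(2) by (metis less_imp_le)+
qed

lemma section_in_Ioc:
  assumes "s1 < X - Ys X \<tau>" "X - Ys X \<tau> \<le> s2"
  shows "Xd \<tau> s1 \<le> X" "X \<le> Xd \<tau> s2"
  using Xd_mono[of s1 "X - Ys X \<tau>" \<tau>] Xd_mono[of "X - Ys X \<tau>" s2 \<tau>] assms by (simp_all add: Xd_section)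

text \<open>The value 0 on \<open>NX\<close> gives a trace that is nonnegative at every
  \<open>X\<close>, whereas the coefficients are known to be nonnegative only off
  \<open>NX\<close>.\<close>

definition trX :: "(real \<Rightarrow> real \<Rightarrow> real) \<Rightarrow> real \<Rightarrow> real \<Rightarrow> real" where
  "trX f \<tau> X = (if X \<in> NX then 0 else f X (Ys X \<tau>))"

definition trY :: "(real \<Rightarrow> real \<Rightarrow> real) \<Rightarrow> real \<Rightarrow> real \<Rightarrow> real" where
  "trY f \<tau> Y = (if Y \<in> NY then 0 else f (Xs Y \<tau>) Y)"

lemma trX_measurable:
  assumes "(\<lambda>p. f (fst p) (snd p)) \<in> borel_measurable borel"
  shows "trX f \<tau> \<in> borel_measurable borel"
proof -
  have [measurable]: "NX \<in> sets borel" using null by (auto simp: null_sets_def)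
  note Ys_measurable[measurable]
  have "(\<lambda>X. (X, Ys X \<tau>)) \<in> borel_measurable borel" by measurable
  from measurable_compose[OF this assms] have [measurable]: "(\<lambda>X. f X (Ys X \<tau>)) \<in> borel_measurable borel" by simp
  show ?thesis unfolding trX_def by measurable
qed

text \<open>On the horizontal segment at height \<open>Yd \<tau> s1\<close> the increment of
  \<open>F\<close> is the integral of \<open>f\<close>. Moving \<open>f\<close> from there down to
  the curve changes it by at most \<open>L\<close> times the height of the arc, so the error is
  \<open>L\<close> times the area of the enclosing rectangle.\<close>

lemma trX_approx:
  assumes der: "\<And>X Y. X \<notin> NX \<Longrightarrow> ((\<lambda>X. F X Y) has_real_derivative f X Y) (at X)"
    and F: "rect_lipschitz F"
    and f: "(\<lambda>p. f (fst p) (snd p)) \<in> borel_measurable borel"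
    and L: "rect_bound F M L" and s: "s1 \<le> s2"
    and b: "\<bar>Xd \<tau> s1\<bar> < M" "\<bar>Xd \<tau> s2\<bar> < M" "\<bar>Yd \<tau> s1\<bar> < M" "\<bar>Yd \<tau> s2\<bar> < M"
  shows "trX f \<tau> integrable_on {Xd \<tau> s1..Xd \<tau> s2}"
    "\<bar>F (Xd \<tau> s2) (Yd \<tau> s1) - F (Xd \<tau> s1) (Yd \<tau> s1) - integral {Xd \<tau> s1..Xd \<tau> s2} (trX f \<tau>)\<bar>
      \<le> L * ((Xd \<tau> s2 - Xd \<tau> s1) * (Yd \<tau> s1 - Yd \<tau> s2))"
proof -
  define X1 X2 Y1 Y2 where "X1 = Xd \<tau> s1" "X2 = Xd \<tau> s2" "Y1 = Yd \<tau> s1" "Y2 = Yd \<tau> s2"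
  note defs = X1_X2_Y1_Y2_def
  have le: "X1 \<le> X2" "Y2 \<le> Y1" using Xd_mono[OF s] Yd_antimono[OF s] by (simp_all add: defs)
  \<comment> \<open>The end points join the null set because \<open>section_between\<close> needs
    strict inequalities: over an end point the lowest point of the level set may lie outside the
    arc.\<close>
  define N where "N = NX \<union> {X1, X2}"
  have N: "negligible N" using null(1) by (simp add: N_def negligible_iff_null_sets null_sets_completionI negligible_Un_eq)
  define h where "h X = (if X \<in> N then 0 else trX f \<tau> X)" for X
  have Nb: "N \<in> sets borel" using null by (auto simp: null_sets_def N_def)
  have hm: "h \<in> borel_measurable borel"
    unfolding h_def using trX_measurable[OF f] Nb by measurable
  have pt: "\<bar>X\<bar> < M" "\<bar>Ys X \<tau>\<bar> \<le> M" "\<bar>Y1 - Ys X \<tau>\<bar> \<le> Y1 - Y2" "X \<notin> NX" if "X \<in> {X1..X2} - N" for X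
  proof -
    have "X1 < X" "X < X2" using that by (auto simp: N_def)
    then show "\<bar>X\<bar> < M" "\<bar>Ys X \<tau>\<bar> \<le> M" "\<bar>Y1 - Ys X \<tau>\<bar> \<le> Y1 - Y2"
      using section_between[of \<tau> s1 X s2] b by (auto simp: defs)
    show "X \<notin> NX" using that by (auto simp: N_def)
  qed
  have Y1: "\<bar>Y1\<bar> \<le> M" using b by (simp add: defs)
  have hb: "\<bar>h X\<bar> \<le> L" if "X \<in> {X1..X2}" for X
  proof (cases "X \<in> N")
    case False
    then have X: "X \<in> {X1..X2} - N" using that by simp
    show ?thesis
      using rect_lipschitz_deriv_bounds(2)[OF L pt(1)[OF X] pt(2)[OF X] pt(2)[OF X] der[OF pt(4)[OF X]] der[OF pt(4)[OF X]]]
        pt(4)[OF X] False by (simp add: h_def trX_def)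
  qed (use rect_boundD(1)[OF L] in \<open>simp add: h_def\<close>)
  have hi: "h integrable_on {X1..X2}" by (rule bounded_borel_integrable_on[OF hm hb])
  have eq: "trX f \<tau> X = h X" if "X \<in> {X1..X2} - N" for X using that by (simp add: h_def)
  show tri: "trX f \<tau> integrable_on {Xd \<tau> s1..Xd \<tau> s2}"
    using integrable_spike[OF hi N eq] by (simp add: defs)
  have ie: "integral {X1..X2} (trX f \<tau>) = integral {X1..X2} h"
    by (rule integral_spike[OF N]) (simp add: h_def)
  obtain K where K: "K-lipschitz_on {X1..X2} (\<lambda>X. F X Y1)" using rect_lipschitz_lipschitz_X[OF F] .
  have "negligible NX" using null(1) by (simp add: negligible_iff_null_sets null_sets_completionI)
  then have "((\<lambda>X. f X Y1) has_integral (F X2 Y1 - F X1 Y1)) {X1..X2}"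
    by (rule lipschitz_has_integral_deriv[OF le(1) _ K]) (auto intro: der)
  then have "((\<lambda>X. if X \<in> N then 0 else f X Y1) has_integral (F X2 Y1 - F X1 Y1)) {X1..X2}"
    by (rule has_integral_spike[OF N, rotated]) auto
  then have diff: "((\<lambda>X. (if X \<in> N then 0 else f X Y1) - h X) has_integral (F X2 Y1 - F X1 Y1 - integral {X1..X2} h)) {X1..X2}"
    by (intro has_integral_diff integrable_integral hi)
  have "norm (F X2 Y1 - F X1 Y1 - integral {X1..X2} h) \<le> (L * (Y1 - Y2)) * measure lborel (cbox X1 X2)"
  proof (rule has_integral_bound)
    show "0 \<le> L * (Y1 - Y2)" using rect_boundD(1)[OF L] le by simp
    show "((\<lambda>X. (if X \<in> N then 0 else f X Y1) - h X) has_integral (F X2 Y1 - F X1 Y1 - integral {X1..X2} h)) (cbox X1 X2)"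
      using diff by simp
    fix X assume X: "X \<in> cbox X1 X2"
    show "norm ((if X \<in> N then 0 else f X Y1) - h X) \<le> L * (Y1 - Y2)"
    proof (cases "X \<in> N")
      case False
      then have X': "X \<in> {X1..X2} - N" using X by simp
      have "\<bar>f X Y1 - f X (Ys X \<tau>)\<bar> \<le> L * \<bar>Y1 - Ys X \<tau>\<bar>"
        by (rule rect_lipschitz_deriv_bounds(1)[OF L pt(1)[OF X'] Y1 pt(2)[OF X'] der[OF pt(4)[OF X']] der[OF pt(4)[OF X']]])
      also have "\<dots> \<le> L * (Y1 - Y2)" using pt(3)[OF X'] rect_boundD(1)[OF L] by (intro mult_left_mono)
      finally show ?thesis using False pt(4)[OF X'] by (simp add: h_def trX_def)
    qed (use rect_boundD(1)[OF L] le in \<open>simp add: h_def\<close>)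
  qed
  then show "\<bar>F (Xd \<tau> s2) (Yd \<tau> s1) - F (Xd \<tau> s1) (Yd \<tau> s1) - integral {Xd \<tau> s1..Xd \<tau> s2} (trX f \<tau>)\<bar>
      \<le> L * ((Xd \<tau> s2 - Xd \<tau> s1) * (Yd \<tau> s1 - Yd \<tau> s2))"
    using le ie by (simp add: defs mult_ac)
qed

lemma swap_trX: "wave_chart.trX (\<lambda>X Y. t Y X) NY (\<lambda>X Y. f Y X) \<tau> Y = trY f \<tau> Y"
  using wave_chart.trX_def[OF swap, of "\<lambda>X Y. f Y X" \<tau> Y] swap_Ys by (simp add: trY_def)

lemma trY_measurable:
  assumes "(\<lambda>p. f (fst p) (snd p)) \<in> borel_measurable borel"
  shows "trY f \<tau> \<in> borel_measurable borel"
proof -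
  have "(\<lambda>p::real \<times> real. (snd p, fst p)) \<in> borel_measurable borel"
    by (intro borel_measurable_continuous_onI continuous_intros)
  from measurable_compose[OF this assms] have "(\<lambda>p. f (snd p) (fst p)) \<in> borel_measurable borel" by simp
  from wave_chart.trX_measurable[OF swap this, of \<tau>] show ?thesis unfolding swap_trX .
qed

text \<open>The mirror image of \<open>trX_approx\<close>: it is applied to \<open>- F\<close> in
  exchanged variables, with the parameters \<open>- s2 \<le> - s1\<close>.\<close>

lemma trY_approx:
  assumes der: "\<And>X Y. Y \<notin> NY \<Longrightarrow> ((\<lambda>Y. F X Y) has_real_derivative - f X Y) (at Y)"
    and F: "rect_lipschitz F"
    and f: "(\<lambda>p. f (fst p) (snd p)) \<in> borel_measurable borel"
    and L: "rect_bound F M L" and s: "s1 \<le> s2"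
    and b: "\<bar>Xd \<tau> s1\<bar> < M" "\<bar>Xd \<tau> s2\<bar> < M" "\<bar>Yd \<tau> s1\<bar> < M" "\<bar>Yd \<tau> s2\<bar> < M"
  shows "trY f \<tau> integrable_on {Yd \<tau> s2..Yd \<tau> s1}"
    "\<bar>F (Xd \<tau> s2) (Yd \<tau> s2) - F (Xd \<tau> s2) (Yd \<tau> s1) - integral {Yd \<tau> s2..Yd \<tau> s1} (trY f \<tau>)\<bar>
      \<le> L * ((Xd \<tau> s2 - Xd \<tau> s1) * (Yd \<tau> s1 - Yd \<tau> s2))"
proof -
  have m: "(\<lambda>p. f (snd p) (fst p)) \<in> borel_measurable borel"
  proof -
    have "(\<lambda>p::real \<times> real. (snd p, fst p)) \<in> borel_measurable borel"
      by (intro borel_measurable_continuous_onI continuous_intros)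
    from measurable_compose[OF this f] show ?thesis by simp
  qed
  have L': "rect_bound (\<lambda>X Y. - F Y X) M L"
  proof (rule rect_boundI)
    fix X X' Y Y' assume b: "\<bar>X\<bar> \<le> M" "\<bar>X'\<bar> \<le> M" "\<bar>Y\<bar> \<le> M"
    show "\<bar>- F Y X - - F Y X'\<bar> \<le> L * \<bar>X - X'\<bar>" using rect_boundD(3)[OF L b(3,1,2)] by simp
    assume b': "\<bar>Y'\<bar> \<le> M"
    show "\<bar>- F Y X - - F Y' X\<bar> \<le> L * \<bar>Y - Y'\<bar>" using rect_boundD(2)[OF L b(3) b' b(1)] by simp
    have "- F Y X - - F Y X' - - F Y' X + - F Y' X' = - (F Y X - F Y' X - F Y X' + F Y' X')" by simp
    then have "\<bar>- F Y X - - F Y X' - - F Y' X + - F Y' X'\<bar> = \<bar>F Y X - F Y' X - F Y X' + F Y' X'\<bar>" by (simp only: abs_minus_cancel)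
    then show "\<bar>- F Y X - - F Y X' - - F Y' X + - F Y' X'\<bar> \<le> L * (\<bar>X - X'\<bar> * \<bar>Y - Y'\<bar>)"
      using rect_boundD(4)[OF L b(3) b' b(1,2)] by (simp only: mult.commute)
  qed (rule rect_boundD(1)[OF L])
  have d: "((\<lambda>Y. - F X Y) has_real_derivative f X Y) (at Y)" if "Y \<notin> NY" for X Y
    using DERIV_minus[OF der[OF that, of X]] by simp
  have F': "rect_lipschitz (\<lambda>X Y. - F Y X)" by (rule rect_lipschitz_uminus[OF rect_lipschitz_swap[OF F]])
  note T = wave_chart.trX_approx[OF swap, where F="\<lambda>X Y. - F Y X" and f="\<lambda>X Y. f Y X" and ?s1.0="-s2" and ?s2.0="-s1" and \<tau>=\<tau>,
      OF d F' m L']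
  show "trY f \<tau> integrable_on {Yd \<tau> s2..Yd \<tau> s1}"
    using T(1) s b unfolding swap_trX swap_Xd by simp
  show "\<bar>F (Xd \<tau> s2) (Yd \<tau> s2) - F (Xd \<tau> s2) (Yd \<tau> s1) - integral {Yd \<tau> s2..Yd \<tau> s1} (trY f \<tau>)\<bar>
      \<le> L * ((Xd \<tau> s2 - Xd \<tau> s1) * (Yd \<tau> s1 - Yd \<tau> s2))"
    using T(2) s b unfolding swap_trX swap_Xd by (simp add: mult_ac)
qed

text \<open>The curve may follow a line in \<open>NX\<close> or \<open>NY\<close>, where one of the
  partial derivatives is missing, so there is no chain rule in \<open>s\<close>. Instead the
  increment on a short arc is compared with its two line integrals; the errors are quadratic in the
  length of the arc and add up to nothing.\<close>

theorem curve_formula: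
  assumes derX: "\<And>X Y. X \<notin> NX \<Longrightarrow> ((\<lambda>X. F X Y) has_real_derivative f X Y) (at X)"
    and derY: "\<And>X Y. Y \<notin> NY \<Longrightarrow> ((\<lambda>Y. F X Y) has_real_derivative - k X Y) (at Y)"
    and F: "rect_lipschitz F"
    and f: "(\<lambda>p. f (fst p) (snd p)) \<in> borel_measurable borel"
    and k: "(\<lambda>p. k (fst p) (snd p)) \<in> borel_measurable borel" and s: "s1 \<le> s2"
  shows "trX f \<tau> integrable_on {Xd \<tau> s1..Xd \<tau> s2}" "trY k \<tau> integrable_on {Yd \<tau> s2..Yd \<tau> s1}"
    "F (Xd \<tau> s2) (Yd \<tau> s2) - F (Xd \<tau> s1) (Yd \<tau> s1) =
       integral {Xd \<tau> s1..Xd \<tau> s2} (trX f \<tau>) + integral {Yd \<tau> s2..Yd \<tau> s1} (trY k \<tau>)"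
proof -
  define M where "M = \<bar>Xd \<tau> s1\<bar> + \<bar>Xd \<tau> s2\<bar> + \<bar>Yd \<tau> s1\<bar> + \<bar>Yd \<tau> s2\<bar> + 1"
  obtain L where L: "rect_bound F M L" using rect_lipschitzE[OF F] .
  have b: "\<bar>Xd \<tau> r\<bar> < M" "\<bar>Yd \<tau> r\<bar> < M" if "s1 \<le> r" "r \<le> s2" for r
    using Xd_mono[OF that(1), of \<tau>] Xd_mono[OF that(2), of \<tau>] Yd_antimono[OF that(1), of \<tau>] Yd_antimono[OF that(2), of \<tau>]
    by (auto simp: M_def)
  have Ti: "trX f \<tau> integrable_on {Xd \<tau> r..Xd \<tau> r'}" "trY k \<tau> integrable_on {Yd \<tau> r'..Yd \<tau> r}"
    and Ta: "\<bar>F (Xd \<tau> r') (Yd \<tau> r) - F (Xd \<tau> r) (Yd \<tau> r) - integral {Xd \<tau> r..Xd \<tau> r'} (trX f \<tau>)\<bar>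
        \<le> L * ((Xd \<tau> r' - Xd \<tau> r) * (Yd \<tau> r - Yd \<tau> r'))"
      "\<bar>F (Xd \<tau> r') (Yd \<tau> r') - F (Xd \<tau> r') (Yd \<tau> r) - integral {Yd \<tau> r'..Yd \<tau> r} (trY k \<tau>)\<bar>
        \<le> L * ((Xd \<tau> r' - Xd \<tau> r) * (Yd \<tau> r - Yd \<tau> r'))" if "s1 \<le> r" "r \<le> r'" "r' \<le> s2" for r r'
  proof -
    have bb: "\<bar>Xd \<tau> r\<bar> < M" "\<bar>Xd \<tau> r'\<bar> < M" "\<bar>Yd \<tau> r\<bar> < M" "\<bar>Yd \<tau> r'\<bar> < M" using b that by auto
    show "trX f \<tau> integrable_on {Xd \<tau> r..Xd \<tau> r'}"
      by (rule trX_approx(1)[OF derX F f L that(2) bb])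
    show "\<bar>F (Xd \<tau> r') (Yd \<tau> r) - F (Xd \<tau> r) (Yd \<tau> r) - integral {Xd \<tau> r..Xd \<tau> r'} (trX f \<tau>)\<bar>
        \<le> L * ((Xd \<tau> r' - Xd \<tau> r) * (Yd \<tau> r - Yd \<tau> r'))"
      by (rule trX_approx(2)[OF derX F f L that(2) bb])
    show "trY k \<tau> integrable_on {Yd \<tau> r'..Yd \<tau> r}"
      by (rule trY_approx(1)[OF derY F k L that(2) bb])
    show "\<bar>F (Xd \<tau> r') (Yd \<tau> r') - F (Xd \<tau> r') (Yd \<tau> r) - integral {Yd \<tau> r'..Yd \<tau> r} (trY k \<tau>)\<bar>
        \<le> L * ((Xd \<tau> r' - Xd \<tau> r) * (Yd \<tau> r - Yd \<tau> r'))"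
      by (rule trY_approx(2)[OF derY F k L that(2) bb])
  qed
  show "trX f \<tau> integrable_on {Xd \<tau> s1..Xd \<tau> s2}" "trY k \<tau> integrable_on {Yd \<tau> s2..Yd \<tau> s1}"
    using Ti[OF order_refl s order_refl] .
  define D where "D r = F (Xd \<tau> r) (Yd \<tau> r) - integral {Xd \<tau> s1..Xd \<tau> r} (trX f \<tau>) - integral {Yd \<tau> r..Yd \<tau> s1} (trY k \<tau>)" for r
  have "D s1 = D s2"
  proof (rule quadratic_increments_imp_const[OF s, where L="2 * L"])
    fix r r' assume r: "s1 \<le> r" "r \<le> r'" "r' \<le> s2"
    have r13: "s1 \<le> r'" "r \<le> s2" using r by auto
    have "integral {Xd \<tau> s1..Xd \<tau> r} (trX f \<tau>) + integral {Xd \<tau> r..Xd \<tau> r'} (trX f \<tau>) = integral {Xd \<tau> s1..Xd \<tau> r'} (trX f \<tau>)"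
      by (intro Henstock_Kurzweil_Integration.integral_combine Xd_mono r Ti order_refl r13)
    moreover have "integral {Yd \<tau> r'..Yd \<tau> r} (trY k \<tau>) + integral {Yd \<tau> r..Yd \<tau> s1} (trY k \<tau>) = integral {Yd \<tau> r'..Yd \<tau> s1} (trY k \<tau>)"
      by (intro Henstock_Kurzweil_Integration.integral_combine Yd_antimono r Ti order_refl r13)
    ultimately have "D r' - D r = (F (Xd \<tau> r') (Yd \<tau> r) - F (Xd \<tau> r) (Yd \<tau> r) - integral {Xd \<tau> r..Xd \<tau> r'} (trX f \<tau>)) +
        (F (Xd \<tau> r') (Yd \<tau> r') - F (Xd \<tau> r') (Yd \<tau> r) - integral {Yd \<tau> r'..Yd \<tau> r} (trY k \<tau>))"
      by (simp add: D_def)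
    then have "\<bar>D r' - D r\<bar> \<le> 2 * (L * ((Xd \<tau> r' - Xd \<tau> r) * (Yd \<tau> r - Yd \<tau> r')))"
      using Ta[OF r] by linarith
    also have "\<dots> \<le> 2 * (L * ((r' - r) * (r' - r)))"
      using Xd_mono[OF r(2), of \<tau>] Yd_antimono[OF r(2), of \<tau>] r rect_boundD(1)[OF L]
      by (intro mult_left_mono mult_mono) (auto simp: Yd_def)
    finally show "\<bar>D r' - D r\<bar> \<le> 2 * L * (r' - r)\<^sup>2" by (simp add: power2_eq_square mult.assoc)
  qed
  then show "F (Xd \<tau> s2) (Yd \<tau> s2) - F (Xd \<tau> s1) (Yd \<tau> s1) =
       integral {Xd \<tau> s1..Xd \<tau> s2} (trX f \<tau>) + integral {Yd \<tau> s2..Yd \<tau> s1} (trY k \<tau>)"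
    by (simp add: D_def)
qed

end

section \<open>Length and energy measures on level curves\<close>

definition add_measure :: "'a measure \<Rightarrow> 'a measure \<Rightarrow> 'a measure" where
  "add_measure M N = measure_of (space M) (sets M) (\<lambda>A. emeasure M A + emeasure N A)"

lemma sets_add_measure [simp]: "sets (add_measure M N) = sets M"
  by (simp add: add_measure_def)

lemma emeasure_add_measure:
  assumes "sets M = sets N" "A \<in> sets M"
  shows "emeasure (add_measure M N) A = emeasure M A + emeasure N A"
proof (rule emeasure_measure_of[OF add_measure_def])
  show "countably_additive (sets (add_measure M N)) (\<lambda>A. emeasure M A + emeasure N A)"
    unfolding countably_additive_def
  proof (intro allI impI)
    fix F :: "nat \<Rightarrow> 'a set" assume F: "range F \<subseteq> sets (add_measure M N)" "disjoint_family F"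
    then have "(\<Sum>i. emeasure M (F i)) = emeasure M (\<Union>i. F i)" "(\<Sum>i. emeasure N (F i)) = emeasure N (\<Union>i. F i)"
      using assms(1) by (auto intro!: suminf_emeasure)
    then show "(\<Sum>i. emeasure M (F i) + emeasure N (F i)) = emeasure M (\<Union>i. F i) + emeasure N (\<Union>i. F i)"
      by (simp add: suminf_add[symmetric])
  qed
qed (use assms sets.space_closed in \<open>auto simp: positive_def\<close>)

lemma nn_integral_Icc_eq_integral:
  fixes f :: "real \<Rightarrow> real"
  assumes f: "f \<in> borel_measurable borel" and i: "f integrable_on {p..q}" and nn: "\<And>x. 0 \<le> f x"
  shows "(\<integral>\<^sup>+x. ennreal (indicator {p..q} x * f x) \<partial>lborel) = ennreal (integral {p..q} f)"
proof (rule nn_integral_has_integral_lborel)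
  have "((\<lambda>x. if x \<in> {p..q} then f x else 0) has_integral integral {p..q} f) UNIV"
    using integrable_integral[OF i] by (simp only: has_integral_restrict_UNIV)
  then show "((\<lambda>x. indicator {p..q} x * f x) has_integral integral {p..q} f) UNIV"
    by (rule has_integral_eq[rotated]) (simp add: indicator_def)
qed (use f nn in auto)

context wave_chart
begin

text \<open>\<open>MX\<close> and \<open>MY\<close> are the Stieltjes measures of \<open>Xd\<close>
  and \<open>- Yd\<close>, that is, \<open>dX\<close> and \<open>- dY\<close> along the level curve.
  As images of Lebesgue measure on the axes they ignore null sets of lines.\<close>

definition MX :: "real \<Rightarrow> real measure" where "MX \<tau> = distr lborel borel (\<lambda>X. X - Ys X \<tau>)"
definition MY :: "real \<Rightarrow> real measure" where "MY \<tau> = distr lborel borel (\<lambda>Y. Xs Y \<tau> - Y)"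

definition muX :: "(real \<Rightarrow> real \<Rightarrow> real) \<Rightarrow> real \<Rightarrow> real measure" where
  "muX f \<tau> = density (MX \<tau>) (\<lambda>s. ennreal (f (Xd \<tau> s) (Yd \<tau> s)))"
definition muY :: "(real \<Rightarrow> real \<Rightarrow> real) \<Rightarrow> real \<Rightarrow> real measure" where
  "muY f \<tau> = density (MY \<tau>) (\<lambda>s. ennreal (f (Xd \<tau> s) (Yd \<tau> s)))"

lemma sets_mu [simp]: "sets (MX \<tau>) = sets borel" "sets (MY \<tau>) = sets borel" "sets (muX f \<tau>) = sets borel" "sets (muY f \<tau>) = sets borel"
  "space (MX \<tau>) = UNIV" "space (MY \<tau>) = UNIV"
  by (simp_all add: MX_def MY_def muX_def muY_def)

lemma Xs_measurable: "(\<lambda>Y. Xs Y \<tau>) \<in> borel_measurable borel"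
  using wave_chart.Ys_measurable[OF swap, of \<tau>] unfolding swap_Ys .

lemma curve_measurable:
  "(\<lambda>s. (Xd \<tau> s, Yd \<tau> s)) \<in> borel_measurable borel" "Xd \<tau> \<in> borel_measurable borel" "Yd \<tau> \<in> borel_measurable borel"
  by (intro borel_measurable_continuous_onI continuous_intros continuous_Xd continuous_Yd)+

lemma on_curve_measurable:
  fixes f :: "real \<Rightarrow> real \<Rightarrow> real"
  assumes "(\<lambda>p. f (fst p) (snd p)) \<in> borel_measurable borel"
  shows "(\<lambda>s. f (Xd \<tau> s) (Yd \<tau> s)) \<in> borel_measurable borel"
  using measurable_compose[OF curve_measurable(1) assms] by simp

lemma nn_integral_MX:
  assumes "h \<in> borel_measurable borel"
  shows "(\<integral>\<^sup>+s. h s \<partial>MX \<tau>) = (\<integral>\<^sup>+X. h (X - Ys X \<tau>) \<partial>lborel)"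
  unfolding MX_def using assms Ys_measurable by (intro nn_integral_distr) auto

lemma nn_integral_MY:
  assumes "h \<in> borel_measurable borel"
  shows "(\<integral>\<^sup>+s. h s \<partial>MY \<tau>) = (\<integral>\<^sup>+Y. h (Xs Y \<tau> - Y) \<partial>lborel)"
  unfolding MY_def using assms Xs_measurable by (intro nn_integral_distr) auto

lemma AE_notin_null: "AE X in lborel. X \<notin> NX" "AE Y in lborel. Y \<notin> NY"
  using null by (auto intro: AE_not_in)

lemma Yd_section_in_Ioc:
  assumes "s1 < Xs Y \<tau> - Y" "Xs Y \<tau> - Y \<le> s2"
  shows "Yd \<tau> s2 \<le> Y" "Y \<le> Yd \<tau> s1"
  using Yd_antimono[of s1 "Xs Y \<tau> - Y" \<tau>] Yd_antimono[of "Xs Y \<tau> - Y" s2 \<tau>] assms by (simp_all add: Yd_section)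

lemma Yd_section_between:
  assumes "Yd \<tau> s2 < Y" "Y < Yd \<tau> s1"
  shows "s1 < Xs Y \<tau> - Y" "Xs Y \<tau> - Y < s2"
  using Yd_antimono[of "Xs Y \<tau> - Y" s1 \<tau>] Yd_antimono[of s2 "Xs Y \<tau> - Y" \<tau>] assms by (force simp: Yd_section)+

lemma emeasure_muX_Ioc:
  assumes f: "(\<lambda>p. f (fst p) (snd p)) \<in> borel_measurable borel" and nn: "\<And>X Y. X \<notin> NX \<Longrightarrow> 0 \<le> f X Y"
    and i: "trX f \<tau> integrable_on {Xd \<tau> s1..Xd \<tau> s2}"
  shows "emeasure (muX f \<tau>) {s1<..s2} = ennreal (integral {Xd \<tau> s1..Xd \<tau> s2} (trX f \<tau>))"
proof -
  note on_curve_measurable[OF f, of \<tau>, measurable]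
  have "emeasure (muX f \<tau>) {s1<..s2} = (\<integral>\<^sup>+s. ennreal (f (Xd \<tau> s) (Yd \<tau> s)) * indicator {s1<..s2} s \<partial>MX \<tau>)"
    unfolding muX_def by (rule emeasure_density) (auto simp: MX_def)
  also have "\<dots> = (\<integral>\<^sup>+X. ennreal (f X (Ys X \<tau>)) * indicator {s1<..s2} (X - Ys X \<tau>) \<partial>lborel)"
    by (subst nn_integral_MX) (auto simp: Xd_section)
  also have "\<dots> = (\<integral>\<^sup>+X. ennreal (indicator {Xd \<tau> s1..Xd \<tau> s2} X * trX f \<tau> X) \<partial>lborel)"
  proof (rule nn_integral_cong_AE)
    have "AE X in lborel. X \<noteq> Xd \<tau> s1" "AE X in lborel. X \<noteq> Xd \<tau> s2" by (rule AE_lborel_singleton)+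
    with AE_notin_null(1) show "AE X in lborel. ennreal (f X (Ys X \<tau>)) * indicator {s1<..s2} (X - Ys X \<tau>) =
        ennreal (indicator {Xd \<tau> s1..Xd \<tau> s2} X * trX f \<tau> X)"
    proof eventually_elim
      case (elim X)
      have "X - Ys X \<tau> \<in> {s1<..s2} \<longleftrightarrow> X \<in> {Xd \<tau> s1..Xd \<tau> s2}"
        using section_in_Ioc[of s1 X \<tau> s2] section_between(1,2)[of \<tau> s1 X s2] elim by auto
      then show ?case using elim by (simp add: indicator_def trX_def)
    qed
  qed
  also have "\<dots> = ennreal (integral {Xd \<tau> s1..Xd \<tau> s2} (trX f \<tau>))"
    by (rule nn_integral_Icc_eq_integral[OF trX_measurable[OF f] i]) (simp add: trX_def nn)
  finally show ?thesis .
qed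

lemma emeasure_muY_Ioc:
  assumes f: "(\<lambda>p. f (fst p) (snd p)) \<in> borel_measurable borel" and nn: "\<And>X Y. Y \<notin> NY \<Longrightarrow> 0 \<le> f X Y"
    and i: "trY f \<tau> integrable_on {Yd \<tau> s2..Yd \<tau> s1}"
  shows "emeasure (muY f \<tau>) {s1<..s2} = ennreal (integral {Yd \<tau> s2..Yd \<tau> s1} (trY f \<tau>))"
proof -
  note on_curve_measurable[OF f, of \<tau>, measurable]
  have "emeasure (muY f \<tau>) {s1<..s2} = (\<integral>\<^sup>+s. ennreal (f (Xd \<tau> s) (Yd \<tau> s)) * indicator {s1<..s2} s \<partial>MY \<tau>)"
    unfolding muY_def by (rule emeasure_density) (auto simp: MY_def)
  also have "\<dots> = (\<integral>\<^sup>+Y. ennreal (f (Xs Y \<tau>) Y) * indicator {s1<..s2} (Xs Y \<tau> - Y) \<partial>lborel)"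
    by (subst nn_integral_MY) (auto simp: Yd_section)
  also have "\<dots> = (\<integral>\<^sup>+Y. ennreal (indicator {Yd \<tau> s2..Yd \<tau> s1} Y * trY f \<tau> Y) \<partial>lborel)"
  proof (rule nn_integral_cong_AE)
    have "AE Y in lborel. Y \<noteq> Yd \<tau> s1" "AE Y in lborel. Y \<noteq> Yd \<tau> s2" by (rule AE_lborel_singleton)+
    with AE_notin_null(2) show "AE Y in lborel. ennreal (f (Xs Y \<tau>) Y) * indicator {s1<..s2} (Xs Y \<tau> - Y) =
        ennreal (indicator {Yd \<tau> s2..Yd \<tau> s1} Y * trY f \<tau> Y)"
    proof eventually_elim
      case (elim Y)
      have "Xs Y \<tau> - Y \<in> {s1<..s2} \<longleftrightarrow> Y \<in> {Yd \<tau> s2..Yd \<tau> s1}"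
        using Yd_section_in_Ioc[of s1 Y \<tau> s2] Yd_section_between[of \<tau> s2 Y s1] elim by auto
      then show ?case using elim by (simp add: indicator_def trY_def)
    qed
  qed
  also have "\<dots> = ennreal (integral {Yd \<tau> s2..Yd \<tau> s1} (trY f \<tau>))"
    by (rule nn_integral_Icc_eq_integral[OF trY_measurable[OF f] i]) (simp add: trY_def nn)
  finally show ?thesis .
qed

lemma u_measurable: "(\<lambda>p. u (fst p) (snd p)) \<in> borel_measurable borel" "c \<in> borel_measurable borel"
  using continuous_potentials(3) c_cont by (auto intro: borel_measurable_continuous_onI)

lemma quotient_measurable:
  "(\<lambda>p. \<alpha> (fst p) (snd p) / c (u (fst p) (snd p))) \<in> borel_measurable borel"
  "(\<lambda>p. a (fst p) (snd p) / c (u (fst p) (snd p))) \<in> borel_measurable borel"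
  by (intro borel_measurable_divide meas measurable_compose[OF u_measurable])+

text \<open>Since \<open>t\<close> is constant on the level curve, \<open>curve_formula\<close>
  gives \<open>(\<alpha> / c) dX\<close> and \<open>(a / c) (- dY)\<close> the same mass on every
  arc; multiplication by the common density \<open>c\<close> removes the quotients. So each family
  of characteristics contributes half of \<open>dx\<close>.\<close>

lemma muX_alpha_eq_muY_a: "muX \<alpha> \<tau> = muY a \<tau>"
proof -
  have dt: "((\<lambda>Y. t X Y) has_real_derivative - (- (a X Y / c (u X Y)))) (at Y)" if "Y \<notin> NY" for X Y
    using der_Y(1)[OF that] by simp
  have neg: "trY (\<lambda>X Y. - (a X Y / c (u X Y))) \<tau> = (\<lambda>Y. - trY (\<lambda>X Y. a X Y / c (u X Y)) \<tau> Y)"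
    by (auto simp: trY_def)
  have i: "trX (\<lambda>X Y. \<alpha> X Y / c (u X Y)) \<tau> integrable_on {Xd \<tau> s1..Xd \<tau> s2}"
    "trY (\<lambda>X Y. a X Y / c (u X Y)) \<tau> integrable_on {Yd \<tau> s2..Yd \<tau> s1}"
    "integral {Xd \<tau> s1..Xd \<tau> s2} (trX (\<lambda>X Y. \<alpha> X Y / c (u X Y)) \<tau>) = integral {Yd \<tau> s2..Yd \<tau> s1} (trY (\<lambda>X Y. a X Y / c (u X Y)) \<tau>)"
    if "s1 \<le> s2" for s1 s2
    using curve_formula[OF der_X(1) dt reg(1) quotient_measurable(1) borel_measurable_uminus[OF quotient_measurable(2)] that, of \<tau>]
    unfolding neg by (simp_all add: t_Xd integrable_neg_iff)
  have eq: "muX (\<lambda>X Y. \<alpha> X Y / c (u X Y)) \<tau> = muY (\<lambda>X Y. a X Y / c (u X Y)) \<tau>"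
  proof (rule measure_eqI_Ioc)
    fix s1 s2 :: real assume s: "s1 \<le> s2"
    have 1: "emeasure (muX (\<lambda>X Y. \<alpha> X Y / c (u X Y)) \<tau>) {s1<..s2} = ennreal (integral {Xd \<tau> s1..Xd \<tau> s2} (trX (\<lambda>X Y. \<alpha> X Y / c (u X Y)) \<tau>))"
      by (rule emeasure_muX_Ioc[OF quotient_measurable(1) _ i(1)[OF s]]) (simp add: nonneg_X c_pos less_imp_le)
    have 2: "emeasure (muY (\<lambda>X Y. a X Y / c (u X Y)) \<tau>) {s1<..s2} = ennreal (integral {Yd \<tau> s2..Yd \<tau> s1} (trY (\<lambda>X Y. a X Y / c (u X Y)) \<tau>))"
      by (rule emeasure_muY_Ioc[OF quotient_measurable(2) _ i(2)[OF s]]) (simp add: nonneg_Y c_pos less_imp_le)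
    show "emeasure (muX (\<lambda>X Y. \<alpha> X Y / c (u X Y)) \<tau>) {s1<..s2} = emeasure (muY (\<lambda>X Y. a X Y / c (u X Y)) \<tau>) {s1<..s2}"
      unfolding 1 2 i(3)[OF s] ..
    show "emeasure (muX (\<lambda>X Y. \<alpha> X Y / c (u X Y)) \<tau>) {s1<..s2} < \<infinity>" unfolding 1 by simp
  qed simp_all
  have cm: "(\<lambda>s. ennreal (c (u (Xd \<tau> s) (Yd \<tau> s)))) \<in> borel_measurable borel"
    using measurable_compose[OF on_curve_measurable[OF u_measurable(1)] u_measurable(2)] by simp
  have mul: "ennreal (v / c w) * ennreal (c w) = ennreal v" for v w
    using c_pos[of w] ennreal_mult''[of "c w" "v / c w"] by simp
  have "muX \<alpha> \<tau> = density (muX (\<lambda>X Y. \<alpha> X Y / c (u X Y)) \<tau>) (\<lambda>s. ennreal (c (u (Xd \<tau> s) (Yd \<tau> s))))"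
    unfolding muX_def using cm on_curve_measurable[OF quotient_measurable(1), of \<tau>]
    by (subst density_density_eq) (auto simp: mul MX_def)
  also have "\<dots> = density (muY (\<lambda>X Y. a X Y / c (u X Y)) \<tau>) (\<lambda>s. ennreal (c (u (Xd \<tau> s) (Yd \<tau> s))))"
    by (simp only: eq)
  also have "\<dots> = muY a \<tau>"
    unfolding muY_def using cm on_curve_measurable[OF quotient_measurable(2), of \<tau>]
    by (subst density_density_eq) (auto simp: mul MY_def)
  finally show ?thesis .
qed

text \<open>The measure \<open>dx\<close> along the level curve. It is twice either of its summands
  by \<open>muX_alpha_eq_muY_a\<close>.\<close>

definition lam :: "real \<Rightarrow> real measure" where "lam \<tau> = add_measure (muX \<alpha> \<tau>) (muY a \<tau>)"

lemma sets_lam [simp]: "sets (lam \<tau>) = sets borel" by (simp add: lam_def)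

lemma emeasure_lam:
  "B \<in> sets borel \<Longrightarrow> emeasure (lam \<tau>) B = 2 * emeasure (muX \<alpha> \<tau>) B"
  "B \<in> sets borel \<Longrightarrow> emeasure (lam \<tau>) B = 2 * emeasure (muY a \<tau>) B"
  by (simp_all add: lam_def emeasure_add_measure muX_alpha_eq_muY_a mult_2)

lemma der_Y_x_e: "Y \<notin> NY \<Longrightarrow> ((\<lambda>Y. x X Y) has_real_derivative - a X Y) (at Y)"
  "Y \<notin> NY \<Longrightarrow> ((\<lambda>Y. e X Y) has_real_derivative - b X Y) (at Y)"
  by (rule der_Y; assumption)+

lemma trX_nonneg: "(\<And>X Y. X \<notin> NX \<Longrightarrow> 0 \<le> f X Y) \<Longrightarrow> trX f \<tau> integrable_on A \<Longrightarrow> 0 \<le> integral A (trX f \<tau>)"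
  by (rule Henstock_Kurzweil_Integration.integral_nonneg) (auto simp: trX_def)

lemma trY_nonneg: "(\<And>X Y. Y \<notin> NY \<Longrightarrow> 0 \<le> f X Y) \<Longrightarrow> trY f \<tau> integrable_on A \<Longrightarrow> 0 \<le> integral A (trY f \<tau>)"
  by (rule Henstock_Kurzweil_Integration.integral_nonneg) (auto simp: trY_def)

lemma emeasure_lam_Ioc:
  assumes s: "s1 \<le> s2" shows "emeasure (lam \<tau>) {s1<..s2} = ennreal (xh \<tau> s2 - xh \<tau> s1)"
proof -
  note cf = curve_formula[OF der_X(2) der_Y_x_e(1) reg(2) meas(1,3) s, of \<tau>]
  have "emeasure (lam \<tau>) {s1<..s2} = emeasure (muX \<alpha> \<tau>) {s1<..s2} + emeasure (muY a \<tau>) {s1<..s2}"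
    by (simp add: lam_def emeasure_add_measure)
  also have "\<dots> = ennreal (xh \<tau> s2 - xh \<tau> s1)"
    using emeasure_muX_Ioc[OF meas(1) nonneg_X(1) cf(1)] emeasure_muY_Ioc[OF meas(3) nonneg_Y(1) cf(2)] cf(3)
      trX_nonneg[OF nonneg_X(1) cf(1)] trY_nonneg[OF nonneg_Y(1) cf(2)]
    by (simp add: xh_def ennreal_plus[symmetric] del: ennreal_plus)
  finally show ?thesis .
qed

lemma distr_lam: "distr (lam \<tau>) borel (xh \<tau>) = lborel"
  by (rule onto_mono.distr_eq_lborel[OF onto_mono_xh]) (simp_all add: emeasure_lam_Ioc)

text \<open>The measure \<open>de\<close> on the parameter line, before \<open>xh\<close> carries it
  to physical space.\<close>

definition muh :: "real \<Rightarrow> real measure" where "muh \<tau> = add_measure (muX \<beta> \<tau>) (muY b \<tau>)"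

lemma sets_muh [simp]: "sets (muh \<tau>) = sets borel" "space (muh \<tau>) = UNIV"
  by (simp_all add: muh_def) (metis sets_add_measure sets_eq_imp_space_eq sets_mu(3) space_borel)

lemma emeasure_muh: "B \<in> sets borel \<Longrightarrow> emeasure (muh \<tau>) B = emeasure (muX \<beta> \<tau>) B + emeasure (muY b \<tau>) B"
  by (simp add: muh_def emeasure_add_measure)

lemma emeasure_muh_Ioc:
  assumes s: "s1 \<le> s2" shows "emeasure (muh \<tau>) {s1<..s2} = ennreal (eh \<tau> s2 - eh \<tau> s1)"
proof -
  note cf = curve_formula[OF der_X(4) der_Y_x_e(2) reg(4) meas(2,4) s, of \<tau>]
  show ?thesis
    using emeasure_muX_Ioc[OF meas(2) nonneg_X(2) cf(1)] emeasure_muY_Ioc[OF meas(4) nonneg_Y(2) cf(2)] cf(3)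
      trX_nonneg[OF nonneg_X(2) cf(1)] trY_nonneg[OF nonneg_Y(2) cf(2)]
    by (simp add: emeasure_muh eh_def ennreal_plus[symmetric] del: ennreal_plus)
qed

lemma emeasure_muh_UNIV: "emeasure (muh \<tau>) UNIV = ennreal (ep - em)"
proof (rule antisym)
  have "(\<Union>n::nat. {- real n<..real n}) = UNIV"
  proof safe
    fix x :: real
    obtain n :: nat where "\<bar>x\<bar> < real n" using reals_Archimedean2 by blast
    then show "x \<in> (\<Union>i. {- real i<..real i})" by (intro UN_I[of n]) auto
  qed auto
  moreover have "(SUP n. emeasure (muh \<tau>) {- real n<..real n}) = emeasure (muh \<tau>) (\<Union>n. {- real n<..real n})"
    by (rule SUP_emeasure_incseq) (auto simp: incseq_def)
  moreover have "(SUP n. emeasure (muh \<tau>) {- real n<..real n}) \<le> ennreal (ep - em)"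
    by (intro SUP_least) (auto simp: emeasure_muh_Ioc intro!: ennreal_leI diff_mono eh_bounds)
  ultimately show "emeasure (muh \<tau>) UNIV \<le> ennreal (ep - em)" by simp
  show "ennreal (ep - em) \<le> emeasure (muh \<tau>) UNIV"
  proof (rule ennreal_le_epsilon)
    fix r :: real assume r: "r > 0"
    obtain s1 s2 where s: "ep - r / 2 < eh \<tau> s2" "eh \<tau> s1 < em + r / 2"
      using eh_approaches[of "r / 2" \<tau>] r by auto
    have "ep - em \<le> (eh \<tau> (max s1 s2) - eh \<tau> s1) + r"
      using s eh_mono[of s2 "max s1 s2" \<tau>] by simp
    then have "ennreal (ep - em) \<le> ennreal (eh \<tau> (max s1 s2) - eh \<tau> s1) + ennreal r"
      using r eh_mono[of s1 "max s1 s2" \<tau>] by (simp add: ennreal_plus[symmetric] ennreal_leI del: ennreal_plus)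
    also have "ennreal (eh \<tau> (max s1 s2) - eh \<tau> s1) = emeasure (muh \<tau>) {s1<..max s1 s2}"
      by (simp add: emeasure_muh_Ioc)
    also have "\<dots> \<le> emeasure (muh \<tau>) UNIV" by (rule emeasure_mono) auto
    finally show "ennreal (ep - em) \<le> emeasure (muh \<tau>) UNIV + ennreal r" by (simp add: add_right_mono)
  qed
qed

lemma emeasure_muh_greaterThan: "emeasure (muh \<tau>) {r<..} = ennreal (ep - eh \<tau> r)"
proof (rule antisym)
  have "(\<Union>n::nat. {r<..r + real n}) = {r<..}"
  proof safe
    fix x assume "r < x"
    obtain n :: nat where "\<bar>x - r\<bar> < real n" using reals_Archimedean2 by blast
    with \<open>r < x\<close> show "x \<in> (\<Union>i. {r<..r + real i})" by (intro UN_I[of n]) auto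
  qed auto
  moreover have "(SUP n. emeasure (muh \<tau>) {r<..r + real n}) = emeasure (muh \<tau>) (\<Union>n. {r<..r + real n})"
    by (rule SUP_emeasure_incseq) (auto simp: incseq_def)
  moreover have "(SUP n. emeasure (muh \<tau>) {r<..r + real n}) \<le> ennreal (ep - eh \<tau> r)"
    by (intro SUP_least) (auto simp: emeasure_muh_Ioc intro!: ennreal_leI diff_mono eh_bounds)
  ultimately show "emeasure (muh \<tau>) {r<..} \<le> ennreal (ep - eh \<tau> r)" by simp
  show "ennreal (ep - eh \<tau> r) \<le> emeasure (muh \<tau>) {r<..}"
  proof (rule ennreal_le_epsilon)
    fix d :: real assume d: "d > 0"
    obtain s2 where s: "ep - d < eh \<tau> s2" using eh_approaches(1)[OF d] by blast
    have "ep - eh \<tau> r \<le> (eh \<tau> (max r s2) - eh \<tau> r) + d"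
      using s eh_mono[of s2 "max r s2" \<tau>] by simp
    then have "ennreal (ep - eh \<tau> r) \<le> ennreal (eh \<tau> (max r s2) - eh \<tau> r) + ennreal d"
      using d eh_mono[of r "max r s2" \<tau>] by (simp add: ennreal_plus[symmetric] ennreal_leI del: ennreal_plus)
    also have "ennreal (eh \<tau> (max r s2) - eh \<tau> r) = emeasure (muh \<tau>) {r<..max r s2}"
      by (simp add: emeasure_muh_Ioc)
    also have "\<dots> \<le> emeasure (muh \<tau>) {r<..}" by (rule emeasure_mono) auto
    finally show "ennreal (ep - eh \<tau> r) \<le> emeasure (muh \<tau>) {r<..} + ennreal d" by (simp add: add_right_mono)
  qed
qed

section \<open>The energy measure and its continuity in time\<close>

definition mu :: "real \<Rightarrow> real measure" where "mu \<tau> = distr (muh \<tau>) borel (xh \<tau>)"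

lemma sets_mu_time [simp]: "sets (mu \<tau>) = sets borel" "space (mu \<tau>) = UNIV"
  by (simp_all add: mu_def)

lemma xh_measurable: "xh \<tau> \<in> borel_measurable borel"
  by (rule onto_mono.measurable_self[OF onto_mono_xh])

lemma xh_measurable_muh: "xh \<tau> \<in> measurable (muh \<tau>) borel"
  by (subst measurable_cong_sets[OF sets_muh(1) refl]) (rule xh_measurable)

lemma emeasure_mu: "B \<in> sets borel \<Longrightarrow> emeasure (mu \<tau>) B = emeasure (muh \<tau>) (xh \<tau> -` B)"
  unfolding mu_def by (subst emeasure_distr[OF xh_measurable_muh]) auto

lemma emeasure_mu_UNIV: "emeasure (mu \<tau>) UNIV = ennreal (ep - em)"
  by (simp add: emeasure_mu emeasure_muh_UNIV)

text \<open>Parametrizing the level set by energy makes the positions at different times comparable.\<close>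

definition Se :: "real \<Rightarrow> real \<Rightarrow> real" where "Se \<tau> y = Inf {s. y \<le> eh \<tau> s}"
definition Q :: "real \<Rightarrow> real \<Rightarrow> real" where "Q \<tau> y = xh \<tau> (Se \<tau> y)"

lemma Se_le_iff:
  assumes y: "em < y" "y < ep" shows "Se \<tau> y \<le> s \<longleftrightarrow> y \<le> eh \<tau> s"
proof -
  obtain s2 where s2: "y \<le> eh \<tau> s2" using eh_approaches(1)[of "ep - y" \<tau>] y by (auto intro: less_imp_le)
  obtain s1 where s1: "eh \<tau> s1 < y" using eh_approaches(2)[of "y - em" \<tau>] y by auto
  have "s1 \<le> s" if "y \<le> eh \<tau> s" for s using eh_mono[of s s1 \<tau>] s1 that by (cases "s1 \<le> s") auto
  then have bdd: "bdd_below {s. y \<le> eh \<tau> s}" by (auto intro!: bdd_belowI[of _ s1])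
  have "closed {s. y \<le> eh \<tau> s}" by (rule closed_Collect_le) (auto intro: continuous_eh)
  moreover have "{s. y \<le> eh \<tau> s} \<noteq> {}" using s2 by auto
  ultimately have mem: "y \<le> eh \<tau> (Se \<tau> y)"
    using closed_contains_Inf[OF _ bdd] by (simp add: Se_def)
  show ?thesis
  proof
    assume "Se \<tau> y \<le> s" then show "y \<le> eh \<tau> s" using eh_mono mem order_trans by blast
  next
    assume "y \<le> eh \<tau> s" then show "Se \<tau> y \<le> s"
      unfolding Se_def by (intro cInf_lower bdd) auto
  qed
qed

lemma Q_mono: "em < y \<Longrightarrow> y \<le> y' \<Longrightarrow> y' < ep \<Longrightarrow> Q \<tau> y \<le> Q \<tau> y'"
  unfolding Q_def by (intro xh_mono) (use Se_le_iff[of y \<tau> "Se \<tau> y'"] Se_le_iff[of y' \<tau> "Se \<tau> y'"] in auto)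

lemma Q_measurable: "Q \<tau> \<in> borel_measurable (restrict_space borel {em<..<ep})"
  by (rule borel_measurable_mono_on_fnc) (auto intro!: mono_onI Q_mono)

text \<open>\<open>Q \<tau>\<close> is the quantile function of the energy. All the measures become
  images of one fixed measure, Lebesgue measure on \<open>{em<..<ep}\<close>, so continuity in time
  reduces to continuity of the maps.\<close>

lemma mu_eq_distr_Q: "mu \<tau> = distr (restrict_space lborel {em<..<ep}) borel (Q \<tau>)"
proof (rule measure_eqI_lessThan)
  have Qm: "Q \<tau> \<in> measurable (restrict_space lborel {em<..<ep}) borel"
    using Q_measurable[of \<tau>] measurable_cong_sets[OF sets_restrict_space_cong[OF sets_lborel] refl] by blast
  fix \<xi>
  \<comment> \<open>With \<open>r\<close> the largest parameter whose position is at most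
    \<open>\<xi>\<close>, both sides become the energy beyond \<open>r\<close>.\<close>
  obtain r where r: "\<And>s. xh \<tau> s \<le> \<xi> \<longleftrightarrow> s \<le> r" using onto_mono.vimage_Ioc[OF onto_mono_xh, of \<tau>] by metis
  have "xh \<tau> -` {\<xi><..} = {r<..}" using r by (auto simp: not_le[symmetric])
  then have 1: "emeasure (mu \<tau>) {\<xi><..} = ennreal (ep - eh \<tau> r)"
    by (simp add: emeasure_mu emeasure_muh_greaterThan)
  show "emeasure (mu \<tau>) {\<xi><..} < \<infinity>" unfolding 1 by simp
  have "Q \<tau> -` {\<xi><..} \<inter> {em<..<ep} = {eh \<tau> r<..<ep}"
    using r Se_le_iff[of _ \<tau> r] eh_bounds[of \<tau> r] by (auto simp: Q_def not_le[symmetric])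
  then have "emeasure (distr (restrict_space lborel {em<..<ep}) borel (Q \<tau>)) {\<xi><..} = emeasure lborel {eh \<tau> r<..<ep}"
    using eh_bounds(1)[of \<tau> r]
    by (subst emeasure_distr[OF Qm]) (auto simp: space_restrict_space intro!: emeasure_restrict_space)
  also have "\<dots> = ennreal (ep - eh \<tau> r)" using eh_bounds by simp
  finally show "emeasure (mu \<tau>) {\<xi><..} = emeasure (distr (restrict_space lborel {em<..<ep}) borel (Q \<tau>)) {\<xi><..}"
    using 1 by simp
qed simp_all

text \<open>From the point where \<open>e\<close> reaches \<open>y\<close> at time
  \<open>\<tau>\<close>, the \<open>X\<close>-characteristic leads to time \<open>\<tau>'\<close>
  without lowering \<open>e\<close> and moves to the right by at most
  \<open>\<kappa> * (\<tau>' - \<tau>)\<close>; so the quantile cannot have moved further. Backward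
  in time the \<open>Y\<close>-characteristic does the same.\<close>

lemma Q_finite_speed:
  assumes y: "em < y" "y < ep" and lt: "\<tau> < \<tau>'"
  shows "\<bar>Q \<tau>' y - Q \<tau> y\<bar> \<le> \<kappa> * (\<tau>' - \<tau>)"
proof -
  have 1: "Q \<tau>' y \<le> Q \<tau> y + \<kappa> * (\<tau>' - \<tau>)"
  proof -
    define X Y where "X = Xd \<tau> (Se \<tau> y)" and "Y = Yd \<tau> (Se \<tau> y)"
    have e: "y \<le> e X Y" using Se_le_iff[OF y, of \<tau> "Se \<tau> y"] by (simp add: eh_def X_def Y_def)
    have tX: "t X Y = \<tau>" by (simp add: X_def Y_def t_Xd)
    have "\<not> Xs Y \<tau>' \<le> X" using tX lt by (simp add: Xs_le_iff)
    then have le: "X \<le> Xs Y \<tau>'" by simp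
    have "y \<le> eh \<tau>' (Xs Y \<tau>' - Y)" using mono_X(3)[OF le, of Y] e by (simp add: eh_def Yd_section)
    then have "Q \<tau>' y \<le> xh \<tau>' (Xs Y \<tau>' - Y)" unfolding Q_def by (intro xh_mono) (simp add: Se_le_iff[OF y])
    also have "\<dots> = x (Xs Y \<tau>') Y" by (simp add: xh_def Yd_section)
    also have "\<dots> \<le> x X Y + \<kappa> * (\<tau>' - \<tau>)" using cone_X(1)[OF le, of Y] tX by (simp add: t_Xs)
    finally show ?thesis by (simp add: Q_def xh_def X_def Y_def)
  qed
  have 2: "Q \<tau> y \<le> Q \<tau>' y + \<kappa> * (\<tau>' - \<tau>)"
  proof -
    define X Y where "X = Xd \<tau>' (Se \<tau>' y)" and "Y = Yd \<tau>' (Se \<tau>' y)"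
    have e: "y \<le> e X Y" using Se_le_iff[OF y, of \<tau>' "Se \<tau>' y"] by (simp add: eh_def X_def Y_def)
    have tX: "t X Y = \<tau>'" by (simp add: X_def Y_def t_Xd)
    have le: "Ys X \<tau> \<le> Y" using tX lt by (simp add: Ys_le_iff)
    have "y \<le> eh \<tau> (X - Ys X \<tau>)" using mono_Y(3)[OF le, of X] e by (simp add: eh_def Xd_section)
    then have "Q \<tau> y \<le> xh \<tau> (X - Ys X \<tau>)" unfolding Q_def by (intro xh_mono) (simp add: Se_le_iff[OF y])
    also have "\<dots> = x X (Ys X \<tau>)" by (simp add: xh_def Xd_section)
    also have "\<dots> \<le> x X Y + \<kappa> * (\<tau>' - \<tau>)" using cone_Y(1)[OF le, of X] tX by (simp add: t_Ys)
    finally show ?thesis by (simp add: Q_def xh_def X_def Y_def)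
  qed
  show ?thesis using 1 2 by linarith
qed

lemma mu_vaguely_continuous:
  fixes f :: "real \<Rightarrow> real"
  assumes f: "continuous_on UNIV f" and K: "\<And>v. \<bar>f v\<bar> \<le> K"
  shows "continuous_on UNIV (\<lambda>\<tau>. LINT x|mu \<tau>. f x)"
  unfolding continuous_on_sequentially
proof (intro allI impI ballI, elim conjE)
  fix T :: "nat \<Rightarrow> real" and \<tau> assume T: "T \<longlonglongrightarrow> \<tau>"
  have Qm: "Q \<tau> \<in> measurable (restrict_space lborel {em<..<ep}) borel" for \<tau>
    using Q_measurable[of \<tau>] measurable_cong_sets[OF sets_restrict_space_cong[OF sets_lborel] refl] by blast
  have fm: "f \<in> borel_measurable borel" using f by (rule borel_measurable_continuous_onI)
  have eq: "(LINT x|mu \<tau>. f x) = (LINT y|restrict_space lborel {em<..<ep}. f (Q \<tau> y))" for \<tau>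
    unfolding mu_eq_distr_Q by (rule integral_distr[OF Qm fm])
  have sp: "\<bar>Q \<tau>' y - Q \<tau> y\<bar> \<le> \<kappa> * \<bar>\<tau>' - \<tau>\<bar>" if "em < y" "y < ep" for \<tau> \<tau>' y
    using Q_finite_speed[OF that, of \<tau> \<tau>'] Q_finite_speed[OF that, of \<tau>' \<tau>]
    by (cases \<tau> \<tau>' rule: linorder_cases) (auto simp: abs_minus_commute)
  have "(\<lambda>n. LINT y|restrict_space lborel {em<..<ep}. f (Q (T n) y)) \<longlonglongrightarrow> (LINT y|restrict_space lborel {em<..<ep}. f (Q \<tau> y))"
  proof (rule integral_dominated_convergence[where w="\<lambda>_. K"])
    show "(\<lambda>y. f (Q \<tau> y)) \<in> borel_measurable (restrict_space lborel {em<..<ep})" "(\<lambda>y. f (Q (T n) y)) \<in> borel_measurable (restrict_space lborel {em<..<ep})" for n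
      using measurable_compose[OF Qm fm] by auto
    show "integrable (restrict_space lborel {em<..<ep}) (\<lambda>_. K)"
      by (rule finite_measure.integrable_const, rule finite_measureI)
         (use em_le_ep in \<open>simp add: space_restrict_space emeasure_restrict_space\<close>)
    show "AE y in restrict_space lborel {em<..<ep}. (\<lambda>n. f (Q (T n) y)) \<longlonglongrightarrow> f (Q \<tau> y)"
    proof (rule AE_I2)
      fix y assume "y \<in> space (restrict_space lborel {em<..<ep})"
      then have y: "em < y" "y < ep" by (auto simp: space_restrict_space)
      have "(\<lambda>n. \<kappa> * \<bar>T n - \<tau>\<bar>) \<longlonglongrightarrow> \<kappa> * \<bar>\<tau> - \<tau>\<bar>" by (intro tendsto_intros T)
      then have z: "(\<lambda>n. \<kappa> * \<bar>T n - \<tau>\<bar>) \<longlonglongrightarrow> 0" by simp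
      have "(\<lambda>n. Q (T n) y - Q \<tau> y) \<longlonglongrightarrow> 0"
        by (rule Lim_null_comparison[OF _ z]) (use sp[OF y] in auto)
      then have "(\<lambda>n. Q (T n) y) \<longlonglongrightarrow> Q \<tau> y" by (rule LIM_zero_cancel)
      moreover have "isCont f (Q \<tau> y)" using f by (simp add: continuous_on_eq_continuous_at)
      ultimately show "(\<lambda>n. f (Q (T n) y)) \<longlonglongrightarrow> f (Q \<tau> y)" by (rule isCont_tendsto_compose[rotated])
    qed
  qed (use K in auto)
  then show "((\<lambda>\<tau>. LINT x|mu \<tau>. f x) \<circ> T) \<longlonglongrightarrow> (LINT x|mu \<tau>. f x)"
    by (simp add: eq comp_def)
qed

text \<open>The energy carried by the complement of \<open>G \<tau>\<close> becomes the singular part.\<close>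

definition G :: "real \<Rightarrow> real set" where
  "G \<tau> = {s. Xd \<tau> s \<notin> NX \<and> Yd \<tau> s \<notin> NY \<and> 0 < \<alpha> (Xd \<tau> s) (Yd \<tau> s) \<and> 0 < a (Xd \<tau> s) (Yd \<tau> s)}"

lemma G_borel: "G \<tau> \<in> sets borel"
proof -
  have [measurable]: "NX \<in> sets borel" "NY \<in> sets borel" using null by (auto simp: null_sets_def)
  note [measurable] = curve_measurable(2,3)[of \<tau>] on_curve_measurable[OF meas(1), of \<tau>] on_curve_measurable[OF meas(3), of \<tau>]
  show ?thesis unfolding G_def by measurable
qed

text \<open>Read as \<open>\<alpha> dX\<close>, the measure ignores the lines in \<open>NX\<close>
  and the points where \<open>\<alpha>\<close> is not positive. Read as \<open>a (- dY)\<close>, it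
  ignores the lines in \<open>NY\<close> and the points where \<open>a\<close> is not positive.
  Together these are the four conditions in \<open>G\<close>.\<close>

lemma AE_muX_alpha: "AE s in muX \<alpha> \<tau>. s \<in> G \<tau>"
proof -
  have [measurable]: "NX \<in> sets borel" "NY \<in> sets borel" using null by (auto simp: null_sets_def)
  note [measurable] = curve_measurable(2,3)[of \<tau>] on_curve_measurable[OF meas(1), of \<tau>] on_curve_measurable[OF meas(3), of \<tau>]
    Ys_measurable[of \<tau>] Xs_measurable[of \<tau>]
  have "AE s in MX \<tau>. Xd \<tau> s \<notin> NX"
    unfolding MX_def using AE_notin_null(1) by (subst AE_distr_iff) (auto simp: Xd_section)
  then have 1: "AE s in muX \<alpha> \<tau>. Xd \<tau> s \<notin> NX \<and> 0 < \<alpha> (Xd \<tau> s) (Yd \<tau> s)"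
    unfolding muX_def by (subst AE_density) (auto simp: MX_def elim!: eventually_mono)
  have "AE s in MY \<tau>. Yd \<tau> s \<notin> NY"
    unfolding MY_def using AE_notin_null(2) by (subst AE_distr_iff) (auto simp: Yd_section)
  then have "AE s in muY a \<tau>. Yd \<tau> s \<notin> NY \<and> 0 < a (Xd \<tau> s) (Yd \<tau> s)"
    unfolding muY_def by (subst AE_density) (auto simp: MY_def elim!: eventually_mono)
  with 1 show ?thesis unfolding muX_alpha_eq_muY_a[symmetric] G_def by eventually_elim auto
qed

lemma muX_alpha_compl_G: "emeasure (muX \<alpha> \<tau>) (- G \<tau>) = 0"
  using AE_muX_alpha[of \<tau>] G_borel[of \<tau>]
  by (subst (asm) AE_iff_measurable[where N="- G \<tau>"]) (auto simp: muX_def)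

text \<open>\<open>localize\<close> with arbitrarily small \<open>r\<close> forces every point with
  the same time and position to coincide with the good one.\<close>

lemma G_injective:
  assumes s: "s \<in> G \<tau>" and eq: "xh \<tau> s' = xh \<tau> s" shows "s' = s"
proof -
  have G: "Xd \<tau> s \<notin> NX" "Yd \<tau> s \<notin> NY" "0 < \<alpha> (Xd \<tau> s) (Yd \<tau> s)" "0 < a (Xd \<tau> s) (Yd \<tau> s)"
    using s by (auto simp: G_def)
  have "\<bar>Xd \<tau> s' - Xd \<tau> s\<bar> < r \<and> \<bar>Yd \<tau> s' - Yd \<tau> s\<bar> < r" if r: "r > 0" for r
  proof -
    obtain \<delta> where \<delta>: "\<delta> > 0" "\<And>X Y. \<bar>t X Y - t (Xd \<tau> s) (Yd \<tau> s)\<bar> + \<bar>x X Y - x (Xd \<tau> s) (Yd \<tau> s)\<bar> < \<delta> \<Longrightarrow>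
        \<bar>X - Xd \<tau> s\<bar> < r \<and> \<bar>Y - Yd \<tau> s\<bar> < r"
      using localize[OF G r] by metis
    then show ?thesis using \<delta>(2)[of "Xd \<tau> s'" "Yd \<tau> s'"] eq by (simp add: t_Xd xh_def)
  qed
  from this[of "\<bar>Xd \<tau> s' - Xd \<tau> s\<bar>"] this[of "\<bar>Yd \<tau> s' - Yd \<tau> s\<bar>"]
  have "Xd \<tau> s' = Xd \<tau> s" "Yd \<tau> s' = Yd \<tau> s" by auto
  then show ?thesis by (simp add: Yd_def)
qed

text \<open>The image under \<open>xh\<close> of the complement of \<open>G \<tau>\<close>. Writing
  it through the Borel section \<open>sx\<close> makes it a Borel set, and
  \<open>G_injective\<close> makes its preimage exactly that complement.\<close>

definition Z :: "real \<Rightarrow> real set" where "Z \<tau> = {\<xi>. sx \<tau> \<xi> \<notin> G \<tau>}"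

lemma vimage_Z: "xh \<tau> -` Z \<tau> = - G \<tau>"
  unfolding Z_def using G_injective[of _ \<tau>] xh_sx by (auto, metis+)

lemma Z_borel: "Z \<tau> \<in> sets borel"
proof -
  have [measurable]: "sx \<tau> \<in> borel_measurable borel"
    unfolding sx_def using onto_mono.ginv_measurable[OF onto_mono_xh] by simp
  have [measurable]: "G \<tau> \<in> sets borel" by (rule G_borel)
  show ?thesis unfolding Z_def by measurable
qed

text \<open>Lebesgue measure is the image of \<open>lam\<close>, and \<open>lam\<close> gives no
  mass to the complement of \<open>G \<tau>\<close>.\<close>

lemma Z_null: "Z \<tau> \<in> null_sets lborel"
proof -
  have m: "xh \<tau> \<in> measurable (lam \<tau>) borel"
    by (subst measurable_cong_sets[OF sets_lam refl]) (rule xh_measurable)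
  have sp: "space (lam \<tau>) = UNIV" using sets_eq_imp_space_eq[OF sets_lam, of \<tau>] by simp
  have "emeasure lborel (Z \<tau>) = emeasure (distr (lam \<tau>) borel (xh \<tau>)) (Z \<tau>)" by (simp only: distr_lam)
  also have "\<dots> = emeasure (lam \<tau>) (- G \<tau>)" by (subst emeasure_distr[OF m]) (auto simp: Z_borel sp vimage_Z)
  also have "\<dots> = 0" using G_borel[of \<tau>] by (subst emeasure_lam(1)) (auto simp: muX_alpha_compl_G)
  finally show ?thesis using Z_borel by (simp add: null_sets_def)
qed

end

section \<open>Local L^p convergence and weak derivatives\<close>

lemma Lp_loc_continuous:
  assumes f: "continuous_on UNIV f" and p: "p > 0" shows "Lp_loc p f"
  unfolding Lp_loc_def
proof (intro conjI allI impI)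
  have fm: "f \<in> borel_measurable borel" using f by (rule borel_measurable_continuous_onI)
  then show "f \<in> borel_measurable lebesgue" by (intro measurable_completion) simp
  fix K :: "real set" assume K: "compact K"
  have "integrable lborel (\<lambda>x. indicator K x *\<^sub>R \<bar>f x\<bar> powr p)"
    by (rule borel_integrable_compact[OF K])
       (use p in \<open>intro continuous_on_powr' continuous_intros continuous_on_subset[OF f], auto\<close>)
  then show "set_integrable lebesgue K (\<lambda>x. \<bar>f x\<bar> powr p)"
    unfolding set_integrable_def using integrable_completion[of "\<lambda>x. indicator K x *\<^sub>R \<bar>f x\<bar> powr p" lborel]
      borel_measurable_integrable by blast
qed

lemma abs_powr_le_1_plus_square: "0 \<le> p \<Longrightarrow> p \<le> 2 \<Longrightarrow> \<bar>y\<bar> powr p \<le> 1 + y\<^sup>2" for y p :: real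
proof (cases "\<bar>y\<bar> \<le> 1")
  case True
  assume "0 \<le> p"
  then have "\<bar>y\<bar> powr p \<le> 1" using True powr_mono2[of p "\<bar>y\<bar>" 1] by simp
  then show ?thesis by (simp add: add_increasing2)
next
  case False
  assume "p \<le> 2"
  then have "\<bar>y\<bar> powr p \<le> \<bar>y\<bar> powr 2" using False by (intro powr_mono) auto
  also have "\<dots> = y\<^sup>2" using False by simp
  finally show ?thesis by simp
qed

lemma Lp_loc_of_square_integrable:
  assumes v: "v \<in> borel_measurable borel" and i: "integrable lborel (\<lambda>x. (v x)\<^sup>2)" and p: "0 \<le> p" "p \<le> 2"
  shows "Lp_loc p v"
  unfolding Lp_loc_def
proof (intro conjI allI impI)
  show "v \<in> borel_measurable lebesgue" using v by (intro measurable_completion) simp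
  fix K :: "real set" assume K: "compact K"
  have Kb: "K \<in> sets borel" using K by (rule borel_compact)
  have "integrable lborel (\<lambda>x. indicator K x *\<^sub>R \<bar>v x\<bar> powr p)"
  proof (rule Bochner_Integration.integrable_bound)
    show "integrable lborel (\<lambda>x. indicator K x *\<^sub>R (1::real) + (v x)\<^sup>2)"
      by (intro Bochner_Integration.integrable_add i borel_integrable_compact[OF K] continuous_intros)
    show "AE x in lborel. norm (indicator K x *\<^sub>R \<bar>v x\<bar> powr p) \<le> norm (indicator K x *\<^sub>R (1::real) + (v x)\<^sup>2)"
      using abs_powr_le_1_plus_square[OF p] by (auto simp: indicator_def)
  qed (use v Kb in measurable)
  then show "set_integrable lebesgue K (\<lambda>x. \<bar>v x\<bar> powr p)"
    unfolding set_integrable_def using integrable_completion[of "\<lambda>x. indicator K x *\<^sub>R \<bar>v x\<bar> powr p" lborel]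
      borel_measurable_integrable by blast
qed

lemma compact_subset_interval:
  fixes K :: "real set" assumes "compact K" obtains M where "M \<ge> 0" "K \<subseteq> {-M..M}"
proof -
  obtain M where "\<And>x. x \<in> K \<Longrightarrow> norm x \<le> M" using compact_imp_bounded[OF assms] bounded_iff by metis
  then show thesis using that[of "max M 0"] by (force simp: abs_le_iff)
qed

lemma Lp_loc_limit_of_quotients:
  fixes q :: "nat \<Rightarrow> real \<Rightarrow> real" and v :: "real \<Rightarrow> real"
  assumes q: "\<And>n. continuous_on UNIV (q n)" and v: "v \<in> borel_measurable borel"
    and vi: "integrable lborel (\<lambda>x. (v x)\<^sup>2)" and K: "compact K"
    and ae: "AE x in lborel. (\<lambda>n. q n x) \<longlonglongrightarrow> v x"
    and bd: "\<And>n A B. A \<le> B \<Longrightarrow> integral {A..B} (\<lambda>x. (q n x)\<^sup>2) \<le> C" and p: "1 \<le> p" "p < 2"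
  shows "(\<lambda>n. LINT x:K|lebesgue. (\<bar>q n x - v x\<bar> powr p)) \<longlonglongrightarrow> 0"
proof -
  have Kb: "K \<in> sets borel" using K by (rule borel_compact)
  have qm[measurable]: "q n \<in> borel_measurable borel" for n using q by (rule borel_measurable_continuous_onI)
  note v[measurable] Kb[measurable]
  define N where "N = restrict_space lborel K"
  have mN: "f \<in> borel_measurable N" if "f \<in> borel_measurable borel" for f :: "real \<Rightarrow> real"
    unfolding N_def by (rule measurable_restrict_space1) (simp add: that)
  have eq: "(LINT x:K|lebesgue. (\<bar>q n x - v x\<bar> powr p)) = (\<integral>x. \<bar>q n x - v x\<bar> powr p \<partial>N)" for n
  proof -
    have "(LINT x:K|lebesgue. (\<bar>q n x - v x\<bar> powr p)) = (LINT x|lborel. indicator K x *\<^sub>R \<bar>q n x - v x\<bar> powr p)"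
      unfolding set_lebesgue_integral_def by (rule integral_completion) measurable
    also have "\<dots> = (\<integral>x. \<bar>q n x - v x\<bar> powr p \<partial>N)"
      unfolding N_def by (subst integral_restrict_space) (simp_all add: Kb)
    finally show ?thesis .
  qed
  obtain M where M: "M \<ge> 0" "K \<subseteq> {-M..M}" using compact_subset_interval[OF K] .
  define V where "V = (\<integral>x. (v x)\<^sup>2 \<partial>lborel)"
  have qi: "integrable N (\<lambda>x. (q n x)\<^sup>2)" "(\<integral>x. (q n x)\<^sup>2 \<partial>N) \<le> C" for n
  proof -
    have c: "continuous_on S (\<lambda>x. (q n x)\<^sup>2)" for S
      by (intro continuous_intros continuous_on_subset[OF q]) auto
    have i1: "integrable lborel (\<lambda>x. indicator K x *\<^sub>R (q n x)\<^sup>2)" "integrable lborel (\<lambda>x. indicator {-M..M} x *\<^sub>R (q n x)\<^sup>2)"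
      by (rule borel_integrable_compact[OF K c]) (rule borel_integrable_compact[OF compact_Icc c])
    then show "integrable N (\<lambda>x. (q n x)\<^sup>2)" unfolding N_def by (subst integrable_restrict_space) (simp_all add: Kb)
    have "(\<integral>x. (q n x)\<^sup>2 \<partial>N) = (LINT x|lborel. indicator K x *\<^sub>R (q n x)\<^sup>2)"
      unfolding N_def by (subst integral_restrict_space) (simp_all add: Kb)
    also have "\<dots> \<le> (LINT x|lborel. indicator {-M..M} x *\<^sub>R (q n x)\<^sup>2)"
      by (rule integral_mono[OF i1]) (use M in \<open>auto simp: indicator_def\<close>)
    also have "\<dots> = integral {-M..M} (\<lambda>x. (q n x)\<^sup>2)"
      using set_borel_integral_eq_integral(2)[of "{-M..M}" "\<lambda>x. (q n x)\<^sup>2"] i1(2)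
      by (simp add: set_integrable_def set_lebesgue_integral_def)
    also have "\<dots> \<le> C" using bd[of "-M" M] M by simp
    finally show "(\<integral>x. (q n x)\<^sup>2 \<partial>N) \<le> C" .
  qed
  have vN: "integrable N (\<lambda>x. (v x)\<^sup>2)" "(\<integral>x. (v x)\<^sup>2 \<partial>N) \<le> V"
  proof -
    have i: "integrable lborel (\<lambda>x. indicator K x *\<^sub>R (v x)\<^sup>2)"
      by (rule Bochner_Integration.integrable_bound[OF vi]) (auto simp: indicator_def)
    then show "integrable N (\<lambda>x. (v x)\<^sup>2)" unfolding N_def by (subst integrable_restrict_space) (simp_all add: Kb)
    have "(\<integral>x. (v x)\<^sup>2 \<partial>N) = (LINT x|lborel. indicator K x *\<^sub>R (v x)\<^sup>2)"
      unfolding N_def by (subst integral_restrict_space) (simp_all add: Kb)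
    also have "\<dots> \<le> V" unfolding V_def by (rule integral_mono[OF i vi]) (auto simp: indicator_def)
    finally show "(\<integral>x. (v x)\<^sup>2 \<partial>N) \<le> V" .
  qed
  have "(\<lambda>n. \<integral>x. \<bar>q n x - v x\<bar> powr p \<partial>N) \<longlonglongrightarrow> 0"
  \<comment> \<open>The constant comes from
    \<open>(q - v)\<^sup>2 \<le> 2 * q\<^sup>2 + 2 * v\<^sup>2\<close>.\<close>
  proof (rule Lp_tendsto_0_of_L2_bounded[OF _ p, where C="2 * C + 2 * V"])
    show "finite_measure N"
    proof (rule finite_measureI)
      have "emeasure lborel K < \<infinity>" using emeasure_bounded_finite[OF compact_imp_bounded[OF K]] .
      then show "emeasure N (space N) \<noteq> \<infinity>" by (simp add: N_def space_restrict_space emeasure_restrict_space Kb)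
    qed
    show "(\<lambda>x. q n x - v x) \<in> borel_measurable N" for n by (rule mN) measurable
    show "AE x in N. (\<lambda>n. q n x - v x) \<longlonglongrightarrow> 0"
    proof -
      have "AE x in lborel. (\<lambda>n. q n x - v x) \<longlonglongrightarrow> 0" using ae by eventually_elim (rule LIM_zero)
      then show ?thesis unfolding N_def by (subst AE_restrict_space_iff) (auto simp: Kb)
    qed
    fix n
    have i2: "integrable N (\<lambda>x. 2 * (q n x)\<^sup>2 + 2 * (v x)\<^sup>2)"
      by (intro Bochner_Integration.integrable_add integrable_mult_right qi vN)
    have le: "(q n x - v x)\<^sup>2 \<le> 2 * (q n x)\<^sup>2 + 2 * (v x)\<^sup>2" for x
      using zero_le_power2[of "q n x + v x"] by (simp add: power2_eq_square algebra_simps)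
    show i: "integrable N (\<lambda>x. (q n x - v x)\<^sup>2)"
      by (rule Bochner_Integration.integrable_bound[OF i2]) (use le in \<open>auto intro!: mN order_trans[OF _ abs_ge_self]\<close>)
    have "(\<integral>x. (q n x - v x)\<^sup>2 \<partial>N) \<le> (\<integral>x. 2 * (q n x)\<^sup>2 + 2 * (v x)\<^sup>2 \<partial>N)" by (rule integral_mono[OF i i2 le])
    also have "\<dots> = 2 * (\<integral>x. (q n x)\<^sup>2 \<partial>N) + 2 * (\<integral>x. (v x)\<^sup>2 \<partial>N)"
      by (subst Bochner_Integration.integral_add) (auto intro!: qi vN)
    also have "\<dots> \<le> 2 * C + 2 * V" using qi(2)[of n] vN(2) by simp
    finally show "(\<integral>x. (q n x - v x)\<^sup>2 \<partial>N) \<le> 2 * C + 2 * V" .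
  qed
  then show ?thesis by (simp only: eq)
qed

lemma continuous_bounded_Icc:
  fixes k :: "real \<Rightarrow> real"
  assumes "continuous_on UNIV k" shows "\<exists>B. \<forall>x\<in>{p..q}. \<bar>k x\<bar> \<le> B"
proof -
  have "bounded (k ` {p..q})"
    by (intro compact_imp_bounded compact_continuous_image continuous_on_subset[OF assms] compact_Icc) auto
  then show ?thesis unfolding bounded_iff by auto
qed

text \<open>A change of variable moves the difference quotient from \<open>f\<close> to
  \<open>\<psi>\<close>, where it converges boundedly. On the side of \<open>f\<close> it converges
  in L^1 on the support of \<open>\<psi>\<close>, thanks to the square-integral bound; it is this
  bound that excludes a singular part in the derivative of \<open>f\<close>.\<close>

lemma has_weak_derivativeI:
  fixes f v :: "real \<Rightarrow> real"
  assumes f: "continuous_on UNIV f" and v: "v \<in> borel_measurable borel"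
    and vi: "integrable lborel (\<lambda>x. (v x)\<^sup>2)"
    and ae: "AE x in lborel. (\<lambda>n. (f (x + 1 / real (Suc n)) - f x) * real (Suc n)) \<longlonglongrightarrow> v x"
    and bd: "\<And>n A B. A \<le> B \<Longrightarrow> integral {A..B} (\<lambda>x. ((f (x + 1 / real (Suc n)) - f x) * real (Suc n))\<^sup>2) \<le> C"
  shows "has_weak_derivative f v"
  unfolding has_weak_derivative_def
proof (intro conjI allI impI; (elim conjE)?)
  show "Lp_loc 1 f" by (rule Lp_loc_continuous[OF f]) simp
  show "Lp_loc 1 v" by (rule Lp_loc_of_square_integrable[OF v vi]) simp_all
  fix \<psi> assume sm: "smooth_fun \<psi>" and cs: "compactly_supported \<psi>"
  define K where "K = closure {x. \<psi> x \<noteq> 0}"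
  have K: "compact K" using cs by (simp add: K_def compactly_supported_def)
  have zero: "\<psi> x = 0" if "x \<notin> K" for x using that closure_subset[of "{x. \<psi> x \<noteq> 0}"] by (auto simp: K_def)
  have "(deriv ^^ n) \<psi> differentiable_on UNIV" for n using sm by (auto simp: smooth_fun_def)
  from this[of 0] this[of 1] have d0: "\<psi> differentiable_on UNIV" and d1: "deriv \<psi> differentiable_on UNIV" by simp_all
  have der: "(\<psi> has_real_derivative deriv \<psi> x) (at x)" for x
    using d0 by (auto simp: differentiable_on_def DERIV_deriv_iff_real_differentiable)
  have c0: "continuous_on UNIV \<psi>" and c1: "continuous_on UNIV (deriv \<psi>)"
    using d0 d1 differentiable_imp_continuous_on by auto
  note fm = borel_measurable_continuous_onI[OF f] and m0 = borel_measurable_continuous_onI[OF c0]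
    and m1 = borel_measurable_continuous_onI[OF c1]
  note [measurable] = v fm m0 m1
  obtain M where M: "M \<ge> 0" "K \<subseteq> {-M..M}" using compact_subset_interval[OF K] .
  \<comment> \<open>The margin 2 serves two purposes: the shifted test functions live in
    \<open>{-M-1..M+1}\<close>, and the mean value points lie within one more step.\<close>
  obtain B where B: "\<And>x. x \<in> {-M-2..M+2} \<Longrightarrow> \<bar>deriv \<psi> x\<bar> \<le> B"
    using continuous_bounded_Icc[OF c1, of "-M-2" "M+2"] by blast
  obtain F where F: "\<And>x. x \<in> {-M-2..M+2} \<Longrightarrow> \<bar>f x\<bar> \<le> F"
    using continuous_bounded_Icc[OF f, of "-M-2" "M+2"] by blast
  obtain P where P: "\<And>x. x \<in> {-M-2..M+2} \<Longrightarrow> \<bar>\<psi> x\<bar> \<le> P"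
    using continuous_bounded_Icc[OF c0, of "-M-2" "M+2"] by blast
  have B0: "B \<ge> 0" "F \<ge> 0" "P \<ge> 0" using B[of 0] F[of 0] P[of 0] M by auto
  define h where "h = (\<lambda>n. 1 / real (Suc n))"
  have h: "0 < h n" "h n \<le> 1" "1 / h n = real (Suc n)" for n by (simp_all add: h_def)
  have h0: "h \<longlonglongrightarrow> 0" unfolding h_def by (rule LIMSEQ_Suc[OF lim_1_over_n])
  define q where "q = (\<lambda>n x. (f (x + h n) - f x) * real (Suc n))"
  have qc: "continuous_on UNIV (q n)" for n
    unfolding q_def by (intro continuous_intros continuous_on_compose2[OF f] f) auto
  have supp: "\<psi> x = 0" if "\<bar>x\<bar> > M" for x
  proof (rule zero)
    show "x \<notin> K" using M that by fastforce
  qed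
  have out: "\<psi> (x - h n) = 0" "\<psi> x = 0" if "\<bar>x\<bar> > M + 1" for x n
    using supp[of x] supp[of "x - h n"] h[of n] that by auto
  have cint: "integrable lborel (\<lambda>x. k x * l x)"
    if "continuous_on UNIV k" "continuous_on UNIV l" "\<And>x. \<bar>x\<bar> > M + 1 \<Longrightarrow> l x = 0" for k l :: "real \<Rightarrow> real"
  proof -
    have "integrable lborel (\<lambda>x. indicator {-M-1..M+1} x *\<^sub>R (k x * l x))"
      by (rule borel_integrable_compact[OF compact_Icc]) (intro continuous_intros continuous_on_subset[OF that(1)] continuous_on_subset[OF that(2)], auto)
    moreover have e: "indicator {-M-1..M+1} x *\<^sub>R (k x * l x) = k x * l x" for x
    proof (cases "\<bar>x\<bar> > M + 1")
      case False
      then have "x \<in> {-M-1..M+1}" by auto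
      then show ?thesis by simp
    qed (simp add: that(3))
    ultimately show ?thesis by (simp only: e)
  qed
  have shift: "(LINT x|lborel. q n x * \<psi> x) = (LINT x|lborel. f x * ((\<psi> (x - h n) - \<psi> x) * real (Suc n)))" for n
  proof -
    have c0': "continuous_on UNIV (\<lambda>x. \<psi> (x - h n))" by (intro continuous_on_compose2[OF c0] continuous_intros) auto
    have f': "continuous_on UNIV (\<lambda>x. f (x + h n))" by (intro continuous_on_compose2[OF f] continuous_intros) auto
    have i: "integrable lborel (\<lambda>x. f (x + h n) * \<psi> x)" "integrable lborel (\<lambda>x. f x * \<psi> x)" "integrable lborel (\<lambda>x. f x * \<psi> (x - h n))"
      by (rule cint[OF f' c0] cint[OF f c0] cint[OF f c0']; use out in blast)+
    have "(LINT x|lborel. f x * \<psi> (x - h n)) = (LINT x|lborel. f (x + h n) * \<psi> x)"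
      using lborel_integral_real_affine[of 1 "\<lambda>x. f x * \<psi> (x - h n)" "h n"] by (simp add: add.commute)
    moreover have "(LINT x|lborel. q n x * \<psi> x) = ((LINT x|lborel. f (x + h n) * \<psi> x) - (LINT x|lborel. f x * \<psi> x)) * real (Suc n)"
    proof -
      have "(LINT x|lborel. q n x * \<psi> x) = (LINT x|lborel. (f (x + h n) * \<psi> x - f x * \<psi> x) * real (Suc n))"
        unfolding q_def by (intro Bochner_Integration.integral_cong) (simp_all add: algebra_simps)
      then show ?thesis using i by simp
    qed
    moreover have "(LINT x|lborel. f x * ((\<psi> (x - h n) - \<psi> x) * real (Suc n))) =
        ((LINT x|lborel. f x * \<psi> (x - h n)) - (LINT x|lborel. f x * \<psi> x)) * real (Suc n)"
    proof -
      have "(LINT x|lborel. f x * ((\<psi> (x - h n) - \<psi> x) * real (Suc n))) = (LINT x|lborel. (f x * \<psi> (x - h n) - f x * \<psi> x) * real (Suc n))"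
        by (intro Bochner_Integration.integral_cong) (simp_all add: algebra_simps)
      then show ?thesis using i by simp
    qed
    ultimately show ?thesis by simp
  qed
  have "(\<lambda>n. LINT x|lborel. f x * ((\<psi> (x - h n) - \<psi> x) * real (Suc n))) \<longlonglongrightarrow> (LINT x|lborel. f x * (- deriv \<psi> x))"
  proof (rule integral_dominated_convergence[where w="\<lambda>x. F * B * indicator {-M-1..M+1} x"])
    show "AE x in lborel. (\<lambda>n. f x * ((\<psi> (x - h n) - \<psi> x) * real (Suc n))) \<longlonglongrightarrow> f x * (- deriv \<psi> x)"
    proof (intro AE_I2 tendsto_mult tendsto_const)
      fix x
      have "filterlim (\<lambda>n. - h n) (at 0) sequentially"
        unfolding filterlim_at using tendsto_minus[OF h0] h(1) by (auto simp: less_le)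
      from filterlim_compose[OF der[of x, unfolded DERIV_def] this]
      have "(\<lambda>n. (\<psi> (x + - h n) - \<psi> x) / (- h n)) \<longlonglongrightarrow> deriv \<psi> x" .
      then have "(\<lambda>n. - ((\<psi> (x + - h n) - \<psi> x) / (- h n))) \<longlonglongrightarrow> - deriv \<psi> x" by (rule tendsto_minus)
      then show "(\<lambda>n. (\<psi> (x - h n) - \<psi> x) * real (Suc n)) \<longlonglongrightarrow> - deriv \<psi> x"
        by (simp add: h_def)
    qed
    show "AE x in lborel. norm (f x * ((\<psi> (x - h n) - \<psi> x) * real (Suc n))) \<le> F * B * indicator {-M-1..M+1} x" for n
    proof (rule AE_I2)
      fix x
      show "norm (f x * ((\<psi> (x - h n) - \<psi> x) * real (Suc n))) \<le> F * B * indicator {-M-1..M+1} x"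
      proof (cases "\<bar>x\<bar> > M + 1")
        case True
        then show ?thesis using out[OF True] B0 by simp
      next
        case False
        then have x: "x \<in> {-M-2..M+2}" "x \<in> {-M-1..M+1}" by auto
        obtain z where z: "x - h n < z" "z < x" "\<psi> x - \<psi> (x - h n) = (x - (x - h n)) * deriv \<psi> z"
          using MVT2[of "x - h n" x \<psi> "deriv \<psi>"] der h(1)[of n] by auto
        have "z \<in> {-M-2..M+2}" using z x h(2)[of n] by auto
        then have "\<bar>deriv \<psi> z\<bar> \<le> B" by (rule B)
        moreover have "(\<psi> (x - h n) - \<psi> x) * real (Suc n) = - deriv \<psi> z"
          using z(3) h(1)[of n] by (simp add: h_def field_simps)
        ultimately have "\<bar>f x\<bar> * \<bar>(\<psi> (x - h n) - \<psi> x) * real (Suc n)\<bar> \<le> F * B"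
          using F[OF x(1)] B0 by (intro mult_mono) auto
        then show ?thesis using x(2) by (simp add: abs_mult)
      qed
    qed
    show "integrable lborel (\<lambda>x. F * B * indicator {-M-1..M+1} x)"
      by (intro integrable_mult_right integrable_real_indicator) (auto simp: emeasure_lborel_Icc_eq)
  qed measurable
  then have lim1: "(\<lambda>n. LINT x|lborel. q n x * \<psi> x) \<longlonglongrightarrow> - (LINT x|lborel. f x * deriv \<psi> x)"
    by (simp add: shift)
  have vK: "integrable lborel (\<lambda>x. v x * \<psi> x)"
  proof (rule Bochner_Integration.integrable_bound)
    show "integrable lborel (\<lambda>x. (v x)\<^sup>2 + P * P * indicator {-M..M} x)"
      by (intro Bochner_Integration.integrable_add vi integrable_mult_right integrable_real_indicator) (auto simp: emeasure_lborel_Icc_eq)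
    show "AE x in lborel. norm (v x * \<psi> x) \<le> norm ((v x)\<^sup>2 + P * P * indicator {-M..M} x)"
    proof (rule AE_I2)
      fix x
      show "norm (v x * \<psi> x) \<le> norm ((v x)\<^sup>2 + P * P * indicator {-M..M} x)"
      proof (cases "\<bar>x\<bar> > M")
        case False
        then have x: "x \<in> {-M..M}" by auto
        then have x': "\<bar>\<psi> x\<bar> \<le> P" using P[of x] by simp
        have "\<bar>v x\<bar> * \<bar>\<psi> x\<bar> \<le> \<bar>v x\<bar> * P" using x' by (intro mult_left_mono) auto
        also have "\<dots> \<le> (v x)\<^sup>2 + P * P"
        proof -
          have "2 * (\<bar>v x\<bar> * P) \<le> (v x)\<^sup>2 + P * P"
            using sum_squares_bound[of "\<bar>v x\<bar>" P] by (simp add: power2_eq_square mult.assoc)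
          moreover have "0 \<le> \<bar>v x\<bar> * P" using B0(3) by simp
          ultimately show ?thesis by linarith
        qed
        finally show ?thesis using x by (simp add: abs_mult)
      qed (simp add: supp)
    qed
  qed measurable
  have lim2: "(\<lambda>n. LINT x|lborel. q n x * \<psi> x) \<longlonglongrightarrow> (LINT x|lborel. v x * \<psi> x)"
  proof -
    have L: "(\<lambda>n. LINT x:K|lebesgue. (\<bar>q n x - v x\<bar> powr 1)) \<longlonglongrightarrow> 0"
      by (rule Lp_loc_limit_of_quotients[OF qc v vi K _ _ order_refl]) (use ae bd in \<open>simp_all add: q_def h_def\<close>)
    have "(\<lambda>n. (LINT x|lborel. q n x * \<psi> x) - (LINT x|lborel. v x * \<psi> x)) \<longlonglongrightarrow> 0"
    proof (rule Lim_null_comparison)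
      show "(\<lambda>n. P * (LINT x:K|lebesgue. (\<bar>q n x - v x\<bar> powr 1))) \<longlonglongrightarrow> 0" using tendsto_mult_left[OF L, of P] by simp
      show "\<forall>\<^sub>F n in sequentially. norm ((LINT x|lborel. q n x * \<psi> x) - (LINT x|lborel. v x * \<psi> x)) \<le> P * (LINT x:K|lebesgue. (\<bar>q n x - v x\<bar> powr 1))"
      proof (rule always_eventually, rule allI)
        fix n
        have Kb[measurable]: "K \<in> sets borel" using K by (rule borel_compact)
        have qm[measurable]: "q n \<in> borel_measurable borel" using qc by (rule borel_measurable_continuous_onI)
        have iq: "integrable lborel (\<lambda>x. q n x * \<psi> x)" by (rule cint[OF qc c0]) (use out in blast)
        have iK: "integrable lborel (\<lambda>x. indicator K x *\<^sub>R \<bar>q n x - v x\<bar>)"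
        proof -
          have "set_integrable lebesgue K (\<lambda>x. \<bar>q n x\<bar> powr 1)" "set_integrable lebesgue K (\<lambda>x. \<bar>v x\<bar> powr 1)"
            using Lp_loc_continuous[OF qc, of 1 n] Lp_loc_of_square_integrable[OF v vi, of 1] K unfolding Lp_loc_def by auto
          then have "integrable lebesgue (\<lambda>x. indicator K x *\<^sub>R \<bar>q n x\<bar>)" "integrable lebesgue (\<lambda>x. indicator K x *\<^sub>R \<bar>v x\<bar>)"
            by (simp_all add: set_integrable_def)
          then have "integrable lborel (\<lambda>x. indicator K x *\<^sub>R \<bar>q n x\<bar>)" "integrable lborel (\<lambda>x. indicator K x *\<^sub>R \<bar>v x\<bar>)"
            using integrable_completion[of "\<lambda>x. indicator K x *\<^sub>R \<bar>q n x\<bar>" lborel]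
              integrable_completion[of "\<lambda>x. indicator K x *\<^sub>R \<bar>v x\<bar>" lborel] by (simp_all add: qm v Kb)
          from Bochner_Integration.integrable_add[OF this]
          show ?thesis by (rule Bochner_Integration.integrable_bound) (auto simp: indicator_def)
        qed
        have "(LINT x|lborel. q n x * \<psi> x) - (LINT x|lborel. v x * \<psi> x) = (LINT x|lborel. (q n x - v x) * \<psi> x)"
          using Bochner_Integration.integral_diff[OF iq vK] by (simp add: left_diff_distrib)
        also have "norm \<dots> \<le> (LINT x|lborel. norm ((q n x - v x) * \<psi> x))" by (rule integral_norm_bound)
        also have "\<dots> \<le> (LINT x|lborel. P * (indicator K x *\<^sub>R \<bar>q n x - v x\<bar>))"
        proof (rule integral_mono)
          show "integrable lborel (\<lambda>x. norm ((q n x - v x) * \<psi> x))"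
            using integrable_norm[OF Bochner_Integration.integrable_diff[OF iq vK]] by (simp add: left_diff_distrib)
          show "integrable lborel (\<lambda>x. P * (indicator K x *\<^sub>R \<bar>q n x - v x\<bar>))" by (intro integrable_mult_right iK)
          fix x
          show "norm ((q n x - v x) * \<psi> x) \<le> P * (indicator K x *\<^sub>R \<bar>q n x - v x\<bar>)"
          proof (cases "x \<in> K")
            case True
            then have "\<bar>\<psi> x\<bar> \<le> P" using M P[of x] by auto
            from mult_right_mono[OF this, of "\<bar>q n x - v x\<bar>"] show ?thesis using True by (simp add: abs_mult mult.commute)
          qed (simp add: zero)
        qed
        also have "\<dots> = P * (LINT x:K|lebesgue. (\<bar>q n x - v x\<bar> powr 1))"
        proof -
          have "(LINT x:K|lebesgue. \<bar>q n x - v x\<bar>) = (LINT x|lborel. indicator K x *\<^sub>R \<bar>q n x - v x\<bar>)"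
            unfolding set_lebesgue_integral_def by (rule integral_completion) measurable
          then show ?thesis using iK by simp
        qed
        finally show "norm ((LINT x|lborel. q n x * \<psi> x) - (LINT x|lborel. v x * \<psi> x)) \<le> P * (LINT x:K|lebesgue. (\<bar>q n x - v x\<bar> powr 1))" .
      qed
    qed
    then show ?thesis by (rule LIM_zero_cancel)
  qed
  have "- (LINT x|lborel. f x * deriv \<psi> x) = (LINT x|lborel. v x * \<psi> x)" by (rule LIMSEQ_unique[OF lim1 lim2])
  moreover have "(LINT x|lebesgue. f x * deriv \<psi> x) = (LINT x|lborel. f x * deriv \<psi> x)"
    "(LINT x|lebesgue. v x * \<psi> x) = (LINT x|lborel. v x * \<psi> x)"
    by (rule integral_completion; measurable)+
  ultimately show "(LINT x|lebesgue. f x * deriv \<psi> x) = - (LINT x|lebesgue. v x * \<psi> x)" by simp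
qed

lemma DERIV_imp_forward_quotients:
  fixes k :: "real \<Rightarrow> real"
  assumes "(k has_real_derivative D) (at y)"
  shows "(\<lambda>n. (k (y + 1 / real (Suc n)) - k y) * real (Suc n)) \<longlonglongrightarrow> D"
proof -
  have "filterlim (\<lambda>n. 1 / real (Suc n)) (at 0) sequentially"
    unfolding filterlim_at using LIMSEQ_Suc[OF lim_1_over_n] by (auto simp del: of_nat_Suc)
  from filterlim_compose[OF assms[unfolded DERIV_def] this] show ?thesis by simp
qed

section \<open>Null sets of times and the singular part\<close>

context wave_chart
begin

text \<open>On a vertical line \<open>t\<close> carries the measure with density
  \<open>a / c\<close> to Lebesgue measure on the times. A property valid at almost every
  \<open>Y\<close> with \<open>a \<noteq> 0\<close> is therefore met at almost every time on that
  line.\<close>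

lemma t_density_push:
  assumes X: "X \<notin> NX" and B: "B \<in> sets borel"
  shows "emeasure lborel B = (\<integral>\<^sup>+Y. ennreal (if Y \<in> NY then 0 else a X Y / c (u X Y)) * indicator B (t X Y) \<partial>lborel)"
proof -
  interpret m: onto_mono "\<lambda>Y. t X Y" by (rule onto_mono_t_Y)
  define k where "k Y = (if Y \<in> NY then 0 else a X Y / c (u X Y))" for Y
  have [measurable]: "NY \<in> sets borel" using null by (auto simp: null_sets_def)
  have "(\<lambda>Y. (X, Y)) \<in> borel_measurable borel" by (intro borel_measurable_continuous_onI continuous_intros)
  from measurable_compose[OF this quotient_measurable(2)] have [measurable]: "(\<lambda>Y. a X Y / c (u X Y)) \<in> borel_measurable borel" by simp
  have km[measurable]: "k \<in> borel_measurable borel" unfolding k_def by measurable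
  have k0: "0 \<le> k Y" for Y using nonneg_Y(1) c_pos by (auto simp: k_def less_imp_le)
  define M where "M = density lborel (\<lambda>Y. ennreal (k Y))"
  have "distr M borel (\<lambda>Y. t X Y) = lborel"
  proof (rule m.distr_eq_lborel)
    show "sets M = sets borel" by (simp add: M_def)
    fix Y1 Y2 :: real assume le: "Y1 \<le> Y2"
    obtain L where "L-lipschitz_on {Y1..Y2} (\<lambda>Y. t X Y)"
      using rect_lipschitz_lipschitz_X[OF rect_lipschitz_swap[OF reg(1)]] by metis
    moreover have N: "negligible NY" using null(2) by (simp add: negligible_iff_null_sets null_sets_completionI)
    ultimately have i: "(k has_integral (t X Y2 - t X Y1)) {Y1..Y2}"
      by (intro lipschitz_has_integral_deriv[OF le N]) (auto simp: k_def der_Y)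
    have "emeasure M {Y1<..Y2} = (\<integral>\<^sup>+Y. ennreal (k Y) * indicator {Y1<..Y2} Y \<partial>lborel)"
      unfolding M_def by (rule emeasure_density) auto
    also have "\<dots> = (\<integral>\<^sup>+Y. ennreal (indicator {Y1..Y2} Y * k Y) \<partial>lborel)"
      by (rule nn_integral_cong_AE) (use AE_lborel_singleton[of Y1] in \<open>eventually_elim, auto simp: indicator_def\<close>)
    also have "\<dots> = ennreal (t X Y2 - t X Y1)"
      using nn_integral_Icc_eq_integral[OF km _ k0, of Y1 Y2] i by (simp add: has_integral_iff)
    finally show "emeasure M {Y1<..Y2} = ennreal (t X Y2 - t X Y1)" .
  qed
  then have "emeasure lborel B = emeasure (distr M borel (\<lambda>Y. t X Y)) B" by simp
  also have "\<dots> = emeasure M ((\<lambda>Y. t X Y) -` B)"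
    by (subst emeasure_distr) (auto simp: M_def B m.measurable_self)
  also have "\<dots> = (\<integral>\<^sup>+Y. ennreal (k Y) * indicator B (t X Y) \<partial>lborel)"
  proof -
    have "(\<lambda>Y. t X Y) -` B \<in> sets borel" using measurable_sets[OF m.measurable_self B] by simp
    then show ?thesis unfolding M_def by (subst emeasure_density) (auto simp: indicator_def intro!: nn_integral_cong)
  qed
  finally show ?thesis by (simp add: k_def)
qed

lemma Ys_measurable_joint: "(\<lambda>p. Ys (fst p) (snd p)) \<in> borel_measurable borel"
proof (rule borel_measurableI_le)
  fix y
  have "closed {p. snd p \<le> t (fst p) y}"
    by (rule closed_Collect_le) (intro continuous_intros continuous_potentials_comp)+
  then show "{p \<in> space borel. Ys (fst p) (snd p) \<le> y} \<in> sets borel"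
    by (simp add: Ys_le_iff borel_closed)
qed

lemma dc_u_measurable: "(\<lambda>p. dc (u (fst p) (snd p))) \<in> borel_measurable borel"
  by (rule measurable_compose[OF u_measurable(1) dc_meas])

text \<open>\<open>degen_X\<close> concerns almost every \<open>Y\<close> for fixed
  \<open>X\<close>. By \<open>t_density_push\<close> this becomes almost every time for fixed
  \<open>X\<close>, where the condition \<open>a \<noteq> 0\<close> disappears because points with
  \<open>a = 0\<close> contribute no times; Fubini then exchanges the order of the
  quantifiers.\<close>

lemma degenerate_AE_X:
  "AE \<tau> in lborel. AE X in lborel. X \<notin> NX \<longrightarrow> \<alpha> X (Ys X \<tau>) = 0 \<longrightarrow> \<beta> X (Ys X \<tau>) \<noteq> 0 \<longrightarrow> dc (u X (Ys X \<tau>)) = 0"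
proof -
  let ?P = "\<lambda>X \<tau>. X \<notin> NX \<longrightarrow> \<alpha> X (Ys X \<tau>) = 0 \<longrightarrow> \<beta> X (Ys X \<tau>) \<noteq> 0 \<longrightarrow> dc (u X (Ys X \<tau>)) = 0"
  have [measurable]: "NX \<in> sets borel" using null by (auto simp: null_sets_def)
  have f[measurable]: "(\<lambda>p::real \<times> real. fst p) \<in> borel_measurable borel"
    by (intro borel_measurable_continuous_onI continuous_intros)
  have "(\<lambda>p. (fst p, Ys (fst p) (snd p))) \<in> borel_measurable borel"
    by (rule borel_measurable_Pair[OF f Ys_measurable_joint])
  from measurable_compose[OF this meas(1)] measurable_compose[OF this meas(2)] measurable_compose[OF this dc_u_measurable]
  have m[measurable]: "(\<lambda>p. \<alpha> (fst p) (Ys (fst p) (snd p))) \<in> borel_measurable borel"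
    "(\<lambda>p. \<beta> (fst p) (Ys (fst p) (snd p))) \<in> borel_measurable borel"
    "(\<lambda>p. dc (u (fst p) (Ys (fst p) (snd p)))) \<in> borel_measurable borel" by simp_all
  have S: "{p. ?P (fst p) (snd p)} \<in> sets borel" by measurable
  have sets: "sets (lborel \<Otimes>\<^sub>M lborel) = sets (borel :: (real \<times> real) measure)" unfolding lborel_prod by simp
  have sec: "{\<tau>. ?P X \<tau>} \<in> sets borel" for X
  proof -
    have "(\<lambda>\<tau>. (X, \<tau>)) \<in> measurable borel borel"
      by (intro borel_measurable_continuous_onI continuous_intros)
    from measurable_sets[OF this S] show ?thesis by (simp add: vimage_def)
  qed
  have "AE X in lborel. AE \<tau> in lborel. ?P X \<tau>"
  proof (rule AE_I2)
    fix X
    show "AE \<tau> in lborel. ?P X \<tau>"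
    proof (cases "X \<in> NX")
      case False
      define B where "B = - {\<tau>. ?P X \<tau>}"
      have B: "B \<in> sets borel" unfolding B_def using sec[of X] by (simp add: borel_comp)
      have "emeasure lborel B = (\<integral>\<^sup>+Y. ennreal (if Y \<in> NY then 0 else a X Y / c (u X Y)) * indicator B (t X Y) \<partial>lborel)"
        by (rule t_density_push[OF False B])
      also have "\<dots> = (\<integral>\<^sup>+Y. 0 \<partial>(lborel :: real measure))"
      proof (rule nn_integral_cong_AE)
        show "AE Y in lborel. ennreal (if Y \<in> NY then 0 else a X Y / c (u X Y)) * indicator B (t X Y) = 0"
          using degen_X[OF False] AE_notin_null(2)
        proof eventually_elim
          case (elim Y)
          show ?case
          proof (cases "a X Y > 0 \<and> t X Y \<in> B")
            case True
            then have apos: "a X Y / c (u X Y) > 0" using c_pos by simp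
            \<comment> \<open>As \<open>a > 0\<close>, \<open>t\<close> is strictly smaller just
              below \<open>Y\<close>. So \<open>Y\<close> is the lowest point of its level on this
              line, and the trace is taken at \<open>Y\<close> itself.\<close>
            have Y: "Ys X (t X Y) = Y"
            proof (rule ccontr)
              assume "Ys X (t X Y) \<noteq> Y"
              moreover have "Ys X (t X Y) \<le> Y" by (simp add: Ys_le_iff)
              ultimately have lt: "Ys X (t X Y) < Y" by simp
              obtain d where d: "d > 0" "\<And>h. 0 < h \<Longrightarrow> h < d \<Longrightarrow> t X (Y - h) < t X Y"
                using DERIV_pos_inc_left[OF der_Y(1)[OF elim(2)] apos] by blast
              have "t X (Y - min (d / 2) (Y - Ys X (t X Y))) < t X Y" using d lt by (intro d) (auto simp: min_def)
              moreover have "t X (Ys X (t X Y)) \<le> t X (Y - min (d / 2) (Y - Ys X (t X Y)))" by (rule mono_Y) simp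
              ultimately show False by (simp add: t_Ys)
            qed
            have "\<not> ?P X (t X Y)" using True by (simp add: B_def)
            then show ?thesis using elim(1) True Y by auto
          next
            case F: False
            then show ?thesis using nonneg_Y(1)[OF elim(2), of X] elim(2) by (auto simp: indicator_def not_less)
          qed
        qed
      qed
      finally have "emeasure lborel B = 0" by simp
      then show ?thesis using B by (intro AE_I[of _ _ B]) (auto simp: B_def)
    qed simp
  qed
  moreover have "{p \<in> space (lborel \<Otimes>\<^sub>M lborel). ?P (fst p) (snd p)} \<in> sets (lborel \<Otimes>\<^sub>M lborel)"
    using S unfolding sets by (simp add: space_pair_measure)
  ultimately show ?thesis using lborel_pair.AE_commute[of ?P] by simp
qed

lemma degenerate_AE_Y:
  "AE \<tau> in lborel. AE Y in lborel. Y \<notin> NY \<longrightarrow> a (Xs Y \<tau>) Y = 0 \<longrightarrow> b (Xs Y \<tau>) Y \<noteq> 0 \<longrightarrow> dc (u (Xs Y \<tau>) Y) = 0"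
  using wave_chart.degenerate_AE_X[OF swap] unfolding swap_Ys .

text \<open>Almost every crossing point with \<open>\<alpha> > 0\<close> belongs to
  \<open>G \<tau>\<close>, so off \<open>G \<tau>\<close> the part \<open>\<beta> dX\<close> lives
  where \<open>\<alpha> = 0\<close>. There either \<open>\<beta> = 0\<close> or
  \<open>degenerate_AE_X\<close> makes \<open>dc\<close> vanish. The part \<open>b (- dY)\<close> is
  treated symmetrically.\<close>

lemma singular_part_concentrated:
  "AE \<tau> in lborel. emeasure (muh \<tau>) (- G \<tau> \<inter> {s. dc (u (Xd \<tau> s) (Yd \<tau> s)) \<noteq> 0}) = 0"
  using degenerate_AE_X degenerate_AE_Y
proof eventually_elim
  case (elim \<tau>)
  define W where "W = - G \<tau> \<inter> {s. dc (u (Xd \<tau> s) (Yd \<tau> s)) \<noteq> 0}"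
  note [measurable] = on_curve_measurable[OF meas(1), of \<tau>] on_curve_measurable[OF meas(2), of \<tau>]
    on_curve_measurable[OF meas(3), of \<tau>] on_curve_measurable[OF meas(4), of \<tau>]
    on_curve_measurable[OF dc_u_measurable, of \<tau>] Ys_measurable[of \<tau>] Xs_measurable[of \<tau>]
  have G[measurable]: "G \<tau> \<in> sets borel" by (rule G_borel)
  have W[measurable]: "W \<in> sets borel" unfolding W_def by measurable
  have "AE s in MX \<tau>. 0 < \<alpha> (Xd \<tau> s) (Yd \<tau> s) \<longrightarrow> s \<in> G \<tau>"
    using AE_muX_alpha[of \<tau>] unfolding muX_def by (subst (asm) AE_density) (auto simp: MX_def)
  then have GX: "AE X in lborel. 0 < \<alpha> X (Ys X \<tau>) \<longrightarrow> X - Ys X \<tau> \<in> G \<tau>"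
    unfolding MX_def by (subst (asm) AE_distr_iff) (auto simp: Xd_section)
  have "AE s in MY \<tau>. 0 < a (Xd \<tau> s) (Yd \<tau> s) \<longrightarrow> s \<in> G \<tau>"
    using AE_muX_alpha[of \<tau>] unfolding muX_alpha_eq_muY_a muY_def by (subst (asm) AE_density) (auto simp: MY_def)
  then have GY: "AE Y in lborel. 0 < a (Xs Y \<tau>) Y \<longrightarrow> Xs Y \<tau> - Y \<in> G \<tau>"
    unfolding MY_def by (subst (asm) AE_distr_iff) (auto simp: Yd_section)
  have "emeasure (muX \<beta> \<tau>) W = (\<integral>\<^sup>+X. ennreal (\<beta> X (Ys X \<tau>)) * indicator W (X - Ys X \<tau>) \<partial>lborel)"
    unfolding muX_def by (subst emeasure_density) (auto simp: MX_def nn_integral_distr Xd_section)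
  also have "\<dots> = (\<integral>\<^sup>+X. 0 \<partial>(lborel :: real measure))"
  proof (rule nn_integral_cong_AE)
    show "AE X in lborel. ennreal (\<beta> X (Ys X \<tau>)) * indicator W (X - Ys X \<tau>) = 0"
      using elim(1) GX AE_notin_null(1)
    proof eventually_elim
      case (elim X)
      then show ?case using nonneg_X[OF elim(3), of "Ys X \<tau>"]
        by (cases "X - Ys X \<tau> \<in> W") (auto simp: W_def Xd_section)
    qed
  qed
  finally have 1: "emeasure (muX \<beta> \<tau>) W = 0" by simp
  have "emeasure (muY b \<tau>) W = (\<integral>\<^sup>+Y. ennreal (b (Xs Y \<tau>) Y) * indicator W (Xs Y \<tau> - Y) \<partial>lborel)"
    unfolding muY_def by (subst emeasure_density) (auto simp: MY_def nn_integral_distr Yd_section)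
  also have "\<dots> = (\<integral>\<^sup>+Y. 0 \<partial>(lborel :: real measure))"
  proof (rule nn_integral_cong_AE)
    show "AE Y in lborel. ennreal (b (Xs Y \<tau>) Y) * indicator W (Xs Y \<tau> - Y) = 0"
      using elim(2) GY AE_notin_null(2)
    proof eventually_elim
      case (elim Y)
      then show ?case using nonneg_Y[OF elim(3), of "Xs Y \<tau>"]
        by (cases "Xs Y \<tau> - Y \<in> W") (auto simp: W_def Yd_section)
    qed
  qed
  finally have 2: "emeasure (muY b \<tau>) W = 0" by simp
  show ?case using 1 2 emeasure_muh[OF W, of \<tau>] by (simp add: W_def)
qed

end

section \<open>Derivatives of the solution and the Lebesgue decomposition\<close>

context wave_solution
begin

text \<open>A limit along one fixed sequence is Borel in \<open>\<xi>\<close> by construction. By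
  \<open>AE_derivatives\<close> it is the true derivative at almost every position, at each time;
  elsewhere the value does not matter.\<close>

definition ut :: "real \<Rightarrow> real \<Rightarrow> real" where
  "ut \<tau> \<xi> = lim (\<lambda>n. (U (\<tau> + 1 / real (Suc n)) \<xi> - U \<tau> \<xi>) * real (Suc n))"
definition ux :: "real \<Rightarrow> real \<Rightarrow> real" where
  "ux \<tau> \<xi> = lim (\<lambda>n. (U \<tau> (\<xi> + 1 / real (Suc n)) - U \<tau> \<xi>) * real (Suc n))"
definition dens :: "real \<Rightarrow> real \<Rightarrow> real" where
  "dens \<tau> \<xi> = 1 / 2 * ((ut \<tau> \<xi>)\<^sup>2 + (c (U \<tau> \<xi>))\<^sup>2 * (ux \<tau> \<xi>)\<^sup>2)"

lemma U_measurable: "U \<tau> \<in> borel_measurable borel"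
  by (rule borel_measurable_continuous_onI[OF continuous_U])

lemma ut_measurable: "ut \<tau> \<in> borel_measurable borel" and ux_measurable: "ux \<tau> \<in> borel_measurable borel"
proof -
  note U_measurable[measurable]
  have [measurable]: "(\<lambda>\<xi>. U \<tau> (\<xi> + h)) \<in> borel_measurable borel" for h
    by (rule measurable_compose[OF _ U_measurable]) measurable
  show "ut \<tau> \<in> borel_measurable borel" unfolding ut_def by measurable
  show "ux \<tau> \<in> borel_measurable borel" unfolding ux_def by measurable
qed

lemma dens_measurable: "dens \<tau> \<in> borel_measurable borel"
proof -
  note U_measurable[measurable] ut_measurable[measurable] ux_measurable[measurable]
  have [measurable]: "(\<lambda>\<xi>. c (U \<tau> \<xi>)) \<in> borel_measurable borel"
    by (rule measurable_compose[OF U_measurable u_measurable(2)])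
  show ?thesis unfolding dens_def by measurable
qed

lemma dens_nonneg: "0 \<le> dens \<tau> \<xi>" by (simp add: dens_def)

text \<open>In terms of the Riemann variables the energy density is
  \<open>(R\<^sup>2 + S\<^sup>2) / 4\<close>, and \<open>sq_X\<close> and \<open>sq_Y\<close> give
  \<open>R\<^sup>2 = 2 * (\<beta> / \<alpha>)\<close> and
  \<open>S\<^sup>2 = 2 * (b / a)\<close>.\<close>

lemma regular_derivatives:
  assumes s: "s \<in> G \<tau>"
  shows "((\<lambda>\<tau>'. U \<tau>' (xh \<tau> s)) has_real_derivative ut \<tau> (xh \<tau> s)) (at \<tau>)"
    "(U \<tau> has_real_derivative ux \<tau> (xh \<tau> s)) (at (xh \<tau> s))"
    "dens \<tau> (xh \<tau> s) = (\<beta> (Xd \<tau> s) (Yd \<tau> s) / \<alpha> (Xd \<tau> s) (Yd \<tau> s) + b (Xd \<tau> s) (Yd \<tau> s) / a (Xd \<tau> s) (Yd \<tau> s)) / 2"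
proof -
  define X Y where "X = Xd \<tau> s" and "Y = Yd \<tau> s"
  have P: "X \<notin> NX" "Y \<notin> NY" "0 < \<alpha> X Y" "0 < a X Y" using s by (auto simp: G_def X_def Y_def)
  define R S C where "R = \<gamma> X Y / \<alpha> X Y" and "S = g X Y / a X Y" and "C = c (u X Y)"
  have tx: "t X Y = \<tau>" "x X Y = xh \<tau> s" by (simp_all add: X_def Y_def t_Xd xh_def)
  have d: "((\<lambda>\<tau>'. U \<tau>' (xh \<tau> s)) has_real_derivative (R + S) / 2) (at \<tau>)"
    "(U \<tau> has_real_derivative (R - S) / (2 * C)) (at (xh \<tau> s))"
    using U_derivatives[OF P] unfolding tx R_def S_def C_def by auto
  have t: "ut \<tau> (xh \<tau> s) = (R + S) / 2" unfolding ut_def by (rule limI, rule DERIV_imp_forward_quotients[OF d(1)])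
  have x: "ux \<tau> (xh \<tau> s) = (R - S) / (2 * C)" unfolding ux_def by (rule limI, rule DERIV_imp_forward_quotients[OF d(2)])
  show "((\<lambda>\<tau>'. U \<tau>' (xh \<tau> s)) has_real_derivative ut \<tau> (xh \<tau> s)) (at \<tau>)"
    "(U \<tau> has_real_derivative ux \<tau> (xh \<tau> s)) (at (xh \<tau> s))" unfolding t x by (rule d)+
  have C: "C > 0" "c (U \<tau> (xh \<tau> s)) = C" using c_pos U[of X Y] tx by (auto simp: C_def)
  have "dens \<tau> (xh \<tau> s) = (R\<^sup>2 + S\<^sup>2) / 4"
    unfolding dens_def t x C(2) using C(1) by (simp add: power2_eq_square field_simps)
  also have "R\<^sup>2 = 2 * (\<beta> X Y / \<alpha> X Y)" using P sq_X[OF P(1), of Y] by (simp add: R_def power_divide) (simp add: power2_eq_square)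
  also have "S\<^sup>2 = 2 * (b X Y / a X Y)" using P sq_Y[OF P(2), of X] by (simp add: S_def power_divide) (simp add: power2_eq_square)
  finally show "dens \<tau> (xh \<tau> s) = (\<beta> (Xd \<tau> s) (Yd \<tau> s) / \<alpha> (Xd \<tau> s) (Yd \<tau> s) + b (Xd \<tau> s) (Yd \<tau> s) / a (Xd \<tau> s) (Yd \<tau> s)) / 2"
    by (simp add: X_def Y_def)
qed

lemma AE_derivatives:
  "AE \<xi> in lborel. ((\<lambda>\<tau>'. U \<tau>' \<xi>) has_real_derivative ut \<tau> \<xi>) (at \<tau>) \<and> (U \<tau> has_real_derivative ux \<tau> \<xi>) (at \<xi>)"
  using AE_not_in[OF Z_null[of \<tau>]]
proof eventually_elim
  case (elim \<xi>)
  then have "sx \<tau> \<xi> \<in> G \<tau>" by (simp add: Z_def)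
  from regular_derivatives(1,2)[OF this] show ?case by (simp add: xh_sx)
qed

text \<open>On \<open>G \<tau>\<close> the whole energy has a density with respect to
  \<open>muX \<alpha> \<tau> = muY a \<tau>\<close>: \<open>\<beta> / \<alpha>\<close> from one
  family of characteristics and \<open>b / a\<close> from the other. Their sum is
  \<open>2 * dens\<close>, and \<open>lam\<close>, which is twice
  \<open>muX \<alpha> \<tau>\<close>, is carried to Lebesgue measure by \<open>xh\<close>.\<close>

lemma mu_regular_part:
  assumes B: "B \<in> sets borel"
  shows "emeasure (mu \<tau>) (B - Z \<tau>) = emeasure (density lborel (\<lambda>\<xi>. ennreal (dens \<tau> \<xi>))) B"
proof -
  note [measurable] = on_curve_measurable[OF meas(1), of \<tau>] on_curve_measurable[OF meas(2), of \<tau>]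
    on_curve_measurable[OF meas(3), of \<tau>] on_curve_measurable[OF meas(4), of \<tau>]
    dens_measurable[of \<tau>] xh_measurable[of \<tau>]
  have G[measurable]: "G \<tau> \<in> sets borel" by (rule G_borel)
  define B' where "B' = xh \<tau> -` B"
  have B'[measurable]: "B' \<in> sets borel" unfolding B'_def using measurable_sets[OF xh_measurable B] by simp
  have BG[measurable]: "B' \<inter> G \<tau> \<in> sets borel" by measurable
  let ?\<alpha> = "\<lambda>s. \<alpha> (Xd \<tau> s) (Yd \<tau> s)" and ?\<beta> = "\<lambda>s. \<beta> (Xd \<tau> s) (Yd \<tau> s)"
  let ?a = "\<lambda>s. a (Xd \<tau> s) (Yd \<tau> s)" and ?b = "\<lambda>s. b (Xd \<tau> s) (Yd \<tau> s)"
  have pos: "0 < ?\<alpha> s" "0 < ?a s" "0 \<le> ?\<beta> s" "0 \<le> ?b s" if "s \<in> G \<tau>" for s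
    using that nonneg_X(2) nonneg_Y(2) by (auto simp: G_def)
  have X: "emeasure (muX \<beta> \<tau>) (B' \<inter> G \<tau>) = (\<integral>\<^sup>+s. ennreal (?\<beta> s / ?\<alpha> s) * indicator (B' \<inter> G \<tau>) s \<partial>muX \<alpha> \<tau>)"
  proof -
    have "emeasure (muX \<beta> \<tau>) (B' \<inter> G \<tau>) = (\<integral>\<^sup>+s. ennreal (?\<beta> s) * indicator (B' \<inter> G \<tau>) s \<partial>MX \<tau>)"
      unfolding muX_def by (rule emeasure_density) (auto simp: MX_def)
    also have "\<dots> = (\<integral>\<^sup>+s. ennreal (?\<alpha> s) * (ennreal (?\<beta> s / ?\<alpha> s) * indicator (B' \<inter> G \<tau>) s) \<partial>MX \<tau>)"
    proof (rule nn_integral_cong)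
      fix s
      show "ennreal (?\<beta> s) * indicator (B' \<inter> G \<tau>) s = ennreal (?\<alpha> s) * (ennreal (?\<beta> s / ?\<alpha> s) * indicator (B' \<inter> G \<tau>) s)"
        using pos[of s] by (cases "s \<in> G \<tau>") (auto simp: indicator_def ennreal_mult[symmetric])
    qed
    also have "\<dots> = (\<integral>\<^sup>+s. ennreal (?\<beta> s / ?\<alpha> s) * indicator (B' \<inter> G \<tau>) s \<partial>muX \<alpha> \<tau>)"
      unfolding muX_def by (rule nn_integral_density[symmetric]) (auto simp: MX_def)
    finally show ?thesis .
  qed
  have Y: "emeasure (muY b \<tau>) (B' \<inter> G \<tau>) = (\<integral>\<^sup>+s. ennreal (?b s / ?a s) * indicator (B' \<inter> G \<tau>) s \<partial>muX \<alpha> \<tau>)"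
  proof -
    have "emeasure (muY b \<tau>) (B' \<inter> G \<tau>) = (\<integral>\<^sup>+s. ennreal (?b s) * indicator (B' \<inter> G \<tau>) s \<partial>MY \<tau>)"
      unfolding muY_def by (rule emeasure_density) (auto simp: MY_def)
    also have "\<dots> = (\<integral>\<^sup>+s. ennreal (?a s) * (ennreal (?b s / ?a s) * indicator (B' \<inter> G \<tau>) s) \<partial>MY \<tau>)"
    proof (rule nn_integral_cong)
      fix s
      show "ennreal (?b s) * indicator (B' \<inter> G \<tau>) s = ennreal (?a s) * (ennreal (?b s / ?a s) * indicator (B' \<inter> G \<tau>) s)"
        using pos[of s] by (cases "s \<in> G \<tau>") (auto simp: indicator_def ennreal_mult[symmetric])
    qed
    also have "\<dots> = (\<integral>\<^sup>+s. ennreal (?b s / ?a s) * indicator (B' \<inter> G \<tau>) s \<partial>muY a \<tau>)"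
      unfolding muY_def by (rule nn_integral_density[symmetric]) (auto simp: MY_def)
    finally show ?thesis by (simp only: muX_alpha_eq_muY_a)
  qed
  have lam: "lam \<tau> = density (muX \<alpha> \<tau>) (\<lambda>_. 2)"
  proof (rule measure_eqI)
    fix A assume "A \<in> sets (lam \<tau>)"
    then show "emeasure (lam \<tau>) A = emeasure (density (muX \<alpha> \<tau>) (\<lambda>_. 2)) A"
      by (simp add: emeasure_lam(1) emeasure_density_const)
  qed simp
  have [measurable_cong]: "sets (muX \<alpha> \<tau>) = sets borel" by simp
  have "xh \<tau> -` (B - Z \<tau>) = B' \<inter> G \<tau>" using vimage_Z[of \<tau>] by (auto simp: B'_def)
  then have "emeasure (mu \<tau>) (B - Z \<tau>) = emeasure (muX \<beta> \<tau>) (B' \<inter> G \<tau>) + emeasure (muY b \<tau>) (B' \<inter> G \<tau>)"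
    using B Z_borel by (simp add: emeasure_mu emeasure_muh)
  also have "\<dots> = (\<integral>\<^sup>+s. ennreal (?\<beta> s / ?\<alpha> s) * indicator (B' \<inter> G \<tau>) s + ennreal (?b s / ?a s) * indicator (B' \<inter> G \<tau>) s \<partial>muX \<alpha> \<tau>)"
    unfolding X Y by (rule nn_integral_add[symmetric]) measurable
  also have "\<dots> = (\<integral>\<^sup>+s. 2 * (ennreal (dens \<tau> (xh \<tau> s)) * indicator B (xh \<tau> s)) \<partial>muX \<alpha> \<tau>)"
  proof (rule nn_integral_cong_AE)
    show "AE s in muX \<alpha> \<tau>. ennreal (?\<beta> s / ?\<alpha> s) * indicator (B' \<inter> G \<tau>) s + ennreal (?b s / ?a s) * indicator (B' \<inter> G \<tau>) s =
      2 * (ennreal (dens \<tau> (xh \<tau> s)) * indicator B (xh \<tau> s))"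
      using AE_muX_alpha[of \<tau>]
    proof eventually_elim
      case (elim s)
      have "ennreal (?\<beta> s / ?\<alpha> s) + ennreal (?b s / ?a s) = ennreal (?\<beta> s / ?\<alpha> s + ?b s / ?a s)"
        using pos[OF elim] by (intro ennreal_plus[symmetric]) auto
      also have "?\<beta> s / ?\<alpha> s + ?b s / ?a s = 2 * dens \<tau> (xh \<tau> s)"
      proof -
        have "v = 2 * (v / 2)" for v :: real by simp
        then show ?thesis unfolding regular_derivatives(3)[OF elim] .
      qed
      also have "ennreal \<dots> = 2 * ennreal (dens \<tau> (xh \<tau> s))" using ennreal_mult'[of 2 "dens \<tau> (xh \<tau> s)"] by simp
      finally have "ennreal (?\<beta> s / ?\<alpha> s) + ennreal (?b s / ?a s) = 2 * ennreal (dens \<tau> (xh \<tau> s))" .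
      then show ?case using elim by (cases "xh \<tau> s \<in> B") (simp_all add: B'_def)
    qed
  qed
  also have "\<dots> = (\<integral>\<^sup>+s. ennreal (dens \<tau> (xh \<tau> s)) * indicator B (xh \<tau> s) \<partial>lam \<tau>)"
    unfolding lam using B by (subst nn_integral_density) auto
  also have "\<dots> = (\<integral>\<^sup>+\<xi>. ennreal (dens \<tau> \<xi>) * indicator B \<xi> \<partial>distr (lam \<tau>) borel (xh \<tau>))"
  proof (rule nn_integral_distr[symmetric])
    show "xh \<tau> \<in> measurable (lam \<tau>) borel"
      by (subst measurable_cong_sets[OF sets_lam refl]) (rule xh_measurable)
  qed (use B in measurable)
  also have "\<dots> = emeasure (density lborel (\<lambda>\<xi>. ennreal (dens \<tau> \<xi>))) B"
    using B by (subst emeasure_density) (auto simp: distr_lam)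
  finally show ?thesis .
qed

lemma dens_integrable: "integrable lborel (dens \<tau>)"
proof (rule integrableI_nonneg)
  have "(\<integral>\<^sup>+\<xi>. ennreal (dens \<tau> \<xi>) \<partial>lborel) = emeasure (density lborel (\<lambda>\<xi>. ennreal (dens \<tau> \<xi>))) UNIV"
    using dens_measurable by (subst emeasure_density) auto
  also have "\<dots> = emeasure (mu \<tau>) (UNIV - Z \<tau>)" by (rule mu_regular_part[symmetric]) simp
  also have "\<dots> \<le> emeasure (mu \<tau>) UNIV" by (rule emeasure_mono) auto
  also have "\<dots> < \<infinity>" by (simp add: emeasure_mu_UNIV)
  finally show "(\<integral>\<^sup>+\<xi>. ennreal (dens \<tau> \<xi>) \<partial>lborel) < \<infinity>" .
qed (use dens_measurable dens_nonneg in auto)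

lemma square_integrable_derivatives:
  "integrable lborel (\<lambda>\<xi>. (ut \<tau> \<xi>)\<^sup>2)" "integrable lborel (\<lambda>\<xi>. (ux \<tau> \<xi>)\<^sup>2)"
proof -
  have i: "integrable lborel (\<lambda>\<xi>. 2 * dens \<tau> \<xi>)" "integrable lborel (\<lambda>\<xi>. 2 * \<kappa>\<^sup>2 * dens \<tau> \<xi>)"
    by (intro integrable_mult_right dens_integrable)+
  show "integrable lborel (\<lambda>\<xi>. (ut \<tau> \<xi>)\<^sup>2)"
    by (rule Bochner_Integration.integrable_bound[OF i(1)]) (use ut_measurable in \<open>auto simp: dens_def\<close>)
  show "integrable lborel (\<lambda>\<xi>. (ux \<tau> \<xi>)\<^sup>2)"
  proof (rule Bochner_Integration.integrable_bound[OF i(2)])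
    show "AE \<xi> in lborel. norm ((ux \<tau> \<xi>)\<^sup>2) \<le> norm (2 * \<kappa>\<^sup>2 * dens \<tau> \<xi>)"
    proof (rule AE_I2)
      fix \<xi>
      have "1 \<le> \<kappa> * c (U \<tau> \<xi>)" using c_bounds(1)[of "U \<tau> \<xi>"] kappa by (simp add: field_simps)
      then have "1 \<le> (\<kappa> * c (U \<tau> \<xi>))\<^sup>2" by simp
      from mult_right_mono[OF this, of "(ux \<tau> \<xi>)\<^sup>2"]
      have "(ux \<tau> \<xi>)\<^sup>2 \<le> \<kappa>\<^sup>2 * ((c (U \<tau> \<xi>))\<^sup>2 * (ux \<tau> \<xi>)\<^sup>2)" by (simp add: power_mult_distrib mult_ac)
      also have "\<dots> \<le> \<kappa>\<^sup>2 * (2 * dens \<tau> \<xi>)" by (intro mult_left_mono) (simp_all add: dens_def)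
      finally show "norm ((ux \<tau> \<xi>)\<^sup>2) \<le> norm (2 * \<kappa>\<^sup>2 * dens \<tau> \<xi>)" using dens_nonneg[of \<tau> \<xi>] by (simp add: mult_ac)
    qed
  qed (use ux_measurable in auto)
qed

text \<open>At every time the quotients converge at almost every position by
  \<open>AE_derivatives\<close>, and \<open>U_time_L2\<close> bounds their square integrals
  uniformly in the time step.\<close>

lemma U_has_Lp_loc_derivative:
  assumes p: "1 \<le> p" "p < 2"
  shows "has_Lp_loc_derivative p U \<tau> (ut \<tau>)"
  unfolding has_Lp_loc_derivative_def
proof (intro conjI allI impI)
  show "Lp_loc p (U s)" for s by (rule Lp_loc_continuous[OF continuous_U]) (use p in simp)
  show "Lp_loc p (ut \<tau>)" by (rule Lp_loc_of_square_integrable[OF ut_measurable square_integrable_derivatives(1)]) (use p in auto)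
  fix K :: "real set" assume K: "compact K"
  show "((\<lambda>h. LINT x:K|lebesgue. (\<bar>(U (\<tau> + h) x - U \<tau> x) / h - ut \<tau> x\<bar> powr p)) \<longlongrightarrow> 0) (at 0)"
  \<comment> \<open>The limit at 0 is tested on arbitrary null sequences, since the convergence
    theorem is a statement about sequences.\<close>
  proof (subst LIMSEQ_SEQ_conv[symmetric], intro allI impI, elim conjE)
    fix S :: "nat \<Rightarrow> real" assume S: "\<forall>n. S n \<noteq> 0" "S \<longlonglongrightarrow> 0"
    define q where "q = (\<lambda>n x. (U (\<tau> + S n) x - U \<tau> x) / S n)"
    have qc: "continuous_on UNIV (q n)" for n
      unfolding q_def using S(1) by (intro continuous_intros continuous_U) auto
    have ae: "AE x in lborel. (\<lambda>n. q n x) \<longlonglongrightarrow> ut \<tau> x"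
      using AE_derivatives[of \<tau>]
    proof eventually_elim
      case (elim x)
      have "filterlim S (at 0) sequentially" unfolding filterlim_at using S by auto
      from filterlim_compose[OF elim[THEN conjunct1, unfolded DERIV_def] this]
      show ?case by (simp add: q_def)
    qed
    have bd: "integral {A..B} (\<lambda>x. (q n x)\<^sup>2) \<le> 12 * \<kappa>^4 * (ep - em)" if "A \<le> B" for n A B
    proof -
      have "integral {A..B} (\<lambda>x. (q n x)\<^sup>2) = integral {A..B} (\<lambda>x. (1 / (S n)\<^sup>2) * (U (\<tau> + S n) x - U \<tau> x)\<^sup>2)"
        by (simp add: q_def power_divide)
      also have "\<dots> = (1 / (S n)\<^sup>2) * integral {A..B} (\<lambda>x. (U (\<tau> + S n) x - U \<tau> x)\<^sup>2)" by (rule integral_mult_right)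
      also have "\<dots> \<le> (1 / (S n)\<^sup>2) * (12 * \<kappa>^4 * (ep - em) * (\<tau> + S n - \<tau>)\<^sup>2)"
        by (intro mult_left_mono U_time_L2 that) simp
      also have "\<dots> = 12 * \<kappa>^4 * (ep - em)" using S(1) by simp
      finally show ?thesis .
    qed
    show "(\<lambda>n. LINT x:K|lebesgue. (\<bar>(U (\<tau> + S n) x - U \<tau> x) / S n - ut \<tau> x\<bar> powr p)) \<longlonglongrightarrow> 0"
      using Lp_loc_limit_of_quotients[OF qc ut_measurable square_integrable_derivatives(1) K ae bd p] by (simp add: q_def)
  qed
qed

lemma U_has_weak_derivative: "has_weak_derivative (U \<tau>) (ux \<tau>)"
proof (rule has_weak_derivativeI[OF continuous_U ux_measurable square_integrable_derivatives(2)])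
  show "AE x in lborel. (\<lambda>n. (U \<tau> (x + 1 / real (Suc n)) - U \<tau> x) * real (Suc n)) \<longlonglongrightarrow> ux \<tau> x"
    using AE_derivatives[of \<tau>] by eventually_elim (rule DERIV_imp_forward_quotients, simp)
  fix n :: nat and A B :: real assume AB: "A \<le> B"
  have "integral {A..B} (\<lambda>x. ((U \<tau> (x + 1 / real (Suc n)) - U \<tau> x) * real (Suc n))\<^sup>2) =
      integral {A..B} (\<lambda>x. (real (Suc n))\<^sup>2 * (U \<tau> (x + 1 / real (Suc n)) - U \<tau> x)\<^sup>2)"
    by (simp only: power_mult_distrib mult.commute)
  also have "\<dots> = (real (Suc n))\<^sup>2 * integral {A..B} (\<lambda>x. (U \<tau> (x + 1 / real (Suc n)) - U \<tau> x)\<^sup>2)" by (rule integral_mult_right)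
  also have "\<dots> \<le> (real (Suc n))\<^sup>2 * (2 * \<kappa>\<^sup>2 * (ep - em) * (1 / real (Suc n))\<^sup>2)"
    by (intro mult_left_mono U_space_L2 AB) simp
  also have "\<dots> = 2 * \<kappa>\<^sup>2 * (ep - em)" by (simp add: power_divide del: of_nat_Suc)
  finally show "integral {A..B} (\<lambda>x. ((U \<tau> (x + 1 / real (Suc n)) - U \<tau> x) * real (Suc n))\<^sup>2) \<le> 2 * \<kappa>\<^sup>2 * (ep - em)" .
qed

definition mus :: "real \<Rightarrow> real measure" where "mus \<tau> = density (mu \<tau>) (indicator (Z \<tau>))"

lemma emeasure_mus: "B \<in> sets borel \<Longrightarrow> emeasure (mus \<tau>) B = emeasure (mu \<tau>) (B \<inter> Z \<tau>)"
proof -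
  assume B: "B \<in> sets borel"
  have "emeasure (mus \<tau>) B = (\<integral>\<^sup>+x. indicator (Z \<tau>) x * indicator B x \<partial>mu \<tau>)"
    unfolding mus_def using Z_borel[of \<tau>] B by (intro emeasure_density borel_measurable_indicator) simp_all
  also have "\<dots> = (\<integral>\<^sup>+x. indicator (B \<inter> Z \<tau>) x \<partial>mu \<tau>)"
    by (intro nn_integral_cong) (auto simp: indicator_def)
  finally show ?thesis using Z_borel[of \<tau>] B by simp
qed

lemma lebesgue_decomposition_mu:
  "lebesgue_decomposition (mu \<tau>) (density lborel (\<lambda>\<xi>. ennreal (dens \<tau> \<xi>))) (mus \<tau>)"
  unfolding lebesgue_decomposition_def
proof (intro conjI ballI)
  fix B :: "real set" assume B: "B \<in> sets borel"
  have "emeasure (mu \<tau>) ((B - Z \<tau>) \<union> (B \<inter> Z \<tau>)) = emeasure (mu \<tau>) (B - Z \<tau>) + emeasure (mu \<tau>) (B \<inter> Z \<tau>)"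
    using B Z_borel[of \<tau>] by (intro plus_emeasure[symmetric]) auto
  moreover have "(B - Z \<tau>) \<union> (B \<inter> Z \<tau>) = B" by auto
  ultimately show "emeasure (mu \<tau>) B = emeasure (density lborel (\<lambda>\<xi>. ennreal (dens \<tau> \<xi>))) B + emeasure (mus \<tau>) B"
    by (simp add: mu_regular_part[OF B] emeasure_mus[OF B])
next
  show "absolutely_continuous lborel (density lborel (\<lambda>\<xi>. ennreal (dens \<tau> \<xi>)))"
    using dens_measurable by (intro absolutely_continuousI_density) auto
  have "(UNIV - Z \<tau>) \<inter> Z \<tau> = {}" by auto
  then show "\<exists>N\<in>null_sets lborel. emeasure (mus \<tau>) (UNIV - N) = 0"
    using Z_null Z_borel[of \<tau>] by (intro bexI[of _ "Z \<tau>"]) (simp_all add: emeasure_mus)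
qed (simp_all add: mus_def)

lemma radon_measure_mu: "radon_measure (mu \<tau>)"
  unfolding radon_measure_def
proof (intro conjI allI impI ballI)
  have fin: "emeasure (mu \<tau>) (space (mu \<tau>)) \<noteq> \<infinity>" by (simp add: emeasure_mu_UNIV)
  fix K :: "real set"
  have "emeasure (mu \<tau>) K \<le> emeasure (mu \<tau>) UNIV" by (rule emeasure_mono) auto
  then show "emeasure (mu \<tau>) K < \<infinity>" using emeasure_mu_UNIV[of \<tau>] by (simp add: le_less_trans)
  fix B :: "real set" assume B: "B \<in> sets borel"
  show "emeasure (mu \<tau>) B = (SUP K\<in>{K. compact K \<and> K \<subseteq> B}. emeasure (mu \<tau>) K)"
    using inner_regular[OF sets_mu_time(1) fin B] by (simp add: conj_commute)
qed simp

lemma vaguely_continuous_mu: "vaguely_continuous mu"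
  unfolding vaguely_continuous_def
proof (intro allI impI, elim conjE)
  fix f :: "real \<Rightarrow> real" assume f: "continuous_on UNIV f" and cs: "compactly_supported f"
  have K: "compact (closure {x. f x \<noteq> 0})" using cs by (simp add: compactly_supported_def)
  obtain M where M: "closure {x. f x \<noteq> 0} \<subseteq> {-M..M}" using compact_subset_interval[OF K] by blast
  obtain B where B: "\<forall>x\<in>{-M..M}. \<bar>f x\<bar> \<le> B" using continuous_bounded_Icc[OF f] by blast
  have "\<bar>f v\<bar> \<le> max B 0" for v
  proof (cases "f v = 0")
    case False
    then have "v \<in> {-M..M}" using M closure_subset[of "{x. f x \<noteq> 0}"] by auto
    then show ?thesis using B by force
  qed simp
  then show "continuous_on UNIV (\<lambda>t. LINT x|mu t. f x)" by (rule mu_vaguely_continuous[OF f])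
qed

lemma AE_mus: "AE \<tau> in lebesgue. AE \<xi> in mus \<tau>. dc (U \<tau> \<xi>) = 0"
proof (rule AE_completion)
  show "AE \<tau> in lborel. AE \<xi> in mus \<tau>. dc (U \<tau> \<xi>) = 0"
    using singular_part_concentrated
  proof eventually_elim
    case (elim \<tau>)
    have [measurable]: "(\<lambda>\<xi>. dc (U \<tau> \<xi>)) \<in> borel_measurable borel"
      by (rule measurable_compose[OF U_measurable dc_meas])
    define W where "W = {\<xi>. dc (U \<tau> \<xi>) \<noteq> 0}"
    have W: "W \<in> sets borel" unfolding W_def by measurable
    have uU: "U \<tau> (xh \<tau> s) = u (Xd \<tau> s) (Yd \<tau> s)" for s using U[of "Xd \<tau> s" "Yd \<tau> s"] by (simp add: t_Xd xh_def)
    have "xh \<tau> -` (W \<inter> Z \<tau>) = - G \<tau> \<inter> {s. dc (u (Xd \<tau> s) (Yd \<tau> s)) \<noteq> 0}"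
      using vimage_Z[of \<tau>] by (auto simp: W_def uU)
    then have "emeasure (mus \<tau>) W = 0"
      using elim W Z_borel[of \<tau>] by (simp add: emeasure_mus emeasure_mu)
    then show ?case using W by (intro AE_I[of _ _ W]) (auto simp: W_def mus_def)
  qed
qed

end

section \<open>The semilinear system\<close>

text \<open>A difference of oriented integrals from a common base point \<open>r\<close> is an
  integral over \<open>{a..b}\<close>, so the base point on the initial curve drops out of the
  equations.\<close>

lemma has_integral_interval_lebesgue_integral:
  fixes f :: "real \<Rightarrow> real"
  assumes f: "\<And>a b. set_integrable lebesgue {a..b} f" and le: "a \<le> b"
  shows "(f has_integral ((LINT s=ereal r..ereal b|lebesgue. f s) - (LINT s=ereal r..ereal a|lebesgue. f s))) {a..b}"
proof -
  have i: "f integrable_on {a..b}" for a b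
    using set_lebesgue_integral_eq_integral(1)[OF f] .
  have eq: "(LINT s=ereal r..ereal y|lebesgue. f s) = (if r \<le> y then integral {r..y} f else - integral {y..r} f)" for y
  proof -
    have "(LINT x:{p<..<q}|lebesgue. f x) = integral {p..q} f" for p q
    proof -
      have "set_integrable lebesgue {p<..<q} f"
        by (rule set_integrable_subset[OF f[of p q]]) auto
      from set_lebesgue_integral_eq_integral(2)[OF this] show ?thesis
        by (simp add: integral_open_interval_real)
    qed
    then show ?thesis by (simp add: interval_lebesgue_integral_def)
  qed
  have c: "integral {p..q} f + integral {q..s} f = integral {p..s} f" if "p \<le> q" "q \<le> s" for p q s
    by (rule Henstock_Kurzweil_Integration.integral_combine[OF that i])
  have "(LINT s=ereal r..ereal b|lebesgue. f s) - (LINT s=ereal r..ereal a|lebesgue. f s) = integral {a..b} f"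
    using c[of r a b] c[of a r b] c[of a b r] le by (auto simp: eq)
  then show ?thesis using integrable_integral[OF i[of a b]] by simp
qed

text \<open>The data are prescribed for almost every curve parameter \<open>y\<close>, but they are
  needed at almost every \<open>X = F y\<close>. The image of \<open>f dy\<close> under
  \<open>F\<close> is Lebesgue measure, so \<open>F\<close> maps null sets to null sets.\<close>

lemma AE_transport:
  fixes F f :: "real \<Rightarrow> real"
  assumes F: "onto_mono F" and inj: "inj F" and f: "\<And>a b. a \<le> b \<Longrightarrow> (f has_integral (F b - F a)) {a..b}"
    and fm: "f \<in> borel_measurable lebesgue" and nn: "\<And>y. 0 \<le> f y"
    and ae: "AE y in lebesgue. P (F y)"
  shows "AE X in lborel. P X"
proof -
  interpret onto_mono F by (rule F)
  obtain f' where f': "f' \<in> borel_measurable lborel" "AE x in lborel. f x = f' x"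
    using completion_ex_borel_measurable_real[OF fm] by blast
  define k where "k y = max 0 (f' y)" for y
  have km: "k \<in> borel_measurable borel" unfolding k_def using f'(1) by measurable
  have "AE x in lborel. f x = k x" using f'(2) by eventually_elim (metis k_def max.absorb2 nn)
  then obtain N0 where N0: "N0 \<in> null_sets lborel" "{x. f x \<noteq> k x} \<subseteq> N0"
    unfolding eventually_ae_filter by auto
  have neg: "negligible N0" using N0(1) by (simp add: negligible_iff_null_sets null_sets_completionI)
  have k: "(k has_integral (F b - F a)) {a..b}" if "a \<le> b" for a b
  proof (rule has_integral_spike[OF neg _ f[OF that]])
    fix y assume "y \<in> {a..b} - N0"
    then show "k y = f y" using N0(2) by force
  qed
  define M where "M = density lborel (\<lambda>y. ennreal (k y))"
  have d: "distr M borel F = lborel"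
  proof (rule distr_eq_lborel)
    show "sets M = sets borel" by (simp add: M_def)
    fix a b :: real assume ab: "a \<le> b"
    have "emeasure M {a<..b} = (\<integral>\<^sup>+y. ennreal (k y) * indicator {a<..b} y \<partial>lborel)"
      unfolding M_def using km by (intro emeasure_density) auto
    also have "\<dots> = (\<integral>\<^sup>+y. ennreal (indicator {a..b} y * k y) \<partial>lborel)"
      by (rule nn_integral_cong_AE) (use AE_lborel_singleton[of a] in \<open>eventually_elim, auto simp: indicator_def\<close>)
    also have "\<dots> = ennreal (F b - F a)"
      using nn_integral_Icc_eq_integral[OF km, of a b] k[OF ab] by (simp add: has_integral_iff k_def)
    finally show "emeasure M {a<..b} = ennreal (F b - F a)" .
  qed
  have "AE y in lborel. P (F y)" using ae by (simp only: AE_completion_iff)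
  then obtain N where N: "N \<in> null_sets lborel" "{y. \<not> P (F y)} \<subseteq> N"
    unfolding eventually_ae_filter by auto
  have Nb: "N \<in> sets borel" using N(1) by auto
  define W where "W = ginv F -` N"
  have W: "W \<in> sets borel" unfolding W_def using measurable_sets[OF ginv_measurable Nb] by simp
  \<comment> \<open>Injectivity makes \<open>ginv F\<close> a left inverse, so the preimage of
    \<open>W\<close> under \<open>F\<close> is exactly \<open>N\<close>.\<close>
  have inv: "ginv F (F y) = y" for y using ginv_eq[of "F y"] inj by (simp add: inj_eq)
  have FW: "F -` W = N" by (auto simp: W_def inv)
  have "AE y in lborel. y \<notin> N" using N(1) by (rule AE_not_in)
  then have "(\<integral>\<^sup>+y. ennreal (k y) * indicator N y \<partial>lborel) = (\<integral>\<^sup>+y. 0 \<partial>(lborel :: real measure))"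
    by (intro nn_integral_cong_AE) (auto elim!: eventually_mono)
  then have "emeasure M N = 0"
    unfolding M_def using km Nb by (subst emeasure_density) auto
  moreover have "emeasure lborel W = emeasure M N"
  proof -
    have "emeasure (distr M borel F) W = emeasure M (F -` W \<inter> space M)"
      using W measurable_self by (intro emeasure_distr) (auto simp: M_def)
    moreover have "space M = UNIV" by (simp add: M_def)
    ultimately show ?thesis unfolding d FW by simp
  qed
  ultimately have "W \<in> null_sets lborel" using W by (simp add: null_sets_def)
  moreover have "P X" if "X \<notin> W" for X
  proof -
    have "ginv F X \<notin> N" using that by (simp add: W_def)
    then have "P (F (ginv F X))" using N(2) by auto
    then show ?thesis by (simp add: ginv_eq)
  qed
  ultimately show ?thesis by (intro AE_I'[of W]) auto
qed

lemma borel_measurable_completion_AE: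
  fixes f g :: "'a \<Rightarrow> real"
  assumes f: "f \<in> borel_measurable M" and ae: "AE x in M. f x = g x"
  shows "g \<in> borel_measurable (completion M)"
proof (rule measurableI)
  fix B :: "real set" assume B: "B \<in> sets borel"
  show "g -` B \<inter> space (completion M) \<in> sets (completion M)"
  proof (rule completion.in_sets_AE)
    show "f -` B \<inter> space (completion M) \<in> sets (completion M)"
      using measurable_sets[OF measurable_completion[OF f] B] .
    show "AE x in completion M. (x \<in> f -` B \<inter> space (completion M)) = (x \<in> g -` B \<inter> space (completion M))"
      using AE_completion[OF ae] by eventually_elim auto
  qed simp
qed simp

section \<open>Locally bounded measurable coefficients\<close>

definition lbm :: "(real \<Rightarrow> real \<Rightarrow> real) \<Rightarrow> bool" where
  "lbm f \<longleftrightarrow> (\<lambda>p. f (fst p) (snd p)) \<in> borel_measurable lebesgue \<and>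
     (\<forall>M. \<exists>B. \<forall>X Y. \<bar>X\<bar> \<le> M \<longrightarrow> \<bar>Y\<bar> \<le> M \<longrightarrow> \<bar>f X Y\<bar> \<le> B)"

lemma lbmD:
  assumes "lbm f" obtains B where "B \<ge> 0" "\<And>X Y. \<bar>X\<bar> \<le> M \<Longrightarrow> \<bar>Y\<bar> \<le> M \<Longrightarrow> \<bar>f X Y\<bar> \<le> B"
proof -
  obtain B where "\<And>X Y. \<bar>X\<bar> \<le> M \<Longrightarrow> \<bar>Y\<bar> \<le> M \<Longrightarrow> \<bar>f X Y\<bar> \<le> B" using assms unfolding lbm_def by blast
  then show thesis using that[of "max B 0"] by (meson le_max_iff_disj max.cobounded2)
qed

lemma locally_bounded_measurable_imp_lbm:
  assumes "locally_bounded_measurable f" shows "lbm f"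
  unfolding lbm_def
proof (intro conjI allI)
  show "(\<lambda>p. f (fst p) (snd p)) \<in> borel_measurable lebesgue"
    using assms by (simp add: locally_bounded_measurable_def case_prod_beta')
  fix M :: real
  have "compact ({-M..M} \<times> {-M..M})" by (intro compact_Times compact_Icc)
  then have "bounded ((\<lambda>(X, Y). f X Y) ` ({-M..M} \<times> {-M..M}))"
    using assms by (auto simp: locally_bounded_measurable_def)
  then obtain B where "\<forall>X\<in>{-M..M}. \<forall>Y\<in>{-M..M}. \<bar>f X Y\<bar> \<le> B"
    unfolding bounded_iff by auto
  then show "\<exists>B. \<forall>X Y. \<bar>X\<bar> \<le> M \<longrightarrow> \<bar>Y\<bar> \<le> M \<longrightarrow> \<bar>f X Y\<bar> \<le> B"
    by (intro exI[of _ B]) (simp add: abs_le_iff)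
qed

lemma lbm_add: assumes "lbm f" "lbm g" shows "lbm (\<lambda>X Y. f X Y + g X Y)"
  unfolding lbm_def
proof (intro conjI allI)
  show "(\<lambda>p. f (fst p) (snd p) + g (fst p) (snd p)) \<in> borel_measurable lebesgue"
    using assms by (intro borel_measurable_add) (auto simp: lbm_def)
  fix M
  obtain B where B: "\<And>X Y. \<bar>X\<bar> \<le> M \<Longrightarrow> \<bar>Y\<bar> \<le> M \<Longrightarrow> \<bar>f X Y\<bar> \<le> B" using lbmD[OF assms(1)] by metis
  obtain C where C: "\<And>X Y. \<bar>X\<bar> \<le> M \<Longrightarrow> \<bar>Y\<bar> \<le> M \<Longrightarrow> \<bar>g X Y\<bar> \<le> C" using lbmD[OF assms(2)] by metis
  show "\<exists>B. \<forall>X Y. \<bar>X\<bar> \<le> M \<longrightarrow> \<bar>Y\<bar> \<le> M \<longrightarrow> \<bar>f X Y + g X Y\<bar> \<le> B"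
    by (intro exI[of _ "B + C"] allI impI order_trans[OF abs_triangle_ineq] add_mono B C)
qed

lemma lbm_mult: assumes "lbm f" "lbm g" shows "lbm (\<lambda>X Y. f X Y * g X Y)"
  unfolding lbm_def
proof (intro conjI allI)
  show "(\<lambda>p. f (fst p) (snd p) * g (fst p) (snd p)) \<in> borel_measurable lebesgue"
    using assms by (intro borel_measurable_times) (auto simp: lbm_def)
  fix M
  obtain B where B: "B \<ge> 0" "\<And>X Y. \<bar>X\<bar> \<le> M \<Longrightarrow> \<bar>Y\<bar> \<le> M \<Longrightarrow> \<bar>f X Y\<bar> \<le> B" using lbmD[OF assms(1)] by metis
  obtain C where C: "C \<ge> 0" "\<And>X Y. \<bar>X\<bar> \<le> M \<Longrightarrow> \<bar>Y\<bar> \<le> M \<Longrightarrow> \<bar>g X Y\<bar> \<le> C" using lbmD[OF assms(2)] by metis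
  show "\<exists>B. \<forall>X Y. \<bar>X\<bar> \<le> M \<longrightarrow> \<bar>Y\<bar> \<le> M \<longrightarrow> \<bar>f X Y * g X Y\<bar> \<le> B"
    by (intro exI[of _ "B * C"] allI impI) (auto simp: abs_mult intro!: mult_mono B C)
qed

lemma lbm_compose: assumes "lbm f" "continuous_on UNIV h" shows "lbm (\<lambda>X Y. h (f X Y))"
  unfolding lbm_def
proof (intro conjI allI)
  show "(\<lambda>p. h (f (fst p) (snd p))) \<in> borel_measurable lebesgue"
    using assms by (intro measurable_compose[OF _ borel_measurable_continuous_onI[OF assms(2)]]) (auto simp: lbm_def)
  fix M
  obtain B where B: "\<And>X Y. \<bar>X\<bar> \<le> M \<Longrightarrow> \<bar>Y\<bar> \<le> M \<Longrightarrow> \<bar>f X Y\<bar> \<le> B" using lbmD[OF assms(1)] by metis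
  obtain C where C: "\<forall>v\<in>{-B..B}. \<bar>h v\<bar> \<le> C" using continuous_bounded_Icc[OF assms(2)] by blast
  have "\<bar>h (f X Y)\<bar> \<le> C" if "\<bar>X\<bar> \<le> M" "\<bar>Y\<bar> \<le> M" for X Y
  proof -
    have "f X Y \<in> {-B..B}" using B[OF that] by auto
    then show ?thesis using C by blast
  qed
  then show "\<exists>B. \<forall>X Y. \<bar>X\<bar> \<le> M \<longrightarrow> \<bar>Y\<bar> \<le> M \<longrightarrow> \<bar>h (f X Y)\<bar> \<le> B" by blast
qed

lemma lbm_const: "lbm (\<lambda>X Y. k)"
  unfolding lbm_def by auto

lemma lbm_uminus: "lbm f \<Longrightarrow> lbm (\<lambda>X Y. - f X Y)"
  using lbm_compose[of f uminus] by (simp add: continuous_on_minus continuous_on_id)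

lemma lbm_diff: "lbm f \<Longrightarrow> lbm g \<Longrightarrow> lbm (\<lambda>X Y. f X Y - g X Y)"
  using lbm_add[OF _ lbm_uminus, of f g] by simp

lemma lbm_continuous:
  assumes "continuous_on UNIV (\<lambda>p. f (fst p) (snd p))" shows "lbm f"
proof (rule locally_bounded_measurable_imp_lbm)
  have "(\<lambda>p. f (fst p) (snd p)) \<in> borel_measurable lborel" using borel_measurable_continuous_onI[OF assms] by simp
  then show "locally_bounded_measurable f"
    unfolding locally_bounded_measurable_def case_prod_beta'
    by (auto intro!: measurable_completion compact_imp_bounded compact_continuous_image continuous_on_subset[OF assms])
qed

lemma lbm_swap: assumes "lbm f" shows "lbm (\<lambda>X Y. f Y X)"
  unfolding lbm_def
proof (intro conjI allI)
  obtain f' where f': "f' \<in> borel_measurable lborel" "AE p in lborel. f (fst p) (snd p) = f' p"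
    using assms completion_ex_borel_measurable_real[of "\<lambda>p. f (fst p) (snd p)" lborel] unfolding lbm_def by blast
  have P: "AE x in lborel \<Otimes>\<^sub>M lborel. f (fst x) (snd x) = f' x" unfolding lborel_prod by (rule f'(2))
  then have "AE x in distr (lborel \<Otimes>\<^sub>M lborel) (lborel \<Otimes>\<^sub>M lborel) (\<lambda>(x, y). (y, x)). f (fst x) (snd x) = f' x"
    by (rule lborel_pair.distr_pair_swap[THEN subst])
  then have "AE x in lborel \<Otimes>\<^sub>M lborel. f (snd x) (fst x) = f' (snd x, fst x)"
    by (rule AE_distrD[rotated, THEN AE_mp]) (auto simp: split_beta intro!: AE_I2)
  then have ae: "AE x in lborel. f (snd x) (fst x) = f' (snd x, fst x)" unfolding lborel_prod .
  have "(\<lambda>p::real \<times> real. (snd p, fst p)) \<in> borel_measurable borel"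
    by (intro borel_measurable_continuous_onI continuous_intros)
  from measurable_compose[OF this] f'(1) have "(\<lambda>p. f' (snd p, fst p)) \<in> borel_measurable lborel" by simp
  moreover have "AE x in lborel. f' (snd x, fst x) = f (snd x) (fst x)"
    using ae by eventually_elim simp
  ultimately show "(\<lambda>p. f (snd p) (fst p)) \<in> borel_measurable lebesgue"
    by (rule borel_measurable_completion_AE)
  fix M
  show "\<exists>B. \<forall>X Y. \<bar>X\<bar> \<le> M \<longrightarrow> \<bar>Y\<bar> \<le> M \<longrightarrow> \<bar>f Y X\<bar> \<le> B" using assms unfolding lbm_def by meson
qed

text \<open>A nonzero derivative isolates a point within its level set. Sorted by the radius of
  isolation \<open>1 / real (Suc n)\<close>, the points form sets \<open>T n\<close> without limit
  points, and such sets are countable.\<close>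

lemma countable_level_set_regular_points:
  fixes f :: "real \<Rightarrow> real"
  shows "countable {y. f y = v \<and> (\<exists>D. D \<noteq> 0 \<and> (f has_real_derivative D) (at y))}" (is "countable ?S")
proof -
  define T where "T n = {y \<in> ?S. \<forall>z. 0 < \<bar>z - y\<bar> \<and> \<bar>z - y\<bar> < 1 / real (Suc n) \<longrightarrow> f z \<noteq> v}" for n
  have "?S \<subseteq> (\<Union>n. T n)"
  proof
    fix y assume y: "y \<in> ?S"
    then obtain D where D: "D \<noteq> 0" "(f has_real_derivative D) (at y)" "f y = v" by blast
    obtain r where r: "r > 0" "\<And>x. \<bar>x - y\<bar> < r \<Longrightarrow> \<bar>f x - f y - D * (x - y)\<bar> \<le> (\<bar>D\<bar> / 2) * \<bar>x - y\<bar>"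
      using DERIV_linear_approx[OF D(2), of "\<bar>D\<bar> / 2"] D(1) by auto
    obtain n where n: "1 / real (Suc n) < r" using r(1) nat_approx_posE by blast
    have "f z \<noteq> v" if z: "0 < \<bar>z - y\<bar>" "\<bar>z - y\<bar> < 1 / real (Suc n)" for z
    proof
      assume "f z = v"
      then have "\<bar>D\<bar> * \<bar>z - y\<bar> \<le> (\<bar>D\<bar> / 2) * \<bar>z - y\<bar>" using r(2)[of z] z n D(3) by (simp add: abs_mult)
      then show False using z D(1) by simp
    qed
    then show "y \<in> (\<Union>n. T n)" using y by (auto simp: T_def)
  qed
  moreover have "countable (T n)" for n
  proof (rule no_limpt_imp_countable)
    fix z
    show "\<not> z islimpt T n"
    proof
      assume lim: "z islimpt T n"
      have "1 / (2 * real (Suc n)) > 0" by simp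
      then obtain y1 where y1: "y1 \<in> T n" "y1 \<noteq> z" "dist y1 z < 1 / (2 * real (Suc n))"
        using lim unfolding islimpt_approachable by blast
      then have "dist y1 z > 0" by simp
      then obtain y2 where y2: "y2 \<in> T n" "y2 \<noteq> z" "dist y2 z < dist y1 z"
        using lim unfolding islimpt_approachable by blast
      have "y1 \<noteq> y2" using y2 by auto
      moreover have "\<bar>y2 - y1\<bar> < 1 / real (Suc n)"
      proof -
        define d where "d = 1 / (2 * real (Suc n))"
        have "2 * (1 / (2 * k)) = 1 / k" for k :: real by simp
        then have "1 / real (Suc n) = 2 * d" by (simp only: d_def)
        moreover have "\<bar>y1 - z\<bar> < d" "\<bar>y2 - z\<bar> < \<bar>y1 - z\<bar>"
          using y1(3) y2(3) by (simp_all only: dist_real_def d_def)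
        ultimately show ?thesis by linarith
      qed
      ultimately show False using y1(1) y2(1) by (auto simp: T_def)
    qed
  qed
  ultimately show ?thesis by (meson countable_UN countable_subset countableI_type)
qed

section \<open>Equations on almost every line and their potentials\<close>

text \<open>The equation \<open>f_Y = h\<close> on almost every vertical line, expressed by
  increments over all intervals. Since no base curve occurs, exchanging the variables or changing
  signs is immediate.\<close>

definition Yint :: "(real \<Rightarrow> real \<Rightarrow> real) \<Rightarrow> (real \<Rightarrow> real \<Rightarrow> real) \<Rightarrow> bool" where
  "Yint f h \<longleftrightarrow> (AE X in lborel. \<forall>Y1 Y2. Y1 \<le> Y2 \<longrightarrow> (h X has_integral (f X Y2 - f X Y1)) {Y1..Y2})"

abbreviation Xint :: "(real \<Rightarrow> real \<Rightarrow> real) \<Rightarrow> (real \<Rightarrow> real \<Rightarrow> real) \<Rightarrow> bool" where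
  "Xint f h \<equiv> Yint (\<lambda>Y X. f X Y) (\<lambda>Y X. h X Y)"

definition YLip :: "(real \<Rightarrow> real \<Rightarrow> real) \<Rightarrow> bool" where
  "YLip f \<longleftrightarrow> (\<forall>M. \<exists>L\<ge>0. AE X in lborel. \<bar>X\<bar> \<le> M \<longrightarrow>
     (\<forall>Y Y'. \<bar>Y\<bar> \<le> M \<longrightarrow> \<bar>Y'\<bar> \<le> M \<longrightarrow> \<bar>f X Y - f X Y'\<bar> \<le> L * \<bar>Y - Y'\<bar>))"

definition loclip :: "(real \<Rightarrow> real) \<Rightarrow> bool" where
  "loclip h \<longleftrightarrow> (\<forall>M. \<exists>L\<ge>0. \<forall>v w. \<bar>v\<bar> \<le> M \<longrightarrow> \<bar>w\<bar> \<le> M \<longrightarrow> \<bar>h v - h w\<bar> \<le> L * \<bar>v - w\<bar>)"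

lemma YLipE:
  assumes "YLip f" obtains L where "L \<ge> 0" "AE X in lborel. \<bar>X\<bar> \<le> M \<longrightarrow>
     (\<forall>Y Y'. \<bar>Y\<bar> \<le> M \<longrightarrow> \<bar>Y'\<bar> \<le> M \<longrightarrow> \<bar>f X Y - f X Y'\<bar> \<le> L * \<bar>Y - Y'\<bar>)"
  using assms unfolding YLip_def by blast

lemma loclip_C1:
  assumes d: "\<And>v. (h has_real_derivative h' v) (at v)" and c: "continuous_on UNIV h'"
  shows "loclip h"
  unfolding loclip_def
proof
  fix M
  obtain B where B: "\<forall>v\<in>{-M..M}. \<bar>h' v\<bar> \<le> B" using continuous_bounded_Icc[OF c] by blast
  have *: "\<bar>h v - h w\<bar> \<le> max B 0 * \<bar>v - w\<bar>" if "\<bar>v\<bar> \<le> M" "\<bar>w\<bar> \<le> M" and wv: "w < v" for v w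
  proof -
    obtain z where z: "w < z" "z < v" "h v - h w = (v - w) * h' z" using MVT2[OF wv, of h h'] d by blast
    have "z \<in> {-M..M}" using that z by auto
    then have "\<bar>h' z\<bar> \<le> max B 0" using B by force
    then show ?thesis using z mult_left_mono[of "\<bar>h' z\<bar>" "max B 0" "\<bar>v - w\<bar>"] by (simp add: abs_mult mult.commute)
  qed
  have "\<bar>h v - h w\<bar> \<le> max B 0 * \<bar>v - w\<bar>" if "\<bar>v\<bar> \<le> M" "\<bar>w\<bar> \<le> M" for v w
    using *[of v w] *[of w v] that by (cases v w rule: linorder_cases) (simp_all add: abs_minus_commute)
  then show "\<exists>L\<ge>0. \<forall>v w. \<bar>v\<bar> \<le> M \<longrightarrow> \<bar>w\<bar> \<le> M \<longrightarrow> \<bar>h v - h w\<bar> \<le> L * \<bar>v - w\<bar>"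
    by (intro exI[of _ "max B 0"]) simp
qed

lemma loclip_sin_cos: "loclip sin" "loclip cos"
  by (rule loclip_C1, rule DERIV_sin, intro continuous_intros)
     (rule loclip_C1, rule DERIV_cos, intro continuous_intros)

lemma lbm_section:
  assumes f: "lbm f" shows "AE X in lborel. \<forall>a b. set_integrable lebesgue {a..b} (f X)"
proof -
  have m: "(\<lambda>p. f (fst p) (snd p)) \<in> borel_measurable lebesgue" using f by (simp add: lbm_def)
  obtain f' where f': "f' \<in> borel_measurable borel"
    "AE X in lborel. AE Y in lborel. f (fst (X, Y)) (snd (X, Y)) = f' (X, Y)"
    by (rule lebesgue_plane_borel_version[OF m])
  show ?thesis using f'(2)
  proof eventually_elim
    case (elim X)
    show ?case
    proof (intro allI)
      fix a b
      have "(\<lambda>Y. (X, Y)) \<in> borel_measurable borel" by (intro borel_measurable_continuous_onI continuous_intros)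
      from measurable_compose[OF this f'(1)] have "(\<lambda>Y. f' (X, Y)) \<in> borel_measurable lborel" by simp
      moreover have "AE Y in lborel. f' (X, Y) = f X Y" using elim by eventually_elim simp
      ultimately have m': "f X \<in> borel_measurable lebesgue" by (rule borel_measurable_completion_AE)
      obtain B where B: "\<And>X' Y. \<bar>X'\<bar> \<le> \<bar>X\<bar> + \<bar>a\<bar> + \<bar>b\<bar> \<Longrightarrow> \<bar>Y\<bar> \<le> \<bar>X\<bar> + \<bar>a\<bar> + \<bar>b\<bar> \<Longrightarrow> \<bar>f X' Y\<bar> \<le> B"
        using lbmD[OF f] by metis
      show "set_integrable lebesgue {a..b} (f X)"
        unfolding set_integrable_def
      proof (rule integrableI_bounded_set[where A="{a..b}" and B=B])
        show "AE Y in lebesgue. Y \<in> {a..b} \<longrightarrow> norm (indicator {a..b} Y *\<^sub>R f X Y) \<le> B"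
          by (rule AE_I2) (auto intro!: B)
      qed (use m' in \<open>auto simp: emeasure_lborel_Icc_eq intro!: borel_measurable_times borel_measurable_indicator\<close>)
    qed
  qed
qed

lemma Yint_of_integrated_in_Y:
  assumes h: "lbm h" and i: "integrated_in_Y \<theta> f h" shows "Yint f h"
proof -
  have "AE X in lborel. \<forall>Y. f X Y = f X (\<theta> X) + (LINT s=ereal (\<theta> X)..ereal Y|lebesgue. h X s)"
    using i unfolding integrated_in_Y_def by (simp only: AE_completion_iff)
  with lbm_section[OF h] show ?thesis unfolding Yint_def
  proof eventually_elim
    case (elim X)
    show ?case
    proof (intro allI impI)
      fix Y1 Y2 :: real assume le: "Y1 \<le> Y2"
      have "f X Y2 - f X Y1 = (LINT s=ereal (\<theta> X)..ereal Y2|lebesgue. h X s) - (LINT s=ereal (\<theta> X)..ereal Y1|lebesgue. h X s)"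
        using elim(2)[rule_format, of Y2] elim(2)[rule_format, of Y1] by linarith
      then show "(h X has_integral (f X Y2 - f X Y1)) {Y1..Y2}"
        using has_integral_interval_lebesgue_integral[of "h X" Y1 Y2 "\<theta> X"] elim(1) le by simp
    qed
  qed
qed

lemma integrated_in_X_swap:
  "integrated_in_X \<phi> f g \<longleftrightarrow> integrated_in_Y (inv \<phi>) (\<lambda>X Y. f Y X) (\<lambda>X Y. g Y X)"
  by (simp add: integrated_in_X_def integrated_in_Y_def)

lemma Xint_of_integrated_in_X: "lbm h \<Longrightarrow> integrated_in_X \<phi> f h \<Longrightarrow> Xint f h"
  unfolding integrated_in_X_swap by (rule Yint_of_integrated_in_Y[OF lbm_swap])

lemma has_integral_abs_le:
  fixes k :: "real \<Rightarrow> real"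
  assumes i: "(k has_integral I) {a..b}" and b: "\<And>x. x \<in> {a..b} \<Longrightarrow> \<bar>k x\<bar> \<le> B" and "a \<le> b" "B \<ge> 0"
  shows "\<bar>I\<bar> \<le> B * (b - a)"
  using has_integral_bound[of B k I a b] assms by simp

lemma YLip_of_Yint:
  assumes h: "lbm h" and i: "Yint f h" shows "YLip f"
  unfolding YLip_def
proof
  fix M
  obtain B where B: "B \<ge> 0" "\<And>X Y. \<bar>X\<bar> \<le> M \<Longrightarrow> \<bar>Y\<bar> \<le> M \<Longrightarrow> \<bar>h X Y\<bar> \<le> B" using lbmD[OF h] by metis
  have "AE X in lborel. \<bar>X\<bar> \<le> M \<longrightarrow> (\<forall>Y Y'. \<bar>Y\<bar> \<le> M \<longrightarrow> \<bar>Y'\<bar> \<le> M \<longrightarrow> \<bar>f X Y - f X Y'\<bar> \<le> B * \<bar>Y - Y'\<bar>)"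
    using i unfolding Yint_def
  proof eventually_elim
    case (elim X)
    have *: "\<bar>f X Y - f X Y'\<bar> \<le> B * (Y - Y')" if "\<bar>X\<bar> \<le> M" "\<bar>Y\<bar> \<le> M" "\<bar>Y'\<bar> \<le> M" "Y' \<le> Y" for Y Y'
      by (rule has_integral_abs_le[of "h X"]) (use elim that B in auto)
    show ?case
    proof (intro allI impI)
      fix Y Y' assume "\<bar>X\<bar> \<le> M" "\<bar>Y\<bar> \<le> M" "\<bar>Y'\<bar> \<le> M"
      then show "\<bar>f X Y - f X Y'\<bar> \<le> B * \<bar>Y - Y'\<bar>"
        using *[of Y Y'] *[of Y' Y] by (cases "Y' \<le> Y") (simp_all add: abs_minus_commute)
    qed
  qed
  then show "\<exists>L\<ge>0. AE X in lborel. \<bar>X\<bar> \<le> M \<longrightarrow> (\<forall>Y Y'. \<bar>Y\<bar> \<le> M \<longrightarrow> \<bar>Y'\<bar> \<le> M \<longrightarrow> \<bar>f X Y - f X Y'\<bar> \<le> L * \<bar>Y - Y'\<bar>)"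
    using B(1) by blast
qed

lemma YLip_add: assumes "YLip f" "YLip g" shows "YLip (\<lambda>X Y. f X Y + g X Y)"
  unfolding YLip_def
proof
  fix M
  obtain L where L: "L \<ge> 0" "AE X in lborel. \<bar>X\<bar> \<le> M \<longrightarrow> (\<forall>Y Y'. \<bar>Y\<bar> \<le> M \<longrightarrow> \<bar>Y'\<bar> \<le> M \<longrightarrow> \<bar>f X Y - f X Y'\<bar> \<le> L * \<bar>Y - Y'\<bar>)"
    using YLipE[OF assms(1), where M=M] by blast
  obtain K where K: "K \<ge> 0" "AE X in lborel. \<bar>X\<bar> \<le> M \<longrightarrow> (\<forall>Y Y'. \<bar>Y\<bar> \<le> M \<longrightarrow> \<bar>Y'\<bar> \<le> M \<longrightarrow> \<bar>g X Y - g X Y'\<bar> \<le> K * \<bar>Y - Y'\<bar>)"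
    using YLipE[OF assms(2), where M=M] by blast
  have "AE X in lborel. \<bar>X\<bar> \<le> M \<longrightarrow> (\<forall>Y Y'. \<bar>Y\<bar> \<le> M \<longrightarrow> \<bar>Y'\<bar> \<le> M \<longrightarrow>
      \<bar>f X Y + g X Y - (f X Y' + g X Y')\<bar> \<le> (L + K) * \<bar>Y - Y'\<bar>)"
    using L(2) K(2)
  proof eventually_elim
    case (elim X)
    show ?case
    proof (intro allI impI)
      fix Y Y' assume "\<bar>X\<bar> \<le> M" "\<bar>Y\<bar> \<le> M" "\<bar>Y'\<bar> \<le> M"
      then have "\<bar>f X Y - f X Y'\<bar> \<le> L * \<bar>Y - Y'\<bar>" "\<bar>g X Y - g X Y'\<bar> \<le> K * \<bar>Y - Y'\<bar>" using elim by auto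
      then show "\<bar>f X Y + g X Y - (f X Y' + g X Y')\<bar> \<le> (L + K) * \<bar>Y - Y'\<bar>" by (simp add: distrib_right)
    qed
  qed
  then show "\<exists>L\<ge>0. AE X in lborel. \<bar>X\<bar> \<le> M \<longrightarrow> (\<forall>Y Y'. \<bar>Y\<bar> \<le> M \<longrightarrow> \<bar>Y'\<bar> \<le> M \<longrightarrow>
      \<bar>f X Y + g X Y - (f X Y' + g X Y')\<bar> \<le> L * \<bar>Y - Y'\<bar>)" using L(1) K(1) by (intro exI[of _ "L + K"]) simp
qed

lemma YLip_mult: assumes "YLip f" "YLip g" "lbm f" "lbm g" shows "YLip (\<lambda>X Y. f X Y * g X Y)"
  unfolding YLip_def
proof
  fix M
  obtain L where L: "L \<ge> 0" "AE X in lborel. \<bar>X\<bar> \<le> M \<longrightarrow> (\<forall>Y Y'. \<bar>Y\<bar> \<le> M \<longrightarrow> \<bar>Y'\<bar> \<le> M \<longrightarrow> \<bar>f X Y - f X Y'\<bar> \<le> L * \<bar>Y - Y'\<bar>)"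
    using YLipE[OF assms(1), where M=M] by blast
  obtain K where K: "K \<ge> 0" "AE X in lborel. \<bar>X\<bar> \<le> M \<longrightarrow> (\<forall>Y Y'. \<bar>Y\<bar> \<le> M \<longrightarrow> \<bar>Y'\<bar> \<le> M \<longrightarrow> \<bar>g X Y - g X Y'\<bar> \<le> K * \<bar>Y - Y'\<bar>)"
    using YLipE[OF assms(2), where M=M] by blast
  obtain B where B: "B \<ge> 0" "\<And>X Y. \<bar>X\<bar> \<le> M \<Longrightarrow> \<bar>Y\<bar> \<le> M \<Longrightarrow> \<bar>f X Y\<bar> \<le> B" using lbmD[OF assms(3)] by metis
  obtain C where C: "C \<ge> 0" "\<And>X Y. \<bar>X\<bar> \<le> M \<Longrightarrow> \<bar>Y\<bar> \<le> M \<Longrightarrow> \<bar>g X Y\<bar> \<le> C" using lbmD[OF assms(4)] by metis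
  have "AE X in lborel. \<bar>X\<bar> \<le> M \<longrightarrow> (\<forall>Y Y'. \<bar>Y\<bar> \<le> M \<longrightarrow> \<bar>Y'\<bar> \<le> M \<longrightarrow>
      \<bar>f X Y * g X Y - f X Y' * g X Y'\<bar> \<le> (B * K + C * L) * \<bar>Y - Y'\<bar>)"
    using L(2) K(2)
  proof eventually_elim
    case (elim X)
    show ?case
    proof (intro allI impI)
      fix Y Y' assume b: "\<bar>X\<bar> \<le> M" "\<bar>Y\<bar> \<le> M" "\<bar>Y'\<bar> \<le> M"
      then have d: "\<bar>f X Y - f X Y'\<bar> \<le> L * \<bar>Y - Y'\<bar>" "\<bar>g X Y - g X Y'\<bar> \<le> K * \<bar>Y - Y'\<bar>" using elim by auto
      have "f X Y * g X Y - f X Y' * g X Y' = f X Y * (g X Y - g X Y') + g X Y' * (f X Y - f X Y')" by (simp add: algebra_simps)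
      also have "\<bar>\<dots>\<bar> \<le> \<bar>f X Y\<bar> * \<bar>g X Y - g X Y'\<bar> + \<bar>g X Y'\<bar> * \<bar>f X Y - f X Y'\<bar>"
        by (rule order_trans[OF abs_triangle_ineq]) (simp add: abs_mult)
      also have "\<dots> \<le> B * (K * \<bar>Y - Y'\<bar>) + C * (L * \<bar>Y - Y'\<bar>)"
        using b by (intro add_mono mult_mono d B C) auto
      finally show "\<bar>f X Y * g X Y - f X Y' * g X Y'\<bar> \<le> (B * K + C * L) * \<bar>Y - Y'\<bar>" by (simp add: algebra_simps)
    qed
  qed
  then show "\<exists>L\<ge>0. AE X in lborel. \<bar>X\<bar> \<le> M \<longrightarrow> (\<forall>Y Y'. \<bar>Y\<bar> \<le> M \<longrightarrow> \<bar>Y'\<bar> \<le> M \<longrightarrow>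
      \<bar>f X Y * g X Y - f X Y' * g X Y'\<bar> \<le> L * \<bar>Y - Y'\<bar>)" using L(1) K(1) B(1) C(1) by (intro exI[of _ "B * K + C * L"]) simp
qed

lemma YLip_compose: assumes "YLip f" "lbm f" "loclip h" shows "YLip (\<lambda>X Y. h (f X Y))"
  unfolding YLip_def
proof
  fix M
  obtain L where L: "L \<ge> 0" "AE X in lborel. \<bar>X\<bar> \<le> M \<longrightarrow> (\<forall>Y Y'. \<bar>Y\<bar> \<le> M \<longrightarrow> \<bar>Y'\<bar> \<le> M \<longrightarrow> \<bar>f X Y - f X Y'\<bar> \<le> L * \<bar>Y - Y'\<bar>)"
    using YLipE[OF assms(1), where M=M] by blast
  obtain B where B: "B \<ge> 0" "\<And>X Y. \<bar>X\<bar> \<le> M \<Longrightarrow> \<bar>Y\<bar> \<le> M \<Longrightarrow> \<bar>f X Y\<bar> \<le> B" using lbmD[OF assms(2)] by metis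
  obtain K where K: "K \<ge> 0" "\<And>v w. \<bar>v\<bar> \<le> B \<Longrightarrow> \<bar>w\<bar> \<le> B \<Longrightarrow> \<bar>h v - h w\<bar> \<le> K * \<bar>v - w\<bar>"
    using assms(3) unfolding loclip_def by blast
  have "AE X in lborel. \<bar>X\<bar> \<le> M \<longrightarrow> (\<forall>Y Y'. \<bar>Y\<bar> \<le> M \<longrightarrow> \<bar>Y'\<bar> \<le> M \<longrightarrow> \<bar>h (f X Y) - h (f X Y')\<bar> \<le> (K * L) * \<bar>Y - Y'\<bar>)"
    using L(2)
  proof eventually_elim
    case (elim X)
    show ?case
    proof (intro allI impI)
      fix Y Y' assume b: "\<bar>X\<bar> \<le> M" "\<bar>Y\<bar> \<le> M" "\<bar>Y'\<bar> \<le> M"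
      have "\<bar>h (f X Y) - h (f X Y')\<bar> \<le> K * \<bar>f X Y - f X Y'\<bar>" using b by (intro K B)
      also have "\<dots> \<le> K * (L * \<bar>Y - Y'\<bar>)" using elim b K by (intro mult_left_mono) auto
      finally show "\<bar>h (f X Y) - h (f X Y')\<bar> \<le> (K * L) * \<bar>Y - Y'\<bar>" by (simp add: mult.assoc)
    qed
  qed
  then show "\<exists>L\<ge>0. AE X in lborel. \<bar>X\<bar> \<le> M \<longrightarrow> (\<forall>Y Y'. \<bar>Y\<bar> \<le> M \<longrightarrow> \<bar>Y'\<bar> \<le> M \<longrightarrow> \<bar>h (f X Y) - h (f X Y')\<bar> \<le> L * \<bar>Y - Y'\<bar>)"
    using L(1) K(1) by (intro exI[of _ "K * L"]) simp
qed

lemma YLip_const: "YLip (\<lambda>X Y. k)"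
  unfolding YLip_def by (auto intro: exI[of _ 0])

text \<open>Inside the interval the points violating a closed condition form an open set, which has
  positive measure unless it is empty. This carries estimates from almost every line to every
  line.\<close>

lemma AE_closed_imp_all:
  assumes ae: "AE Y in lborel. \<bar>Y\<bar> < R \<longrightarrow> P Y" and cl: "closed {Y. P Y}" and Y: "\<bar>Y\<bar> < (R::real)"
  shows "P Y"
proof (rule ccontr)
  assume n: "\<not> P Y"
  have "open ({-R<..<R} - {Y. P Y})" using cl by (intro open_Diff) auto
  moreover have "Y \<in> {-R<..<R} - {Y. P Y}" using n Y by auto
  ultimately have "\<not> negligible ({-R<..<R} - {Y. P Y})" using open_not_negligible by blast
  moreover have "negligible ({-R<..<R} - {Y. P Y})"
  proof -
    obtain N where N: "N \<in> null_sets lborel" "{Y. \<not> (\<bar>Y\<bar> < R \<longrightarrow> P Y)} \<subseteq> N"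
      using ae unfolding eventually_ae_filter by auto
    have "negligible N" using N(1) by (simp add: negligible_iff_null_sets null_sets_completionI)
    moreover have "{-R<..<R} - {Y. P Y} \<subseteq> {Y. \<not> (\<bar>Y\<bar> < R \<longrightarrow> P Y)}" by auto
    ultimately show ?thesis using N(2) negligible_subset by blast
  qed
  ultimately show False by blast
qed

lemma continuous_plane_sections:
  assumes "continuous_on UNIV (\<lambda>p. F (fst p) (snd p))"
  shows "continuous_on S (\<lambda>Y. F X Y)" "continuous_on S (\<lambda>X. F X (Y::real) :: real)"
proof -
  have "continuous_on S (\<lambda>Y. F (fst (X, Y)) (snd (X, Y)))"
    by (rule continuous_on_compose2[OF assms]) (intro continuous_intros, auto)
  then show "continuous_on S (\<lambda>Y. F X Y)" by simp
  have "continuous_on S (\<lambda>X. F (fst (X, Y)) (snd (X, Y)))"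
    by (rule continuous_on_compose2[OF assms]) (intro continuous_intros, auto)
  then show "continuous_on S (\<lambda>X. F X Y)" by simp
qed

text \<open>On good lines the increments of \<open>F\<close> are integrals of bounded functions, and
  a mixed difference is the integral of \<open>f s Y - f s Y'\<close>, whose integrand is at most
  \<open>L * \<bar>Y - Y'\<bar>\<close>. Continuity of \<open>F\<close> extends these bounds to all
  lines; \<open>R = M + 1\<close> leaves an open neighbourhood for that passage.\<close>

lemma rect_lipschitz_of_potential:
  assumes F: "continuous_on UNIV (\<lambda>p. F (fst p) (snd p))" and iX: "Xint F f" and iY: "Yint F k"
    and f: "lbm f" and k: "lbm k" and fL: "YLip f"
  shows "rect_lipschitz F"
  unfolding rect_lipschitz_def
proof
  fix M :: real
  define R where "R = M + 1"
  note cs = continuous_plane_sections[OF F, of UNIV]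
  obtain B where B: "B \<ge> 0" "\<And>X Y. \<bar>X\<bar> \<le> R \<Longrightarrow> \<bar>Y\<bar> \<le> R \<Longrightarrow> \<bar>f X Y\<bar> \<le> B" using lbmD[OF f] by metis
  obtain C where C: "C \<ge> 0" "\<And>X Y. \<bar>X\<bar> \<le> R \<Longrightarrow> \<bar>Y\<bar> \<le> R \<Longrightarrow> \<bar>k X Y\<bar> \<le> C" using lbmD[OF k] by metis
  obtain L where L: "L \<ge> 0" "AE X in lborel. \<bar>X\<bar> \<le> R \<longrightarrow> (\<forall>Y Y'. \<bar>Y\<bar> \<le> R \<longrightarrow> \<bar>Y'\<bar> \<le> R \<longrightarrow> \<bar>f X Y - f X Y'\<bar> \<le> L * \<bar>Y - Y'\<bar>)"
    using YLipE[OF fL, where M=R] by blast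
  obtain N where N: "N \<in> null_sets lborel"
    "{X. \<not> (\<bar>X\<bar> \<le> R \<longrightarrow> (\<forall>Y Y'. \<bar>Y\<bar> \<le> R \<longrightarrow> \<bar>Y'\<bar> \<le> R \<longrightarrow> \<bar>f X Y - f X Y'\<bar> \<le> L * \<bar>Y - Y'\<bar>))} \<subseteq> N"
    using L(2) unfolding eventually_ae_filter by auto
  have neg: "negligible N" using N(1) by (simp add: negligible_iff_null_sets null_sets_completionI)
  define K where "K = B + C + L"
  have X1: "\<bar>F X Y - F X' Y\<bar> \<le> B * \<bar>X - X'\<bar>" if b: "\<bar>X\<bar> \<le> M" "\<bar>X'\<bar> \<le> M" "\<bar>Y\<bar> \<le> M" for X X' Y
  proof (rule AE_closed_imp_all[where R=R and P="\<lambda>Y. \<bar>F X Y - F X' Y\<bar> \<le> B * \<bar>X - X'\<bar>" and Y=Y])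
    show "AE Y in lborel. \<bar>Y\<bar> < R \<longrightarrow> \<bar>F X Y - F X' Y\<bar> \<le> B * \<bar>X - X'\<bar>"
      using iX unfolding Yint_def
    proof eventually_elim
      case (elim Y)
      have *: "\<bar>F X Y - F X' Y\<bar> \<le> B * (X - X')" if "\<bar>X\<bar> \<le> M" "\<bar>X'\<bar> \<le> M" "\<bar>Y\<bar> < R" "X' \<le> X" for X X'
        by (rule has_integral_abs_le[of "\<lambda>X. f X Y"]) (use elim that B in \<open>auto simp: R_def\<close>)
      show ?case using *[of X X'] *[of X' X] b by (cases "X' \<le> X") (simp_all add: abs_minus_commute)
    qed
    show "closed {Y. \<bar>F X Y - F X' Y\<bar> \<le> B * \<bar>X - X'\<bar>}" by (intro closed_Collect_le continuous_intros cs)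
    show "\<bar>Y\<bar> < R" using b by (simp add: R_def)
  qed
  have Y1: "\<bar>F X Y - F X Y'\<bar> \<le> C * \<bar>Y - Y'\<bar>" if b: "\<bar>X\<bar> \<le> M" "\<bar>Y\<bar> \<le> M" "\<bar>Y'\<bar> \<le> M" for X Y Y'
  proof (rule AE_closed_imp_all[where R=R and P="\<lambda>X. \<bar>F X Y - F X Y'\<bar> \<le> C * \<bar>Y - Y'\<bar>" and Y=X])
    show "AE X in lborel. \<bar>X\<bar> < R \<longrightarrow> \<bar>F X Y - F X Y'\<bar> \<le> C * \<bar>Y - Y'\<bar>"
      using iY unfolding Yint_def
    proof eventually_elim
      case (elim X)
      have *: "\<bar>F X Y - F X Y'\<bar> \<le> C * (Y - Y')" if "\<bar>Y\<bar> \<le> M" "\<bar>Y'\<bar> \<le> M" "\<bar>X\<bar> < R" "Y' \<le> Y" for Y Y'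
        by (rule has_integral_abs_le[of "\<lambda>Y. k X Y"]) (use elim that C in \<open>auto simp: R_def\<close>)
      show ?case using *[of Y Y'] *[of Y' Y] b by (cases "Y' \<le> Y") (simp_all add: abs_minus_commute)
    qed
    show "closed {X. \<bar>F X Y - F X Y'\<bar> \<le> C * \<bar>Y - Y'\<bar>}" by (intro closed_Collect_le continuous_intros cs)
    show "\<bar>X\<bar> < R" using b by (simp add: R_def)
  qed
  have XY: "\<bar>F X Y - F X' Y - F X Y' + F X' Y'\<bar> \<le> L * (\<bar>X - X'\<bar> * \<bar>Y - Y'\<bar>)"
    if b: "\<bar>X\<bar> \<le> M" "\<bar>X'\<bar> \<le> M" "\<bar>Y\<bar> \<le> M" "\<bar>Y'\<bar> \<le> M" for X X' Y Y'
  proof -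
    let ?G = "\<lambda>Y. \<forall>X1 X2. X1 \<le> X2 \<longrightarrow> ((\<lambda>X. f X Y) has_integral (F X2 Y - F X1 Y)) {X1..X2}"
    have gg: "\<bar>F X Y - F X' Y - F X Y' + F X' Y'\<bar> \<le> L * (\<bar>X - X'\<bar> * \<bar>Y - Y'\<bar>)"
      if G: "?G Y" "?G Y'" and bY: "\<bar>Y\<bar> < R" "\<bar>Y'\<bar> < R" for Y Y'
    proof -
      have *: "\<bar>F X Y - F X' Y - F X Y' + F X' Y'\<bar> \<le> L * \<bar>Y - Y'\<bar> * (X - X')" if bX: "\<bar>X\<bar> \<le> M" "\<bar>X'\<bar> \<le> M" "X' \<le> X" for X X'
      proof (rule has_integral_abs_le[of "\<lambda>s. if s \<in> N then 0 else f s Y - f s Y'"])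
        have "((\<lambda>s. f s Y - f s Y') has_integral (F X Y - F X' Y - (F X Y' - F X' Y'))) {X'..X}"
          by (intro has_integral_diff) (use G bX in auto)
        moreover have "F X Y - F X' Y - (F X Y' - F X' Y') = F X Y - F X' Y - F X Y' + F X' Y'" by simp
        ultimately have "((\<lambda>s. f s Y - f s Y') has_integral (F X Y - F X' Y - F X Y' + F X' Y')) {X'..X}" by (simp only:)
        then show "((\<lambda>s. if s \<in> N then 0 else f s Y - f s Y') has_integral (F X Y - F X' Y - F X Y' + F X' Y')) {X'..X}"
          by (rule has_integral_spike[OF neg, rotated]) auto
        fix s assume s: "s \<in> {X'..X}"
        then have "\<bar>s\<bar> \<le> R" using bX by (auto simp: R_def)
        moreover have "s \<notin> N \<Longrightarrow> \<bar>s\<bar> \<le> R \<longrightarrow> (\<forall>Y Y'. \<bar>Y\<bar> \<le> R \<longrightarrow> \<bar>Y'\<bar> \<le> R \<longrightarrow> \<bar>f s Y - f s Y'\<bar> \<le> L * \<bar>Y - Y'\<bar>)"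
          using N(2) by blast
        ultimately show "\<bar>if s \<in> N then 0 else f s Y - f s Y'\<bar> \<le> L * \<bar>Y - Y'\<bar>"
          using bY L(1) by auto
      qed (use bX L in auto)
      show ?thesis
      proof (cases "X' \<le> X")
        case True
        then show ?thesis using *[of X X'] b by (simp add: mult_ac)
      next
        case False
        have "F X' Y - F X Y - F X' Y' + F X Y' = - (F X Y - F X' Y - F X Y' + F X' Y')" by simp
        then show ?thesis using *[of X' X] b False by (simp add: mult_ac abs_minus_commute)
      qed
    qed
    have G: "AE Y in lborel. ?G Y" using iX unfolding Yint_def .
    \<comment> \<open>The closedness argument is needed once for each height: here for
      \<open>Y\<close> with a good \<open>Y'\<close>, and afterwards for \<open>Y'\<close>.\<close>
    have 1: "AE Y' in lborel. \<bar>Y'\<bar> < R \<longrightarrow> (\<forall>Y. \<bar>Y\<bar> < R \<longrightarrow> \<bar>F X Y - F X' Y - F X Y' + F X' Y'\<bar> \<le> L * (\<bar>X - X'\<bar> * \<bar>Y - Y'\<bar>))"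
      using G
    proof eventually_elim
      case (elim Y')
      show ?case
      proof (intro impI allI)
        fix Y assume Y': "\<bar>Y'\<bar> < R" and Y: "\<bar>Y\<bar> < R"
        show "\<bar>F X Y - F X' Y - F X Y' + F X' Y'\<bar> \<le> L * (\<bar>X - X'\<bar> * \<bar>Y - Y'\<bar>)"
        proof (rule AE_closed_imp_all[where R=R and P="\<lambda>Y. \<bar>F X Y - F X' Y - F X Y' + F X' Y'\<bar> \<le> L * (\<bar>X - X'\<bar> * \<bar>Y - Y'\<bar>)" and Y=Y])
          show "AE Y in lborel. \<bar>Y\<bar> < R \<longrightarrow> \<bar>F X Y - F X' Y - F X Y' + F X' Y'\<bar> \<le> L * (\<bar>X - X'\<bar> * \<bar>Y - Y'\<bar>)"
            using G by eventually_elim (intro impI gg elim Y')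
          show "closed {Y. \<bar>F X Y - F X' Y - F X Y' + F X' Y'\<bar> \<le> L * (\<bar>X - X'\<bar> * \<bar>Y - Y'\<bar>)}"
            by (intro closed_Collect_le continuous_intros cs)
        qed (rule Y)
      qed
    qed
    show ?thesis
    proof (rule AE_closed_imp_all[where R=R and P="\<lambda>Y'. \<bar>F X Y - F X' Y - F X Y' + F X' Y'\<bar> \<le> L * (\<bar>X - X'\<bar> * \<bar>Y - Y'\<bar>)" and Y=Y'])
      show "AE Y' in lborel. \<bar>Y'\<bar> < R \<longrightarrow> \<bar>F X Y - F X' Y - F X Y' + F X' Y'\<bar> \<le> L * (\<bar>X - X'\<bar> * \<bar>Y - Y'\<bar>)"
        using 1 by eventually_elim (use b in \<open>auto simp: R_def\<close>)
      show "closed {Y'. \<bar>F X Y - F X' Y - F X Y' + F X' Y'\<bar> \<le> L * (\<bar>X - X'\<bar> * \<bar>Y - Y'\<bar>)}"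
        by (intro closed_Collect_le continuous_intros cs)
    qed (use b in \<open>simp add: R_def\<close>)
  qed
  have up: "v \<le> K * d" if "v \<le> D * d" "D \<le> K" "0 \<le> d" for v D d
    using that mult_right_mono[of D K d] by linarith
  have "rect_bound F M K"
  proof (rule rect_boundI)
    have K: "B \<le> K" "C \<le> K" "L \<le> K" using B(1) C(1) L(1) by (simp_all add: K_def)
    show "0 \<le> K" using K B(1) by simp
    fix X X' Y Y' assume b: "\<bar>X\<bar> \<le> M" "\<bar>X'\<bar> \<le> M" "\<bar>Y\<bar> \<le> M"
    show "\<bar>F X Y - F X' Y\<bar> \<le> K * \<bar>X - X'\<bar>" by (rule up[OF X1[OF b] K(1)]) simp
    assume b': "\<bar>Y'\<bar> \<le> M"
    show "\<bar>F X Y - F X Y'\<bar> \<le> K * \<bar>Y - Y'\<bar>" by (rule up[OF Y1[OF b(1,3) b'] K(2)]) simp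
    show "\<bar>F X Y - F X' Y - F X Y' + F X' Y'\<bar> \<le> K * (\<bar>X - X'\<bar> * \<bar>Y - Y'\<bar>)" by (rule up[OF XY[OF b b'] K(3)]) simp
  qed
  then show "\<exists>L. rect_bound F M L" by blast
qed

text \<open>For a single good \<open>Y\<close> the derivative exists off a null set that depends on
  \<open>Y\<close>. One null set serves a countable dense set \<open>D\<close> of heights; the mixed
  difference bound and the Lipschitz dependence of \<open>f\<close> on \<open>Y\<close> then reach
  every height. This is how the exceptional sets come to consist of whole lines.\<close>

lemma potential_derivative:
  assumes F: "rect_lipschitz F" and iX: "Xint F f" and fL: "YLip f"
  shows "AE X in lborel. \<forall>Y. ((\<lambda>X. F X Y) has_real_derivative f X Y) (at X)"
proof -
  let ?G = "\<lambda>Y. \<forall>X1 X2. X1 \<le> X2 \<longrightarrow> ((\<lambda>X. f X Y) has_integral (F X2 Y - F X1 Y)) {X1..X2}"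
  have G: "AE Y in lborel. ?G Y" using iX unfolding Yint_def .
  have ex: "\<exists>d. ?G d \<and> r < d \<and> d < s" if "r < s" for r s
  proof (rule ccontr)
    assume "\<not> ?thesis"
    then have sub: "{r<..<s} \<subseteq> {Y. \<not> ?G Y}" by auto
    obtain N where N: "N \<in> null_sets lborel" "{Y. \<not> ?G Y} \<subseteq> N" using G unfolding eventually_ae_filter by auto
    have "negligible N" using N(1) by (simp add: negligible_iff_null_sets null_sets_completionI)
    then have "negligible {r<..<s}" by (rule negligible_subset) (use sub N(2) in auto)
    moreover have "{r<..<s} \<noteq> {}" using that by simp
    ultimately show False using open_not_negligible[OF open_greaterThanLessThan] by blast
  qed
  \<comment> \<open>Good heights have full measure, so every interval with rational ends contains
    one; choosing one from each gives the countable dense set.\<close>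
  define d where "d = (\<lambda>(r::rat, s::rat). SOME d. ?G d \<and> real_of_rat r < d \<and> d < real_of_rat s)"
  define D where "D = d ` {(r, s). r < s}"
  have dG: "?G (d (r, s)) \<and> real_of_rat r < d (r, s) \<and> d (r, s) < real_of_rat s" if "r < s" for r s
  proof -
    have "\<exists>d. ?G d \<and> real_of_rat r < d \<and> d < real_of_rat s" using ex[of "real_of_rat r" "real_of_rat s"] that by (simp add: of_rat_less)
    from someI_ex[OF this] show ?thesis by (simp add: d_def)
  qed
  have Dc: "countable D" unfolding D_def by blast
  have DG: "?G Y" if "Y \<in> D" for Y using that dG by (auto simp: D_def)
  have dense: "\<exists>Y\<in>D. \<bar>Y - Y0\<bar> < r" if r: "r > 0" for Y0 r
  proof -
    obtain r1 where r1: "Y0 - r < real_of_rat r1" "real_of_rat r1 < Y0" using of_rat_dense[of "Y0 - r" Y0] r by auto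
    obtain r2 where r2: "Y0 < real_of_rat r2" "real_of_rat r2 < Y0 + r" using of_rat_dense[of Y0 "Y0 + r"] r by auto
    have "real_of_rat r1 < real_of_rat r2" using r1 r2 by linarith
    then have lt: "r1 < r2" by (simp add: of_rat_less)
    have "d (r1, r2) \<in> D" using lt by (auto simp: D_def)
    then show ?thesis using dG[OF lt] r1 r2 by (intro bexI[of _ "d (r1, r2)"]) auto
  qed
  have "AE X in lborel. \<forall>Y\<in>D. ((\<lambda>X. F X Y) has_real_derivative f X Y) (at X)"
  proof (subst AE_ball_countable[OF Dc], intro ballI)
    fix Y assume "Y \<in> D"
    then obtain N where N: "negligible N" "\<And>X. X \<notin> N \<Longrightarrow> ((\<lambda>X. F X Y) has_real_derivative f X Y) (at X)"
      using indefinite_integral_deriv_ae[of "\<lambda>X. f X Y" "\<lambda>X. F X Y"] DG by metis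
    have "AE X in lebesgue. X \<notin> N" using N(1) by (intro AE_not_in) (simp add: negligible_iff_null_sets)
    then have "AE X in lborel. X \<notin> N" by (simp only: AE_completion_iff)
    then show "AE X in lborel. ((\<lambda>X. F X Y) has_real_derivative f X Y) (at X)" by eventually_elim (rule N(2))
  qed
  moreover have "AE X in lborel. \<forall>n::nat. \<exists>L\<ge>0. \<bar>X\<bar> \<le> real n \<longrightarrow> (\<forall>Y Y'. \<bar>Y\<bar> \<le> real n \<longrightarrow> \<bar>Y'\<bar> \<le> real n \<longrightarrow> \<bar>f X Y - f X Y'\<bar> \<le> L * \<bar>Y - Y'\<bar>)"
  proof (subst AE_all_countable, intro allI)
    fix n :: nat
    obtain L where "L \<ge> 0" "AE X in lborel. \<bar>X\<bar> \<le> real n \<longrightarrow> (\<forall>Y Y'. \<bar>Y\<bar> \<le> real n \<longrightarrow> \<bar>Y'\<bar> \<le> real n \<longrightarrow> \<bar>f X Y - f X Y'\<bar> \<le> L * \<bar>Y - Y'\<bar>)"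
      using YLipE[OF fL, where M="real n"] by blast
    then show "AE X in lborel. \<exists>L\<ge>0. \<bar>X\<bar> \<le> real n \<longrightarrow> (\<forall>Y Y'. \<bar>Y\<bar> \<le> real n \<longrightarrow> \<bar>Y'\<bar> \<le> real n \<longrightarrow> \<bar>f X Y - f X Y'\<bar> \<le> L * \<bar>Y - Y'\<bar>)"
      by (auto elim!: eventually_mono)
  qed
  ultimately show ?thesis
  proof eventually_elim
    case (elim X)
    show ?case
    proof
      fix Y
      obtain n :: nat where n: "\<bar>X\<bar> + \<bar>Y\<bar> + 1 \<le> real n" using real_arch_simple by blast
      obtain K where K: "K \<ge> 0" "\<bar>X\<bar> \<le> real n \<longrightarrow> (\<forall>Y Y'. \<bar>Y\<bar> \<le> real n \<longrightarrow> \<bar>Y'\<bar> \<le> real n \<longrightarrow> \<bar>f X Y - f X Y'\<bar> \<le> K * \<bar>Y - Y'\<bar>)"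
        using elim(2) by blast
      obtain L where L: "rect_bound F (real n) L" using rect_lipschitzE[OF F] .
      show "((\<lambda>X. F X Y) has_real_derivative f X Y) (at X)"
        unfolding has_field_derivative_def has_derivative_at_alt
      proof (intro conjI bounded_linear_mult_right allI impI)
        fix \<epsilon> :: real assume e: "\<epsilon> > 0"
        \<comment> \<open>There are three errors of size \<open>\<epsilon> / 3\<close>: the mixed
          difference, the replacement of \<open>f X Y\<close> by \<open>f X Y'\<close>, and the
          derivative at height \<open>Y'\<close>. The first two are controlled by
          \<open>\<bar>Y - Y'\<bar> < r\<close>.\<close>
        define r where "r = min 1 (\<epsilon> / (3 * (K + L + 1)))"
        have L0: "L \<ge> 0" using rect_boundD(1)[OF L] .
        have r: "r > 0" using e K L0 by (simp add: r_def)
        obtain Y' where Y': "Y' \<in> D" "\<bar>Y' - Y\<bar> < r" using dense[OF r] by blast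
        have rb: "D * \<bar>Y - Y'\<bar> \<le> \<epsilon> / 3" if "0 \<le> D" "D \<le> K + L + 1" for D
        proof -
          have "D * \<bar>Y - Y'\<bar> \<le> (K + L + 1) * (\<epsilon> / (3 * (K + L + 1)))"
            using that Y' K L0 by (intro mult_mono) (auto simp: r_def abs_minus_commute)
          also have "\<dots> = \<epsilon> / 3"
          proof -
            have kk: "k * (\<epsilon> / (3 * k)) = \<epsilon> / 3" if "k > 0" for k using that by simp
            have "K + L + 1 > 0" using K(1) L0 by simp
            then show ?thesis by (rule kk)
          qed
          finally show ?thesis .
        qed
        have "r \<le> 1" by (simp add: r_def)
        then have bY: "\<bar>X\<bar> \<le> real n" "\<bar>Y\<bar> \<le> real n" "\<bar>Y'\<bar> \<le> real n" using n Y'(2) by linarith+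
        obtain s where s: "s > 0" "\<And>x. \<bar>x - X\<bar> < s \<Longrightarrow> \<bar>F x Y' - F X Y' - f X Y' * (x - X)\<bar> \<le> (\<epsilon> / 3) * \<bar>x - X\<bar>"
          using DERIV_linear_approx[of "\<lambda>X. F X Y'" "f X Y'" X "\<epsilon> / 3"] elim(1) Y'(1) e by auto
        have "norm (F y Y - F X Y - f X Y * (y - X)) \<le> \<epsilon> * norm (y - X)" if y: "norm (y - X) < min s 1" for y
        proof -
          have by_: "\<bar>y\<bar> \<le> real n" using y n by auto
          have 1: "\<bar>F y Y' - F X Y' - f X Y' * (y - X)\<bar> \<le> (\<epsilon> / 3) * \<bar>y - X\<bar>" using y by (intro s) simp
          have "\<bar>F y Y - F X Y - F y Y' + F X Y'\<bar> \<le> L * (\<bar>y - X\<bar> * \<bar>Y - Y'\<bar>)" by (intro rect_boundD(4)[OF L] by_ bY)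
          also have "\<dots> = (L * \<bar>Y - Y'\<bar>) * \<bar>y - X\<bar>" by simp
          also have "\<dots> \<le> (\<epsilon> / 3) * \<bar>y - X\<bar>" using K L0 by (intro mult_right_mono rb) auto
          finally have 2: "\<bar>F y Y - F X Y - F y Y' + F X Y'\<bar> \<le> (\<epsilon> / 3) * \<bar>y - X\<bar>" .
          have "\<bar>f X Y - f X Y'\<bar> \<le> K * \<bar>Y - Y'\<bar>" using K(2) bY by blast
          also have "\<dots> \<le> \<epsilon> / 3" using K L0 by (intro rb) auto
          finally have "\<bar>f X Y - f X Y'\<bar> * \<bar>y - X\<bar> \<le> (\<epsilon> / 3) * \<bar>y - X\<bar>" by (intro mult_right_mono) auto
          then have 3: "\<bar>f X Y * (y - X) - f X Y' * (y - X)\<bar> \<le> (\<epsilon> / 3) * \<bar>y - X\<bar>" by (simp add: abs_mult left_diff_distrib[symmetric])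
          have "\<bar>F y Y - F X Y - f X Y * (y - X)\<bar> \<le> (\<epsilon> / 3) * \<bar>y - X\<bar> + (\<epsilon> / 3) * \<bar>y - X\<bar> + (\<epsilon> / 3) * \<bar>y - X\<bar>"
            using 1 2 3 by linarith
          then show ?thesis by simp
        qed
        then show "\<exists>d>0. \<forall>y. norm (y - X) < d \<longrightarrow> norm (F y Y - F X Y - f X Y * (y - X)) \<le> \<epsilon> * norm (y - X)"
          using s(1) by (intro exI[of _ "min s 1"]) simp
      qed
    qed
  qed
qed

text \<open>The weight that turns an integral over the line into the oriented integral from \<open>r\<close> to \<open>v\<close>.\<close>

definition sg :: "real \<Rightarrow> real \<Rightarrow> real \<Rightarrow> real" where
  "sg r v s = (if r \<le> s \<and> s < v then 1 else if v \<le> s \<and> s < r then -1 else 0)"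

lemma sg_increment: "v \<le> v' \<Longrightarrow> sg r v' s - sg r v s = indicator {v..<v'} s"
  by (auto simp: sg_def indicator_def)

lemma sg_measurable: "sg r v \<in> borel_measurable borel"
  unfolding sg_def by measurable

lemma sg_abs_le: "\<bar>sg r v s\<bar> \<le> 1" and sg_outside: "\<bar>r\<bar> + \<bar>v\<bar> < \<bar>s\<bar> \<Longrightarrow> sg r v s = 0"
  by (auto simp: sg_def)

lemma integral_sg:
  fixes k F :: "real \<Rightarrow> real"
  assumes i: "\<And>a b. a \<le> b \<Longrightarrow> (k has_integral (F b - F a)) {a..b}"
  shows "((\<lambda>s. sg r v s * k s) has_integral (F v - F r)) UNIV"
proof -
  have *: "((\<lambda>s. indicator {a..<b} s * k s) has_integral (F b - F a)) UNIV" if "a \<le> b" for a b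
  proof -
    have "((\<lambda>s. if s \<in> {a..b} then k s else 0) has_integral (F b - F a)) UNIV"
      using i[OF that] by (simp only: has_integral_restrict_UNIV)
    then show ?thesis
      by (rule has_integral_spike[where S="{b}", rotated 2]) (auto simp: indicator_def)
  qed
  show ?thesis
  proof (cases "r \<le> v")
    case True
    then have "sg r v s = indicator {r..<v} s" for s by (auto simp: sg_def indicator_def)
    then show ?thesis using *[OF True] by simp
  next
    case False
    then have e: "sg r v s = - indicator {v..<r} s" for s by (auto simp: sg_def indicator_def)
    have "((\<lambda>s. - (indicator {v..<r} s * k s)) has_integral - (F r - F v)) UNIV"
      by (intro has_integral_neg *) (use False in simp)
    then show ?thesis by (simp add: e)
  qed
qed

section \<open>A potential for the form p dX - q dY\<close>

text \<open>The oriented double integral of \<open>h\<close> over the rectangle with opposite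
  corners \<open>(X0, Y0)\<close> and \<open>(X, Y)\<close>.\<close>

definition dbl :: "real \<Rightarrow> real \<Rightarrow> (real \<times> real \<Rightarrow> real) \<Rightarrow> real \<Rightarrow> real \<Rightarrow> real" where
  "dbl X0 Y0 h X Y = (LINT z|(lborel \<Otimes>\<^sub>M lborel). sg X0 X (fst z) * sg Y0 Y (snd z) * h z)"

lemma dbl_increment:
  fixes h :: "real \<times> real \<Rightarrow> real"
  assumes int: "\<And>X Y. integrable (lborel \<Otimes>\<^sub>M lborel) (\<lambda>z. sg X0 X (fst z) * sg Y0 Y (snd z) * h z)"
    and le: "X1 \<le> X2"
  shows "((\<lambda>s. LINT r|lborel. sg Y0 Y r * h (s, r)) has_integral (dbl X0 Y0 h X2 Y - dbl X0 Y0 h X1 Y)) {X1..X2}"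
proof -
  define k where "k s = (LINT r|lborel. sg Y0 Y r * h (s, r))" for s
  have i: "integrable (lborel \<Otimes>\<^sub>M lborel) (\<lambda>z. indicator {X1..<X2} (fst z) * sg Y0 Y (snd z) * h z)"
    and d: "dbl X0 Y0 h X2 Y - dbl X0 Y0 h X1 Y = (LINT z|(lborel \<Otimes>\<^sub>M lborel). indicator {X1..<X2} (fst z) * sg Y0 Y (snd z) * h z)"
  proof -
    have eq: "sg X0 X2 (fst z) * sg Y0 Y (snd z) * h z - sg X0 X1 (fst z) * sg Y0 Y (snd z) * h z =
        indicator {X1..<X2} (fst z) * sg Y0 Y (snd z) * h z" for z
      unfolding sg_increment[OF le, of X0, symmetric] by (simp add: algebra_simps)
    show "integrable (lborel \<Otimes>\<^sub>M lborel) (\<lambda>z. indicator {X1..<X2} (fst z) * sg Y0 Y (snd z) * h z)"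
      using Bochner_Integration.integrable_diff[OF int[of X2 Y] int[of X1 Y]] unfolding eq .
    show "dbl X0 Y0 h X2 Y - dbl X0 Y0 h X1 Y = (LINT z|(lborel \<Otimes>\<^sub>M lborel). indicator {X1..<X2} (fst z) * sg Y0 Y (snd z) * h z)"
      unfolding dbl_def Bochner_Integration.integral_diff[OF int[of X2 Y] int[of X1 Y], symmetric] eq ..
  qed
  have inner: "(LINT r|lborel. indicator {X1..<X2} (fst (s, r)) * sg Y0 Y (snd (s, r)) * h (s, r)) = indicator {X1..<X2} s * k s" for s
    unfolding k_def by (simp add: mult.assoc)
  have "integrable lborel (\<lambda>s. indicator {X1..<X2} s * k s)"
    using lborel_pair.integrable_fst'[OF i] unfolding inner .
  from has_integral_integral_lborel[OF this]
  have "((\<lambda>s. indicator {X1..<X2} s * k s) has_integral (dbl X0 Y0 h X2 Y - dbl X0 Y0 h X1 Y)) UNIV"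
    using lborel_pair.integral_fst'[OF i] unfolding inner d by simp
  then have "((\<lambda>s. if s \<in> {X1..X2} then k s else 0) has_integral (dbl X0 Y0 h X2 Y - dbl X0 Y0 h X1 Y)) UNIV"
    by (rule has_integral_spike[where S="{X2}", rotated 2]) (auto simp: indicator_def)
  then show ?thesis unfolding has_integral_restrict_UNIV k_def .
qed

lemma dbl_swap:
  fixes h :: "real \<times> real \<Rightarrow> real"
  assumes int: "\<And>X Y. integrable (lborel \<Otimes>\<^sub>M lborel) (\<lambda>z. sg X0 X (fst z) * sg Y0 Y (snd z) * h z)"
  shows "integrable (lborel \<Otimes>\<^sub>M lborel) (\<lambda>z. sg Y0 Y (fst z) * sg X0 X (snd z) * h (snd z, fst z))"
    "dbl Y0 X0 (\<lambda>z. h (snd z, fst z)) Y X = dbl X0 Y0 h X Y"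
  using lborel_pair.integrable_product_swap[OF int[of X Y]] lborel_pair.integral_product_swap[OF borel_measurable_integrable[OF int[of X Y]]]
  by (simp_all add: dbl_def case_prod_beta' mult.commute mult.left_commute)

text \<open>The equations \<open>p_Y = h\<close> and \<open>q_X = - h\<close> say that
  \<open>p dX - q dY\<close> is closed. Its potential is assembled from integrals along two base
  lines and the double integral of \<open>h\<close>; Fubini then gives the increments on every line,
  although the equations hold only on almost every one.\<close>

lemma mixed_potential_exists:
  assumes p: "lbm p" and q: "lbm q" and h: "lbm h" and ip: "Yint p h" and iq: "Xint q (\<lambda>X Y. - h X Y)"
  obtains m where "\<And>X1 X2 Y. X1 \<le> X2 \<Longrightarrow> ((\<lambda>s. p s Y) has_integral (m X2 Y - m X1 Y)) {X1..X2}"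
    "\<And>X Y1 Y2. Y1 \<le> Y2 \<Longrightarrow> ((\<lambda>r. q X r) has_integral (m X Y1 - m X Y2)) {Y1..Y2}"
proof -
  have hm: "(\<lambda>p. h (fst p) (snd p)) \<in> borel_measurable lebesgue" using h by (simp add: lbm_def)
  obtain h' where h': "h' \<in> borel_measurable borel"
    "AE z in lborel \<Otimes>\<^sub>M lborel. h (fst z) (snd z) = h' z"
    "AE X in lborel. AE Y in lborel. h (fst (X, Y)) (snd (X, Y)) = h' (X, Y)"
    "AE Y in lborel. AE X in lborel. h (fst (X, Y)) (snd (X, Y)) = h' (X, Y)"
    by (rule lebesgue_plane_borel_version[OF hm])
  have sets: "sets (lborel \<Otimes>\<^sub>M lborel) = sets (borel :: (real \<times> real) measure)" unfolding lborel_prod by simp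
  have h'm: "h' \<in> borel_measurable (lborel \<Otimes>\<^sub>M lborel)" unfolding lborel_prod using h'(1) by simp
  have ae_ex: "\<exists>X. P X" if aeP: "AE X in lborel. P (X::real)" for P
  proof (rule ccontr)
    assume no: "\<not> ?thesis"
    obtain N where N: "N \<in> null_sets lborel" "{X. \<not> P X} \<subseteq> N" using aeP unfolding eventually_ae_filter by auto
    then have "N = UNIV" using no by auto
    then show False using N(1) by (auto simp: null_sets_def)
  qed
  obtain X0 where X0: "\<forall>a b. set_integrable lebesgue {a..b} (q X0)" using ae_ex[OF lbm_section[OF q]] by blast
  obtain Y0 where Y0: "\<forall>a b. set_integrable lebesgue {a..b} (\<lambda>X. p X Y0)" using ae_ex[OF lbm_section[OF lbm_swap[OF p]]] by blast
  define P where "P X = (LINT s=ereal 0..ereal X|lebesgue. p s Y0)" for X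
  define Q where "Q Y = (LINT r=ereal 0..ereal Y|lebesgue. q X0 r)" for Y
  have Pi: "((\<lambda>s. p s Y0) has_integral (P X2 - P X1)) {X1..X2}" if "X1 \<le> X2" for X1 X2
    unfolding P_def by (rule has_integral_interval_lebesgue_integral[OF _ that]) (use Y0 in blast)
  have Qi: "(q X0 has_integral (Q Y2 - Q Y1)) {Y1..Y2}" if "Y1 \<le> Y2" for Y1 Y2
    unfolding Q_def by (rule has_integral_interval_lebesgue_integral[OF _ that]) (use X0 in blast)
  have int: "integrable (lborel \<Otimes>\<^sub>M lborel) (\<lambda>z. sg X0 X (fst z) * sg Y0 Y (snd z) * h' z)" for X Y
  proof -
    define M where "M = \<bar>X0\<bar> + \<bar>X\<bar> + \<bar>Y0\<bar> + \<bar>Y\<bar>"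
    obtain B where B: "B \<ge> 0" "\<And>X Y. \<bar>X\<bar> \<le> M \<Longrightarrow> \<bar>Y\<bar> \<le> M \<Longrightarrow> \<bar>h X Y\<bar> \<le> B" using lbmD[OF h, where M=M] by blast
    define A where "A = {-M..M} \<times> {-M..M}"
    have out: "sg X0 X (fst z) * sg Y0 Y (snd z) = 0" if "z \<notin> A" for z
    proof -
      have "\<bar>fst z\<bar> > M \<or> \<bar>snd z\<bar> > M" using that by (cases z) (auto simp: A_def abs_le_iff not_le)
      then have "\<bar>X0\<bar> + \<bar>X\<bar> < \<bar>fst z\<bar> \<or> \<bar>Y0\<bar> + \<bar>Y\<bar> < \<bar>snd z\<bar>" unfolding M_def by linarith
      then show ?thesis using sg_outside[of X0 X "fst z"] sg_outside[of Y0 Y "snd z"] by auto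
    qed
    show ?thesis
    proof (rule integrableI_bounded_set[where A=A and B=B])
      show "A \<in> sets (lborel \<Otimes>\<^sub>M lborel)" unfolding A_def by (intro pair_measureI) auto
      have f: "(\<lambda>z. fst z) \<in> borel_measurable (lborel \<Otimes>\<^sub>M (lborel :: real measure))" for f :: "real \<Rightarrow> real"
        unfolding lborel_prod by (simp add: borel_measurable_continuous_onI continuous_on_fst)
      have g: "(\<lambda>z. snd z) \<in> borel_measurable ((lborel :: real measure) \<Otimes>\<^sub>M lborel)"
        unfolding lborel_prod by (simp add: borel_measurable_continuous_onI continuous_on_snd)
      show "(\<lambda>z. sg X0 X (fst z) * sg Y0 Y (snd z) * h' z) \<in> borel_measurable (lborel \<Otimes>\<^sub>M lborel)"
        by (intro borel_measurable_times h'm measurable_compose[OF f sg_measurable] measurable_compose[OF g sg_measurable])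
      have "bounded A" unfolding A_def by (intro bounded_Times) auto
      then show "emeasure (lborel \<Otimes>\<^sub>M lborel) A < \<infinity>" unfolding lborel_prod by (rule emeasure_bounded_finite)
      show "AE z in lborel \<Otimes>\<^sub>M lborel. z \<in> A \<longrightarrow> norm (sg X0 X (fst z) * sg Y0 Y (snd z) * h' z) \<le> B"
        using h'(2)
      proof eventually_elim
        case (elim z)
        show ?case
        proof
          assume z: "z \<in> A"
          then have "\<bar>h' z\<bar> \<le> B" unfolding elim[symmetric] by (intro B) (auto simp: A_def)
          then have "\<bar>sg X0 X (fst z)\<bar> * \<bar>sg Y0 Y (snd z)\<bar> * \<bar>h' z\<bar> \<le> 1 * 1 * B"
            by (intro mult_mono sg_abs_le) auto
          then show "norm (sg X0 X (fst z) * sg Y0 Y (snd z) * h' z) \<le> B" by (simp add: abs_mult)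
        qed
      qed
      show "AE z in lborel \<Otimes>\<^sub>M lborel. z \<notin> A \<longrightarrow> sg X0 X (fst z) * sg Y0 Y (snd z) * h' z = 0"
        by (rule AE_I2) (use out in auto)
    qed
  qed
  have inner: "(LINT r|lborel. sg Y0 Y r * k' r) = F Y - F Y0"
    if k: "\<And>a b. a \<le> b \<Longrightarrow> (k has_integral (F b - F a)) {a..b}" and ae: "AE r in lborel. k r = k' r"
      and i: "integrable lborel (\<lambda>r. sg Y0 Y r * k' r)" for k k' F :: "real \<Rightarrow> real" and Y0 Y
  proof -
    have "AE r in lebesgue. k r = k' r" by (rule AE_completion[OF ae])
    then obtain N where N: "negligible N" "{r. k r \<noteq> k' r} \<subseteq> N"
      unfolding eventually_ae_filter by (auto simp: negligible_iff_null_sets)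
    have "((\<lambda>r. sg Y0 Y r * k r) has_integral (F Y - F Y0)) UNIV" by (rule integral_sg[OF k])
    then have "((\<lambda>r. sg Y0 Y r * k' r) has_integral (F Y - F Y0)) UNIV"
    proof (rule has_integral_spike[OF N(1), rotated])
      fix r assume "r \<in> UNIV - N"
      then have "k r = k' r" using N(2) by blast
      then show "sg Y0 Y r * k' r = sg Y0 Y r * k r" by simp
    qed
    then show ?thesis using has_integral_integral_lborel[OF i] has_integral_unique by blast
  qed
  define m where "m X Y = P X - Q Y + dbl X0 Y0 h' X Y" for X Y
  show thesis
  proof
    fix X1 X2 Y :: real assume le: "X1 \<le> X2"
    have "AE s in lborel. s \<in> {X1..<X2} \<longrightarrow> integrable lborel (\<lambda>r. sg Y0 Y r * h' (s, r))"
    proof -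
      \<comment> \<open>The weights at \<open>X\<close> and \<open>-X\<close> differ by 1 on all of
        \<open>{X1..<X2}\<close>, so integrability over the plane gives integrability of almost
        every section there.\<close>
      define X where "X = \<bar>X1\<bar> + \<bar>X2\<bar> + \<bar>X0\<bar> + 1"
      have "AE s in lborel. integrable lborel (\<lambda>r. (sg X0 X (fst (s, r)) - sg X0 (-X) (fst (s, r))) * sg Y0 Y (snd (s, r)) * h' (s, r))"
        using lborel_pair.AE_integrable_fst'[OF Bochner_Integration.integrable_diff[OF int[of X Y] int[of "-X" Y]]]
        by (simp add: left_diff_distrib)
      then show ?thesis
      proof eventually_elim
        case (elim s)
        show ?case
        proof
          assume "s \<in> {X1..<X2}"
          then have "sg X0 X s - sg X0 (-X) s = 1" by (subst sg_increment) (auto simp: X_def indicator_def)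
          then show "integrable lborel (\<lambda>r. sg Y0 Y r * h' (s, r))" using elim by simp
        qed
      qed
    qed
    moreover have "AE s in lborel. AE r in lborel. h s r = h' (s, r)" using h'(3) by simp
    moreover note ip[unfolded Yint_def]
    moreover have "AE s in lborel. s \<noteq> X2" by (rule AE_lborel_singleton)
    ultimately have "AE s in lborel. s \<in> {X1..X2} \<longrightarrow> (LINT r|lborel. sg Y0 Y r * h' (s, r)) = p s Y - p s Y0"
    proof eventually_elim
      case (elim s)
      show ?case
      proof
        assume "s \<in> {X1..X2}"
        then have "s \<in> {X1..<X2}" using elim(4) by auto
        then show "(LINT r|lborel. sg Y0 Y r * h' (s, r)) = p s Y - p s Y0"
          by (intro inner[of "h s" "p s"]) (use elim in auto)
      qed
    qed
    then have "AE s in lebesgue. s \<in> {X1..X2} \<longrightarrow> (LINT r|lborel. sg Y0 Y r * h' (s, r)) = p s Y - p s Y0"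
      by (rule AE_completion)
    then obtain N where N: "negligible N"
      "{s. \<not> (s \<in> {X1..X2} \<longrightarrow> (LINT r|lborel. sg Y0 Y r * h' (s, r)) = p s Y - p s Y0)} \<subseteq> N"
      unfolding eventually_ae_filter by (auto simp: negligible_iff_null_sets)
    have "((\<lambda>s. p s Y - p s Y0) has_integral (dbl X0 Y0 h' X2 Y - dbl X0 Y0 h' X1 Y)) {X1..X2}"
      by (rule has_integral_spike[OF N(1) _ dbl_increment[OF int le]]) (use N(2) in force)
    from has_integral_add[OF this Pi[OF le]]
    show "((\<lambda>s. p s Y) has_integral (m X2 Y - m X1 Y)) {X1..X2}"
      by (simp add: m_def algebra_simps)
  next
    fix X Y1 Y2 :: real assume le: "Y1 \<le> Y2"
    let ?h = "\<lambda>z. h' (snd z, fst z)"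
    note int' = dbl_swap(1)[OF int] and dsw = dbl_swap(2)[OF int]
    have "AE r in lborel. r \<in> {Y1..<Y2} \<longrightarrow> integrable lborel (\<lambda>s. sg X0 X s * h' (s, r))"
    proof -
      define Y where "Y = \<bar>Y1\<bar> + \<bar>Y2\<bar> + \<bar>Y0\<bar> + 1"
      have "AE r in lborel. integrable lborel (\<lambda>s. (sg Y0 Y (fst (r, s)) - sg Y0 (-Y) (fst (r, s))) * sg X0 X (snd (r, s)) * ?h (r, s))"
        using lborel_pair.AE_integrable_fst'[OF Bochner_Integration.integrable_diff[OF int'[of Y X] int'[of "-Y" X]]]
        by (simp add: left_diff_distrib)
      then show ?thesis
      proof eventually_elim
        case (elim r)
        show ?case
        proof
          assume "r \<in> {Y1..<Y2}"
          then have "sg Y0 Y r - sg Y0 (-Y) r = 1" by (subst sg_increment) (auto simp: Y_def indicator_def)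
          then show "integrable lborel (\<lambda>s. sg X0 X s * h' (s, r))" using elim by simp
        qed
      qed
    qed
    moreover have "AE r in lborel. AE s in lborel. h s r = h' (s, r)" using h'(4) by simp
    moreover note iq[unfolded Yint_def]
    moreover have "AE r in lborel. r \<noteq> Y2" by (rule AE_lborel_singleton)
    ultimately have "AE r in lborel. r \<in> {Y1..Y2} \<longrightarrow> (LINT s|lborel. sg X0 X s * h' (s, r)) = q X0 r - q X r"
    proof eventually_elim
      case (elim r)
      show ?case
      proof
        assume "r \<in> {Y1..Y2}"
        then have r: "r \<in> {Y1..<Y2}" using elim(4) by auto
        have hi: "((\<lambda>s. h s r) has_integral (- q v r - - q w r)) {w..v}" if "w \<le> v" for w v
        proof -
          have "((\<lambda>s. - h s r) has_integral (q v r - q w r)) {w..v}" using elim(3) that by blast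
          from has_integral_neg[OF this] show ?thesis by simp
        qed
        have "(LINT s|lborel. sg X0 X s * h' (s, r)) = - q X r - - q X0 r"
          by (intro inner[of "\<lambda>s. h s r" "\<lambda>s. - q s r"] hi) (use elim r in auto)
        then show "(LINT s|lborel. sg X0 X s * h' (s, r)) = q X0 r - q X r" by simp
      qed
    qed
    then have "AE r in lebesgue. r \<in> {Y1..Y2} \<longrightarrow> (LINT s|lborel. sg X0 X s * h' (s, r)) = q X0 r - q X r"
      by (rule AE_completion)
    then obtain N where N: "negligible N"
      "{r. \<not> (r \<in> {Y1..Y2} \<longrightarrow> (LINT s|lborel. sg X0 X s * h' (s, r)) = q X0 r - q X r)} \<subseteq> N"
      unfolding eventually_ae_filter by (auto simp: negligible_iff_null_sets)
    have "((\<lambda>r. LINT s|lborel. sg X0 X s * h' (s, r)) has_integral (dbl X0 Y0 h' X Y2 - dbl X0 Y0 h' X Y1)) {Y1..Y2}"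
      using dbl_increment[OF int' le, of X] by (simp add: dsw)
    then have "((\<lambda>r. q X0 r - q X r) has_integral (dbl X0 Y0 h' X Y2 - dbl X0 Y0 h' X Y1)) {Y1..Y2}"
      by (rule has_integral_spike[OF N(1), rotated]) (use N(2) in force)
    from has_integral_diff[OF Qi[OF le] this]
    show "((\<lambda>r. q X r) has_integral (m X Y1 - m X Y2)) {Y1..Y2}"
      by (simp add: m_def algebra_simps)
  qed
qed

section \<open>Continuity, positivity and behaviour near the initial curve\<close>

lemma locally_lipschitz_plane_continuous:
  assumes "locally_lipschitz_plane f" shows "continuous_on UNIV (\<lambda>p. f (fst p) (snd p))"
  unfolding continuous_on_eq_continuous_at[OF open_UNIV]
proof
  fix p :: "real \<times> real"
  have "compact (cball p 1)" by simp
  then obtain L where "L-lipschitz_on (cball p 1) (\<lambda>(X, Y). f X Y)"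
    using assms unfolding locally_lipschitz_plane_def by blast
  then have "continuous_on (cball p 1) (\<lambda>(X, Y). f X Y)" by (rule lipschitz_on_continuous_on)
  then have "isCont (\<lambda>(X, Y). f X Y) p" by (rule continuous_on_interior) simp
  then show "isCont (\<lambda>p. f (fst p) (snd p)) p" by (simp add: case_prod_beta')
qed

lemma has_integral_imp_continuous:
  fixes f F :: "real \<Rightarrow> real"
  assumes i: "\<And>a b. a \<le> b \<Longrightarrow> (f has_integral (F b - F a)) {a..b}"
  shows "continuous_on UNIV F"
  unfolding continuous_on_eq_continuous_at[OF open_UNIV]
proof
  fix x :: real
  have "f integrable_on {x - 1..x + 1}" using i[of "x - 1" "x + 1"] by (auto simp: integrable_on_def)
  then have "continuous_on {x - 1..x + 1} (\<lambda>y. F (x - 1) + integral {x - 1..y} f)"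
    by (intro continuous_intros indefinite_integral_continuous_1)
  then have "continuous_on {x - 1..x + 1} F"
  proof (rule continuous_on_eq)
    fix y assume "y \<in> {x - 1..x + 1}"
    then have "integral {x - 1..y} f = F y - F (x - 1)" by (intro integral_unique i) simp
    then show "F (x - 1) + integral {x - 1..y} f = F y" by simp
  qed
  then show "isCont F x" by (rule continuous_on_interior) simp
qed

lemma abs_continuous_fun_continuous:
  assumes "abs_continuous_fun f" shows "continuous_on UNIV f"
  unfolding continuous_on_iff
proof (intro ballI allI impI)
  fix x \<epsilon> :: real assume e: "\<epsilon> > 0"
  obtain \<delta> where \<delta>: "\<delta> > 0" "\<forall>D :: (real \<times> real) set. finite D \<and> (\<forall>(a, b)\<in>D. a < b) \<and>
        pairwise (\<lambda>I J. {fst I<..<snd I} \<inter> {fst J<..<snd J} = {}) D \<and>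
        (\<Sum>(a, b)\<in>D. b - a) < \<delta> \<longrightarrow> (\<Sum>(a, b)\<in>D. \<bar>f b - f a\<bar>) < \<epsilon>"
    using assms[unfolded abs_continuous_fun_def, rule_format, OF e] by (elim exE conjE)
  have *: "\<bar>f b - f a\<bar> < \<epsilon>" if "a < b" "b - a < \<delta>" for a b
    using \<delta>(2)[rule_format, of "{(a, b)}"] that by simp
  have "dist (f y) (f x) < \<epsilon>" if d: "dist y x < \<delta>" for y
  proof (cases x y rule: linorder_cases)
    case less
    then show ?thesis using *[of x y] d by (simp add: dist_real_def)
  next
    case greater
    then show ?thesis using *[of y x] d by (simp add: dist_real_def abs_minus_commute)
  qed (use e in simp)
  then show "\<exists>\<delta>>0. \<forall>y\<in>UNIV. dist y x < \<delta> \<longrightarrow> dist (f y) (f x) < \<epsilon>" using \<delta>(1) by auto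
qed

text \<open>A solution of a linear equation that is 1 somewhere has no zero: near a zero,
  \<open>\<bar>P\<bar>\<close> is at most half of its own maximum, so the zero set is open as well
  as closed, and it misses \<open>r\<close>. By the intermediate value theorem \<open>P\<close>
  keeps the sign it has at \<open>r\<close>.\<close>

lemma nonvanishing_of_linear_equation:
  fixes P :: "real \<Rightarrow> real"
  assumes step: "\<And>M. \<exists>B\<ge>0. \<forall>a b. -M \<le> a \<longrightarrow> a \<le> b \<longrightarrow> b \<le> M \<longrightarrow>
      (\<exists>h. (h has_integral (P b - P a)) {a..b} \<and> (\<forall>s\<in>{a..b}. \<bar>h s\<bar> \<le> B * \<bar>P s\<bar>))"
    and c: "continuous_on UNIV P" and one: "P r = 1"
  shows "0 \<le> P y"
proof -
  let ?Z = "{y. P y = 0}"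
  have "closed ?Z" using c by (intro closed_Collect_eq) auto
  moreover have "open ?Z"
    unfolding open_dist
  proof
    fix y assume y: "y \<in> ?Z"
    obtain B where B: "B \<ge> 0" "\<And>a b. - (\<bar>y\<bar> + 1) \<le> a \<Longrightarrow> a \<le> b \<Longrightarrow> b \<le> \<bar>y\<bar> + 1 \<Longrightarrow>
      (\<exists>h. (h has_integral (P b - P a)) {a..b} \<and> (\<forall>s\<in>{a..b}. \<bar>h s\<bar> \<le> B * \<bar>P s\<bar>))"
      using step[of "\<bar>y\<bar> + 1"] by blast
    \<comment> \<open>This gives \<open>B * \<delta> \<le> 1 / 2\<close>, with \<open>B + 1\<close>
      in case \<open>B = 0\<close>; the bound 1 keeps the interval inside the range where
      \<open>B\<close> is valid.\<close>
    define \<delta> where "\<delta> = min 1 (1 / (2 * (B + 1)))"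
    have \<delta>: "\<delta> > 0" "\<delta> \<le> 1" using B(1) by (auto simp: \<delta>_def)
    have "B * \<delta> \<le> (B + 1) * (1 / (2 * (B + 1)))" using B(1) by (intro mult_mono) (auto simp: \<delta>_def)
    also have "\<dots> = 1 / 2" by (rule cancel_double) (use B(1) in simp)
    finally have B\<delta>: "B * \<delta> \<le> 1 / 2" .
    have "continuous_on {y - \<delta>..y + \<delta>} (\<lambda>s. \<bar>P s\<bar>)"
      by (intro continuous_intros continuous_on_subset[OF c]) auto
    then obtain m where m: "m \<in> {y - \<delta>..y + \<delta>}" "\<And>s. s \<in> {y - \<delta>..y + \<delta>} \<Longrightarrow> \<bar>P s\<bar> \<le> \<bar>P m\<bar>"
      using continuous_attains_sup[of "{y - \<delta>..y + \<delta>}" "\<lambda>s. \<bar>P s\<bar>"] \<delta> by auto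
    have seg: "\<bar>P b - P a\<bar> \<le> (B * \<bar>P m\<bar>) * (b - a)" if ab: "y - \<delta> \<le> a" "a \<le> b" "b \<le> y + \<delta>" for a b
    proof -
      have "- (\<bar>y\<bar> + 1) \<le> a" "b \<le> \<bar>y\<bar> + 1" using ab \<delta>(2) by linarith+
      then obtain h where h: "(h has_integral (P b - P a)) {a..b}" "\<forall>s\<in>{a..b}. \<bar>h s\<bar> \<le> B * \<bar>P s\<bar>"
        using B(2)[OF _ ab(2)] by blast
      show ?thesis
      proof (rule has_integral_abs_le[OF h(1) _ ab(2)])
        fix s assume s: "s \<in> {a..b}"
        then have "\<bar>P s\<bar> \<le> \<bar>P m\<bar>" using ab by (intro m) auto
        then have "B * \<bar>P s\<bar> \<le> B * \<bar>P m\<bar>" using B(1) by (rule mult_left_mono)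
        then show "\<bar>h s\<bar> \<le> B * \<bar>P m\<bar>" using h(2) s by force
      qed (use B(1) in simp)
    qed
    have "\<bar>P m\<bar> \<le> (B * \<bar>P m\<bar>) * \<delta>"
    proof -
      have "\<bar>P m\<bar> \<le> (B * \<bar>P m\<bar>) * \<bar>m - y\<bar>"
        using seg[of y m] seg[of m y] m(1) y \<delta> by (cases "y \<le> m") auto
      also have "\<dots> \<le> (B * \<bar>P m\<bar>) * \<delta>" using m(1) B(1) by (intro mult_left_mono) auto
      finally show ?thesis .
    qed
    also have "\<dots> = (B * \<delta>) * \<bar>P m\<bar>" by simp
    also have "\<dots> \<le> (1 / 2) * \<bar>P m\<bar>" by (intro mult_right_mono B\<delta>) simp
    finally have "P m = 0" by simp
    then have zero: "P s = 0" if "s \<in> {y - \<delta>..y + \<delta>}" for s using m(2)[OF that] by simp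
    have "P s = 0" if "dist s y < \<delta>" for s
      by (rule zero) (use that in \<open>simp add: dist_real_def abs_less_iff\<close>)
    then show "\<exists>e>0. \<forall>s. dist s y < e \<longrightarrow> s \<in> ?Z" using \<delta>(1) by auto
  qed
  ultimately have "?Z = {} \<or> ?Z = UNIV" using clopen[of ?Z] by simp
  moreover have "r \<notin> ?Z" using one by simp
  ultimately have "?Z = {}" by auto
  then have nz: "P s \<noteq> 0" for s by auto
  show ?thesis
  proof (rule ccontr)
    assume "\<not> 0 \<le> P y"
    then have neg: "P y < 0" by simp
    have "\<exists>s. P s = 0"
    proof (cases "y \<le> r")
      case True
      then show ?thesis using IVT'[of P y 0 r, OF _ _ True continuous_on_subset[OF c subset_UNIV]] neg one by auto
    next
      case False
      then have "r \<le> y" by simp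
      then show ?thesis using IVT2'[of P y 0 r, OF _ _ _ continuous_on_subset[OF c subset_UNIV]] neg one by auto
    qed
    then show False using nz by blast
  qed
qed

lemma linear_equation_nonneg:
  assumes p: "lbm p" and G: "lbm G" and i: "Yint p (\<lambda>X Y. G X Y * p X Y)"
    and one: "AE X in lborel. p X (\<theta> X) = 1"
  shows "AE X in lborel. \<forall>Y. 0 \<le> p X Y"
  using i[unfolded Yint_def] one
proof eventually_elim
  case (elim X)
  show ?case
  proof
    fix Y
    show "0 \<le> p X Y"
    proof (rule nonvanishing_of_linear_equation[where P="p X"])
      show "continuous_on UNIV (p X)" by (rule has_integral_imp_continuous) (use elim(1) in blast)
      show "p X (\<theta> X) = 1" by (rule elim(2))
      fix M
      obtain B where B: "B \<ge> 0" "\<And>X' Y. \<bar>X'\<bar> \<le> \<bar>X\<bar> + \<bar>M\<bar> \<Longrightarrow> \<bar>Y\<bar> \<le> \<bar>X\<bar> + \<bar>M\<bar> \<Longrightarrow> \<bar>G X' Y\<bar> \<le> B"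
        using lbmD[OF G, where M="\<bar>X\<bar> + \<bar>M\<bar>"] by blast
      have "\<exists>h. (h has_integral (p X b - p X a)) {a..b} \<and> (\<forall>s\<in>{a..b}. \<bar>h s\<bar> \<le> B * \<bar>p X s\<bar>)"
        if "-M \<le> a" "a \<le> b" "b \<le> M" for a b
      proof (intro exI conjI ballI)
        show "((\<lambda>Y. G X Y * p X Y) has_integral (p X b - p X a)) {a..b}" using elim(1) that by blast
        fix s assume "s \<in> {a..b}"
        then have "\<bar>G X s\<bar> \<le> B" using that by (intro B) auto
        then show "\<bar>G X s * p X s\<bar> \<le> B * \<bar>p X s\<bar>" by (simp add: abs_mult mult_right_mono)
      qed
      then show "\<exists>B\<ge>0. \<forall>a b. -M \<le> a \<longrightarrow> a \<le> b \<longrightarrow> b \<le> M \<longrightarrow>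
        (\<exists>h. (h has_integral (p X b - p X a)) {a..b} \<and> (\<forall>s\<in>{a..b}. \<bar>h s\<bar> \<le> B * \<bar>p X s\<bar>))"
        using B(1) by blast
    qed
  qed
qed

text \<open>The characteristic angle crosses the value \<open>\<pi>\<close> transversally, so only countably often,
  unless its equation degenerates.\<close>

lemma angle_equation_degenerates:
  assumes i: "Yint w W"
  shows "AE X in lborel. AE Y in lborel. cos (w X Y) = -1 \<longrightarrow> W X Y = 0"
  using i[unfolded Yint_def]
proof eventually_elim
  case (elim X)
  obtain N where N: "negligible N" "\<And>Y. Y \<notin> N \<Longrightarrow> (w X has_real_derivative W X Y) (at Y)"
    using indefinite_integral_deriv_ae[of "W X" "w X"] elim by blast
  define C where "C = (\<Union>n::int. {y. w X y = (2 * real_of_int n + 1) * pi \<and> (\<exists>D. D \<noteq> 0 \<and> (w X has_real_derivative D) (at y))})"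
  have "countable C" unfolding C_def by (intro countable_UN countableI_type countable_level_set_regular_points)
  then have "AE Y in lborel. Y \<notin> C" by (intro AE_not_in countable_imp_null_set_lborel)
  moreover have "AE Y in lebesgue. Y \<notin> N" using N(1) by (intro AE_not_in) (simp add: negligible_iff_null_sets)
  then have "AE Y in lborel. Y \<notin> N" by (simp only: AE_completion_iff)
  ultimately show ?case
  proof eventually_elim
    case (elim Y)
    show ?case
    proof
      assume "cos (w X Y) = -1"
      then obtain n :: int where n: "w X Y = (2 * real_of_int n + 1) * pi" unfolding cos_eq_minus1 by blast
      show "W X Y = 0"
      proof (rule ccontr)
        assume "W X Y \<noteq> 0"
        then have "Y \<in> C" unfolding C_def using n N(2)[OF elim(2)] by blast
        then show False using elim(1) by blast
      qed
    qed
  qed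
qed

text \<open>Since \<open>p\<close> equals 1 on the curve and is Lipschitz in \<open>Y\<close>, it
  differs from 1 on a horizontal segment by at most \<open>L\<close> times the vertical distance to
  the curve. The condition on \<open>\<theta>\<close> bounds that distance by
  \<open>\<bar>Y1 - Y2\<bar>\<close>.\<close>

lemma curve_increment_approx:
  assumes mi: "\<And>X1 X2 Y. X1 \<le> X2 \<Longrightarrow> ((\<lambda>s. p s Y) has_integral (m X2 Y - m X1 Y)) {X1..X2}"
    and pL: "YLip p" and one: "AE X in lborel. p X (\<theta> X) = 1"
  obtains L where "L \<ge> 0" "\<And>X1 X2 Y1 Y2. \<bar>X1\<bar> \<le> M \<Longrightarrow> \<bar>X2\<bar> \<le> M \<Longrightarrow> \<bar>Y1\<bar> \<le> M \<Longrightarrow> \<bar>Y2\<bar> \<le> M \<Longrightarrow> X1 \<le> X2 \<Longrightarrow>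
    \<forall>X. X1 \<le> X \<and> X \<le> X2 \<longrightarrow> \<bar>\<theta> X\<bar> \<le> M \<and> \<bar>Y1 - \<theta> X\<bar> \<le> \<bar>Y1 - Y2\<bar> \<Longrightarrow>
    \<bar>m X2 Y1 - m X1 Y1 - (X2 - X1)\<bar> \<le> L * \<bar>Y1 - Y2\<bar> * (X2 - X1)"
proof -
  obtain L where L: "L \<ge> 0" "AE X in lborel. \<bar>X\<bar> \<le> M \<longrightarrow> (\<forall>Y Y'. \<bar>Y\<bar> \<le> M \<longrightarrow> \<bar>Y'\<bar> \<le> M \<longrightarrow> \<bar>p X Y - p X Y'\<bar> \<le> L * \<bar>Y - Y'\<bar>)"
    using YLipE[OF pL, where M=M] by blast
  have "AE X in lborel. p X (\<theta> X) = 1 \<and> (\<bar>X\<bar> \<le> M \<longrightarrow> (\<forall>Y Y'. \<bar>Y\<bar> \<le> M \<longrightarrow> \<bar>Y'\<bar> \<le> M \<longrightarrow> \<bar>p X Y - p X Y'\<bar> \<le> L * \<bar>Y - Y'\<bar>))"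
    using one L(2) by eventually_elim blast
  then obtain N where N: "N \<in> null_sets lborel"
    "{X. \<not> (p X (\<theta> X) = 1 \<and> (\<bar>X\<bar> \<le> M \<longrightarrow> (\<forall>Y Y'. \<bar>Y\<bar> \<le> M \<longrightarrow> \<bar>Y'\<bar> \<le> M \<longrightarrow> \<bar>p X Y - p X Y'\<bar> \<le> L * \<bar>Y - Y'\<bar>)))} \<subseteq> N"
    unfolding eventually_ae_filter by auto
  have neg: "negligible N" using N(1) by (simp add: negligible_iff_null_sets null_sets_completionI)
  show thesis
  proof (rule that[OF L(1)])
    fix X1 X2 Y1 Y2
    assume b: "\<bar>X1\<bar> \<le> M" "\<bar>X2\<bar> \<le> M" "\<bar>Y1\<bar> \<le> M" "\<bar>Y2\<bar> \<le> M" and le: "X1 \<le> X2"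
      and th: "\<forall>X. X1 \<le> X \<and> X \<le> X2 \<longrightarrow> \<bar>\<theta> X\<bar> \<le> M \<and> \<bar>Y1 - \<theta> X\<bar> \<le> \<bar>Y1 - Y2\<bar>"
    have c1: "((\<lambda>s. 1) has_integral (X2 - X1)) {X1..X2}"
      using has_integral_const_real[of "1::real" X1 X2] le by simp
    have "((\<lambda>s. p s Y1 - 1) has_integral (m X2 Y1 - m X1 Y1 - (X2 - X1))) {X1..X2}"
      by (intro has_integral_diff mi le c1)
    then have i: "((\<lambda>s. if s \<in> N then 0 else p s Y1 - 1) has_integral (m X2 Y1 - m X1 Y1 - (X2 - X1))) {X1..X2}"
      by (rule has_integral_spike[OF neg, rotated]) auto
    show "\<bar>m X2 Y1 - m X1 Y1 - (X2 - X1)\<bar> \<le> L * \<bar>Y1 - Y2\<bar> * (X2 - X1)"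
    proof (rule has_integral_abs_le[OF i _ le])
      fix s assume s: "s \<in> {X1..X2}"
      show "\<bar>if s \<in> N then 0 else p s Y1 - 1\<bar> \<le> L * \<bar>Y1 - Y2\<bar>"
      proof (cases "s \<in> N")
        case False
        have sM: "\<bar>s\<bar> \<le> M" using s b by auto
        have P: "p s (\<theta> s) = 1 \<and> (\<bar>s\<bar> \<le> M \<longrightarrow> (\<forall>Y Y'. \<bar>Y\<bar> \<le> M \<longrightarrow> \<bar>Y'\<bar> \<le> M \<longrightarrow> \<bar>p s Y - p s Y'\<bar> \<le> L * \<bar>Y - Y'\<bar>))"
          using False N(2) by blast
        have t: "\<bar>\<theta> s\<bar> \<le> M" "\<bar>Y1 - \<theta> s\<bar> \<le> \<bar>Y1 - Y2\<bar>" using th[rule_format, of s] s by auto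
        have "\<bar>p s Y1 - p s (\<theta> s)\<bar> \<le> L * \<bar>Y1 - \<theta> s\<bar>" using P sM b(3) t(1) by blast
        also have "\<dots> \<le> L * \<bar>Y1 - Y2\<bar>" using t L(1) by (intro mult_left_mono)
        finally show ?thesis using False P by simp
      qed (use L in simp)
    qed (use L in simp)
  qed
qed

lemma lbm_divide: "lbm f \<Longrightarrow> lbm (\<lambda>X Y. f X Y / r)"
  using lbm_mult[OF _ lbm_const[of "1 / r"]] by simp

lemma lbm_sin: "lbm f \<Longrightarrow> lbm (\<lambda>X Y. sin (f X Y))" and lbm_cos: "lbm f \<Longrightarrow> lbm (\<lambda>X Y. cos (f X Y))"
  by (rule lbm_compose; simp add: continuous_on_sin continuous_on_cos)+

lemma continuous_plane_swap:
  fixes f :: "real \<Rightarrow> real \<Rightarrow> real"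
  assumes "continuous_on UNIV (\<lambda>p. f (fst p) (snd p))"
  shows "continuous_on UNIV (\<lambda>p. f (snd p) (fst p))"
proof -
  have "continuous_on UNIV ((\<lambda>p. f (fst p) (snd p)) \<circ> (\<lambda>p::real \<times> real. (snd p, fst p)))"
    by (intro continuous_on_compose continuous_intros continuous_on_subset[OF assms subset_UNIV])
  then show ?thesis by (simp add: comp_def)
qed

lemma potential_continuous:
  assumes p: "lbm p" and q: "lbm q"
    and mX: "\<And>X1 X2 Y. X1 \<le> X2 \<Longrightarrow> ((\<lambda>s. p s Y) has_integral (m X2 Y - m X1 Y)) {X1..X2}"
    and mY: "\<And>X Y1 Y2. Y1 \<le> Y2 \<Longrightarrow> ((\<lambda>r. q X r) has_integral (m X Y1 - m X Y2)) {Y1..Y2}"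
  shows "continuous_on UNIV (\<lambda>z. m (fst z) (snd z))"
  unfolding continuous_on_eq_continuous_at[OF open_UNIV]
proof
  fix z0 :: "real \<times> real"
  obtain X Y where z0: "z0 = (X, Y)" by (cases z0)
  define M where "M = \<bar>X\<bar> + \<bar>Y\<bar> + 1"
  obtain B where B: "B \<ge> 0" "\<And>X Y. \<bar>X\<bar> \<le> M \<Longrightarrow> \<bar>Y\<bar> \<le> M \<Longrightarrow> \<bar>p X Y\<bar> \<le> B"
    using lbmD[OF p, where M=M] by blast
  obtain C where C: "C \<ge> 0" "\<And>X Y. \<bar>X\<bar> \<le> M \<Longrightarrow> \<bar>Y\<bar> \<le> M \<Longrightarrow> \<bar>q X Y\<bar> \<le> C"
    using lbmD[OF q, where M=M] by blast
  have x: "\<bar>m X2 Y' - m X1 Y'\<bar> \<le> B * (X2 - X1)" if "X1 \<le> X2" "\<bar>X1\<bar> \<le> M" "\<bar>X2\<bar> \<le> M" "\<bar>Y'\<bar> \<le> M" for X1 X2 Y'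
    by (rule has_integral_abs_le[OF mX[OF that(1)] _ that(1) B(1)]) (use that in \<open>auto intro!: B(2)\<close>)
  have y: "\<bar>m X Y1 - m X Y2\<bar> \<le> C * (Y2 - Y1)" if "Y1 \<le> Y2" "\<bar>Y1\<bar> \<le> M" "\<bar>Y2\<bar> \<le> M" for Y1 Y2
    by (rule has_integral_abs_le[OF mY[OF that(1)] _ that(1) C(1)]) (use that in \<open>auto intro!: C(2) simp: M_def\<close>)
  have b: "\<bar>m X' Y' - m X Y\<bar> \<le> B * \<bar>X' - X\<bar> + C * \<bar>Y' - Y\<bar>" if "\<bar>X' - X\<bar> \<le> 1" "\<bar>Y' - Y\<bar> \<le> 1" for X' Y'
  proof -
    have M: "\<bar>X\<bar> \<le> M" "\<bar>X'\<bar> \<le> M" "\<bar>Y\<bar> \<le> M" "\<bar>Y'\<bar> \<le> M" using that by (auto simp: M_def)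
    have "\<bar>m X' Y' - m X Y'\<bar> \<le> B * \<bar>X' - X\<bar>"
      using x[of X X' Y'] x[of X' X Y'] M by (cases "X \<le> X'") (auto simp: abs_minus_commute)
    moreover have "\<bar>m X Y' - m X Y\<bar> \<le> C * \<bar>Y' - Y\<bar>"
      using y[of Y Y'] y[of Y' Y] M by (cases "Y \<le> Y'") (auto simp: abs_minus_commute)
    ultimately show ?thesis by linarith
  qed
  have "((\<lambda>z. B * \<bar>fst z - X\<bar> + C * \<bar>snd z - Y\<bar>) \<longlongrightarrow> B * \<bar>X - X\<bar> + C * \<bar>Y - Y\<bar>) (at z0)"
    unfolding z0 by (intro tendsto_intros tendsto_fst[OF tendsto_ident_at, of "(X, Y)", simplified] tendsto_snd[OF tendsto_ident_at, of "(X, Y)", simplified])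
  then have lim: "((\<lambda>z. B * \<bar>fst z - X\<bar> + C * \<bar>snd z - Y\<bar>) \<longlongrightarrow> 0) (at z0)" by simp
  have "\<forall>\<^sub>F z in at z0. dist z z0 < 1" unfolding eventually_at by (intro exI[of _ 1]) simp
  then have "\<forall>\<^sub>F z in at z0. norm (m (fst z) (snd z) - m X Y) \<le> B * \<bar>fst z - X\<bar> + C * \<bar>snd z - Y\<bar>"
  proof eventually_elim
    case (elim z)
    have "dist (fst z) (fst z0) \<le> dist z z0" "dist (snd z) (snd z0) \<le> dist z z0" by (rule dist_fst_le, rule dist_snd_le)
    then show ?case using b[of "fst z" "snd z"] elim unfolding z0 by (simp add: dist_real_def)
  qed
  from Lim_null_comparison[OF this lim] show "isCont (\<lambda>z. m (fst z) (snd z)) z0"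
    unfolding isCont_def z0 by (simp add: LIM_zero_iff)
qed

text \<open>The coefficients of the system are Lebesgue measurable in the plane, which says nothing
  about their traces on curves. As limits of difference quotients of a continuous \<open>F\<close>
  they are Borel once they are set to 0 on the exceptional lines.\<close>

lemma partial_derivative_borel:
  fixes F :: "real \<Rightarrow> real \<Rightarrow> real"
  assumes F: "continuous_on UNIV (\<lambda>p. F (fst p) (snd p))" and N: "N \<in> null_sets lborel"
    and d: "\<And>X Y. X \<notin> N \<Longrightarrow> ((\<lambda>X. F X Y) has_real_derivative f X Y) (at X)"
  shows "(\<lambda>p. if fst p \<in> N then 0 else f (fst p) (snd p)) \<in> borel_measurable borel"
proof (rule borel_measurable_LIMSEQ_real)
  have Fm: "(\<lambda>p. F (fst p + h) (snd p)) \<in> borel_measurable borel" for h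
  proof -
    have "continuous_on UNIV ((\<lambda>p. F (fst p) (snd p)) \<circ> (\<lambda>p::real \<times> real. (fst p + h, snd p)))"
      by (intro continuous_on_compose continuous_intros continuous_on_subset[OF F subset_UNIV])
    then show ?thesis by (intro borel_measurable_continuous_onI) (simp add: comp_def)
  qed
  have "fst -` N \<in> sets (borel :: (real \<times> real) measure)"
    using N measurable_sets[of fst "borel :: (real \<times> real) measure" borel N]
    by (auto simp: borel_measurable_continuous_onI continuous_on_fst dest: null_setsD2)
  then have s: "{p \<in> space (borel :: (real \<times> real) measure). fst p \<in> N} \<in> sets borel" by (simp add: vimage_def)
  show "(\<lambda>p. if fst p \<in> N then 0 else (F (fst p + 1 / real (Suc n)) (snd p) - F (fst p) (snd p)) * real (Suc n)) \<in> borel_measurable borel" for n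
    using Fm[of "1 / real (Suc n)"] Fm[of 0] s
    by (intro measurable_If borel_measurable_times borel_measurable_diff) auto
  show "(\<lambda>n. if fst p \<in> N then 0 else (F (fst p + 1 / real (Suc n)) (snd p) - F (fst p) (snd p)) * real (Suc n))
      \<longlonglongrightarrow> (if fst p \<in> N then 0 else f (fst p) (snd p))" for p
    using DERIV_imp_forward_quotients[OF d[of "fst p" "snd p"]] by simp
qed

lemma Yint_uminus: "Yint f h \<Longrightarrow> Yint (\<lambda>X Y. - f X Y) (\<lambda>X Y. - h X Y)"
  unfolding Yint_def
proof (erule eventually_mono, intro allI impI)
  fix X Y1 Y2 :: real
  assume "\<forall>Y1 Y2. Y1 \<le> Y2 \<longrightarrow> (h X has_integral f X Y2 - f X Y1) {Y1..Y2}" "Y1 \<le> Y2"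
  then show "((\<lambda>Y. - h X Y) has_integral - f X Y2 - - f X Y1) {Y1..Y2}"
    using has_integral_neg[of "h X" "f X Y2 - f X Y1"] by simp
qed

section \<open>The semilinear system as a wave chart\<close>

locale characteristic_coefficients =
  fixes \<kappa> :: real and c dc :: "real \<Rightarrow> real" and w z p q u t x :: "real \<Rightarrow> real \<Rightarrow> real"
  assumes kappa: "\<kappa> > 0" and c_bounds: "\<And>v. 1 / \<kappa> \<le> c v" "\<And>v. c v \<le> \<kappa>"
    and c_deriv: "\<And>v. (c has_real_derivative dc v) (at v)" and dc_cont: "continuous_on UNIV dc"
    and L: "lbm w" "lbm z" "lbm p" "lbm q"
    and cont: "continuous_on UNIV (\<lambda>p. u (fst p) (snd p))" "continuous_on UNIV (\<lambda>p. t (fst p) (snd p))"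
      "continuous_on UNIV (\<lambda>p. x (fst p) (snd p))"
begin

lemma c_pos: "c v > 0"
  using c_bounds(1)[of v] kappa by (smt (verit) zero_less_divide_1_iff)

lemma c_cont: "continuous_on UNIV c"
  using c_deriv by (meson DERIV_isCont continuous_at_imp_continuous_on)

lemma lbm_u: "lbm u"
  by (rule lbm_continuous[OF cont(1)])

lemma lbm_k: "lbm (\<lambda>X Y. dc (u X Y) / (8 * (c (u X Y))\<^sup>2))"
proof (rule lbm_compose[OF lbm_u])
  show "continuous_on UNIV (\<lambda>v. dc v / (8 * (c v)\<^sup>2))"
    using c_pos by (intro continuous_intros dc_cont c_cont) (simp add: less_imp_neq[symmetric])
qed

lemma lbm_divide_c: "lbm f \<Longrightarrow> lbm (\<lambda>X Y. f X Y / c (u X Y))"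
proof -
  assume f: "lbm f"
  have "continuous_on UNIV (\<lambda>v. 1 / c v)"
    using c_pos by (intro continuous_intros c_cont) (simp add: less_imp_neq[symmetric])
  from lbm_mult[OF f lbm_compose[OF lbm_u this]] show ?thesis by simp
qed

lemma lbm_AX: "lbm (\<lambda>X Y. (1 + cos (w X Y)) * p X Y / 4)" and lbm_AY: "lbm (\<lambda>X Y. (1 + cos (z X Y)) * q X Y / 4)"
  and lbm_GX: "lbm (\<lambda>X Y. sin (w X Y) * p X Y / 4)" and lbm_GY: "lbm (\<lambda>X Y. sin (z X Y) * q X Y / 4)"
  by (rule lbm_divide, rule lbm_mult, (rule lbm_add lbm_sin lbm_cos lbm_const L)+)+

end

text \<open>\<open>\<theta>\<close> and \<open>\<psi>\<close> describe the initial curve as a graph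
  over either axis. In \<open>p_eq\<close> and \<open>q_eq\<close> the unknown stands last, which
  displays them as linear equations.\<close>

locale semilinear = characteristic_coefficients +
  fixes \<theta> \<psi> :: "real \<Rightarrow> real"
  assumes w_eq: "Yint w (\<lambda>X Y. dc (u X Y) / (8 * (c (u X Y))\<^sup>2) * (cos (z X Y) - cos (w X Y)) * q X Y)"
    and z_eq: "Xint z (\<lambda>X Y. dc (u X Y) / (8 * (c (u X Y))\<^sup>2) * (cos (w X Y) - cos (z X Y)) * p X Y)"
    and p_eq: "Yint p (\<lambda>X Y. dc (u X Y) / (8 * (c (u X Y))\<^sup>2) * (sin (z X Y) - sin (w X Y)) * q X Y * p X Y)"
    and q_eq: "Xint q (\<lambda>X Y. dc (u X Y) / (8 * (c (u X Y))\<^sup>2) * (sin (w X Y) - sin (z X Y)) * p X Y * q X Y)"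
    and u_eq: "Xint u (\<lambda>X Y. sin (w X Y) * p X Y / 4 / c (u X Y))" "Yint u (\<lambda>X Y. sin (z X Y) * q X Y / 4 / c (u X Y))"
    and x_eq: "Xint x (\<lambda>X Y. (1 + cos (w X Y)) * p X Y / 4)" "Yint x (\<lambda>X Y. - ((1 + cos (z X Y)) * q X Y / 4))"
    and t_eq: "Xint t (\<lambda>X Y. (1 + cos (w X Y)) * p X Y / 4 / c (u X Y))"
      "Yint t (\<lambda>X Y. (1 + cos (z X Y)) * q X Y / 4 / c (u X Y))"
    and one: "AE X in lborel. p X (\<theta> X) = 1" "AE Y in lborel. q (\<psi> Y) Y = 1"
begin

lemma swap: "semilinear \<kappa> c dc (\<lambda>X Y. z Y X) (\<lambda>X Y. w Y X) (\<lambda>X Y. q Y X) (\<lambda>X Y. p Y X) (\<lambda>X Y. u Y X)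
    (\<lambda>X Y. t Y X) (\<lambda>X Y. - x Y X) \<psi> \<theta>"
proof (unfold_locales, goal_cases)
  case 1 show ?case by (rule kappa)
next
  case 2 show ?case by (rule c_bounds)
next
  case 3 show ?case by (rule c_bounds)
next
  case 4 show ?case by (rule c_deriv)
next
  case 5 show ?case by (rule dc_cont)
next
  case 6 show ?case by (rule lbm_swap[OF L(2)])
next
  case 7 show ?case by (rule lbm_swap[OF L(1)])
next
  case 8 show ?case by (rule lbm_swap[OF L(4)])
next
  case 9 show ?case by (rule lbm_swap[OF L(3)])
next
  case 10 show ?case by (rule continuous_plane_swap[OF cont(1)])
next
  case 11 show ?case by (rule continuous_plane_swap[OF cont(2)])
next
  case 12 show ?case by (intro continuous_on_minus continuous_plane_swap[OF cont(3)])
next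
  case 13 show ?case by (rule z_eq)
next
  case 14 show ?case by (rule w_eq)
next
  case 15 show ?case by (rule q_eq)
next
  case 16 show ?case by (rule p_eq)
next
  case 17 show ?case by (rule u_eq)
next
  case 18 show ?case by (rule u_eq)
next
  case 19 show ?case using Yint_uminus[OF x_eq(2)] by simp
next
  case 20 show ?case by (rule Yint_uminus[OF x_eq(1)])
next
  case 21 show ?case by (rule t_eq)
next
  case 22 show ?case by (rule t_eq)
next
  case 23 show ?case by (rule one)
next
  case 24 show ?case by (rule one)
qed

lemma YLip_p: "YLip p" and YLip_w: "YLip w" and YLip_u: "YLip u"
proof -
  show "YLip p"
    by (rule YLip_of_Yint[OF _ p_eq]) (rule lbm_mult lbm_diff lbm_sin lbm_k L)+
  show "YLip w"
    by (rule YLip_of_Yint[OF _ w_eq]) (rule lbm_mult lbm_diff lbm_cos lbm_k L)+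
  show "YLip u"
    by (rule YLip_of_Yint[OF _ u_eq(2)]) (rule lbm_divide_c lbm_GY)+
qed

text \<open>These functions are \<open>x_X\<close> and \<open>c u_X\<close>. Their Lipschitz
  dependence on the other variable is the origin of the bounded mixed differences.\<close>

lemma YLip_AX: "YLip (\<lambda>X Y. (1 + cos (w X Y)) * p X Y / 4)" and YLip_GX: "YLip (\<lambda>X Y. sin (w X Y) * p X Y / 4)"
proof -
  have "YLip (\<lambda>X Y. (1 + cos (w X Y)) * p X Y * (1 / 4))"
    by (rule YLip_mult YLip_add YLip_const YLip_p YLip_compose[OF YLip_w L(1) loclip_sin_cos(2)]
        lbm_mult lbm_add lbm_const L lbm_cos)+
  then show "YLip (\<lambda>X Y. (1 + cos (w X Y)) * p X Y / 4)" by simp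
  have "YLip (\<lambda>X Y. sin (w X Y) * p X Y * (1 / 4))"
    by (rule YLip_mult YLip_const YLip_p YLip_compose[OF YLip_w L(1) loclip_sin_cos(1)]
        lbm_mult lbm_const L lbm_sin)+
  then show "YLip (\<lambda>X Y. sin (w X Y) * p X Y / 4)" by simp
qed

lemma YLip_divide_c: assumes "YLip f" "lbm f" shows "YLip (\<lambda>X Y. f X Y / c (u X Y))"
proof -
  have "loclip (\<lambda>v. 1 / c v)"
  proof (rule loclip_C1)
    show "((\<lambda>v. 1 / c v) has_real_derivative - dc v / (c v)\<^sup>2) (at v)" for v
      using c_pos[of v] by (auto intro!: derivative_eq_intros c_deriv simp: power2_eq_square)
    show "continuous_on UNIV (\<lambda>v. - dc v / (c v)\<^sup>2)"
      using c_pos by (intro continuous_intros dc_cont c_cont) (simp add: less_imp_neq[symmetric])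
  qed
  from YLip_mult[OF assms(1) YLip_compose[OF YLip_u lbm_u this] assms(2)] show ?thesis
    using lbm_divide_c[OF lbm_const[of 1]] by simp
qed

lemma rect_lipschitz_txu: "rect_lipschitz t" "rect_lipschitz x" "rect_lipschitz u"
proof -
  show "rect_lipschitz t"
    by (rule rect_lipschitz_of_potential[OF cont(2) t_eq]) (rule lbm_divide_c lbm_AX lbm_AY YLip_divide_c YLip_AX)+
  show "rect_lipschitz x"
    by (rule rect_lipschitz_of_potential[OF cont(3) x_eq]) (rule lbm_uminus lbm_AX lbm_AY YLip_AX)+
  show "rect_lipschitz u"
    by (rule rect_lipschitz_of_potential[OF cont(1) u_eq]) (rule lbm_divide_c lbm_GX lbm_GY YLip_divide_c YLip_GX)+
qed

text \<open>One null set of \<open>X\<close> serves everything that a chart requires of a vertical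
  line. The last clause is the angle equation at \<open>cos w = -1\<close>, where
  \<open>cos z - cos w\<close> equals \<open>1 + cos z\<close>, with the positive factor
  \<open>1 / (8 * c\<^sup>2)\<close> removed.\<close>

lemma AE_X_properties:
  assumes m: "rect_lipschitz m" "Xint m p"
  shows "AE X in lborel. (\<forall>Y. ((\<lambda>X. t X Y) has_real_derivative (1 + cos (w X Y)) * p X Y / 4 / c (u X Y)) (at X) \<and>
    ((\<lambda>X. x X Y) has_real_derivative (1 + cos (w X Y)) * p X Y / 4) (at X) \<and>
    ((\<lambda>X. u X Y) has_real_derivative sin (w X Y) * p X Y / 4 / c (u X Y)) (at X) \<and>
    ((\<lambda>X. m X Y) has_real_derivative p X Y) (at X) \<and> 0 \<le> p X Y) \<and>
    (AE Y in lborel. cos (w X Y) = -1 \<longrightarrow> dc (u X Y) * ((1 + cos (z X Y)) * q X Y) = 0)"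
proof -
  have nn: "AE X in lborel. \<forall>Y. 0 \<le> p X Y"
    by (rule linear_equation_nonneg[OF L(3) _ p_eq one(1)]) (rule lbm_mult lbm_diff lbm_sin lbm_k L)+
  note d = potential_derivative[OF rect_lipschitz_txu(1) t_eq(1) YLip_divide_c[OF YLip_AX lbm_AX]]
    potential_derivative[OF rect_lipschitz_txu(2) x_eq(1) YLip_AX]
    potential_derivative[OF rect_lipschitz_txu(3) u_eq(1) YLip_divide_c[OF YLip_GX lbm_GX]]
    potential_derivative[OF m YLip_p]
  from d(1) d(2) d(3) d(4) nn angle_equation_degenerates[OF w_eq] show ?thesis
  proof eventually_elim
    case (elim X)
    have "AE Y in lborel. cos (w X Y) = -1 \<longrightarrow> dc (u X Y) * ((1 + cos (z X Y)) * q X Y) = 0"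
      using elim(6)
    proof eventually_elim
      case (elim Y)
      then show ?case using c_pos[of "u X Y"] by (auto simp: add.commute)
    qed
    then show ?case using elim(1-5) by blast
  qed
qed

text \<open>The right sides of the equations for \<open>p\<close> and \<open>q\<close> are negatives
  of each other, which is the closedness condition of \<open>mixed_potential_exists\<close>.\<close>

lemma potential_exists:
  obtains m where "\<And>X1 X2 Y. X1 \<le> X2 \<Longrightarrow> ((\<lambda>s. p s Y) has_integral (m X2 Y - m X1 Y)) {X1..X2}"
    "\<And>X Y1 Y2. Y1 \<le> Y2 \<Longrightarrow> ((\<lambda>r. q X r) has_integral (m X Y1 - m X Y2)) {Y1..Y2}"
    "rect_lipschitz m" "Xint m p" "Yint m (\<lambda>X Y. - q X Y)"
proof -
  let ?h = "\<lambda>X Y. dc (u X Y) / (8 * (c (u X Y))\<^sup>2) * (sin (z X Y) - sin (w X Y)) * q X Y * p X Y"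
  have h: "lbm ?h" by (rule lbm_mult lbm_diff lbm_sin lbm_k L)+
  have "(\<lambda>X Y. dc (u X Y) / (8 * (c (u X Y))\<^sup>2) * (sin (w X Y) - sin (z X Y)) * p X Y * q X Y) = (\<lambda>X Y. - ?h X Y)"
    by (intro ext) (simp add: algebra_simps diff_divide_distrib)
  then have "\<And>Y X. dc (u X Y) / (8 * (c (u X Y))\<^sup>2) * (sin (w X Y) - sin (z X Y)) * p X Y * q X Y = - ?h X Y" by metis
  with q_eq have iq: "Xint q (\<lambda>X Y. - ?h X Y)" by (simp only:)
  obtain m where m: "\<And>X1 X2 Y. X1 \<le> X2 \<Longrightarrow> ((\<lambda>s. p s Y) has_integral (m X2 Y - m X1 Y)) {X1..X2}"
    "\<And>X Y1 Y2. Y1 \<le> Y2 \<Longrightarrow> ((\<lambda>r. q X r) has_integral (m X Y1 - m X Y2)) {Y1..Y2}"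
    by (rule mixed_potential_exists[OF L(3,4) h p_eq iq]) blast
  have iX: "Xint m p" unfolding Yint_def using m(1) by simp
  have iY: "Yint m (\<lambda>X Y. - q X Y)" unfolding Yint_def
  proof (intro AE_I2 allI impI)
    fix X Y1 Y2 :: real assume "Y1 \<le> Y2"
    from has_integral_neg[OF m(2)[OF this]] show "((\<lambda>Y. - q X Y) has_integral m X Y2 - m X Y1) {Y1..Y2}" by simp
  qed
  have "rect_lipschitz m"
    by (rule rect_lipschitz_of_potential[OF potential_continuous[OF L(3,4) m] iX iY L(3) lbm_uminus[OF L(4)] YLip_p])
  from that[OF m this iX iY] show thesis .
qed

end

lemma surj_of_expanding:
  fixes F :: "real \<Rightarrow> real"
  assumes i: "\<And>y y'. y \<le> y' \<Longrightarrow> y' - y \<le> F y' - F y" and c: "continuous_on UNIV F"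
  shows "\<exists>y. F y = X"
proof -
  let ?l = "- \<bar>X - F 0\<bar>" and ?r = "\<bar>X - F 0\<bar>"
  have "F ?l \<le> X" "X \<le> F ?r" using i[of ?l 0] i[of 0 ?r] by linarith+
  then show ?thesis using IVT'[of F ?l X ?r, OF _ _ _ continuous_on_subset[OF c subset_UNIV]] by auto
qed

text \<open>The function in \<open>energy\<close> is the energy potential on the curve up to a
  constant, because there the potential of \<open>p dX - q dY\<close> is \<open>Xc - Yc\<close> up
  to a constant.\<close>

locale semilinear_curve = semilinear +
  fixes Xc Yc :: "real \<Rightarrow> real" and em ep :: real
  assumes Xc: "\<And>y y'. y \<le> y' \<Longrightarrow> y' - y \<le> Xc y' - Xc y" and Yc: "\<And>y y'. y \<le> y' \<Longrightarrow> y' - y \<le> Yc y - Yc y'"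
    and cont_curve: "continuous_on UNIV Xc" "continuous_on UNIV Yc"
    and curve: "\<And>y. \<theta> (Xc y) = Yc y" "\<And>y. \<psi> (Yc y) = Xc y"
    and data: "\<And>y. t (Xc y) (Yc y) = 0" "\<And>y. x (Xc y) (Yc y) = y"
    and energy: "((\<lambda>y. (Xc y - Yc y) / 4 - y / 2) \<longlongrightarrow> ep) at_top"
      "((\<lambda>y. (Xc y - Yc y) / 4 - y / 2) \<longlongrightarrow> em) at_bot"
begin

lemma Xc_surj: "\<exists>y. Xc y = X" by (rule surj_of_expanding[OF Xc cont_curve(1)])

lemma Yc_surj: "\<exists>y. Yc y = Y"
proof -
  have "\<exists>y. - Yc y = - Y"
    by (rule surj_of_expanding) (use Yc cont_curve(2) in \<open>auto intro: continuous_on_minus\<close>)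
  then show ?thesis by simp
qed

lemma Xc_between: assumes "Xc y \<le> X" "X \<le> Xc y'" obtains s where "X = Xc s" "y \<le> s" "s \<le> y'"
proof -
  obtain s where s: "Xc s = X" using Xc_surj by blast
  have "y \<le> s" using Xc[of s y] s assms by (cases "y \<le> s") auto
  moreover have "s \<le> y'" using Xc[of y' s] s assms by (cases "s \<le> y'") auto
  ultimately show thesis using that s by blast
qed

lemma Yc_between: assumes "Yc y' \<le> Y" "Y \<le> Yc y" obtains s where "Y = Yc s" "y \<le> s" "s \<le> y'"
proof -
  obtain s where s: "Yc s = Y" using Yc_surj by blast
  have "y \<le> s" using Yc[of s y] s assms by (cases "y \<le> s") auto
  moreover have "s \<le> y'" using Yc[of y' s] s assms by (cases "s \<le> y'") auto
  ultimately show thesis using that s by blast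
qed

text \<open>Formally \<open>dm = dX - dY\<close> on the curve, since \<open>p = q = 1\<close> there.
  As the curve is a null set, short arcs are compared with paths of two characteristic segments; the
  error is at most a constant times the product of the side lengths.\<close>

lemma potential_on_curve:
  assumes mX: "\<And>X1 X2 Y. X1 \<le> X2 \<Longrightarrow> ((\<lambda>s. p s Y) has_integral (m X2 Y - m X1 Y)) {X1..X2}"
    and mY: "\<And>X Y1 Y2. Y1 \<le> Y2 \<Longrightarrow> ((\<lambda>r. q X r) has_integral (m X Y1 - m X Y2)) {Y1..Y2}"
    and ab: "a \<le> b"
  shows "m (Xc b) (Yc b) - Xc b + Yc b = m (Xc a) (Yc a) - Xc a + Yc a"
proof -
  interpret sw: semilinear \<kappa> c dc "\<lambda>X Y. z Y X" "\<lambda>X Y. w Y X" "\<lambda>X Y. q Y X" "\<lambda>X Y. p Y X" "\<lambda>X Y. u Y X"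
    "\<lambda>X Y. t Y X" "\<lambda>X Y. - x Y X" \<psi> \<theta> by (rule swap)
  define M where "M = \<bar>Xc a\<bar> + \<bar>Xc b\<bar> + \<bar>Yc a\<bar> + \<bar>Yc b\<bar>"
  \<comment> \<open>The errors are quadratic in the increments of \<open>Xc\<close> and
    \<open>Yc\<close>, which need not be Lipschitz in \<open>y\<close>. So the curve is
    reparametrized by \<open>Xc - Yc\<close>, whose increments dominate both.\<close>
  define V where "V y = Xc y - Yc y" for y
  define D where "D y = m (Xc y) (Yc y) - Xc y + Yc y" for y
  obtain L1 where L1: "L1 \<ge> 0" "\<And>X1 X2 Y1 Y2. \<bar>X1\<bar> \<le> M \<Longrightarrow> \<bar>X2\<bar> \<le> M \<Longrightarrow> \<bar>Y1\<bar> \<le> M \<Longrightarrow> \<bar>Y2\<bar> \<le> M \<Longrightarrow> X1 \<le> X2 \<Longrightarrow>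
    \<forall>X. X1 \<le> X \<and> X \<le> X2 \<longrightarrow> \<bar>\<theta> X\<bar> \<le> M \<and> \<bar>Y1 - \<theta> X\<bar> \<le> \<bar>Y1 - Y2\<bar> \<Longrightarrow>
    \<bar>m X2 Y1 - m X1 Y1 - (X2 - X1)\<bar> \<le> L1 * \<bar>Y1 - Y2\<bar> * (X2 - X1)"
    by (rule curve_increment_approx[where m=m and M=M, OF mX YLip_p one(1)], assumption, rule that)
  have mY': "((\<lambda>s. q Y s) has_integral (- m Y X2 - - m Y X1)) {X1..X2}" if "X1 \<le> X2" for X1 X2 Y
    using mY[OF that] by simp
  obtain L2 where L2: "L2 \<ge> 0" "\<And>X1 X2 Y1 Y2. \<bar>X1\<bar> \<le> M \<Longrightarrow> \<bar>X2\<bar> \<le> M \<Longrightarrow> \<bar>Y1\<bar> \<le> M \<Longrightarrow> \<bar>Y2\<bar> \<le> M \<Longrightarrow> X1 \<le> X2 \<Longrightarrow>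
    \<forall>X. X1 \<le> X \<and> X \<le> X2 \<longrightarrow> \<bar>\<psi> X\<bar> \<le> M \<and> \<bar>Y1 - \<psi> X\<bar> \<le> \<bar>Y1 - Y2\<bar> \<Longrightarrow>
    \<bar>- m Y1 X2 - - m Y1 X1 - (X2 - X1)\<bar> \<le> L2 * \<bar>Y1 - Y2\<bar> * (X2 - X1)"
    by (rule curve_increment_approx[where m="\<lambda>X Y. - m Y X" and M=M, OF mY' sw.YLip_p one(2)], assumption, rule that)
  have step: "\<bar>D y' - D y\<bar> \<le> (L1 + L2) * (V y' - V y)\<^sup>2" if y: "a \<le> y" "y \<le> y'" "y' \<le> b" for y y'
  proof -
    have bd: "\<bar>Xc s\<bar> \<le> M \<and> \<bar>Yc s\<bar> \<le> M" if "y \<le> s" "s \<le> y'" for s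
    proof -
      have "a \<le> s" "s \<le> b" using that y by auto
      then have "Xc a \<le> Xc s" "Xc s \<le> Xc b" "Yc s \<le> Yc a" "Yc b \<le> Yc s"
        using Xc[of a s] Xc[of s b] Yc[of a s] Yc[of s b] by linarith+
      then show ?thesis unfolding M_def by linarith
    qed
    have mono: "Xc y \<le> Xc y'" "Yc y' \<le> Yc y" using Xc[OF y(2)] Yc[OF y(2)] y(2) by linarith+
    have b1: "\<bar>m (Xc y') (Yc y) - m (Xc y) (Yc y) - (Xc y' - Xc y)\<bar> \<le> L1 * \<bar>Yc y - Yc y'\<bar> * (Xc y' - Xc y)"
    proof (rule L1(2))
      show "\<forall>X. Xc y \<le> X \<and> X \<le> Xc y' \<longrightarrow> \<bar>\<theta> X\<bar> \<le> M \<and> \<bar>Yc y - \<theta> X\<bar> \<le> \<bar>Yc y - Yc y'\<bar>"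
      proof (intro allI impI, elim conjE)
      fix X assume "Xc y \<le> X" "X \<le> Xc y'"
      then obtain s where s: "X = Xc s" "y \<le> s" "s \<le> y'" by (rule Xc_between)
      have "Yc y' \<le> Yc s" "Yc s \<le> Yc y" using Yc[OF s(2)] Yc[OF s(3)] s by linarith+
      then show "\<bar>\<theta> X\<bar> \<le> M \<and> \<bar>Yc y - \<theta> X\<bar> \<le> \<bar>Yc y - Yc y'\<bar>" using bd[OF s(2,3)] by (simp add: s(1) curve)
      qed
    qed (use bd[of y] bd[of y'] y mono in auto)
    have b2: "\<bar>- m (Xc y') (Yc y) - - m (Xc y') (Yc y') - (Yc y - Yc y')\<bar> \<le> L2 * \<bar>Xc y' - Xc y\<bar> * (Yc y - Yc y')"
    proof (rule L2(2))
      show "\<forall>Y. Yc y' \<le> Y \<and> Y \<le> Yc y \<longrightarrow> \<bar>\<psi> Y\<bar> \<le> M \<and> \<bar>Xc y' - \<psi> Y\<bar> \<le> \<bar>Xc y' - Xc y\<bar>"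
      proof (intro allI impI, elim conjE)
      fix Y assume "Yc y' \<le> Y" "Y \<le> Yc y"
      then obtain s where s: "Y = Yc s" "y \<le> s" "s \<le> y'" by (rule Yc_between)
      have "Xc y \<le> Xc s" "Xc s \<le> Xc y'" using Xc[OF s(2)] Xc[OF s(3)] s by linarith+
      then show "\<bar>\<psi> Y\<bar> \<le> M \<and> \<bar>Xc y' - \<psi> Y\<bar> \<le> \<bar>Xc y' - Xc y\<bar>" using bd[OF s(2,3)] by (simp add: s(1) curve)
      qed
    qed (use bd[of y] bd[of y'] y mono in auto)
    have "\<bar>D y' - D y\<bar> \<le> L1 * (Yc y - Yc y') * (Xc y' - Xc y) + L2 * (Xc y' - Xc y) * (Yc y - Yc y')"
      using b1 b2 mono unfolding D_def by (simp add: abs_of_nonneg)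
    also have "\<dots> = (L1 + L2) * ((Xc y' - Xc y) * (Yc y - Yc y'))" by (simp add: algebra_simps)
    also have "\<dots> \<le> (L1 + L2) * ((V y' - V y) * (V y' - V y))"
      using L1(1) L2(1) mono by (intro mult_left_mono mult_mono) (auto simp: V_def)
    finally show ?thesis by (simp add: power2_eq_square)
  qed
  have Vc: "continuous_on UNIV V" unfolding V_def by (intro continuous_on_diff cont_curve)
  have Vi: "y' - y \<le> V y' - V y" if "y \<le> y'" for y y' using Xc[OF that] Yc[OF that] that unfolding V_def by linarith
  define W where "W v = (SOME y. V y = v)" for v
  have W: "V (W v) = v" for v unfolding W_def by (rule someI_ex) (rule surj_of_expanding[OF Vi Vc])
  have inj: "y \<le> y'" if "V y \<le> V y'" for y y' using Vi[of y' y] that by (cases "y \<le> y'") auto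
  have WV: "W (V y) = y" for y using inj[of "W (V y)" y] inj[of y "W (V y)"] W by (simp add: antisym)
  have "D (W (V a)) = D (W (V b))"
  proof (rule quadratic_increments_imp_const[where D="\<lambda>v. D (W v)" and L="L1 + L2"])
    show "V a \<le> V b" using Vi[OF ab] ab by linarith
    fix r s assume rs: "V a \<le> r" "r \<le> s" "s \<le> V b"
    have "\<bar>D (W s) - D (W r)\<bar> \<le> (L1 + L2) * (V (W s) - V (W r))\<^sup>2"
      by (intro step; rule inj; use rs in \<open>simp add: W\<close>)
    then show "\<bar>D (W s) - D (W r)\<bar> \<le> (L1 + L2) * (s - r)\<^sup>2" by (simp only: W)
  qed
  then show ?thesis by (simp add: WV D_def)
qed

lemma obtain_null: assumes "AE X in lborel. P (X::real)" obtains N where "N \<in> null_sets lborel" "\<And>X. X \<notin> N \<Longrightarrow> P X"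
proof -
  obtain N where "N \<in> null_sets lborel" "{X. \<not> P X} \<subseteq> N" using assms unfolding eventually_ae_filter by auto
  then show thesis by (intro that) blast+
qed

lemma wave_solution_exists:
  assumes U: "\<And>X Y. U (t X Y) (x X Y) = u X Y"
  obtains e \<alpha> \<beta> \<gamma> a b g NX NY E where
    "wave_solution \<kappa> c dc t x u e \<alpha> \<beta> \<gamma> a b g NX NY Xc Yc (em + E) (ep + E) U"
proof -
  interpret sw: semilinear \<kappa> c dc "\<lambda>X Y. z Y X" "\<lambda>X Y. w Y X" "\<lambda>X Y. q Y X" "\<lambda>X Y. p Y X" "\<lambda>X Y. u Y X"
    "\<lambda>X Y. t Y X" "\<lambda>X Y. - x Y X" \<psi> \<theta> by (rule swap)
  obtain m where m: "\<And>X1 X2 Y. X1 \<le> X2 \<Longrightarrow> ((\<lambda>s. p s Y) has_integral (m X2 Y - m X1 Y)) {X1..X2}"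
    "\<And>X Y1 Y2. Y1 \<le> Y2 \<Longrightarrow> ((\<lambda>r. q X r) has_integral (m X Y1 - m X Y2)) {Y1..Y2}"
    "rect_lipschitz m" "Xint m p" "Yint m (\<lambda>X Y. - q X Y)" by (rule potential_exists) (rule that)
  have m': "rect_lipschitz (\<lambda>X Y. - m Y X)" by (rule rect_lipschitz_uminus[OF rect_lipschitz_swap[OF m(3)]])
  have im': "Xint (\<lambda>X Y. - m Y X) (\<lambda>X Y. q Y X)" using Yint_uminus[OF m(5)] by simp
  obtain NX where NX: "NX \<in> null_sets lborel" "\<And>X. X \<notin> NX \<Longrightarrow>
     (\<forall>Y. ((\<lambda>X. t X Y) has_real_derivative (1 + cos (w X Y)) * p X Y / 4 / c (u X Y)) (at X) \<and>
    ((\<lambda>X. x X Y) has_real_derivative (1 + cos (w X Y)) * p X Y / 4) (at X) \<and>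
    ((\<lambda>X. u X Y) has_real_derivative sin (w X Y) * p X Y / 4 / c (u X Y)) (at X) \<and>
    ((\<lambda>X. m X Y) has_real_derivative p X Y) (at X) \<and> 0 \<le> p X Y) \<and>
    (AE Y in lborel. cos (w X Y) = -1 \<longrightarrow> dc (u X Y) * ((1 + cos (z X Y)) * q X Y) = 0)"
    by (rule obtain_null[OF AE_X_properties[OF m(3,4)]]) (rule that)
  obtain NY where NY: "NY \<in> null_sets lborel" "\<And>Y. Y \<notin> NY \<Longrightarrow>
     (\<forall>X. ((\<lambda>Y. t X Y) has_real_derivative (1 + cos (z X Y)) * q X Y / 4 / c (u X Y)) (at Y) \<and>
    ((\<lambda>Y. - x X Y) has_real_derivative (1 + cos (z X Y)) * q X Y / 4) (at Y) \<and>
    ((\<lambda>Y. u X Y) has_real_derivative sin (z X Y) * q X Y / 4 / c (u X Y)) (at Y) \<and>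
    ((\<lambda>Y. - m X Y) has_real_derivative q X Y) (at Y) \<and> 0 \<le> q X Y) \<and>
    (AE X in lborel. cos (z X Y) = -1 \<longrightarrow> dc (u X Y) * ((1 + cos (w X Y)) * p X Y) = 0)"
    by (rule obtain_null[OF sw.AE_X_properties[OF m' im']]) (rule that)
  define e where "e X Y = 1 / 4 * m X Y - 1 / 2 * x X Y" for X Y
  \<comment> \<open>The value 0 on exceptional lines is the one for which
    \<open>partial_derivative_borel\<close> gives Borel measurability.\<close>
  define \<alpha> where "\<alpha> X Y = (if X \<in> NX then 0 else (1 + cos (w X Y)) * p X Y / 4)" for X Y
  define \<beta> where "\<beta> X Y = (if X \<in> NX then 0 else (1 - cos (w X Y)) * p X Y / 8)" for X Y
  define a where "a X Y = (if Y \<in> NY then 0 else (1 + cos (z X Y)) * q X Y / 4)" for X Y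
  define b where "b X Y = (if Y \<in> NY then 0 else (1 - cos (z X Y)) * q X Y / 8)" for X Y
  define \<gamma> where "\<gamma> X Y = sin (w X Y) * p X Y / 4" for X Y
  define g where "g X Y = sin (z X Y) * q X Y / 4" for X Y
  have e_lip: "rect_lipschitz e" unfolding e_def
    by (intro rect_lipschitz_diff rect_lipschitz_cmult m(3) rect_lipschitz_txu)
  have eX: "((\<lambda>X. e X Y) has_real_derivative (1 - cos (w X Y)) * p X Y / 8) (at X)" if "X \<notin> NX" for X Y
  proof -
    have "((\<lambda>X. e X Y) has_real_derivative 1 / 4 * p X Y - 1 / 2 * ((1 + cos (w X Y)) * p X Y / 4)) (at X)"
      unfolding e_def using NX(2)[OF that] by (intro DERIV_diff DERIV_cmult) blast+
    then show ?thesis by (rule DERIV_cong) (simp add: field_simps)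
  qed
  have eY: "((\<lambda>Y. - e X Y) has_real_derivative (1 - cos (z X Y)) * q X Y / 8) (at Y)" if "Y \<notin> NY" for X Y
  proof -
    have "((\<lambda>Y. 1 / 4 * (- m X Y) - 1 / 2 * (- x X Y)) has_real_derivative 1 / 4 * q X Y - 1 / 2 * ((1 + cos (z X Y)) * q X Y / 4)) (at Y)"
      using NY(2)[OF that] by (intro DERIV_diff DERIV_cmult) blast+
    then have "((\<lambda>Y. - e X Y) has_real_derivative 1 / 4 * q X Y - 1 / 2 * ((1 + cos (z X Y)) * q X Y / 4)) (at Y)"
      by (simp add: e_def)
    then show ?thesis by (rule DERIV_cong) (simp add: field_simps)
  qed
  have neg: "((\<lambda>Y. f Y) has_real_derivative - D) (at Y)" if "((\<lambda>Y. - f Y) has_real_derivative D) (at Y)"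
    for f :: "real \<Rightarrow> real" and D Y using DERIV_minus[OF that] by simp
  have mswap: "(\<lambda>z. f (snd z) (fst z)) \<in> borel_measurable borel"
    if "(\<lambda>z. f (fst z) (snd z)) \<in> borel_measurable borel" for f :: "real \<Rightarrow> real \<Rightarrow> real"
  proof -
    have "(\<lambda>z::real \<times> real. (snd z, fst z)) \<in> borel_measurable borel"
      by (intro borel_measurable_continuous_onI continuous_intros)
    from measurable_compose[OF this that] show ?thesis by simp
  qed
  have meas: "(\<lambda>z. \<alpha> (fst z) (snd z)) \<in> borel_measurable borel" "(\<lambda>z. \<beta> (fst z) (snd z)) \<in> borel_measurable borel"
    unfolding \<alpha>_def \<beta>_def
    by (rule partial_derivative_borel[OF cont(3) NX(1)], use NX(2) in blast)
      (rule partial_derivative_borel[OF rect_lipschitz_continuous[OF e_lip] NX(1) eX])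
  have "(\<lambda>z. a (snd z) (fst z)) \<in> borel_measurable borel" "(\<lambda>z. b (snd z) (fst z)) \<in> borel_measurable borel"
    unfolding a_def b_def
    by (rule partial_derivative_borel[OF sw.cont(3) NY(1)], use NY(2) in blast)
      (rule partial_derivative_borel[OF continuous_on_minus[OF continuous_plane_swap[OF rect_lipschitz_continuous[OF e_lip]]] NY(1) eY])
  from mswap[of "\<lambda>X Y. a Y X", OF this(1)] mswap[of "\<lambda>X Y. b Y X", OF this(2)]
  have meas': "(\<lambda>z. a (fst z) (snd z)) \<in> borel_measurable borel" "(\<lambda>z. b (fst z) (snd z)) \<in> borel_measurable borel" .
  have cos: "0 \<le> 1 + cos r" "0 \<le> 1 - cos r" for r :: real using cos_ge_minus_one[of r] cos_le_one[of r] by linarith+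
  \<comment> \<open>This rests on \<open>(1 + cos r) * (1 - cos r)\<close> being the square of
    \<open>sin r\<close>; it becomes the quadratic relation of the chart for both families.\<close>
  have sq: "(sin r * P / 4)\<^sup>2 = 2 * ((1 + cos r) * P / 4) * ((1 - cos r) * P / 8)" for r P :: real
    by (simp add: power_divide power_mult_distrib sin_squared_eq) (simp add: power2_eq_square algebra_simps)
  \<comment> \<open>The potential is determined only up to a constant. \<open>E\<close> is its
    deviation from the normalization on the curve, and it cancels in the difference of the two end
    values.\<close>
  define E where "E = m (Xc 0) (Yc 0) / 4 - (Xc 0 - Yc 0) / 4"
  have e_curve: "e (Xc y) (Yc y) = ((Xc y - Yc y) / 4 - y / 2) + E" for y
  proof -
    have "m (Xc y) (Yc y) - Xc y + Yc y = m (Xc 0) (Yc 0) - Xc 0 + Yc 0"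
      using potential_on_curve[OF m(1,2), of 0 y] potential_on_curve[OF m(1,2), of y 0] by (cases "0 \<le> y") auto
    then have "m (Xc y) (Yc y) / 4 = (m (Xc 0) (Yc 0) - Xc 0 + Yc 0 + Xc y - Yc y) / 4" by simp
    then show ?thesis unfolding e_def E_def data by (simp add: add_divide_distrib diff_divide_distrib)
  qed
  have "wave_chart \<kappa> c dc t x u e \<alpha> \<beta> \<gamma> a b g NX NY Xc Yc (em + E) (ep + E)"
  proof (unfold_locales, goal_cases)
    case 1 show ?case by (rule kappa)
  next
    case 2 show ?case by (rule c_bounds)
  next
    case 3 show ?case by (rule c_bounds)
  next
    case 4 show ?case by (rule c_cont)
  next
    case 5 show ?case by (rule borel_measurable_continuous_onI[OF dc_cont])
  next
    case 6 show ?case by (rule rect_lipschitz_txu)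
  next
    case 7 show ?case by (rule rect_lipschitz_txu)
  next
    case 8 show ?case by (rule rect_lipschitz_txu)
  next
    case 9 show ?case by (rule e_lip)
  next
    case 10 show ?case by (rule NX)
  next
    case 11 show ?case by (rule NY)
  next
    case 12 show ?case by (rule meas)
  next
    case 13 show ?case by (rule meas)
  next
    case 14 show ?case by (rule meas')
  next
    case 15 show ?case by (rule meas')
  next
    case (16 X Y) then show ?case using NX(2)[of X] by (simp add: \<alpha>_def)
  next
    case (17 X Y) then show ?case using NX(2)[of X] by (simp add: \<alpha>_def)
  next
    case (18 X Y) then show ?case using NX(2)[of X] by (simp add: \<gamma>_def)
  next
    case (19 X Y) then show ?case using eX by (simp add: \<beta>_def)
  next
    case (20 X Y) then show ?case using NX(2)[of X] cos by (simp add: \<alpha>_def)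
  next
    case (21 X Y) then show ?case using NX(2)[of X] cos by (simp add: \<beta>_def)
  next
    case (22 X Y) then show ?case unfolding \<alpha>_def \<beta>_def \<gamma>_def using sq by simp
  next
    case (23 X)
    have "AE Y in lborel. cos (w X Y) = -1 \<longrightarrow> dc (u X Y) * ((1 + cos (z X Y)) * q X Y) = 0" using NX(2)[OF 23] by blast
    then show ?case by eventually_elim (use 23 in \<open>auto simp: \<alpha>_def \<beta>_def a_def split: if_splits\<close>)
  next
    case (24 X Y) then show ?case using NY(2)[of Y] by (simp add: a_def)
  next
    case (25 X Y) then show ?case using NY(2)[of Y] by (intro neg) (simp add: a_def)
  next
    case (26 X Y) then show ?case using NY(2)[of Y] by (simp add: g_def)
  next
    case (27 X Y) then show ?case using eY by (intro neg) (simp add: b_def)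
  next
    case (28 X Y) then show ?case using NY(2)[of Y] cos by (simp add: a_def)
  next
    case (29 X Y) then show ?case using NY(2)[of Y] cos by (simp add: b_def)
  next
    case (30 X Y) then show ?case unfolding a_def b_def g_def using sq by simp
  next
    case (31 Y)
    have "AE X in lborel. cos (z X Y) = -1 \<longrightarrow> dc (u X Y) * ((1 + cos (w X Y)) * p X Y) = 0" using NY(2)[OF 31] by blast
    then show ?case by eventually_elim (use 31 in \<open>auto simp: \<alpha>_def b_def a_def split: if_splits\<close>)
  next
    case (32 y y') then show ?case using Xc[of y y'] by linarith
  next
    case (33 X) show ?case by (rule Xc_surj)
  next
    case (34 y y') then show ?case using Yc[of y y'] by linarith
  next
    case (35 Y) show ?case by (rule Yc_surj)
  next
    case 36 show ?case by (rule data)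
  next
    case 37 show ?case by (rule data)
  next
    case 38 show ?case unfolding e_curve by (intro tendsto_add energy tendsto_const)
  next
    case 39 show ?case unfolding e_curve by (intro tendsto_add energy tendsto_const)
  qed
  then have "wave_solution \<kappa> c dc t x u e \<alpha> \<beta> \<gamma> a b g NX NY Xc Yc (em + E) (ep + E) U"
    by (rule wave_solution.intro) (rule wave_solution_axioms.intro, rule U)
  then show thesis by (rule that)
qed

end

section \<open>The constructed solution\<close>

text \<open>\<open>Yc\<close> decreases while \<open>AE_transport\<close> concerns increasing maps;
  reflection mediates between the two.\<close>

lemma AE_lborel_uminus:
  assumes "AE x in lborel. P (- x)" shows "AE x in lborel. P (x::real)"
proof -
  obtain N where N: "N \<in> null_sets lborel" "{x. \<not> P (- x)} \<subseteq> N"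
    using assms unfolding eventually_ae_filter by auto
  have "emeasure lborel (uminus -` N) = emeasure (distr lborel borel uminus) N"
    using N(1) by (subst emeasure_distr) auto
  also have "\<dots> = 0" using N(1) unfolding lborel_distr_uminus by auto
  finally have "uminus -` N \<in> null_sets lborel"
    using N(1) measurable_sets[of uminus borel borel N] by (auto simp: null_sets_def)
  moreover have "{x. \<not> P x} \<subseteq> uminus -` N"
  proof
    fix x assume "x \<in> {x. \<not> P x}"
    then have "- x \<in> {x. \<not> P (- x)}" by simp
    with N(2) show "x \<in> uminus -` N" by blast
  qed
  ultimately show ?thesis unfolding eventually_ae_filter by auto
qed

text \<open>Up to a constant \<open>G y\<close> is the integral over \<open>{..y}\<close>; its limit
  at \<open>at_top\<close> is the full integral, and the limit at \<open>at_bot\<close> follows by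
  reflection. For the squares of the Riemann variables of the data this yields the end values of the
  energy potential.\<close>

lemma primitive_limits:
  fixes g G :: "real \<Rightarrow> real"
  assumes g: "integrable lebesgue g" and G: "\<And>a b. a \<le> b \<Longrightarrow> (g has_integral (G b - G a)) {a..b}"
  obtains l where "(G \<longlongrightarrow> l + (LINT x|lebesgue. g x)) at_top" "(G \<longlongrightarrow> l) at_bot"
proof -
  obtain f where f: "f \<in> borel_measurable lborel" "AE x in lborel. g x = f x"
    using completion_ex_borel_measurable_real[OF borel_measurable_integrable[OF g]] by blast
  have fm: "f \<in> borel_measurable lebesgue" by (rule measurable_completion[OF f(1)])
  have ae: "AE x in lebesgue. g x = f x" by (rule AE_completion[OF f(2)])
  have "integrable lebesgue f" by (rule integrable_cong_AE_imp[OF g fm ae])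
  then have fi: "integrable lborel f" using f(1) by (simp add: integrable_completion)
  have "(LINT x|lebesgue. g x) = (LINT x|lebesgue. f x)"
    by (rule integral_cong_AE[OF borel_measurable_integrable[OF g] fm ae])
  then have eq: "(LINT x|lborel. f x) = (LINT x|lebesgue. g x)" using f(1) by (simp add: integral_completion)
  have i: "integrable lborel (\<lambda>x. indicator A x *\<^sub>R f x)" if "A \<in> sets lborel" for A
    by (rule integrable_mult_indicator[OF that fi])
  define H where "H y = (LINT x|lborel. indicator {..y} x *\<^sub>R f x)" for y
  have H: "G b - G a = H b - H a" if ab: "a \<le> b" for a b
  proof -
    have "H b - H a = (LINT x|lborel. indicator {..b} x *\<^sub>R f x - indicator {..a} x *\<^sub>R f x)"
      unfolding H_def by (rule Bochner_Integration.integral_diff[symmetric]) (rule i, simp)+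
    also have "\<dots> = (LINT x:{a<..b}|lborel. f x)" unfolding set_lebesgue_integral_def
      using ab by (intro Bochner_Integration.integral_cong) (auto simp: indicator_def)
    finally have h: "H b - H a = (LINT x:{a<..b}|lborel. f x)" .
    have si: "set_integrable lborel {a<..b} f" unfolding set_integrable_def by (rule i) simp
    have "(f has_integral (H b - H a)) {a<..b}"
      unfolding h set_borel_integral_eq_integral(2)[OF si]
      by (rule integrable_integral[OF set_borel_integral_eq_integral(1)[OF si]])
    then have "(f has_integral (H b - H a)) {a..b}"
      by (rule has_integral_spike_set_eq[THEN iffD1, rotated 2])
        (rule negligible_subset[of "{a}"]; auto)+
    moreover obtain N where N: "N \<in> null_sets lborel" "{x. g x \<noteq> f x} \<subseteq> N"
      using f(2) unfolding eventually_ae_filter by auto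
    have "(f has_integral (G b - G a)) {a..b}"
      by (rule has_integral_spike[OF _ _ G[OF ab], of N])
        (use N in \<open>auto simp: negligible_iff_null_sets null_sets_completionI subset_iff eq_commute\<close>)
    ultimately show ?thesis by (rule has_integral_unique[symmetric])
  qed
  have top: "(H \<longlongrightarrow> (LINT x|lborel. f x)) at_top"
    unfolding H_def by (rule tendsto_integral_at_top) (use fi in auto)
  have "((\<lambda>y. LINT x|lborel. indicator {..y} x *\<^sub>R f (- x)) \<longlongrightarrow> (LINT x|lborel. f (- x))) at_top"
    using fi lborel_integrable_real_affine[of f "-1" 0] by (intro tendsto_integral_at_top) auto
  moreover have "(LINT x|lborel. indicator {..y} x *\<^sub>R f (- x)) = (LINT x|lborel. f x) - H (- y)" for y
  proof -
    have "(LINT x|lborel. indicator {..y} x *\<^sub>R f (- x)) = (LINT x|lborel. indicator {-y..} x *\<^sub>R f x)"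
      using lborel_integral_real_affine[of "-1" "\<lambda>x. indicator {-y..} x *\<^sub>R f x" 0]
      by (simp add: indicator_def)
    also have "\<dots> = (LINT x|lborel. f x - indicator {..-y} x *\<^sub>R f x)"
      using f(1) by (intro integral_cong_AE AE_I[where N="{-y}"]) (auto simp: indicator_def)
    also have "\<dots> = (LINT x|lborel. f x) - H (- y)" unfolding H_def
      by (rule Bochner_Integration.integral_diff[OF fi i]) simp
    finally show ?thesis .
  qed
  moreover have "(LINT x|lborel. f (- x)) = (LINT x|lborel. f x)"
    using lborel_integral_real_affine[of "-1" f 0] by simp
  ultimately have "((\<lambda>y. (LINT x|lborel. f x) - ((LINT x|lborel. f x) - H (- y))) \<longlongrightarrow> (LINT x|lborel. f x) - (LINT x|lborel. f x)) at_top"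
    by (intro tendsto_diff tendsto_const) simp
  then have bot: "(H \<longlongrightarrow> 0) at_bot" by (simp add: filterlim_at_bot_mirror)
  have GH: "G = (\<lambda>y. G 0 - H 0 + H y)"
  proof
    fix y show "G y = G 0 - H 0 + H y" using H[of 0 y] H[of y 0] by (cases "0 \<le> y") auto
  qed
  show thesis
  proof (rule that)
    show "(G \<longlongrightarrow> (G 0 - H 0) + (LINT x|lebesgue. g x)) at_top"
      by (subst GH) (intro tendsto_add tendsto_const top[unfolded eq])
    show "(G \<longlongrightarrow> G 0 - H 0) at_bot"
      by (subst GH) (use tendsto_add[OF tendsto_const bot, of "G 0 - H 0"] in simp)
  qed
qed

text \<open>The summand 1 makes \<open>F\<close> grow at least as fast as its argument, hence a
  bijection to which \<open>AE_transport\<close> applies. Subtracting it again leaves the primitive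
  of \<open>g\<close> that enters the energy limits.\<close>

lemma arclength_curve:
  fixes g F :: "real \<Rightarrow> real"
  assumes g: "integrable lebesgue g" and nn: "\<And>y. 0 \<le> g y"
    and F_def: "F = (\<lambda>x. LINT y=ereal 0..ereal x|lebesgue. (1 + g y))"
  shows "\<And>a b. a \<le> b \<Longrightarrow> ((\<lambda>y. 1 + g y) has_integral (F b - F a)) {a..b}"
    and "\<And>a b. a \<le> b \<Longrightarrow> b - a \<le> F b - F a"
    and "onto_mono F" and "inj F"
    and "\<And>a b. a \<le> b \<Longrightarrow> (g has_integral ((F b - b) - (F a - a))) {a..b}"
proof -
  have si: "set_integrable lebesgue {a..b} (\<lambda>y. 1 + g y)" for a b :: real
  proof (rule set_integral_add)
    show "set_integrable lebesgue {a..b} (\<lambda>y. 1 :: real)"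
      unfolding set_integrable_def by (auto intro!: integrable_real_indicator simp: emeasure_lborel_Icc_eq)
    show "set_integrable lebesgue {a..b} g"
      unfolding set_integrable_def using g by (intro integrable_mult_indicator) auto
  qed
  show i: "((\<lambda>y. 1 + g y) has_integral (F b - F a)) {a..b}" if "a \<le> b" for a b
    unfolding F_def by (rule has_integral_interval_lebesgue_integral[OF si that])
  have c1: "((\<lambda>s. 1) has_integral (b - a)) {a..b}" if "a \<le> b" for a b :: real
    using has_integral_const_real[of "1::real" a b] that by simp
  show ex: "b - a \<le> F b - F a" if "a \<le> b" for a b
    by (rule has_integral_le[OF c1[OF that] i[OF that]]) (use nn in simp)
  show "(g has_integral ((F b - b) - (F a - a))) {a..b}" if "a \<le> b" for a b
    using has_integral_diff[OF i[OF that] c1[OF that]] by (simp add: algebra_simps)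
  have c: "continuous_on UNIV F" by (rule has_integral_imp_continuous) (rule i)
  note s = surj_of_expanding[OF ex c]
  show "onto_mono F"
  proof
    show "F x \<le> F y" if "x \<le> y" for x y using ex[OF that] that by linarith
    show "\<exists>x. y \<le> F x" "\<exists>x. F x \<le> y" for y using s[of y] by auto
  qed (rule c)
  show "inj F"
  proof (rule injI)
    fix x y assume "F x = F y"
    then show "x = y" using ex[of x y] ex[of y x] by linarith
  qed
qed

theorem theorem3:
  fixes \<kappa> :: real and c u0 u1 :: "real \<Rightarrow> real" and U :: "real \<Rightarrow> real \<Rightarrow> real"
  assumes "\<kappa> > 1"
    and "smooth_fun c"
    and "\<And>v. inverse \<kappa> \<le> c v \<and> c v \<le> \<kappa>"
    and "abs_continuous_fun u0"
    and "L2_fun (deriv u0)"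
    and "L2_fun u1"
    and "constructed_solution c u0 u1 U"
  shows "\<exists>(\<mu> :: real \<Rightarrow> real measure) (\<mu>ac :: real \<Rightarrow> real measure) (\<mu>s :: real \<Rightarrow> real measure)
           (ut :: real \<Rightarrow> real \<Rightarrow> real) (ux :: real \<Rightarrow> real \<Rightarrow> real).
      (\<forall>t. radon_measure (\<mu> t)) \<and> vaguely_continuous \<mu> \<and>
      (\<forall>t. lebesgue_decomposition (\<mu> t) (\<mu>ac t) (\<mu>s t)) \<and>
      (\<forall>t. ut t \<in> borel_measurable borel \<and>
           (\<forall>p. 1 \<le> p \<and> p < 2 \<longrightarrow> has_Lp_loc_derivative p U t (ut t))) \<and>
      (\<forall>t. ux t \<in> borel_measurable borel \<and> has_weak_derivative (U t) (ux t)) \<and>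
      (\<forall>t. emeasure (\<mu> t) UNIV = ennreal (initial_energy c u0 u1)) \<and>
      (\<forall>t. \<mu>ac t = density lborel
             (\<lambda>x. ennreal (1 / 2 * ((ut t x)\<^sup>2 + (c (U t x))\<^sup>2 * (ux t x)\<^sup>2)))) \<and>
      (AE t in lebesgue. AE x in \<mu>s t. deriv c (U t x) = 0)"
proof -
  have "(deriv ^^ 0) c differentiable_on UNIV" "(deriv ^^ 1) c differentiable_on UNIV"
    using assms(2) unfolding smooth_fun_def by blast+
  then have c0: "c differentiable_on UNIV" and c1: "deriv c differentiable_on UNIV" by simp_all
  have cd: "(c has_real_derivative deriv c v) (at v)" for v
    using c0 by (simp add: differentiable_on_def DERIV_deriv_iff_real_differentiable)
  have dcc: "continuous_on UNIV (deriv c)" by (rule differentiable_imp_continuous_on[OF c1])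
  have cc: "continuous_on UNIV c" by (rule differentiable_imp_continuous_on[OF c0])
  have k0: "\<kappa> > 0" using assms(1) by simp
  have cb: "1 / \<kappa> \<le> c v" "c v \<le> \<kappa>" for v using assms(3)[of v] by (simp_all add: inverse_eq_divide)
  have cp: "c v > 0" for v using cb(1)[of v] k0 by (smt (verit) zero_less_divide_1_iff)
  define R where "R = R_init c u0 u1"
  define S where "S = S_init c u0 u1"
  have u0c: "continuous_on UNIV u0" by (rule abs_continuous_fun_continuous[OF assms(4)])
  have m1: "u1 \<in> borel_measurable lebesgue" "deriv u0 \<in> borel_measurable lebesgue"
    and i1: "integrable lebesgue (\<lambda>x. (u1 x)\<^sup>2)" "integrable lebesgue (\<lambda>x. (deriv u0 x)\<^sup>2)"
    using assms(5,6) unfolding L2_fun_def by blast+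
  have "continuous_on UNIV (\<lambda>y. c (u0 y))" by (rule continuous_on_compose2[OF cc u0c]) simp
  then have mc: "(\<lambda>y. c (u0 y)) \<in> borel_measurable lebesgue"
    by (intro measurable_completion) (simp add: borel_measurable_continuous_onI)
  have mRS: "R \<in> borel_measurable lebesgue" "S \<in> borel_measurable lebesgue"
    unfolding R_def S_def R_init_def S_init_def
    by (intro borel_measurable_add borel_measurable_diff borel_measurable_times m1 mc)+
  have ip: "integrable lebesgue (\<lambda>x. (c (u0 x))\<^sup>2 * (deriv u0 x)\<^sup>2)"
  proof (rule Bochner_Integration.integrable_bound)
    show "integrable lebesgue (\<lambda>x. \<kappa>\<^sup>2 * (deriv u0 x)\<^sup>2)" using i1(2) by simp
    show "(\<lambda>x. (c (u0 x))\<^sup>2 * (deriv u0 x)\<^sup>2) \<in> borel_measurable lebesgue"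
      by (intro borel_measurable_times borel_measurable_power m1 mc)
    have "(c (u0 x))\<^sup>2 \<le> \<kappa>\<^sup>2" for x using cb(2)[of "u0 x"] cp[of "u0 x"] by (intro power_mono) auto
    then show "AE x in lebesgue. norm ((c (u0 x))\<^sup>2 * (deriv u0 x)\<^sup>2) \<le> norm (\<kappa>\<^sup>2 * (deriv u0 x)\<^sup>2)"
      by (intro AE_I2) (simp add: mult_right_mono)
  qed
  have iE: "integrable lebesgue (\<lambda>x. 2 * ((u1 x)\<^sup>2 + (c (u0 x))\<^sup>2 * (deriv u0 x)\<^sup>2))" using i1 ip by simp
  \<comment> \<open>The mixed terms of the two Riemann variables cancel. The identity serves twice,
    for their square integrability and for the value of the energy.\<close>
  have RSsum: "(R x)\<^sup>2 + (S x)\<^sup>2 = 2 * ((u1 x)\<^sup>2 + (c (u0 x))\<^sup>2 * (deriv u0 x)\<^sup>2)" for x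
    unfolding R_def S_def R_init_def S_init_def by (simp add: power2_eq_square algebra_simps)
  have iRS: "integrable lebesgue (\<lambda>x. (R x)\<^sup>2)" "integrable lebesgue (\<lambda>x. (S x)\<^sup>2)"
  proof -
    have b: "(R x)\<^sup>2 \<le> 2 * ((u1 x)\<^sup>2 + (c (u0 x))\<^sup>2 * (deriv u0 x)\<^sup>2)"
      "(S x)\<^sup>2 \<le> 2 * ((u1 x)\<^sup>2 + (c (u0 x))\<^sup>2 * (deriv u0 x)\<^sup>2)" for x
      using RSsum[of x] zero_le_power2[of "R x"] zero_le_power2[of "S x"] by linarith+
    show "integrable lebesgue (\<lambda>x. (R x)\<^sup>2)"
      by (rule Bochner_Integration.integrable_bound[OF iE]) (use b(1) mRS in \<open>auto intro!: AE_I2\<close>)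
    show "integrable lebesgue (\<lambda>x. (S x)\<^sup>2)"
      by (rule Bochner_Integration.integrable_bound[OF iE]) (use b(2) mRS in \<open>auto intro!: AE_I2\<close>)
  qed
  define Xc where "Xc = X_curve c u0 u1"
  define Yc where "Yc = Y_curve c u0 u1"
  define \<phi> where "\<phi> = curve_fun c u0 u1"
  have Xeq: "Xc = (\<lambda>x. LINT y=ereal 0..ereal x|lebesgue. (1 + (R y)\<^sup>2))"
    unfolding Xc_def X_curve_def R_def by (rule refl)
  \<comment> \<open>\<open>- Yc\<close> is the increasing counterpart of \<open>Xc\<close>, so both
    coordinates are covered by the same facts.\<close>
  have Yeq: "(\<lambda>x. - Yc x) = (\<lambda>x. LINT y=ereal 0..ereal x|lebesgue. (1 + (S y)\<^sup>2))"
    unfolding Yc_def Y_curve_def S_def by simp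
  note XC = arclength_curve[OF iRS(1) zero_le_power2 Xeq]
  note YC = arclength_curve[OF iRS(2) zero_le_power2 Yeq]
  interpret Xm: onto_mono Xc by (rule XC(3))
  interpret Ym: onto_mono "\<lambda>x. - Yc x" by (rule YC(3))
  have \<phi>: "\<phi> (Xc y) = Yc y" for y
    unfolding \<phi>_def curve_fun_def Xc_def[symmetric] Yc_def[symmetric] by (simp add: inv_f_f[OF XC(4)])
  have "inj \<phi>"
  proof (rule injI)
    fix X X' assume e: "\<phi> X = \<phi> X'"
    obtain s s' where "X = Xc s" "X' = Xc s'" using Xm.ginv_eq by metis
    then show "X = X'" using e injD[OF YC(4), of s s'] by (simp add: \<phi>)
  qed
  then have \<psi>: "inv \<phi> (Yc y) = Xc y" for y using inv_f_f[of \<phi> "Xc y"] by (simp add: \<phi>)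
  obtain l1 where l1: "((\<lambda>y. Xc y - y) \<longlongrightarrow> l1 + (LINT x|lebesgue. (R x)\<^sup>2)) at_top" "((\<lambda>y. Xc y - y) \<longlongrightarrow> l1) at_bot"
    by (rule primitive_limits[OF iRS(1) XC(5)])
  obtain l2 where l2: "((\<lambda>y. - Yc y - y) \<longlongrightarrow> l2 + (LINT x|lebesgue. (S x)\<^sup>2)) at_top" "((\<lambda>y. - Yc y - y) \<longlongrightarrow> l2) at_bot"
    by (rule primitive_limits[OF iRS(2) YC(5)])
  define em where "em = (l1 + l2) / 4"
  \<comment> \<open>Up to a constant the energy potential on the curve is
    \<open>((Xc y - y) + (- Yc y - y)) / 4\<close>, so its end values are quarters of sums of the
    limits just obtained.\<close>
  define ep where "ep = (l1 + (LINT x|lebesgue. (R x)\<^sup>2) + (l2 + (LINT x|lebesgue. (S x)\<^sup>2))) / 4"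
  have en: "ep - em = initial_energy c u0 u1"
  proof -
    have "(LINT x|lebesgue. (R x)\<^sup>2) + (LINT x|lebesgue. (S x)\<^sup>2) = (LINT x|lebesgue. (R x)\<^sup>2 + (S x)\<^sup>2)"
      using iRS by simp
    also have "\<dots> = 2 * (LINT x|lebesgue. ((u1 x)\<^sup>2 + (c (u0 x))\<^sup>2 * (deriv u0 x)\<^sup>2))"
      unfolding RSsum by (rule integral_mult_right_zero)
    finally show ?thesis unfolding ep_def em_def initial_energy_def by (simp add: field_simps)
  qed
  obtain w z p q u t x where sys: "solves_semilinear_system c u0 u1 w z p q u"
    and orig: "original_variables c u0 u1 w z p q u t x"
    and Ueq: "\<And>\<tau> \<xi> X Y. t X Y = \<tau> \<and> x X Y = \<xi> \<longrightarrow> U \<tau> \<xi> = u X Y"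
    using assms(7) unfolding constructed_solution_def by (elim exE conjE) (rule that, assumption, assumption, blast)
  note sys = sys[unfolded solves_semilinear_system_def Let_def, folded Xc_def Yc_def \<phi>_def]
  note orig = orig[unfolded original_variables_def Let_def, folded Xc_def Yc_def \<phi>_def]
  have lb: "lbm w" "lbm z" "lbm p" "lbm q" and uc: "continuous_on UNIV (\<lambda>p. u (fst p) (snd p))"
    using sys locally_bounded_measurable_imp_lbm locally_lipschitz_plane_continuous by blast+
  have tc: "continuous_on UNIV (\<lambda>p. t (fst p) (snd p))" and xc: "continuous_on UNIV (\<lambda>p. x (fst p) (snd p))"
    using orig locally_lipschitz_plane_continuous by blast+
  interpret co: characteristic_coefficients \<kappa> c "deriv c" w z p q u t x
    by unfold_locales (rule k0 cb cd dcc lb uc tc xc)+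
  have dat: "AE y in lebesgue. p (Xc y) (Yc y) = 1" "AE y in lebesgue. q (Xc y) (Yc y) = 1"
    using sys by (auto elim: eventually_mono)
  have one: "AE X in lborel. p X (\<phi> X) = 1" "AE Y in lborel. q (inv \<phi> Y) Y = 1"
  proof -
    show "AE X in lborel. p X (\<phi> X) = 1"
      by (rule AE_transport[OF XC(3,4,1)]) (use mRS(1) dat(1) in \<open>auto simp: \<phi>\<close>)
    \<comment> \<open>The data for \<open>q\<close> are transported along \<open>- Yc\<close> and
      then reflected.\<close>
    have "AE Y in lborel. q (inv \<phi> (- Y)) (- Y) = 1"
      by (rule AE_transport[OF YC(3,4,1)]) (use mRS(2) dat(2) in \<open>auto simp: \<psi>\<close>)
    then show "AE Y in lborel. q (inv \<phi> Y) Y = 1" by (rule AE_lborel_uminus)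
  qed
  have "semilinear_curve \<kappa> c (deriv c) w z p q u t x \<phi> (inv \<phi>) Xc Yc em ep"
  proof (unfold_locales, goal_cases)
    case 1
    have i: "integrated_in_Y \<phi> w (\<lambda>X Y. deriv c (u X Y) / (8 * (c (u X Y))\<^sup>2) * (cos (z X Y) - cos (w X Y)) * q X Y)"
      using sys by blast
    show ?case by (rule Yint_of_integrated_in_Y[OF _ i]) (rule lbm_mult lbm_diff lbm_cos co.lbm_k lb)+
  next
    case 2
    have i: "integrated_in_X \<phi> z (\<lambda>X Y. deriv c (u X Y) / (8 * (c (u X Y))\<^sup>2) * (cos (w X Y) - cos (z X Y)) * p X Y)"
      using sys by blast
    show ?case by (rule Xint_of_integrated_in_X[OF _ i]) (rule lbm_mult lbm_diff lbm_cos co.lbm_k lb)+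
  next
    case 3
    have i: "integrated_in_Y \<phi> p (\<lambda>X Y. deriv c (u X Y) / (8 * (c (u X Y))\<^sup>2) * (sin (z X Y) - sin (w X Y)) * q X Y * p X Y)"
      using sys by (simp add: mult.assoc mult.commute[of "p _ _"])
    show ?case by (rule Yint_of_integrated_in_Y[OF _ i]) (rule lbm_mult lbm_diff lbm_sin co.lbm_k lb)+
  next
    case 4
    have i: "integrated_in_X \<phi> q (\<lambda>X Y. deriv c (u X Y) / (8 * (c (u X Y))\<^sup>2) * (sin (w X Y) - sin (z X Y)) * p X Y * q X Y)"
      using sys by (simp add: mult.assoc)
    show ?case by (rule Xint_of_integrated_in_X[OF _ i]) (rule lbm_mult lbm_diff lbm_sin co.lbm_k lb)+
  next
    case 5
    have i: "integrated_in_X \<phi> u (\<lambda>X Y. sin (w X Y) * p X Y / 4 / c (u X Y))" using sys by simp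
    show ?case by (rule Xint_of_integrated_in_X[OF _ i]) (rule co.lbm_divide_c co.lbm_GX)+
  next
    case 6
    have i: "integrated_in_Y \<phi> u (\<lambda>X Y. sin (z X Y) * q X Y / 4 / c (u X Y))" using sys by simp
    show ?case by (rule Yint_of_integrated_in_Y[OF _ i]) (rule co.lbm_divide_c co.lbm_GY)+
  next
    case 7
    have i: "integrated_in_X \<phi> x (\<lambda>X Y. (1 + cos (w X Y)) * p X Y / 4)" using orig by blast
    show ?case by (rule Xint_of_integrated_in_X[OF co.lbm_AX i])
  next
    case 8
    have i: "integrated_in_Y \<phi> x (\<lambda>X Y. - ((1 + cos (z X Y)) * q X Y / 4))" using orig by blast
    show ?case by (rule Yint_of_integrated_in_Y[OF lbm_uminus[OF co.lbm_AY] i])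
  next
    case 9
    have i: "integrated_in_X \<phi> t (\<lambda>X Y. (1 + cos (w X Y)) * p X Y / 4 / c (u X Y))" using orig by simp
    show ?case by (rule Xint_of_integrated_in_X[OF _ i]) (rule co.lbm_divide_c co.lbm_AX)+
  next
    case 10
    have i: "integrated_in_Y \<phi> t (\<lambda>X Y. (1 + cos (z X Y)) * q X Y / 4 / c (u X Y))" using orig by simp
    show ?case by (rule Yint_of_integrated_in_Y[OF _ i]) (rule co.lbm_divide_c co.lbm_AY)+
  next
    case 11 show ?case by (rule one)
  next
    case 12 show ?case by (rule one)
  next
    case (13 y y') then show ?case by (rule XC(2))
  next
    case (14 y y') then show ?case using YC(2)[of y y'] by simp
  next
    case 15 show ?case by (rule Xm.cont)
  next
    case 16 show ?case using continuous_on_minus[OF Ym.cont] by simp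
  next
    case 17 show ?case by (rule \<phi>)
  next
    case 18 show ?case by (rule \<psi>)
  next
    case 19 show ?case using orig by blast
  next
    case 20 show ?case using orig by blast
  next
    case 21
    have "(\<lambda>y. (Xc y - Yc y) / 4 - y / 2) = (\<lambda>y. ((Xc y - y) + (- Yc y - y)) / 4)" by (intro ext) (simp add: field_simps)
    then show ?case unfolding ep_def using tendsto_divide[OF tendsto_add[OF l1(1) l2(1)] tendsto_const[of 4]] by simp
  next
    case 22
    have "(\<lambda>y. (Xc y - Yc y) / 4 - y / 2) = (\<lambda>y. ((Xc y - y) + (- Yc y - y)) / 4)" by (intro ext) (simp add: field_simps)
    then show ?case unfolding em_def using tendsto_divide[OF tendsto_add[OF l1(2) l2(2)] tendsto_const[of 4]] by simp
  qed
  then interpret sc: semilinear_curve \<kappa> c "deriv c" w z p q u t x \<phi> "inv \<phi>" Xc Yc em ep .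
  have Utx: "U (t X Y) (x X Y) = u X Y" for X Y using Ueq by blast
  obtain e \<alpha> \<beta> \<gamma> a b g NX NY E where
    "wave_solution \<kappa> c (deriv c) t x u e \<alpha> \<beta> \<gamma> a b g NX NY Xc Yc (em + E) (ep + E) U"
    by (rule sc.wave_solution_exists[OF Utx])
  then interpret ws: wave_solution \<kappa> c "deriv c" t x u e \<alpha> \<beta> \<gamma> a b g NX NY Xc Yc "em + E" "ep + E" U .
  show ?thesis
  proof (intro exI conjI allI impI)
    show "radon_measure (ws.mu t)" for t by (rule ws.radon_measure_mu)
    show "vaguely_continuous ws.mu" by (rule ws.vaguely_continuous_mu)
    show "lebesgue_decomposition (ws.mu t) (density lborel (\<lambda>x. ennreal (1 / 2 * ((ws.ut t x)\<^sup>2 + (c (U t x))\<^sup>2 * (ws.ux t x)\<^sup>2)))) (ws.mus t)" for t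
      using ws.lebesgue_decomposition_mu[of t] unfolding ws.dens_def .
    show "ws.ut t \<in> borel_measurable borel" "ws.ux t \<in> borel_measurable borel" for t
      by (rule ws.ut_measurable ws.ux_measurable)+
    show "has_Lp_loc_derivative p U t (ws.ut t)" if "1 \<le> p \<and> p < 2" for t p
      using that by (intro ws.U_has_Lp_loc_derivative) auto
    show "has_weak_derivative (U t) (ws.ux t)" for t by (rule ws.U_has_weak_derivative)
    show "emeasure (ws.mu t) UNIV = ennreal (initial_energy c u0 u1)" for t
      using ws.emeasure_mu_UNIV[of t] en by simp
    show "AE t in lebesgue. AE x in ws.mus t. deriv c (U t x) = 0" by (rule ws.AE_mus)
  qed (rule refl)
qed

end
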